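(* Let $d\in\mathbb N$, $a\in\{-1,1\}$, and let $\gamma,\alpha\in\mathbb R$ satisfy $\gamma>-\min(2,d)$ and $\alpha>1+\frac{2+\gamma}{d}$. Let $l\in\mathbb R$ and $q,r\in[1,\infty]$ satisfy $\frac ld+\frac1q=\frac1{q_c(\gamma)}$, $\frac{\gamma}{\alpha-1}\le l$, $r=1$ if $q=1$, $r=\infty$ if $q=\infty$. Let $k\in\mathbb R$, $p\in[1,\infty]$ satisfy $$\alpha<p\le\infty,\quad \frac{l+\gamma}{\alpha}\le k\le l,\quad 0\le\frac kd+\frac1p,\quad \frac{2+\gamma\alpha}{d\alpha(\alpha-1)}<\frac kd+\frac1p<\min\Big\{\frac1{q_c(\gamma)},\frac{d+\gamma}{d\alpha}\Big\}.$$ For $j=1,2$ let $\frac{2+\gamma}{\alpha-1}\le\sigma_j<d$ and $\Phi_{\sigma_j}(x)=\omega_j(x)|x|^{-\sigma_j}$, where $\omega_j\in L^\infty(\mathbb R^d)$ is real-valued, homogeneous of degree $0$, with $\|\omega_j\|_{L^\infty}$ sufficiently small. Let $\varphi=\varphi_1+i\varphi_2\in\mathcal S'(\mathbb R^d)$ ($\varphi_1,\varphi_2$ the real and imaginary parts) be nontrivial with $\|e^{t\Delta}\varphi\|_{\mathcal K^p_k}$ sufficiently small, and let $u=u_1+iu_2\in\mathcal K^p_k$ be the global solution of the Hardy–Hénon equation with initial data $\varphi$. Let $(u_{1\mathcal S},z_2)$ be the self-similar solution of system (S3) and $(w_1,u_{2\mathcal S})$ the self-similar solution of system (S4). Let $(k_0,p_0)\in\mathbb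 R\times[1,\infty]$ satisfy, with $\sigma=\sigma_2$ in (i) and $\sigma=\sigma_1$ in (ii), $$0\le\frac{\alpha-1}p+\frac1{p_0}<1,\qquad\frac\sigma d<(\alpha-1)\Big(\frac kd+\frac1p\Big)+\frac{k_0}d+\frac1{p_0}-\frac\gamma d<1,$$ and, in the case that $\alpha>3$ and $\frac kd+\frac1p<\frac{k_0}d+\frac1{p_0}$, also $(\alpha-2)(\frac kd+\frac1p)+\frac{k_0}d+\frac1{p_0}<\frac{2+\gamma}d$. Let $(\tilde k,\tilde p),(\tilde k_0,\tilde p_0)\in\mathbb R\times[1,\infty]$ satisfy $\tilde k\le k$, $p\le\tilde p$, $0\le\frac{\tilde k}d+\frac1{\tilde p}$ and $\tilde k_0\le k_0$, $p_0\le\tilde p_0$, $0\le\frac{\tilde k_0}d+\frac1{\tilde p_0}$. (i) (Nonlinear–"modified linear" behavior) Suppose $\frac{2+\gamma}{\alpha-1}=\sigma_1<\sigma_2$ and there are positive constants $C_1,C_2,\delta_{01},\delta_{02}$ such that for all $t>0$ $$t^{\frac d2(\frac{\sigma_1}d-\frac kd-\frac1p)+\delta_{01}}\|e^{t\Delta}(\varphi_1-\Phi_{\sigma_1})\|_{L^{p,\infty}_k}\le C_1,$$ $$t^{\frac d2(\frac{\sigma_2}d-\frac{k_0}d-\frac1{p_0})}\|e^{t\Delta}\varphi_2\|_{L^{p_0,\infty}_{k_0}}+t^{\frac d2(\frac{\sigma_2}d-\frac{k_0}d-\frac1{p_0})+\delta_{02}}\|e^{t\Delta}(\varphi_2-\Phi_{\sigma_2})\|_{L^{p_0,\infty}_{k_0}}\le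 C_2.$$ Then there exist $\delta_1,\delta_2>0$ (possibly smaller than $\delta_{01},\delta_{02}$) and $C>0$ such that for sufficiently large $t$ $$\|u_1(t)-u_{1\mathcal S}(t)\|_{L^{\tilde p,\infty}_{\tilde k}}\le Ct^{-\frac d2(\frac1{q_c(\gamma)}-\frac{\tilde k}d-\frac1{\tilde p})-\delta_1},\qquad\|u_2(t)-z_2(t)\|_{L^{\tilde p_0,\infty}_{\tilde k_0}}\le Ct^{-\frac d2(\frac{\sigma_2}d-\frac{\tilde k_0}d-\frac1{\tilde p_0})-\delta_2}.$$ (ii) ("Modified linear"–nonlinear behavior) Suppose $\frac{2+\gamma}{\alpha-1}=\sigma_2<\sigma_1$ and there are positive constants $C_1,C_2,\delta_{01},\delta_{02}$ such that for all $t>0$ $$t^{\frac d2(\frac{\sigma_1}d-\frac{k_0}d-\frac1{p_0})}\|e^{t\Delta}\varphi_1\|_{L^{p_0,\infty}_{k_0}}+t^{\frac d2(\frac{\sigma_1}d-\frac{k_0}d-\frac1{p_0})+\delta_{01}}\|e^{t\Delta}(\varphi_1-\Phi_{\sigma_1})\|_{L^{p_0,\infty}_{k_0}}\le C_1,$$ $$t^{\frac d2(\frac{\sigma_2}d-\frac kd-\frac1p)+\delta_{02}}\|e^{t\Delta}(\varphi_2-\Phi_{\sigma_2})\|_{L^{p,\infty}_k}\le C_2.$$ Then there exist $\delta_1,\delta_2>0$ (possibly smaller than $\delta_{01},\delta_{02}$) and $C>0$ such that for sufficiently large $t$ $$\|u_1(t)-w_1(t)\|_{L^{\tilde p_0,\infty}_{\tilde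 k_0}}\le Ct^{-\frac d2(\frac{\sigma_1}d-\frac{\tilde k_0}d-\frac1{\tilde p_0})-\delta_1},\qquad\|u_2(t)-u_{2\mathcal S}(t)\|_{L^{\tilde p,\infty}_{\tilde k}}\le Ct^{-\frac d2(\frac1{q_c(\gamma)}-\frac{\tilde k}d-\frac1{\tilde p})-\delta_2}.$$
   Context: The Hardy–Hénon equation is $\partial_tu-\Delta u=a|x|^\gamma|u|^{\alpha-1}u$ (complex-valued $u$); a solution with initial data $\varphi$ means a solution of $u(t)=e^{t\Delta}\varphi+a\int_0^te^{(t-\tau)\Delta}\{|\cdot|^\gamma|u(\tau)|^{\alpha-1}u(\tau)\}\,d\tau$ for all $t>0$, a.e. $x$, with $e^{t\Delta}$ the heat semigroup. $\frac1{q_c(\gamma)}=\frac{2+\gamma}{d(\alpha-1)}$. $\|f\|_{L^{p,\infty}_k}=\||\cdot|^kf\|_{L^{p,\infty}}$ with $\|g\|_{L^{p,\infty}}=\sup_{t>0}t^{1/p}g^*(t)$, $g^*$ the decreasing rearrangement ($L^{\infty,\infty}=L^\infty$). $\|u\|_{\mathcal K^p_k}=\sup_{t>0}t^{\frac d2(\frac1{q_c(\gamma)}-\frac kd-\frac1p)}\|u(t)\|_{L^{p,\infty}_k}$, and $\mathcal K^p_k$ is the associated space. When $\|e^{t\Delta}\varphi\|_{\mathcal K^p_k}$ is small, the global solution is the one given by the contraction principle: the unique solution in $\{w:\|w\|_{\mathcal K^p_k}\le M\}$ for a sufficiently small $M>0$. $u_{j\mathcal S}$ is the solution so obtained for the data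 $\omega_j(x)|x|^{-\frac{2+\gamma}{\alpha-1}}$; it satisfies $\lambda^{\frac{2+\gamma}{\alpha-1}}u_{j\mathcal S}(\lambda^2t,\lambda x)=u_{j\mathcal S}(t,x)$ for all $\lambda>0$. System (S3) (used in (i)): $\partial_tz_1-\Delta z_1=a|x|^\gamma|z_1|^{\alpha-1}z_1$, $\partial_tz_2-\Delta z_2=a|x|^\gamma|z_1|^{\alpha-1}z_2$, $z_1(0)=\omega_1(x)|x|^{-\frac{2+\gamma}{\alpha-1}}$, $z_2(0)=\omega_2(x)|x|^{-\sigma_2}$. Its solution has $z_1=u_{1\mathcal S}$, and $z_2$ is the solution of $z_2(t)=e^{t\Delta}\Phi_{\sigma_2}+a\int_0^te^{(t-\tau)\Delta}(|\cdot|^\gamma|u_{1\mathcal S}(\tau)|^{\alpha-1}z_2(\tau))\,d\tau$ obtained by the contraction principle in the space of functions with $\sup_{t>0}t^{\frac d2(\frac{\sigma_2}d-\frac{k_0}d-\frac1{p_0})}\|z_2(t)\|_{L^{p_0,\infty}_{k_0}}<\infty$. System (S4) (used in (ii)): $\partial_tw_1-\Delta w_1=a|x|^\gamma|w_2|^{\alpha-1}w_1$, $\partial_tw_2-\Delta w_2=a|x|^\gamma|w_2|^{\alpha-1}w_2$, $w_1(0)=\omega_1(x)|x|^{-\sigma_1}$, $w_2(0)=\omega_2(x)|x|^{-\frac{2+\gamma}{\alpha-1}}$; its solution has $w_2=u_{2\mathcal S}$, and $w_1$ is obtained analogously to $z_2$ (with $\sigma_1$, $\Phi_{\sigma_1}$,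 $u_{2\mathcal S}$ in place of $\sigma_2$, $\Phi_{\sigma_2}$, $u_{1\mathcal S}$). *)

theory Defs
  imports "HOL-Analysis.Analysis"
begin

text \<open>
  Exponents in \<open>[1,\<infinity>]\<close> are extended reals; \<open>rcp p\<close> is the real number \<open>1/p\<close>, with \<open>1/\<infinity> = 0\<close>.
\<close>

definition rcp :: "ereal \<Rightarrow> real" where
  "rcp p = real_of_ereal (1 / p)"


section \<open>Tempered distributions\<close>

text \<open>
  \<open>iter_partial [b1, ..., bn] f\<close> is the iterated partial derivative of \<open>f\<close> in the directions
  \<open>bn, ..., b1\<close> (for \<open>bi\<close> in the standard basis).
\<close>

primrec iter_partial ::
    "'a::euclidean_space list \<Rightarrow> ('a \<Rightarrow> complex) \<Rightarrow> 'a \<Rightarrow> complex" where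
  "iter_partial [] f = f"
| "iter_partial (b # bs) f = (\<lambda>x. frechet_derivative (iter_partial bs f) (at x) b)"

definition schwartz :: "('a::euclidean_space \<Rightarrow> complex) set" where
  "schwartz = {f. \<forall>bs. set bs \<subseteq> Basis \<longrightarrow>
      (\<forall>x. iter_partial bs f differentiable (at x)) \<and>
      (\<forall>N::nat. bounded (range (\<lambda>x. (1 + norm x) ^ N * norm (iter_partial bs f x))))}"

definition schwartz_seminorm :: "nat \<Rightarrow> ('a::euclidean_space \<Rightarrow> complex) \<Rightarrow> real" where
  "schwartz_seminorm N f =
     (\<Sum>bs | set bs \<subseteq> Basis \<and> length bs \<le> N.
        SUP x. (1 + norm x) ^ N * norm (iter_partial bs f x))"

text \<open>
  A distribution is a functional on all complex functions, of which only the values on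
  Schwartz functions are meaningful. The pairing is bilinear (not sesquilinear).
\<close>

type_synonym 'a dist = "('a \<Rightarrow> complex) \<Rightarrow> complex"

definition tempered_distribution :: "'a::euclidean_space dist \<Rightarrow> bool" where
  "tempered_distribution \<phi> \<longleftrightarrow>
     (\<forall>f\<in>schwartz. \<forall>g\<in>schwartz. \<phi> (\<lambda>x. f x + g x) = \<phi> f + \<phi> g) \<and>
     (\<forall>c. \<forall>f\<in>schwartz. \<phi> (\<lambda>x. c * f x) = c * \<phi> f) \<and>
     (\<exists>N C. \<forall>f\<in>schwartz. norm (\<phi> f) \<le> C * schwartz_seminorm N f)"

definition nontrivial_dist :: "'a::euclidean_space dist \<Rightarrow> bool" where
  "nontrivial_dist \<phi> \<longleftrightarrow> (\<exists>f\<in>schwartz. \<phi> f \<noteq> 0)"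

definition dist_of :: "('a::euclidean_space \<Rightarrow> complex) \<Rightarrow> 'a dist" where
  "dist_of f = (\<lambda>\<psi>. LINT x|lborel. f x * \<psi> x)"

definition dist_diff :: "'a dist \<Rightarrow> 'a dist \<Rightarrow> 'a dist" where
  "dist_diff \<phi> \<theta> = (\<lambda>\<psi>. \<phi> \<psi> - \<theta> \<psi>)"

text \<open>
  Real and imaginary part \<open>(\<phi> + cnj \<phi>) / 2\<close> and \<open>(\<phi> - cnj \<phi>) / (2 \<i>)\<close>, where the conjugate
  distribution is \<open>\<psi> \<mapsto> cnj (\<phi> (cnj \<psi>))\<close>.
\<close>

definition dist_Re :: "'a dist \<Rightarrow> 'a dist" where
  "dist_Re \<phi> = (\<lambda>\<psi>. (\<phi> \<psi> + cnj (\<phi> (\<lambda>x. cnj (\<psi> x)))) / 2)"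

definition dist_Im :: "'a dist \<Rightarrow> 'a dist" where
  "dist_Im \<phi> = (\<lambda>\<psi>. (\<phi> \<psi> - cnj (\<phi> (\<lambda>x. cnj (\<psi> x)))) / (2 * \<i>))"


section \<open>Heat semigroup\<close>

definition heat_kernel :: "real \<Rightarrow> 'a::euclidean_space \<Rightarrow> real" where
  "heat_kernel t x =
     (4 * pi * t) powr (- real DIM('a) / 2) * exp (- (norm x)\<^sup>2 / (4 * t))"

text \<open>\<open>exp (t \<Delta>)\<close> on tempered distributions: convolution with the heat kernel (\<open>t > 0\<close>).\<close>

definition heat :: "real \<Rightarrow> 'a::euclidean_space dist \<Rightarrow> 'a \<Rightarrow> complex" where
  "heat t \<phi> x = \<phi> (\<lambda>y. complex_of_real (heat_kernel t (x - y)))"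

text \<open>\<open>exp (t \<Delta>)\<close> on functions for which the convolution integral converges absolutely.\<close>

definition heat_fun :: "real \<Rightarrow> ('a::euclidean_space \<Rightarrow> complex) \<Rightarrow> 'a \<Rightarrow> complex" where
  "heat_fun t f x = (LINT y|lborel. complex_of_real (heat_kernel t (x - y)) * f y)"


section \<open>Weighted weak Lebesgue spaces and the spaces \<open>K\<close>\<close>

definition decr_rearr :: "('a::euclidean_space \<Rightarrow> complex) \<Rightarrow> real \<Rightarrow> ennreal" where
  "decr_rearr g t = Inf {s. emeasure lborel {x. s < ennreal (norm (g x))} \<le> ennreal t}"

text \<open>For \<open>p = \<infinity>\<close> this is the essential supremum, as \<open>rcp \<infinity> = 0\<close>.\<close>

definition weak_norm :: "ereal \<Rightarrow> ('a::euclidean_space \<Rightarrow> complex) \<Rightarrow> ennreal" where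
  "weak_norm p g = (SUP t\<in>{0<..}. ennreal (t powr rcp p) * decr_rearr g t)"

definition wweak_norm ::
    "ereal \<Rightarrow> real \<Rightarrow> ('a::euclidean_space \<Rightarrow> complex) \<Rightarrow> ennreal" where
  "wweak_norm p k f = weak_norm p (\<lambda>x. complex_of_real (norm x powr k) * f x)"

text \<open>
  The space-time norm
  \<open>sup_{t > 0} t ^ (d/2 (s - k/d - 1/p)) * wweak_norm p k (u t)\<close> with scaling exponent \<open>s\<close>:
  \<open>s = 1/q_c(\<gamma>)\<close> for the spaces of the nonlinear equation and \<open>s = \<sigma>/d\<close> for the equations
  that are linear in the unknown.
\<close>

definition K_norm ::
    "real \<Rightarrow> ereal \<Rightarrow> real \<Rightarrow> (real \<Rightarrow> 'a::euclidean_space \<Rightarrow> complex) \<Rightarrow> ennreal" where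
  "K_norm s p k u =
     (SUP t\<in>{0<..}. ennreal (t powr (real DIM('a) / 2 * (s - k / real DIM('a) - rcp p)))
                      * wweak_norm p k (u t))"

text \<open>Elements are represented by functions that are Borel measurable in \<open>(t, x)\<close>, \<open>t > 0\<close>.\<close>

definition K_space ::
    "real \<Rightarrow> ereal \<Rightarrow> real \<Rightarrow> (real \<Rightarrow> 'a::euclidean_space \<Rightarrow> complex) set" where
  "K_space s p k =
     {u. (\<lambda>(t, x). u t x) \<in> borel_measurable (restrict_space borel ({0<..} \<times> UNIV)) \<and>
         K_norm s p k u < \<infinity>}"

definition inv_qc :: "real \<Rightarrow> real \<Rightarrow> real \<Rightarrow> real" where
  "inv_qc d \<gamma> \<alpha> = (2 + \<gamma>) / (d * (\<alpha> - 1))"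


section \<open>Solutions\<close>

text \<open>
  \<open>u(t) = exp(t \<Delta>) \<phi> + a \<integral>\<^sub>0\<^sup>t exp((t - \<tau>) \<Delta>) F(\<tau>) d\<tau>\<close> for all \<open>t > 0\<close> and almost every \<open>x\<close>.
  The integrability clause says that the Duhamel integral converges absolutely, so that it
  does not silently take the default value of a divergent integral.
\<close>

definition mild_solution ::
    "real \<Rightarrow> 'a::euclidean_space dist \<Rightarrow> (real \<Rightarrow> 'a \<Rightarrow> complex) \<Rightarrow>
     (real \<Rightarrow> 'a \<Rightarrow> complex) \<Rightarrow> bool" where
  "mild_solution a \<phi> F u \<longleftrightarrow>
     (\<forall>t>0. AE x in lborel.
        set_integrable lborel ({0<..<t} \<times> UNIV)
          (\<lambda>(\<tau>, y). complex_of_real (heat_kernel (t - \<tau>) (x - y)) * F \<tau> y) \<and>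
        u t x = heat t \<phi> x
          + complex_of_real a * (LINT \<tau>:{0<..<t}|lborel. heat_fun (t - \<tau>) (F \<tau>) x))"

text \<open>The source term \<open>|x|^\<gamma> |v|^(\<alpha>-1) w\<close>.\<close>

definition hh_source ::
    "real \<Rightarrow> real \<Rightarrow> (real \<Rightarrow> 'a::euclidean_space \<Rightarrow> complex) \<Rightarrow>
     (real \<Rightarrow> 'a \<Rightarrow> complex) \<Rightarrow> real \<Rightarrow> 'a \<Rightarrow> complex" where
  "hh_source \<gamma> \<alpha> v w = (\<lambda>t x.
     complex_of_real (norm x powr \<gamma> * norm (v t x) powr (\<alpha> - 1)) * w t x)"

text \<open>
  The solution of the Hardy-Henon equation given by the contraction principle, i.e. the solution
  in the ball of radius \<open>M\<close> of \<open>K\<^sup>p\<^sub>k\<close>. Its uniqueness (almost everywhere, for each \<open>t > 0\<close>) holds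
  for small \<open>M\<close> and is not part of the definition.
\<close>

definition hh_solution ::
    "real \<Rightarrow> real \<Rightarrow> real \<Rightarrow> ereal \<Rightarrow> real \<Rightarrow> real \<Rightarrow> 'a::euclidean_space dist \<Rightarrow>
     (real \<Rightarrow> 'a \<Rightarrow> complex) \<Rightarrow> bool" where
  "hh_solution a \<gamma> \<alpha> p k M \<phi> u \<longleftrightarrow>
     u \<in> K_space (inv_qc (real DIM('a)) \<gamma> \<alpha>) p k \<and>
     K_norm (inv_qc (real DIM('a)) \<gamma> \<alpha>) p k u \<le> ennreal M \<and>
     mild_solution a \<phi> (hh_source \<gamma> \<alpha> u u) u"

definition hom_data :: "('a::euclidean_space \<Rightarrow> real) \<Rightarrow> real \<Rightarrow> 'a \<Rightarrow> complex" where
  "hom_data \<omega> \<sigma> x = complex_of_real (\<omega> x * norm x powr (- \<sigma>))"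

text \<open>
  The triangular system
  \<open>v\<^sub>t - \<Delta> v = a |x|^\<gamma> |v|^(\<alpha>-1) v\<close>,  \<open>z\<^sub>t - \<Delta> z = a |x|^\<gamma> |v|^(\<alpha>-1) z\<close>,
  \<open>v(0) = \<omega>(x) |x|^(-(2+\<gamma>)/(\<alpha>-1))\<close>,  \<open>z(0) = \<eta>(x) |x|^(-\<sigma>)\<close>,
  with \<open>v\<close> and \<open>z\<close> the solutions given by the contraction principle.
\<close>

definition triangular_solution ::
    "real \<Rightarrow> real \<Rightarrow> real \<Rightarrow> ereal \<Rightarrow> real \<Rightarrow> real \<Rightarrow> ereal \<Rightarrow> real \<Rightarrow> real \<Rightarrow>
     ('a::euclidean_space \<Rightarrow> real) \<Rightarrow> ('a \<Rightarrow> real) \<Rightarrow>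
     (real \<Rightarrow> 'a \<Rightarrow> complex) \<Rightarrow> (real \<Rightarrow> 'a \<Rightarrow> complex) \<Rightarrow> bool" where
  "triangular_solution a \<gamma> \<alpha> p k M p0 k0 \<sigma> \<omega> \<eta> v z \<longleftrightarrow>
     hh_solution a \<gamma> \<alpha> p k M (dist_of (hom_data \<omega> ((2 + \<gamma>) / (\<alpha> - 1)))) v \<and>
     z \<in> K_space (\<sigma> / real DIM('a)) p0 k0 \<and>
     mild_solution a (dist_of (hom_data \<eta> \<sigma>)) (hh_source \<gamma> \<alpha> v z) z"

text \<open>
  The pairs \<open>(z\<^sub>1, z\<^sub>2)\<close> and \<open>(w\<^sub>1, w\<^sub>2)\<close>: the first has its first component nonlinear, the second its
  second component.
\<close>

definition S3_solution ::
    "real \<Rightarrow> real \<Rightarrow> real \<Rightarrow> ereal \<Rightarrow> real \<Rightarrow> real \<Rightarrow> ereal \<Rightarrow> real \<Rightarrow> real \<Rightarrow>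
     ('a::euclidean_space \<Rightarrow> real) \<Rightarrow> ('a \<Rightarrow> real) \<Rightarrow>
     (real \<Rightarrow> 'a \<Rightarrow> complex) \<Rightarrow> (real \<Rightarrow> 'a \<Rightarrow> complex) \<Rightarrow> bool" where
  "S3_solution a \<gamma> \<alpha> p k M p0 k0 \<sigma>2 \<omega>1 \<omega>2 z1 z2 \<longleftrightarrow>
     triangular_solution a \<gamma> \<alpha> p k M p0 k0 \<sigma>2 \<omega>1 \<omega>2 z1 z2"

definition S4_solution ::
    "real \<Rightarrow> real \<Rightarrow> real \<Rightarrow> ereal \<Rightarrow> real \<Rightarrow> real \<Rightarrow> ereal \<Rightarrow> real \<Rightarrow> real \<Rightarrow>
     ('a::euclidean_space \<Rightarrow> real) \<Rightarrow> ('a \<Rightarrow> real) \<Rightarrow>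
     (real \<Rightarrow> 'a \<Rightarrow> complex) \<Rightarrow> (real \<Rightarrow> 'a \<Rightarrow> complex) \<Rightarrow> bool" where
  "S4_solution a \<gamma> \<alpha> p k M p0 k0 \<sigma>1 \<omega>1 \<omega>2 w1 w2 \<longleftrightarrow>
     triangular_solution a \<gamma> \<alpha> p k M p0 k0 \<sigma>1 \<omega>2 \<omega>1 w2 w1"


section \<open>Hypotheses on parameters and data\<close>

text \<open>
  A real function in \<open>L\<^sup>\<infinity>\<close> with norm at most \<open>\<epsilon>\<close>, homogeneous of degree 0 (as an element of
  \<open>L\<^sup>\<infinity>\<close>, i.e. up to null sets).
\<close>

definition small_angular :: "real \<Rightarrow> ('a::euclidean_space \<Rightarrow> real) \<Rightarrow> bool" where
  "small_angular \<epsilon> \<omega> \<longleftrightarrow>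
     \<omega> \<in> borel_measurable borel \<and> (AE x in lborel. \<bar>\<omega> x\<bar> \<le> \<epsilon>) \<and>
     (\<forall>c>0. AE x in lborel. \<omega> (c *\<^sub>R x) = \<omega> x)"

definition admissible0 ::
    "real \<Rightarrow> real \<Rightarrow> real \<Rightarrow> ereal \<Rightarrow> real \<Rightarrow> real \<Rightarrow> ereal \<Rightarrow> real \<Rightarrow> bool" where
  "admissible0 d \<gamma> \<alpha> p k \<sigma> p0 k0 \<longleftrightarrow>
     0 \<le> (\<alpha> - 1) * rcp p + rcp p0 \<and> (\<alpha> - 1) * rcp p + rcp p0 < 1 \<and>
     \<sigma> / d < (\<alpha> - 1) * (k / d + rcp p) + k0 / d + rcp p0 - \<gamma> / d \<and>
     (\<alpha> - 1) * (k / d + rcp p) + k0 / d + rcp p0 - \<gamma> / d < 1 \<and>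
     (\<alpha> > 3 \<and> k / d + rcp p < k0 / d + rcp p0 \<longrightarrow>
        (\<alpha> - 2) * (k / d + rcp p) + k0 / d + rcp p0 < (2 + \<gamma>) / d)"

text \<open>The target exponents \<open>(k', p')\<close> that may replace \<open>(k, p)\<close> in the conclusion.\<close>

definition target_exps :: "real \<Rightarrow> ereal \<Rightarrow> real \<Rightarrow> ereal \<Rightarrow> real \<Rightarrow> bool" where
  "target_exps d p k p' k' \<longleftrightarrow> 1 \<le> p' \<and> k' \<le> k \<and> p \<le> p' \<and> 0 \<le> k' / d + rcp p'"

end

theory Submission
  imports Defs "HOL-Probability.Distributions"
begin

text \<open>
  Both differences \<open>D\<close> satisfy \<open>D \<le> H + N(V D) + \<close> source, where \<open>H\<close> is the difference of the free
  evolutions, \<open>N\<close> is the Duhamel operator with the (positive) heat kernel and \<open>V = |x|\<^sup>\<gamma> q\<^sup>(\<^sup>\<alpha>\<^sup>-\<^sup>1\<^sup>)\<close> is built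
  from the small solutions. The operator \<open>N(V \<cdot>)\<close> preserves every decay rate close to the
  self-similar one and is a contraction for small data, so it can be absorbed. The
  source contains a small power \<open>\<theta>\<close> of the faster decaying component, which decays with
  the exponent \<open>\<sigma> > (2 + \<gamma>) / (\<alpha> - 1)\<close>; interpolation turns this into a gain of decay proportional to \<open>\<theta>\<close>.
  The bound in the additional spaces needed for the interpolation, and finally in the target
  spaces, comes from comparison with Neumann series and from iterating small gains of
  integrability, which the heat kernel provides.
\<close>

text \<open>Three obstacles shape the argument. Weak quasi-norms have no countable triangle
  inequality, so convolutions and time integrals are estimated through averages over sets of finite
  measure; for \<open>0 \<le> \<rho> < 1\<close> these are equivalent and pass through Tonelli's
  theorem. Absorption needs a finite a priori bound at the improved rate; on \<open>(0, T)\<close>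
  an extra factor \<open>t powr \<delta>\<close> costs only \<open>T powr \<delta>\<close>, and the
  constant that results is free of \<open>T\<close>. Finally, smoothing can lower a weight exponent
  but not raise it, and \<open>\<gamma> \<le> \<beta> * k\<close> may be an equality, so exchanging
  a power of the nonlinear factor for a power of the faster component may leave too little weight,
  however small the power is. A small power of another factor is therefore measured with a larger
  weight \<open>k + \<eta>\<close>; this is the origin of the additional spaces. Taking
  \<open>\<theta>\<close> small preserves all strict conditions on the exponents and copes with
  \<open>\<beta> < 1\<close>, where \<open>x powr \<beta>\<close> is not Lipschitz at 0. Real and
  imaginary part enter only as two real-linear contractions, so both cases of the theorem are one
  statement with exchanged roles.\<close>

section \<open>Weak Lebesgue bounds\<close>

text \<open>The distribution-function form of a bound in weak L^p with \<rho> = 1/p, so that p =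
  \<infinity> is the ordinary case \<rho> = 0. Carrying the constant \<open>A\<close> as an argument
  avoids suprema, and values in \<open>ennreal\<close> admit functions given by integrals whose
  convergence is not yet known.\<close>

definition wk :: "real \<Rightarrow> real \<Rightarrow> ('a::euclidean_space \<Rightarrow> ennreal) \<Rightarrow> bool" where
  "wk \<rho> A f \<longleftrightarrow> f \<in> borel_measurable borel \<and> 0 \<le> A \<and>
     (\<forall>t>0. emeasure lborel {x. ennreal (A * t powr (- \<rho>)) < f x} \<le> ennreal t)"

lemma wk_meas: "wk \<rho> A f \<Longrightarrow> f \<in> borel_measurable borel"
  by (simp add: wk_def)

lemma wk_nonneg: "wk \<rho> A f \<Longrightarrow> 0 \<le> A"
  by (simp add: wk_def)

lemma wkD: "wk \<rho> A f \<Longrightarrow> 0 < t \<Longrightarrow> emeasure lborel {x. ennreal (A * t powr (- \<rho>)) < f x} \<le> ennreal t"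
  by (simp add: wk_def)

lemma wk_mono_AE:
  fixes f g :: "'a::euclidean_space \<Rightarrow> ennreal"
  assumes "wk \<rho> A f" and [measurable]: "g \<in> borel_measurable borel"
    and le: "AE x in lborel. g x \<le> f x" and AB: "A \<le> B"
  shows "wk \<rho> B g"
proof -
  have [measurable]: "f \<in> borel_measurable borel" using assms(1) by (rule wk_meas)
  have A: "0 \<le> A" using assms(1) by (rule wk_nonneg)
  have "emeasure lborel {x. ennreal (B * t powr (- \<rho>)) < g x} \<le> ennreal t" if t: "t > 0" for t
  proof -
    have "ennreal (A * t powr (- \<rho>)) \<le> ennreal (B * t powr (- \<rho>))"
      using AB by (intro ennreal_leI mult_right_mono) auto
    then have "emeasure lborel {x. ennreal (B * t powr (- \<rho>)) < g x}
        \<le> emeasure lborel {x. ennreal (A * t powr (- \<rho>)) < f x}"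
      by (intro emeasure_mono_AE eventually_mono[OF le]) auto
    then show ?thesis using wkD[OF assms(1) t] by simp
  qed
  with A AB show ?thesis by (simp add: wk_def)
qed

lemma wk_mono:
  assumes "wk \<rho> A f" "g \<in> borel_measurable borel" "\<And>x. g x \<le> f x" "A \<le> B"
  shows "wk \<rho> B g"
  using assms by (intro wk_mono_AE[OF assms(1)]) auto

lemma wk_weaken: "wk \<rho> A f \<Longrightarrow> A \<le> B \<Longrightarrow> wk \<rho> B f"
  using wk_mono wk_meas by blast

text \<open>Hoelder's inequality for weak spaces: each factor is controlled outside a set of measure
  t/2, whence the constant. Any two exponents may be combined.\<close>

lemma wk_mult:
  fixes f g :: "'a::euclidean_space \<Rightarrow> ennreal"
  assumes f: "wk \<rho> A f" and g: "wk \<rho>' B g"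
  shows "wk (\<rho> + \<rho>') (2 powr (\<rho> + \<rho>') * (A * B)) (\<lambda>x. f x * g x)"
proof -
  have [measurable]: "f \<in> borel_measurable borel" "g \<in> borel_measurable borel"
    using f g by (auto dest: wk_meas)
  have A: "0 \<le> A" "0 \<le> B" using f g by (auto dest: wk_nonneg)
  have "emeasure lborel {x. ennreal (2 powr (\<rho> + \<rho>') * (A * B) * t powr (- (\<rho> + \<rho>'))) < f x * g x}
      \<le> ennreal t" (is "emeasure _ ?S \<le> _") if t: "t > 0" for t
  proof -
    define s where "s = t / 2"
    have s: "s > 0" "t = 2 * s" using t by (auto simp: s_def)
    have eq: "2 powr (\<rho> + \<rho>') * (A * B) * t powr (- (\<rho> + \<rho>'))
        = (A * s powr (- \<rho>)) * (B * s powr (- \<rho>'))"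
      using s by (simp add: powr_mult powr_add powr_minus powr_diff divide_simps)
    let ?F = "{x. ennreal (A * s powr (- \<rho>)) < f x}" and ?G = "{x. ennreal (B * s powr (- \<rho>')) < g x}"
    have "?S \<subseteq> ?F \<union> ?G"
    proof
      fix x assume x: "x \<in> ?S"
      show "x \<in> ?F \<union> ?G"
      proof (rule ccontr)
        assume "x \<notin> ?F \<union> ?G"
        then have "f x * g x \<le> ennreal (A * s powr (- \<rho>)) * ennreal (B * s powr (- \<rho>'))"
          by (intro mult_mono) (auto simp: not_less)
        also have "\<dots> = ennreal (2 powr (\<rho> + \<rho>') * (A * B) * t powr (- (\<rho> + \<rho>')))"
          unfolding eq using A by (simp add: ennreal_mult)
        finally show False using x by (simp add: not_less[symmetric])
      qed
    qed
    then have "emeasure lborel ?S \<le> emeasure lborel (?F \<union> ?G)"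
      by (intro emeasure_mono) auto
    also have "\<dots> \<le> emeasure lborel ?F + emeasure lborel ?G"
      by (rule emeasure_subadditive) auto
    also have "\<dots> \<le> ennreal s + ennreal s"
      using wkD[OF f s(1)] wkD[OF g s(1)] by (rule add_mono)
    also have "\<dots> = ennreal t" using s by (simp flip: ennreal_plus)
    finally show ?thesis .
  qed
  with A show ?thesis by (simp add: wk_def)
qed

text \<open>The same halving of t yields only a quasi-triangle inequality. The factor
  \<open>2 powr \<rho>\<close> would accumulate in a series or an integral, so those go through
  \<open>ib\<close> below.\<close>

lemma wk_add:
  fixes f g :: "'a::euclidean_space \<Rightarrow> ennreal"
  assumes f: "wk \<rho> A f" and g: "wk \<rho> B g"
  shows "wk \<rho> (2 powr \<rho> * (A + B)) (\<lambda>x. f x + g x)"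
proof -
  have [measurable]: "f \<in> borel_measurable borel" "g \<in> borel_measurable borel"
    using f g by (auto dest: wk_meas)
  have A: "0 \<le> A" "0 \<le> B" using f g by (auto dest: wk_nonneg)
  have "emeasure lborel {x. ennreal (2 powr \<rho> * (A + B) * t powr (- \<rho>)) < f x + g x}
      \<le> ennreal t" (is "emeasure _ ?S \<le> _") if t: "t > 0" for t
  proof -
    define s where "s = t / 2"
    have s: "s > 0" "t = 2 * s" using t by (auto simp: s_def)
    have eq: "2 powr \<rho> * (A + B) * t powr (- \<rho>) = (A * s powr (- \<rho>)) + (B * s powr (- \<rho>))"
      using s by (simp add: powr_mult powr_minus divide_simps)
    let ?F = "{x. ennreal (A * s powr (- \<rho>)) < f x}" and ?G = "{x. ennreal (B * s powr (- \<rho>)) < g x}"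
    have "?S \<subseteq> ?F \<union> ?G"
    proof
      fix x assume x: "x \<in> ?S"
      show "x \<in> ?F \<union> ?G"
      proof (rule ccontr)
        assume "x \<notin> ?F \<union> ?G"
        then have "f x + g x \<le> ennreal (A * s powr (- \<rho>)) + ennreal (B * s powr (- \<rho>))"
          by (intro add_mono) (auto simp: not_less)
        also have "\<dots> = ennreal (2 powr \<rho> * (A + B) * t powr (- \<rho>))"
          unfolding eq using A by simp
        finally show False using x by (simp add: not_less[symmetric])
      qed
    qed
    then have "emeasure lborel ?S \<le> emeasure lborel (?F \<union> ?G)"
      by (intro emeasure_mono) auto
    also have "\<dots> \<le> emeasure lborel ?F + emeasure lborel ?G"
      by (rule emeasure_subadditive) auto
    also have "\<dots> \<le> ennreal s + ennreal s"
      using wkD[OF f s(1)] wkD[OF g s(1)] by (rule add_mono)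
    also have "\<dots> = ennreal t" using s by (simp flip: ennreal_plus)
    finally show ?thesis .
  qed
  with A show ?thesis by (simp add: wk_def)
qed

lemma wk_cmult:
  fixes f :: "'a::euclidean_space \<Rightarrow> ennreal"
  assumes f: "wk \<rho> A f" and c: "0 \<le> c"
  shows "wk \<rho> (c * A) (\<lambda>x. ennreal c * f x)"
proof -
  have [measurable]: "f \<in> borel_measurable borel"
    using f by (auto dest: wk_meas)
  have A: "0 \<le> A" using f by (auto dest: wk_nonneg)
  have "emeasure lborel {x. ennreal (c * A * t powr (- \<rho>)) < ennreal c * f x} \<le> ennreal t"
    if t: "t > 0" for t
  proof -
    have "{x. ennreal (c * A * t powr (- \<rho>)) < ennreal c * f x} \<subseteq> {x. ennreal (A * t powr (- \<rho>)) < f x}"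
    proof
      fix x assume x: "x \<in> {x. ennreal (c * A * t powr (- \<rho>)) < ennreal c * f x}"
      show "x \<in> {x. ennreal (A * t powr (- \<rho>)) < f x}"
      proof (rule ccontr)
        assume "x \<notin> {x. ennreal (A * t powr (- \<rho>)) < f x}"
        then have "ennreal c * f x \<le> ennreal c * ennreal (A * t powr (- \<rho>))"
          by (intro mult_left_mono) (auto simp: not_less)
        also have "\<dots> = ennreal (c * A * t powr (- \<rho>))"
          using c A by (simp add: ennreal_mult[symmetric] mult.assoc)
        finally show False using x by (simp add: not_less[symmetric])
      qed
    qed
    then have "emeasure lborel {x. ennreal (c * A * t powr (- \<rho>)) < ennreal c * f x}
      \<le> emeasure lborel {x. ennreal (A * t powr (- \<rho>)) < f x}"
      by (intro emeasure_mono) auto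
    then show ?thesis using wkD[OF f t] by simp
  qed
  with A c show ?thesis by (simp add: wk_def)
qed

lemma wk_powr:
  fixes f :: "'a::euclidean_space \<Rightarrow> real"
  assumes f: "wk \<rho> A (\<lambda>x. ennreal (f x))" and \<theta>: "0 \<le> \<theta>" and nn: "\<And>x. 0 \<le> f x"
  shows "wk (\<theta> * \<rho>) (A powr \<theta>) (\<lambda>x. ennreal (f x powr \<theta>))"
proof -
  have "(\<lambda>x. enn2real (ennreal (f x))) \<in> borel_measurable borel"
    by (intro measurable_compose[OF wk_meas[OF f]]) auto
  then have [measurable]: "f \<in> borel_measurable borel" by (simp add: nn)
  have A: "0 \<le> A" using f by (auto dest: wk_nonneg)
  have "emeasure lborel {x. ennreal (A powr \<theta> * t powr (- (\<theta> * \<rho>))) < ennreal (f x powr \<theta>)} \<le> ennreal t"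
    if t: "t > 0" for t
  proof -
    have "{x. ennreal (A powr \<theta> * t powr (- (\<theta> * \<rho>))) < ennreal (f x powr \<theta>)}
        \<subseteq> {x. ennreal (A * t powr (- \<rho>)) < ennreal (f x)}"
    proof
      fix x assume x: "x \<in> {x. ennreal (A powr \<theta> * t powr (- (\<theta> * \<rho>))) < ennreal (f x powr \<theta>)}"
      show "x \<in> {x. ennreal (A * t powr (- \<rho>)) < ennreal (f x)}"
      proof (rule ccontr)
        assume "x \<notin> {x. ennreal (A * t powr (- \<rho>)) < ennreal (f x)}"
        then have "f x \<le> A * t powr (- \<rho>)" using A by (auto simp: not_less ennreal_le_iff)
        then have "f x powr \<theta> \<le> (A * t powr (- \<rho>)) powr \<theta>"
          using nn \<theta> by (intro powr_mono2) auto
        also have "\<dots> = A powr \<theta> * t powr (- (\<theta> * \<rho>))"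
          using A by (simp add: powr_mult powr_powr mult.commute)
        finally show False using x by (auto simp: ennreal_less_iff)
      qed
    qed
    then have "emeasure lborel {x. ennreal (A powr \<theta> * t powr (- (\<theta> * \<rho>))) < ennreal (f x powr \<theta>)}
      \<le> emeasure lborel {x. ennreal (A * t powr (- \<rho>)) < ennreal (f x)}"
      by (intro emeasure_mono) auto
    then show ?thesis using wkD[OF f t] by simp
  qed
  then show ?thesis by (simp add: wk_def)
qed

lemma emeasure_UN_incseq_le:
  assumes "incseq S" "\<And>n. S n \<in> sets M" "\<And>n. emeasure M (S n) \<le> c"
  shows "emeasure M (\<Union>n. S n) \<le> c"
proof -
  have "emeasure M (\<Union>n. S n) = (SUP n. emeasure M (S n))"
    using assms by (intro SUP_emeasure_incseq[symmetric]) auto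
  then show ?thesis using assms by (auto intro: SUP_least)
qed

text \<open>Fatou property without loss: \<open>wk\<close> uses strict superlevel sets, and that of
  a supremum is the increasing union of the individual ones. It bounds the limit of a Neumann series
  by its partial sums.\<close>

lemma wk_SUP:
  fixes S :: "nat \<Rightarrow> 'a::euclidean_space \<Rightarrow> ennreal"
  assumes S: "\<And>n. wk \<rho> A (S n)" and inc: "\<And>x. incseq (\<lambda>n. S n x)"
  shows "wk \<rho> A (\<lambda>x. SUP n. S n x)"
proof -
  have [measurable]: "S n \<in> borel_measurable borel" for n
    using S by (auto dest: wk_meas)
  have "emeasure lborel {x. ennreal (A * t powr (- \<rho>)) < (SUP n. S n x)} \<le> ennreal t"
    if t: "t > 0" for t
  proof -
    have "{x. ennreal (A * t powr (- \<rho>)) < (SUP n. S n x)} = (\<Union>n. {x. ennreal (A * t powr (- \<rho>)) < S n x})"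
      by (auto simp: less_SUP_iff)
    also have "emeasure lborel \<dots> \<le> ennreal t"
      using inc by (intro emeasure_UN_incseq_le wkD[OF S t]) (auto simp: incseq_def intro: less_le_trans)
    finally show ?thesis .
  qed
  then show ?thesis using S wk_nonneg by (auto simp: wk_def)
qed

text \<open>A strict superlevel set is the increasing union of those at slightly higher levels, so
  the admissible constants form a closed set. Absorption by iteration ends with this.\<close>

lemma wk_limit:
  fixes f :: "'a::euclidean_space \<Rightarrow> ennreal"
  assumes A: "0 \<le> A" and f: "\<And>B. A < B \<Longrightarrow> wk \<rho> B f"
  shows "wk \<rho> A f"
proof -
  have [measurable]: "f \<in> borel_measurable borel"
    using f[of "A + 1"] by (auto dest: wk_meas)
  have "emeasure lborel {x. ennreal (A * t powr (- \<rho>)) < f x} \<le> ennreal t"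
    if t: "t > 0" for t
  proof -
    let ?S = "\<lambda>n. {x. ennreal ((A + 1 / real (Suc n)) * t powr (- \<rho>)) < f x}"
    have "{x. ennreal (A * t powr (- \<rho>)) < f x} = (\<Union>n. ?S n)" (is "?L = ?R")
    proof (intro antisym subsetI)
      fix x assume x: "x \<in> ?L"
      then obtain y where y: "ennreal (A * t powr (- \<rho>)) < y" "y < f x"
        using dense by blast
      have "(\<lambda>n. ennreal ((A + 1 / real (Suc n)) * t powr (- \<rho>))) \<longlonglongrightarrow> ennreal ((A + 0) * t powr (- \<rho>))"
        using lim_const_over_n[of 1, THEN LIMSEQ_Suc]
        by (intro tendsto_ennrealI tendsto_intros) (simp_all)
      then have "eventually (\<lambda>n. ennreal ((A + 1 / real (Suc n)) * t powr (- \<rho>)) < y) sequentially"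
        using y(1) by (intro order_tendstoD(2)) auto
      then obtain n where "ennreal ((A + 1 / real (Suc n)) * t powr (- \<rho>)) < y"
        by (auto simp: eventually_sequentially)
      with y(2) show "x \<in> ?R" by (auto intro: less_trans)
    next
      fix x assume "x \<in> ?R"
      then obtain n where n: "ennreal ((A + 1 / real (Suc n)) * t powr (- \<rho>)) < f x" by auto
      have "ennreal (A * t powr (- \<rho>)) \<le> ennreal ((A + 1 / real (Suc n)) * t powr (- \<rho>))"
        by (intro ennreal_leI mult_right_mono) auto
      with n show "x \<in> ?L" by auto
    qed
    also have "emeasure lborel (\<Union>n. ?S n) \<le> ennreal t"
    proof (intro emeasure_UN_incseq_le wkD[OF f t])
      show "incseq ?S"
      proof (rule incseq_SucI)
        fix n
        have "ennreal ((A + 1 / real (Suc (Suc n))) * t powr (- \<rho>)) \<le> ennreal ((A + 1 / real (Suc n)) * t powr (- \<rho>))"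
          by (intro ennreal_leI mult_right_mono add_left_mono divide_left_mono) auto
        then show "?S n \<subseteq> ?S (Suc n)" using le_less_trans by blast
      qed
    qed auto
    finally show ?thesis .
  qed
  with A show ?thesis by (simp add: wk_def)
qed

lemma wk_zero_AE:
  fixes f :: "'a::euclidean_space \<Rightarrow> ennreal"
  assumes "wk \<rho> 0 f" shows "AE x in lborel. f x = 0"
proof -
  have [measurable]: "f \<in> borel_measurable borel"
    using assms by (auto dest: wk_meas)
  have "emeasure lborel {x. 0 < f x} \<le> 0"
  proof (rule ennreal_le_epsilon)
    fix e :: real assume "e > 0"
    then show "emeasure lborel {x. 0 < f x} \<le> 0 + ennreal e"
      using wkD[OF assms, of e] by simp
  qed
  then have "{x. 0 < f x} \<in> null_sets lborel" by (intro null_setsI) auto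
  then have "AE x in lborel. x \<notin> {x. 0 < f x}" by (rule AE_not_in)
  then show ?thesis by eventually_elim (simp add: zero_less_iff_neq_zero)
qed

lemma wk_AE_finite:
  fixes f :: "'a::euclidean_space \<Rightarrow> ennreal"
  assumes "wk \<rho> A f" shows "AE x in lborel. f x < \<infinity>"
proof -
  have [measurable]: "f \<in> borel_measurable borel"
    using assms by (auto dest: wk_meas)
  have "emeasure lborel {x. f x = \<infinity>} \<le> 0"
  proof (rule ennreal_le_epsilon)
    fix e :: real assume e: "e > 0"
    have "emeasure lborel {x. f x = \<infinity>} \<le> emeasure lborel {x. ennreal (A * e powr (- \<rho>)) < f x}"
      by (intro emeasure_mono) auto
    then show "emeasure lborel {x. f x = \<infinity>} \<le> 0 + ennreal e"
      using wkD[OF assms e] by simp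
  qed
  then have "{x. f x = \<infinity>} \<in> null_sets lborel" by (intro null_setsI) auto
  then have "AE x in lborel. x \<notin> {x. f x = \<infinity>}" by (rule AE_not_in)
  then show ?thesis by eventually_elim (simp add: less_top)
qed

lemma weak_norm_le_iff:
  fixes g :: "'a::euclidean_space \<Rightarrow> complex"
  assumes [measurable]: "g \<in> borel_measurable borel" and A: "0 \<le> A"
  shows "weak_norm p g \<le> ennreal A \<longleftrightarrow> wk (rcp p) A (\<lambda>x. ennreal (norm (g x)))"
proof
  assume le: "weak_norm p g \<le> ennreal A"
  have "emeasure lborel {x. ennreal (A * t powr (- rcp p)) < ennreal (norm (g x))} \<le> ennreal t"
    if t: "t > 0" for t
  proof -
    have 1: "ennreal (t powr rcp p) * decr_rearr g t \<le> ennreal A"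
      using le t unfolding weak_norm_def by (meson SUP_le_iff greaterThan_iff)
    have "ennreal (t powr (- rcp p)) * (ennreal (t powr rcp p) * decr_rearr g t) = decr_rearr g t"
      using t by (simp add: mult.assoc[symmetric] ennreal_mult[symmetric] powr_minus)
    with mult_left_mono[OF 1, of "ennreal (t powr (- rcp p))"]
    have 2: "decr_rearr g t \<le> ennreal (A * t powr (- rcp p))"
      using A by (simp add: ennreal_mult[symmetric] mult.commute)
    \<comment> \<open>The infimum in \<open>decr_rearr\<close> is not known to be attained, so the
      measure is bounded at the levels c + 1/(n+1), which lie strictly above it, and the superlevel
      set of c is exhausted from there.\<close>
    define c where "c = ennreal (A * t powr (- rcp p))"
    let ?S = "\<lambda>n. {x. c + ennreal (1 / real (Suc n)) < ennreal (norm (g x))}"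
    have "{x. c < ennreal (norm (g x))} = (\<Union>n. ?S n)" (is "?L = ?R")
    proof (intro antisym subsetI)
      fix x assume x: "x \<in> ?L"
      then obtain y where y: "c < y" "y < ennreal (norm (g x))"
        using dense by blast
      have "(\<lambda>n. ennreal (A * t powr (- rcp p) + 1 / real (Suc n))) \<longlonglongrightarrow> ennreal (A * t powr (- rcp p) + 0)"
        using lim_const_over_n[of 1, THEN LIMSEQ_Suc]
        by (intro tendsto_ennrealI tendsto_intros) (simp_all)
      then have "eventually (\<lambda>n. ennreal (A * t powr (- rcp p) + 1 / real (Suc n)) < y) sequentially"
        using y(1) by (intro order_tendstoD(2)) (auto simp: c_def)
      then obtain n where "c + ennreal (1 / real (Suc n)) < y"
        using A by (auto simp: eventually_sequentially c_def simp flip: ennreal_plus)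
      with y(2) show "x \<in> ?R" by (auto intro: less_trans)
    next
      fix x assume "x \<in> ?R"
      then obtain n where n: "c + ennreal (1 / real (Suc n)) < ennreal (norm (g x))" by auto
      then show "x \<in> ?L" using le_less_trans[OF _ n, of c] by simp
    qed
    also have "emeasure lborel (\<Union>n. ?S n) \<le> ennreal t"
    proof (intro emeasure_UN_incseq_le)
      show "incseq ?S"
      proof (rule incseq_SucI)
        fix n
        have "c + ennreal (1 / real (Suc (Suc n))) \<le> c + ennreal (1 / real (Suc n))"
          by (intro ennreal_leI add_left_mono divide_left_mono) auto
        then show "?S n \<subseteq> ?S (Suc n)" using le_less_trans by blast
      qed
      fix n
      have "c < c + ennreal (1 / real (Suc n))"
        by (simp add: c_def ennreal_less_iff A flip: ennreal_plus)
      with 2 have "decr_rearr g t < c + ennreal (1 / real (Suc n))"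
        unfolding c_def[symmetric] by (rule le_less_trans)
      then obtain s where s: "s < c + ennreal (1 / real (Suc n))"
          "emeasure lborel {x. s < ennreal (norm (g x))} \<le> ennreal t"
        unfolding decr_rearr_def Inf_less_iff by auto
      have "emeasure lborel (?S n) \<le> emeasure lborel {x. s < ennreal (norm (g x))}"
        using s(1) by (intro emeasure_mono) auto
      then show "emeasure lborel (?S n) \<le> ennreal t" using s(2) by simp
    qed auto
    finally show ?thesis by (simp add: c_def)
  qed
  then show "wk (rcp p) A (\<lambda>x. ennreal (norm (g x)))" using A by (simp add: wk_def)
next
  assume wk: "wk (rcp p) A (\<lambda>x. ennreal (norm (g x)))"
  show "weak_norm p g \<le> ennreal A" unfolding weak_norm_def
  proof (rule SUP_least)
    fix t :: real assume "t \<in> {0<..}"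
    then have t: "t > 0" by simp
    have "decr_rearr g t \<le> ennreal (A * t powr (- rcp p))"
      unfolding decr_rearr_def using wkD[OF wk t] by (intro Inf_lower) simp
    then have "ennreal (t powr rcp p) * decr_rearr g t \<le> ennreal (t powr rcp p) * ennreal (A * t powr (- rcp p))"
      by (intro mult_left_mono) auto
    also have "\<dots> = ennreal A"
      using t A by (simp add: ennreal_mult[symmetric] powr_minus mult.left_commute)
    finally show "ennreal (t powr rcp p) * decr_rearr g t \<le> ennreal A" .
  qed
qed

section \<open>Scaling, and homogeneous functions in weak Lebesgue spaces\<close>

lemma nn_integral_lborel_affine:
  fixes f :: "'a::euclidean_space \<Rightarrow> ennreal"
  assumes [measurable]: "f \<in> borel_measurable borel" and c: "c \<noteq> 0"
  shows "(\<integral>\<^sup>+x. f x \<partial>lborel) = ennreal (\<bar>c\<bar> ^ DIM('a)) * (\<integral>\<^sup>+x. f (t + c *\<^sub>R x) \<partial>lborel)"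
  by (subst lborel_affine[OF c, of t])
     (simp add: nn_integral_density nn_integral_distr nn_integral_cmult)

lemma wk_scale:
  fixes f :: "'a::euclidean_space \<Rightarrow> ennreal"
  assumes f: "wk \<rho> A f" and r: "r > 0"
  shows "wk \<rho> (A * r powr (- (real DIM('a) * \<rho>))) (\<lambda>x. f (r *\<^sub>R x))"
proof -
  have [measurable]: "f \<in> borel_measurable borel"
    using f by (auto dest: wk_meas)
  have A: "0 \<le> A" using f by (auto dest: wk_nonneg)
  have "emeasure lborel {x. ennreal (A * r powr (- (real DIM('a) * \<rho>)) * t powr (- \<rho>)) < f (r *\<^sub>R x)}
      \<le> ennreal t" (is "emeasure lborel ?S \<le> _") if t: "t > 0" for t
  proof -
    define s where "s = r ^ DIM('a) * t"
    have s: "s > 0" using r t by (simp add: s_def)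
    have eq: "A * r powr (- (real DIM('a) * \<rho>)) * t powr (- \<rho>) = A * s powr (- \<rho>)"
      using r t by (simp add: s_def powr_mult powr_powr flip: powr_realpow)
    let ?T = "{x. ennreal (A * s powr (- \<rho>)) < f x}"
    have "emeasure lborel ?T = (\<integral>\<^sup>+x. indicator ?T x \<partial>lborel)" by simp
    also have "\<dots> = ennreal (\<bar>r\<bar> ^ DIM('a)) * (\<integral>\<^sup>+x. indicator ?T (0 + r *\<^sub>R x) \<partial>lborel)"
      using r by (intro nn_integral_lborel_affine) auto
    also have "(\<integral>\<^sup>+x. indicator ?T (0 + r *\<^sub>R x) \<partial>lborel) = (\<integral>\<^sup>+x. indicator ?S x \<partial>lborel)"
      unfolding eq by (intro nn_integral_cong) (auto simp: indicator_def)
    also have "\<dots> = emeasure lborel ?S" by simp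
    finally have "ennreal (r ^ DIM('a)) * emeasure lborel ?S \<le> ennreal (r ^ DIM('a)) * ennreal t"
      using wkD[OF f s] r t by (simp add: s_def ennreal_mult)
    then have "ennreal (inverse (r ^ DIM('a))) * (ennreal (r ^ DIM('a)) * emeasure lborel ?S)
        \<le> ennreal (inverse (r ^ DIM('a))) * (ennreal (r ^ DIM('a)) * ennreal t)"
      by (rule mult_left_mono) simp
    then show ?thesis using r by (simp add: mult.assoc[symmetric] ennreal_mult[symmetric])
  qed
  then show ?thesis using A by (simp add: wk_def)
qed

lemma emeasure_ball_le:
  "\<exists>c>0. \<forall>(x::'a::euclidean_space) r. 0 \<le> r \<longrightarrow> emeasure lborel (ball x r) \<le> ennreal (c * r ^ DIM('a))"
  by (rule exI[of _ "unit_ball_vol (real DIM('a))"]) (auto simp: emeasure_ball)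

lemma wk_norm_powr:
  assumes \<rho>: "0 \<le> \<rho>"
  shows "\<exists>C>0. wk \<rho> C (\<lambda>x::'a::euclidean_space. ennreal (norm x powr (- (real DIM('a) * \<rho>))))"
proof -
  obtain c where c: "c > 0" and
    ball: "\<And>(x::'a) r. 0 \<le> r \<Longrightarrow> emeasure lborel (ball x r) \<le> ennreal (c * r ^ DIM('a))"
    using emeasure_ball_le by blast
  let ?n = "real DIM('a)"
  have "emeasure lborel {x::'a. ennreal (c powr \<rho> * t powr (- \<rho>)) < ennreal (norm x powr (- (?n * \<rho>)))}
     \<le> ennreal t" (is "emeasure lborel ?S \<le> _") if t: "t > 0" for t
  proof -
    \<comment> \<open>The radius for which the bound on the measure of a ball equals t; the
      superlevel set lies in that ball.\<close>
    define r where "r = (t / c) powr (1 / ?n)"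
    have r: "r > 0" using t c by (simp add: r_def)
    have rn: "c * r ^ DIM('a) = t"
      using t c by (simp add: r_def powr_powr powr_realpow[symmetric])
    have "?S \<subseteq> ball 0 r"
    proof
      fix x :: 'a assume "x \<in> ?S"
      then have *: "c powr \<rho> * t powr (- \<rho>) < norm x powr (- (?n * \<rho>))"
        by (simp add: ennreal_less_iff)
      have "norm x < r"
      proof (rule ccontr)
        assume "\<not> norm x < r"
        then have "norm x powr (- (?n * \<rho>)) \<le> r powr (- (?n * \<rho>))"
          using \<rho> r by (intro powr_mono2') auto
        also have "r powr (- (?n * \<rho>)) = (t / c) powr (- \<rho>)"
          by (simp add: r_def powr_powr)
        also have "\<dots> = c powr \<rho> * t powr (- \<rho>)"
          using t c by (simp add: powr_divide powr_minus) (simp add: divide_inverse)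
        finally show False using * by simp
      qed
      then show "x \<in> ball 0 r" by simp
    qed
    then have "emeasure lborel ?S \<le> emeasure lborel (ball (0::'a) r)"
      by (intro emeasure_mono) auto
    also have "\<dots> \<le> ennreal t" using ball[of r 0] r rn by simp
    finally show ?thesis .
  qed
  then show ?thesis using c by (intro exI[of _ "c powr \<rho>"]) (simp add: wk_def)
qed

text \<open>Averages over sets of finite measure. For \<open>0 \<le> \<rho> < 1\<close> this is an
  equivalent description of weak L^(1/\<rho>) that is countably subadditive, hence compatible with
  Tonelli's theorem; for \<rho> = 1 it is an L^1 bound.\<close>

definition ib :: "real \<Rightarrow> real \<Rightarrow> ('a::euclidean_space \<Rightarrow> ennreal) \<Rightarrow> bool" where
  "ib \<rho> A f \<longleftrightarrow> f \<in> borel_measurable borel \<and> 0 \<le> A \<and>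
    (\<forall>E\<in>sets borel. \<forall>m\<ge>0. emeasure lborel E = ennreal m \<longrightarrow>
       (\<integral>\<^sup>+x\<in>E. f x \<partial>lborel) \<le> ennreal (A * m powr (1 - \<rho>)))"

lemma ibD: "ib \<rho> A f \<Longrightarrow> E \<in> sets borel \<Longrightarrow> m \<ge> 0 \<Longrightarrow> emeasure lborel E = ennreal m \<Longrightarrow>
   (\<integral>\<^sup>+x\<in>E. f x \<partial>lborel) \<le> ennreal (A * m powr (1 - \<rho>))"
  by (simp only: ib_def)

lemma ib_imp_wk:
  fixes f :: "'a::euclidean_space \<Rightarrow> ennreal"
  assumes f: "ib \<rho> A f" and \<rho>: "0 \<le> \<rho>"
  shows "wk \<rho> A f"
proof -
  have [measurable]: "f \<in> borel_measurable borel" and A: "0 \<le> A"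
    using f by (auto simp: ib_def)
  have "emeasure lborel {x. ennreal (A * t powr (- \<rho>)) < f x} \<le> ennreal t" if t: "t > 0" for t
  proof -
    let ?F = "{x. ennreal (A * t powr (- \<rho>)) < f x}"
    \<comment> \<open>Superlevel sets are cut by balls because \<open>ib\<close> speaks only of sets
      of finite measure.\<close>
    let ?S = "\<lambda>n. ?F \<inter> ball 0 (real n)"
    have "?F = (\<Union>n. ?S n)"
    proof (intro antisym subsetI)
      fix x assume "x \<in> ?F"
      moreover obtain n where "norm x < real n" using reals_Archimedean2 by blast
      ultimately show "x \<in> (\<Union>n. ?S n)" by auto
    qed auto
    also have "emeasure lborel \<dots> \<le> ennreal t"
    proof (rule emeasure_UN_incseq_le)
      show "incseq ?S" by (auto simp: incseq_def)
      fix n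
      show "?S n \<in> sets lborel" by (intro sets.Int) auto
      have "emeasure lborel (?S n) \<le> emeasure lborel (ball (0::'a) (real n))"
        by (intro emeasure_mono) auto
      also have "\<dots> < \<infinity>" by (simp add: emeasure_ball)
      finally have fin: "emeasure lborel (?S n) < \<infinity>" .
      define S where "S = ?S n"
      have SF: "x \<in> S \<Longrightarrow> ennreal (A * t powr (- \<rho>)) < f x" for x by (simp add: S_def)
      have [measurable]: "S \<in> sets borel" unfolding S_def by (intro sets.Int) auto
      define m where "m = measure lborel S"
      have m: "emeasure lborel S = ennreal m" "m \<ge> 0"
        using fin by (simp_all add: m_def S_def emeasure_eq_ennreal_measure)
      show "emeasure lborel (?S n) \<le> ennreal t" unfolding S_def[symmetric]
      proof (rule ccontr)
        assume "\<not> emeasure lborel S \<le> ennreal t"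
        then have mt: "t < m" using m t by (simp add: not_le ennreal_less_iff)
        have "ennreal (A * t powr (- \<rho>)) * emeasure lborel S
            = (\<integral>\<^sup>+x. ennreal (A * t powr (- \<rho>)) * indicator S x \<partial>lborel)"
          by (subst nn_integral_cmult_indicator) auto
        \<comment> \<open>Strictness matters: f exceeds the level on all of S and S has positive
          measure. With a weak inequality the case \<rho> = 0 would give no contradiction.\<close>
        also have "\<dots> < (\<integral>\<^sup>+x\<in>S. f x \<partial>lborel)"
        proof (rule nn_integral_less)
          have "(\<integral>\<^sup>+x. ennreal (A * t powr (- \<rho>)) * indicator S x \<partial>lborel)
              = ennreal (A * t powr (- \<rho>)) * ennreal m"
            unfolding m(1)[symmetric] by (rule nn_integral_cmult_indicator) simp
          also have "\<dots> = ennreal (A * t powr (- \<rho>) * m)" using m A by (simp add: ennreal_mult)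
          finally show "(\<integral>\<^sup>+x. ennreal (A * t powr (- \<rho>)) * indicator S x \<partial>lborel) \<noteq> \<infinity>"
            by (simp only: ennreal_neq_top infinity_ennreal_def not_False_eq_True)
          show "AE x in lborel. ennreal (A * t powr (- \<rho>)) * indicator S x \<le> f x * indicator S x"
            by (auto simp: indicator_def dest!: SF)
          show "\<not> (AE x in lborel. f x * indicator S x \<le> ennreal (A * t powr (- \<rho>)) * indicator S x)"
          proof
            assume "AE x in lborel. f x * indicator S x \<le> ennreal (A * t powr (- \<rho>)) * indicator S x"
            then have "AE x in lborel. x \<notin> S"
              by eventually_elim (auto simp: indicator_def not_less[symmetric] dest: SF)
            then have "emeasure lborel S = 0"
              using AE_iff_null_sets[of S lborel] by auto
            then show False using m mt t by simp
          qed
        qed auto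
        also have "\<dots> \<le> ennreal (A * m powr (1 - \<rho>))"
          using m by (intro ibD[OF f]) auto
        also have "\<dots> = ennreal (A * m powr (- \<rho>) * m)"
          using mt t by (simp add: powr_diff powr_minus divide_simps)
        finally have "A * t powr (- \<rho>) * m < A * m powr (- \<rho>) * m"
          unfolding m using A m mt t by (simp add: ennreal_mult[symmetric] ennreal_less_iff)
        moreover have "m powr (- \<rho>) \<le> t powr (- \<rho>)"
          using mt t \<rho> by (intro powr_mono2') auto
        ultimately show False using A m(2)
          by (meson mult_left_mono mult_right_mono not_less)
      qed
    qed
    finally show ?thesis .
  qed
  with A show ?thesis by (simp add: wk_def)
qed

text \<open>Dyadic layer cake: with m the measure of E, f exceeds the level \<open>a j\<close> only
  on a set of measure \<open>T j\<close> = m 2^(-j), and the sum of the products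
  \<open>a (Suc j) * T j\<close> is geometric with ratio 2^(\<rho> - 1), which is below 1 exactly
  for \<open>\<rho> < 1\<close>.\<close>

lemma wk_imp_ib:
  assumes \<rho>: "0 \<le> \<rho>" "\<rho> < 1"
  shows "\<exists>C\<ge>1. \<forall>A (f :: 'a::euclidean_space \<Rightarrow> ennreal). wk \<rho> A f \<longrightarrow> ib \<rho> (C * A) f"
proof -
  define q :: real where "q = 2 powr (\<rho> - 1)"
  have q: "0 < q" "q < 1" using \<rho> by (auto simp: q_def powr_less_one)
  define C where "C = 1 + 2 powr \<rho> * (1 / (1 - q))"
  have C1: "C \<ge> 1" using q by (simp add: C_def)
  have "ib \<rho> (C * A) f" if f: "wk \<rho> A f" for A and f :: "'a \<Rightarrow> ennreal"
  proof -
    have [measurable]: "f \<in> borel_measurable borel"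
      using f by (auto dest: wk_meas)
    have A: "0 \<le> A" using f by (auto dest: wk_nonneg)
    have "(\<integral>\<^sup>+x\<in>E. f x \<partial>lborel) \<le> ennreal (C * A * m powr (1 - \<rho>))"
      if E[measurable]: "E \<in> sets borel" and m: "m \<ge> 0" "emeasure lborel E = ennreal m" for E m
    proof (cases "m = 0")
      case True
      with m have "E \<in> null_sets lborel" by (auto intro!: null_setsI)
      then have "(\<integral>\<^sup>+x\<in>E. f x \<partial>lborel) = 0"
        by (rule nn_integral_null_set)
      then show ?thesis by simp
    next
      case False
      with m have m0: "m > 0" by simp
      define T where "T j = m * 2 powr (- real j)" for j :: nat
      define a where "a j = A * T j powr (- \<rho>)" for j
      have T: "T j > 0" for j using m0 by (simp add: T_def)
      have a: "a j \<ge> 0" for j using A by (simp add: a_def)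
      let ?L = "\<lambda>j. {x. ennreal (a j) < f x}"
      have L: "emeasure lborel (?L j) \<le> ennreal (T j)" for j
        using wkD[OF f T[of j]] by (simp add: a_def)
      have "emeasure lborel (\<Inter>j. ?L j) \<le> 0"
      proof (rule ennreal_le_epsilon)
        fix e :: real assume e: "e > 0"
        obtain j where j: "m / e < 2 ^ j" using real_arch_pow[of 2 "m / e"] by auto
        then have "T j \<le> e" using e by (simp add: T_def powr_minus powr_realpow field_simps)
        have "emeasure lborel (\<Inter>j. ?L j) \<le> emeasure lborel (?L j)"
          by (intro emeasure_mono) auto
        also have "\<dots> \<le> ennreal (T j)" by (rule L)
        also have "\<dots> \<le> ennreal e" using \<open>T j \<le> e\<close> by (rule ennreal_leI)
        finally show "emeasure lborel (\<Inter>j. ?L j) \<le> 0 + ennreal e" by simp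
      qed
      then have "(\<Inter>j. ?L j) \<in> null_sets lborel" by (intro null_setsI) auto
      then have "AE x in lborel. x \<notin> (\<Inter>j. ?L j)" by (rule AE_not_in)
      then have "AE x in lborel. f x * indicator E x
          \<le> ennreal (a 0) * indicator E x + (\<Sum>j. ennreal (a (Suc j)) * indicator (?L j) x)"
      proof eventually_elim
        case (elim x)
        then obtain j0 where "\<not> ennreal (a j0) < f x" by auto
        \<comment> \<open>The first level that f x does not exceed. For n = Suc i the single summand
          of index i already dominates f x, since f x lies above level i.\<close>
        define n where "n = (LEAST j. \<not> ennreal (a j) < f x)"
        have n: "\<not> ennreal (a n) < f x" unfolding n_def by (rule LeastI) fact
        show ?case
        proof (cases n)
          case 0
          then show ?thesis using n by (auto simp: indicator_def not_less intro: add_increasing2)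
        next
          case (Suc i)
          then have "ennreal (a i) < f x" using not_less_Least[of i "\<lambda>j. \<not> ennreal (a j) < f x"]
            by (auto simp: n_def)
          then have "f x \<le> ennreal (a (Suc i)) * indicator (?L i) x"
            using n Suc by (simp add: not_less)
          also have "\<dots> = (\<Sum>j\<in>{i}. ennreal (a (Suc j)) * indicator (?L j) x)"
            by (simp only: sum.insert finite.emptyI empty_iff sum.empty add_0_right not_False_eq_True)
          also have "\<dots> \<le> (\<Sum>j. ennreal (a (Suc j)) * indicator (?L j) x)"
            by (intro sum_le_suminf) (auto simp: summableI)
          finally show ?thesis by (auto simp: indicator_def intro: add_increasing)
        qed
      qed
      then have "(\<integral>\<^sup>+x\<in>E. f x \<partial>lborel)
         \<le> (\<integral>\<^sup>+x. ennreal (a 0) * indicator E x + (\<Sum>j. ennreal (a (Suc j)) * indicator (?L j) x) \<partial>lborel)"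
        by (rule nn_integral_mono_AE)
      also have "\<dots> = ennreal (a 0) * emeasure lborel E + (\<Sum>j. ennreal (a (Suc j)) * emeasure lborel (?L j))"
        by (subst nn_integral_add, simp, simp, subst nn_integral_suminf) (simp_all add: nn_integral_cmult)
      also have "\<dots> \<le> ennreal (a 0) * ennreal m + (\<Sum>j. ennreal (a (Suc j)) * ennreal (T j))"
        unfolding m by (intro add_mono suminf_le mult_left_mono L) (auto simp: summableI)
      also have "(\<lambda>j. ennreal (a (Suc j)) * ennreal (T j)) = (\<lambda>j. ennreal (A * m powr (1 - \<rho>) * 2 powr \<rho> * q ^ j))"
      proof
        fix j
        have "a (Suc j) * T j = A * m powr (1 - \<rho>) * 2 powr \<rho> * q powr (real j)"
        proof -
          have "T (Suc j) powr (- \<rho>) = m powr (- \<rho>) * 2 powr (real (Suc j) * \<rho>)"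
            using m0 by (simp add: T_def powr_mult powr_powr) (simp add: algebra_simps)
          then have "a (Suc j) * T j = A * (m powr (- \<rho>) * m) * (2 powr (real (Suc j) * \<rho>) * 2 powr (- real j))"
            by (simp only: a_def T_def[of j] mult_ac)
          moreover have "2 powr (real (Suc j) * \<rho>) * 2 powr (- real j) = 2 powr \<rho> * q powr (real j)"
            by (simp add: q_def powr_powr flip: powr_add) (simp add: algebra_simps)
          moreover have "m powr (1 - \<rho>) = m powr (- \<rho>) * m"
            using m0 by (simp add: powr_diff powr_minus divide_simps)
          ultimately show ?thesis by (simp only: mult_ac)
        qed
        then show "ennreal (a (Suc j)) * ennreal (T j) = ennreal (A * m powr (1 - \<rho>) * 2 powr \<rho> * q ^ j)"
          using a T[of j] q by (simp add: ennreal_mult[symmetric] powr_realpow less_imp_le)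
      qed
      also have "(\<Sum>j. ennreal (A * m powr (1 - \<rho>) * 2 powr \<rho> * q ^ j))
          = ennreal (\<Sum>j. A * m powr (1 - \<rho>) * 2 powr \<rho> * q ^ j)"
        using A q by (intro suminf_ennreal2 summable_mult summable_geometric) auto
      also have "(\<Sum>j. A * m powr (1 - \<rho>) * 2 powr \<rho> * q ^ j) = A * m powr (1 - \<rho>) * 2 powr \<rho> * (1 / (1 - q))"
        using q by (subst suminf_mult) (auto simp: suminf_geometric summable_geometric)
      also have "ennreal (a 0) * ennreal m = ennreal (A * m powr (1 - \<rho>))"
        using m0 A by (simp add: a_def T_def ennreal_mult[symmetric] powr_diff powr_minus divide_simps)
      also have "ennreal (A * m powr (1 - \<rho>)) + ennreal (A * m powr (1 - \<rho>) * 2 powr \<rho> * (1 / (1 - q)))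
          = ennreal (C * A * m powr (1 - \<rho>))"
        using A q by (subst ennreal_plus[symmetric]) (auto simp: C_def algebra_simps)
      finally show ?thesis .
    qed
    then show ?thesis using A C1 by (simp add: ib_def)
  qed
  then show ?thesis using C1 by blast
qed

section \<open>Smoothing of the heat semigroup\<close>

definition hop :: "real \<Rightarrow> ('a::euclidean_space \<Rightarrow> ennreal) \<Rightarrow> 'a \<Rightarrow> ennreal" where
  "hop t F x = (\<integral>\<^sup>+y. ennreal (heat_kernel t (x - y)) * F y \<partial>lborel)"

lemma heat_kernel_nonneg [simp]: "0 \<le> heat_kernel t x"
  by (simp add: heat_kernel_def)

lemma heat_kernel_minus: "heat_kernel t (x - y) = heat_kernel t (y - x)"
  by (simp add: heat_kernel_def norm_minus_commute)

lemma measurable_heat_kernel [measurable (raw)]: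
  assumes [measurable]: "f \<in> borel_measurable M" "g \<in> borel_measurable M"
  shows "(\<lambda>x. heat_kernel (f x) (g x :: 'a::euclidean_space)) \<in> borel_measurable M"
  unfolding heat_kernel_def by measurable

lemma measurable_hop [measurable]:
  assumes [measurable]: "F \<in> borel_measurable borel"
  shows "hop t F \<in> borel_measurable borel"
  unfolding hop_def[abs_def] by measurable

lemma hop_mono_AE: "AE y in lborel. F y \<le> G y \<Longrightarrow> hop t F x \<le> hop t G x"
  unfolding hop_def by (intro nn_integral_mono_AE) (auto elim!: eventually_mono intro: mult_left_mono)

lemma hop_cong_AE: "AE y in lborel. F y = G y \<Longrightarrow> hop t F x = hop t G x"
  by (intro antisym hop_mono_AE) (auto elim: eventually_mono)

lemma hop_cmult:
  assumes [measurable]: "F \<in> borel_measurable borel"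
  shows "hop t (\<lambda>y. c * F y) x = c * hop t F x"
  unfolding hop_def by (subst nn_integral_cmult[symmetric]) (auto intro!: nn_integral_cong simp: mult_ac)

text \<open>Parabolic scaling: it reduces every estimate at time t to time 1, so the weighted kernel
  bounds below are needed only there.\<close>

lemma hop_scale:
  fixes F :: "'a::euclidean_space \<Rightarrow> ennreal"
  assumes [measurable]: "F \<in> borel_measurable borel" and t: "t > 0"
  shows "hop t F (sqrt t *\<^sub>R x) = hop 1 (\<lambda>y. F (sqrt t *\<^sub>R y)) x"
proof -
  have *: "(sqrt t) ^ DIM('a) * heat_kernel t (sqrt t *\<^sub>R z) = heat_kernel 1 z" for z :: 'a
  proof -
    have "(4 * pi * t) powr (- real DIM('a) / 2) = (4 * pi) powr (- real DIM('a) / 2) * t powr (- real DIM('a) / 2)"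
      using t by (simp add: powr_mult)
    moreover have "(sqrt t) ^ DIM('a) = t powr (real DIM('a) / 2)"
      using t by (simp add: powr_half_sqrt[symmetric] powr_powr flip: powr_realpow)
    moreover have "t powr (real DIM('a) / 2) * t powr (- real DIM('a) / 2) = 1"
      using t by (simp flip: powr_add)
    ultimately show ?thesis
      using t by (simp add: heat_kernel_def power_mult_distrib)
  qed
  have "hop t F (sqrt t *\<^sub>R x) = ennreal (\<bar>sqrt t\<bar> ^ DIM('a)) *
     (\<integral>\<^sup>+y. ennreal (heat_kernel t (sqrt t *\<^sub>R x - (0 + sqrt t *\<^sub>R y))) * F (0 + sqrt t *\<^sub>R y) \<partial>lborel)"
    unfolding hop_def using t by (subst nn_integral_lborel_affine[where c="sqrt t" and t=0]) auto
  also have "\<dots> = (\<integral>\<^sup>+y. ennreal ((sqrt t) ^ DIM('a)) * (ennreal (heat_kernel t (sqrt t *\<^sub>R x - sqrt t *\<^sub>R y)) * F (sqrt t *\<^sub>R y)) \<partial>lborel)"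
    using t by (subst nn_integral_cmult) auto
  also have "\<dots> = hop 1 (\<lambda>y. F (sqrt t *\<^sub>R y)) x"
    unfolding hop_def
  proof (intro nn_integral_cong)
    fix y
    have "ennreal ((sqrt t) ^ DIM('a)) * ennreal (heat_kernel t (sqrt t *\<^sub>R x - sqrt t *\<^sub>R y))
       = ennreal (heat_kernel 1 (x - y))"
      using t by (subst ennreal_mult[symmetric]) (simp_all add: *[of "x - y"] scaleR_diff_right[symmetric])
    then show "ennreal ((sqrt t) ^ DIM('a)) * (ennreal (heat_kernel t (sqrt t *\<^sub>R x - sqrt t *\<^sub>R y)) * F (sqrt t *\<^sub>R y))
      = ennreal (heat_kernel 1 (x - y)) * F (sqrt t *\<^sub>R y)"
      by (simp only: mult.assoc[symmetric])
  qed
  finally show ?thesis .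
qed

text \<open>A polynomially decaying kernel that takes the place of the Gaussian. The exponent
  dimension + 1 leaves one full power beyond integrability, which makes the dyadic sums below
  geometric for every \<open>0 \<le> \<rho> \<le> 1\<close>.\<close>

definition jk :: "'a::euclidean_space \<Rightarrow> real" where
  "jk z = (1 + norm z) powr (- (real DIM('a) + 1))"

lemma jk_nonneg [simp]: "0 \<le> jk z" and jk_le1: "jk z \<le> 1"
  by (auto simp: jk_def intro: powr_le1 powr_mono2'[of _ 1, simplified])

lemma measurable_jk [measurable]: "jk \<in> borel_measurable borel"
  unfolding jk_def[abs_def] by measurable

text \<open>Dyadic domination of the kernel; ball averages then control convolutions with it.\<close>

lemma jk_le_balls:
  fixes z :: "'a::euclidean_space"
  shows "ennreal (jk z) \<le> (\<Sum>n. ennreal (2 powr (- (real DIM('a) + 1) * real n)) * indicator (ball 0 (2 ^ Suc n)) z)"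
proof -
  define n where "n = (LEAST n. norm z < 2 ^ Suc n)"
  have "\<exists>n. norm z < 2 ^ Suc n"
    using real_arch_pow[of 2 "norm z"] by (metis less_trans numeral_less_iff one_less_numeral_iff power_strict_increasing_iff
        semiring_norm(76) lessI one_less_numeral)
  then have n: "norm z < 2 ^ Suc n" unfolding n_def by (rule LeastI_ex)
  have n': "2 ^ n \<le> 1 + norm z"
  proof (cases n)
    case (Suc i)
    then have "\<not> norm z < 2 ^ Suc i" using not_less_Least[of i "\<lambda>n. norm z < 2 ^ Suc n"] by (simp add: n_def)
    then show ?thesis using Suc by simp
  qed simp
  have "jk z \<le> (2 ^ n) powr (- (real DIM('a) + 1))"
    unfolding jk_def using n' by (intro powr_mono2') auto
  also have "\<dots> = 2 powr (- (real DIM('a) + 1) * real n)"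
    by (simp add: powr_realpow[symmetric] powr_powr mult.commute)
  finally have "ennreal (jk z) \<le> ennreal (2 powr (- (real DIM('a) + 1) * real n)) * indicator (ball 0 (2 ^ Suc n)) z"
    using n by (simp add: ennreal_leI)
  also have "\<dots> = (\<Sum>n\<in>{n}. ennreal (2 powr (- (real DIM('a) + 1) * real n)) * indicator (ball 0 (2 ^ Suc n)) z)"
    by (simp only: sum.insert finite.emptyI empty_iff sum.empty add_0_right not_False_eq_True)
  also have "\<dots> \<le> (\<Sum>n. ennreal (2 powr (- (real DIM('a) + 1) * real n)) * indicator (ball 0 (2 ^ Suc n)) z)"
    by (intro sum_le_suminf) (auto simp: summableI)
  finally show ?thesis .
qed

lemma ib_ball:
  fixes f :: "'a::euclidean_space \<Rightarrow> ennreal"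
  assumes c: "c > 0" and ball: "\<And>(x::'a) r. 0 \<le> r \<Longrightarrow> emeasure lborel (ball x r) \<le> ennreal (c * r ^ DIM('a))"
    and f: "ib \<rho> A f" and \<rho>: "\<rho> \<le> 1" and r: "r > 0"
  shows "(\<integral>\<^sup>+y\<in>ball x r. f y \<partial>lborel) \<le> ennreal (A * (c powr (1 - \<rho>) * r powr (real DIM('a) * (1 - \<rho>))))"
proof -
  define m where "m = measure lborel (ball x r)"
  have A: "A \<ge> 0" using f by (simp add: ib_def)
  have fin: "emeasure lborel (ball x r) < \<infinity>" using r by (simp add: emeasure_ball)
  have m: "emeasure lborel (ball x r) = ennreal m" "m \<ge> 0"
    using fin by (simp_all add: m_def emeasure_eq_ennreal_measure)
  have "ennreal m \<le> ennreal (c * r ^ DIM('a))" using ball[of r x] r m by simp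
  then have mc: "m \<le> c * r ^ DIM('a)" using c r by (simp add: ennreal_le_iff)
  have "(\<integral>\<^sup>+y\<in>ball x r. f y \<partial>lborel) \<le> ennreal (A * m powr (1 - \<rho>))"
    using f m by (intro ibD) auto
  also have "\<dots> \<le> ennreal (A * (c * r ^ DIM('a)) powr (1 - \<rho>))"
    using mc m(2) \<rho> A by (intro ennreal_leI mult_left_mono powr_mono2) auto
  also have "(c * r ^ DIM('a)) powr (1 - \<rho>) = c powr (1 - \<rho>) * r powr (real DIM('a) * (1 - \<rho>))"
    using c r by (simp add: powr_mult powr_powr flip: powr_realpow)
  finally show ?thesis .
qed

text \<open>Integrals of f over balls grow at most like r^(n(1 - \<rho>)), while the dyadic weights
  of \<open>jk\<close> decay like r^(-(n + 1)). Summation over the radii 2^(j+1) gives a bound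
  uniform in x.\<close>

lemma jk_conv_bound:
  assumes \<rho>: "0 \<le> \<rho>" "\<rho> \<le> 1"
  shows "\<exists>C>0. \<forall>A (f :: 'a::euclidean_space \<Rightarrow> ennreal) x. ib \<rho> A f \<longrightarrow>
    (\<integral>\<^sup>+y. ennreal (jk (x - y)) * f y \<partial>lborel) \<le> ennreal (C * A)"
proof -
  let ?n = "real DIM('a)"
  obtain c where c: "c > 0" and
    ball: "\<And>(x::'a) r. 0 \<le> r \<Longrightarrow> emeasure lborel (ball x r) \<le> ennreal (c * r ^ DIM('a))"
    using emeasure_ball_le by blast
  define q :: real where "q = 2 powr (?n * (1 - \<rho>) - (?n + 1))"
  have "?n * (1 - \<rho>) \<le> ?n * 1" using \<rho> by (intro mult_left_mono) auto
  then have "?n * (1 - \<rho>) - (?n + 1) < 0" by linarith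
  then have q: "0 < q" "q < 1" by (simp_all add: q_def powr_less_one)
  define B where "B = c powr (1 - \<rho>) * 2 powr (?n * (1 - \<rho>))"
  have B: "B > 0" using c by (simp add: B_def)
  have "(\<integral>\<^sup>+y. ennreal (jk (x - y)) * f y \<partial>lborel) \<le> ennreal (B / (1 - q) * A)"
    if f: "ib \<rho> A f" for A and f :: "'a \<Rightarrow> ennreal" and x
  proof -
    have [measurable]: "f \<in> borel_measurable borel" and A: "A \<ge> 0" using f by (auto simp: ib_def)
    have bm2: "(\<lambda>y. f y * indicator (ball x r) y) \<in> borel_measurable lborel" for r
      by (intro borel_measurable_times_ennreal borel_measurable_indicator) simp_all
    have bm: "(\<lambda>y. c * (f y * indicator (ball x r) y)) \<in> borel_measurable lborel" for r c
      by (rule borel_measurable_times_ennreal[OF borel_measurable_const bm2])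
    have "(\<integral>\<^sup>+y. ennreal (jk (x - y)) * f y \<partial>lborel)
       \<le> (\<integral>\<^sup>+y. (\<Sum>n. ennreal (2 powr (- (?n + 1) * real n)) * indicator (ball 0 (2 ^ Suc n)) (x - y)) * f y \<partial>lborel)"
      by (intro nn_integral_mono mult_right_mono jk_le_balls) auto
    also have "\<dots> = (\<integral>\<^sup>+y. (\<Sum>n. ennreal (2 powr (- (?n + 1) * real n)) * (f y * indicator (ball x (2 ^ Suc n)) y)) \<partial>lborel)"
    proof (rule nn_integral_cong)
      fix y
      have "indicator (ball 0 (2 ^ Suc n)) (x - y) = (indicator (ball x (2 ^ Suc n)) y :: ennreal)" for n
        by (simp add: indicator_def dist_norm norm_minus_commute)
      then show "(\<Sum>n. ennreal (2 powr (- (?n + 1) * real n)) * indicator (ball 0 (2 ^ Suc n)) (x - y)) * f y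
        = (\<Sum>n. ennreal (2 powr (- (?n + 1) * real n)) * (f y * indicator (ball x (2 ^ Suc n)) y))"
        by (subst ennreal_suminf_multc[symmetric]) (simp only: mult_ac)
    qed
    also have "\<dots> = (\<Sum>n. ennreal (2 powr (- (?n + 1) * real n)) * (\<integral>\<^sup>+y\<in>ball x (2 ^ Suc n). f y \<partial>lborel))"
      by (subst nn_integral_suminf, intro bm, subst nn_integral_cmult, intro bm2, rule refl)
    also have "\<dots> \<le> (\<Sum>n. ennreal (2 powr (- (?n + 1) * real n)) * ennreal (A * (c powr (1 - \<rho>) * (2 ^ Suc n) powr (?n * (1 - \<rho>)))))"
      by (intro suminf_le mult_left_mono ib_ball[OF c ball f \<rho>(2)] summableI) simp_all
    also have "(\<lambda>n. ennreal (2 powr (- (?n + 1) * real n)) * ennreal (A * (c powr (1 - \<rho>) * (2 ^ Suc n) powr (?n * (1 - \<rho>)))))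
        = (\<lambda>n. ennreal (B * A * q ^ n))"
    proof
      fix n
      have 1: "(2 ^ Suc n :: real) powr (?n * (1 - \<rho>)) = 2 powr (?n * (1 - \<rho>)) * 2 powr (real n * (?n * (1 - \<rho>)))"
        by (simp add: powr_mult) (simp add: powr_realpow[symmetric] powr_powr)
      have 2: "2 powr (- (?n + 1) * real n) * 2 powr (real n * (?n * (1 - \<rho>))) = q ^ n"
        by (simp add: q_def powr_realpow[symmetric] powr_powr flip: powr_add) (simp add: algebra_simps)
      have "2 powr (- (?n + 1) * real n) * (A * (c powr (1 - \<rho>) * (2 ^ Suc n) powr (?n * (1 - \<rho>)))) = B * A * q ^ n"
        unfolding 1 2[symmetric] B_def by (simp only: mult_ac)
      moreover have "ennreal (2 powr (- (?n + 1) * real n)) * ennreal (A * (c powr (1 - \<rho>) * (2 ^ Suc n) powr (?n * (1 - \<rho>)))) = ennreal (2 powr (- (?n + 1) * real n) * (A * (c powr (1 - \<rho>) * (2 ^ Suc n) powr (?n * (1 - \<rho>)))))"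
        using A by (intro ennreal_mult[symmetric]) auto
      ultimately show "ennreal (2 powr (- (?n + 1) * real n)) * ennreal (A * (c powr (1 - \<rho>) * (2 ^ Suc n) powr (?n * (1 - \<rho>)))) = ennreal (B * A * q ^ n)"
        by (simp only:)
    qed
    also have "(\<Sum>n. ennreal (B * A * q ^ n)) = ennreal (\<Sum>n. B * A * q ^ n)"
      using A B q by (intro suminf_ennreal2 summable_mult summable_geometric) auto
    also have "(\<Sum>n. B * A * q ^ n) = B / (1 - q) * A"
      using q by (subst suminf_mult) (auto simp: suminf_geometric summable_geometric)
    finally show ?thesis .
  qed
  then show ?thesis using B q by (intro exI[of _ "B / (1 - q)"]) auto
qed

text \<open>The constant function 1 satisfies \<open>ib 0 1\<close>, so the mass of
  \<open>jk\<close> is an instance of the convolution bound at x = 0.\<close>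

lemma nn_integral_jk_finite: "\<exists>c>0. (\<integral>\<^sup>+z. ennreal (jk (z :: 'a::euclidean_space)) \<partial>lborel) \<le> ennreal c"
proof -
  have "ib 0 1 (\<lambda>_::'a. 1)"
    by (auto simp: ib_def)
  moreover obtain C where "C > 0" "\<And>A (f :: 'a \<Rightarrow> ennreal) x. ib 0 A f \<Longrightarrow>
    (\<integral>\<^sup>+y. ennreal (jk (x - y)) * f y \<partial>lborel) \<le> ennreal (C * A)"
    using jk_conv_bound[where 'a='a, of 0] by auto
  ultimately have "C > 0" "\<And>x::'a. (\<integral>\<^sup>+y. ennreal (jk (x - y)) * 1 \<partial>lborel) \<le> ennreal (C * 1)"
    by blast+
  from this(1) this(2)[of 0] show ?thesis by (auto simp: jk_def)
qed

text \<open>\<open>ib\<close> is invariant under translation, and averaging translates against a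
  kernel of finite mass preserves it. The interchange of integrals is the step that a quasi-norm
  would not allow.\<close>

lemma ib_jk_conv:
  assumes \<rho>: "0 \<le> \<rho>" "\<rho> \<le> 1"
  shows "\<exists>C>0. \<forall>A (f :: 'a::euclidean_space \<Rightarrow> ennreal). ib \<rho> A f \<longrightarrow>
    ib \<rho> (C * A) (\<lambda>x. \<integral>\<^sup>+y. ennreal (jk (x - y)) * f y \<partial>lborel)"
proof -
  obtain c where c: "c > 0" "(\<integral>\<^sup>+z. ennreal (jk (z :: 'a)) \<partial>lborel) \<le> ennreal c"
    using nn_integral_jk_finite by blast
  have "ib \<rho> (c * A) (\<lambda>x. \<integral>\<^sup>+y. ennreal (jk (x - y)) * f y \<partial>lborel)" if f: "ib \<rho> A f" for A and f :: "'a \<Rightarrow> ennreal"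
  proof -
    have [measurable]: "f \<in> borel_measurable borel" and A: "A \<ge> 0" using f by (auto simp: ib_def)
    have shift: "(\<integral>\<^sup>+y. ennreal (jk (x - y)) * f y \<partial>lborel) = (\<integral>\<^sup>+z. ennreal (jk z) * f (x - z) \<partial>lborel)" for x
      using nn_integral_lborel_affine[of "\<lambda>y. ennreal (jk (x - y)) * f y" "-1" x] by simp
    have "(\<integral>\<^sup>+x\<in>E. (\<integral>\<^sup>+y. ennreal (jk (x - y)) * f y \<partial>lborel) \<partial>lborel) \<le> ennreal (c * A * m powr (1 - \<rho>))"
      if E[measurable]: "E \<in> sets borel" and m: "m \<ge> 0" "emeasure lborel E = ennreal m" for E m
    proof -
      have "(\<integral>\<^sup>+x\<in>E. (\<integral>\<^sup>+y. ennreal (jk (x - y)) * f y \<partial>lborel) \<partial>lborel)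
          = (\<integral>\<^sup>+x. (\<integral>\<^sup>+z. ennreal (jk z) * (f (x - z) * indicator E x) \<partial>lborel) \<partial>lborel)"
        unfolding shift by (subst nn_integral_multc[symmetric]) (auto simp: mult_ac)
      also have "\<dots> = (\<integral>\<^sup>+z. (\<integral>\<^sup>+x. ennreal (jk z) * (f (x - z) * indicator E x) \<partial>lborel) \<partial>lborel)"
        by (rule lborel_pair.Fubini') measurable
      also have "\<dots> = (\<integral>\<^sup>+z. ennreal (jk z) * (\<integral>\<^sup>+x. f (x - z) * indicator E x \<partial>lborel) \<partial>lborel)"
        by (subst nn_integral_cmult) auto
      also have "\<dots> \<le> nn_integral lborel (\<lambda>z::'a. ennreal (jk z) * ennreal (A * m powr (1 - \<rho>)))"
      proof (rule nn_integral_mono)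
        fix z :: 'a
        let ?E = "(\<lambda>x. x + z) -` E"
        have Em: "?E \<in> sets borel" using measurable_sets[of "\<lambda>x. x + z" borel borel E] by simp
        have "(\<integral>\<^sup>+x. f (x - z) * indicator E x \<partial>lborel) = (\<integral>\<^sup>+x\<in>?E. f x \<partial>lborel)"
          using nn_integral_lborel_affine[of "\<lambda>x. f (x - z) * indicator E x" 1 z]
          by (simp add: indicator_def add.commute)
        also have "\<dots> \<le> ennreal (A * m powr (1 - \<rho>))"
        proof (rule ibD[OF f Em m(1)])
          have "emeasure lborel E = (\<integral>\<^sup>+x. indicator E x \<partial>lborel)" by simp
          also have "\<dots> = (\<integral>\<^sup>+x. indicator ?E x \<partial>lborel)"
            using nn_integral_lborel_affine[of "\<lambda>x. indicator E x" 1 z]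
            by (simp add: indicator_def add.commute)
          also have "\<dots> = emeasure lborel ?E" using Em by simp
          finally show "emeasure lborel ?E = ennreal m" using m by simp
        qed
        finally show "ennreal (jk z) * (\<integral>\<^sup>+x. f (x - z) * indicator E x \<partial>lborel)
            \<le> ennreal (jk z) * ennreal (A * m powr (1 - \<rho>))" by (rule mult_left_mono) simp
      qed
      also have "\<dots> \<le> ennreal c * ennreal (A * m powr (1 - \<rho>))"
        using c by (subst nn_integral_multc) (auto intro: mult_right_mono)
      also have "\<dots> = ennreal (c * A * m powr (1 - \<rho>))"
        using c A by (simp add: ennreal_mult[symmetric] mult.assoc)
      finally show ?thesis .
    qed
    then show ?thesis using A c by (simp add: ib_def)
  qed
  then show ?thesis using c by blast
qed

text \<open>A function that is bounded and integrable lies in all these spaces: integrability serves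
  the sets of measure at least 1, boundedness the smaller ones.\<close>

lemma ib_jk:
  assumes \<rho>: "0 \<le> \<rho>" "\<rho> \<le> 1"
  shows "\<exists>C>0. ib \<rho> C (\<lambda>x::'a::euclidean_space. ennreal (jk x))"
proof -
  obtain c where c: "c > 0" "(\<integral>\<^sup>+z. ennreal (jk (z :: 'a)) \<partial>lborel) \<le> ennreal c"
    using nn_integral_jk_finite by blast
  define C where "C = max 1 c"
  have "(\<integral>\<^sup>+x\<in>E. ennreal (jk x) \<partial>lborel) \<le> ennreal (C * m powr (1 - \<rho>))"
    if E[measurable]: "E \<in> sets borel" and m: "m \<ge> 0" "emeasure lborel E = ennreal m" for E :: "'a set" and m
  proof (cases "m \<ge> 1")
    case True
    have "(\<integral>\<^sup>+x\<in>E. ennreal (jk x) \<partial>lborel) \<le> (\<integral>\<^sup>+x. ennreal (jk (x::'a)) \<partial>lborel)"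
      by (intro nn_integral_mono) (auto simp: indicator_def)
    also have "\<dots> \<le> ennreal c" by fact
    also have "\<dots> \<le> ennreal (C * m powr (1 - \<rho>))"
    proof (rule ennreal_leI)
      have "c * 1 \<le> C * m powr (1 - \<rho>)"
        using True \<rho> c by (intro mult_mono) (auto simp: C_def ge_one_powr_ge_zero)
      then show "c \<le> C * m powr (1 - \<rho>)" by simp
    qed
    finally show ?thesis .
  next
    case False
    have "(\<integral>\<^sup>+x\<in>E. ennreal (jk x) \<partial>lborel) \<le> (\<integral>\<^sup>+x. indicator E x \<partial>lborel)"
      using jk_le1 by (intro nn_integral_mono) (auto simp: indicator_def)
    also have "\<dots> = ennreal m" using m by simp
    also have "\<dots> \<le> ennreal (C * m powr (1 - \<rho>))"
    proof (cases "m = 0")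
      case m0: False
      have "m powr 1 \<le> m powr (1 - \<rho>)" using False m m0 \<rho> by (intro powr_mono') auto
      moreover have "1 * m powr (1 - \<rho>) \<le> C * m powr (1 - \<rho>)"
        by (intro mult_right_mono) (auto simp: C_def)
      ultimately have "m \<le> C * m powr (1 - \<rho>)" using m m0 by (auto intro: order_trans)
      then show ?thesis by (rule ennreal_leI)
    qed simp
    finally show ?thesis .
  qed
  moreover have "C > 0" by (simp add: C_def)
  ultimately show ?thesis by (intro exI[of _ C]) (simp add: ib_def)
qed


text \<open>A single term of the exponential series dominates any prescribed power, and
  \<open>1 + r \<le> 2 + r^2 / 4\<close> compares exp(1 + r) with the inverse of the Gaussian at
  time 1. The free power L later pays for moving a weight past the kernel.\<close>

lemma heat_kernel_le_jk:
  "\<exists>C>0. \<forall>z::'a::euclidean_space. heat_kernel 1 z \<le> C * (1 + norm z) powr (- L) * jk z"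
proof -
  define N where "N = nat \<lceil>\<bar>L\<bar> + real DIM('a) + 1\<rceil>"
  have N: "L + real DIM('a) + 1 \<le> real N" unfolding N_def by linarith
  define C where "C = (4 * pi) powr (- real DIM('a) / 2) * (fact N * exp 2)"
  have "heat_kernel 1 z \<le> C * (1 + norm z) powr (- L) * jk z" for z :: 'a
  proof -
    let ?r = "norm z"
    have "(\<Sum>n\<in>{N}. (1 + ?r) ^ n /\<^sub>R fact n) \<le> (\<Sum>n. (1 + ?r) ^ n /\<^sub>R fact n)"
      using summable_exp_generic[of "1 + ?r"] by (intro sum_le_suminf) auto
    then have "(1 + ?r) ^ N / fact N \<le> exp (1 + ?r)"
      by (simp add: exp_def divide_inverse mult.commute)
    then have "(1 + ?r) ^ N \<le> fact N * exp (1 + ?r)" by (simp add: field_simps)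
    moreover have "1 + ?r \<le> 2 + ?r\<^sup>2 / 4"
      using zero_le_power2[of "?r / 2 - 1"] by (simp add: power2_eq_square field_simps)
    ultimately have *: "(1 + ?r) ^ N \<le> fact N * (exp 2 * exp (?r\<^sup>2 / 4))"
      by (smt (verit, best) exp_le_cancel_iff exp_add fact_ge_zero mult_left_mono)
    have "(1 + ?r) powr L * (1 + ?r) powr (real DIM('a) + 1) \<le> (1 + ?r) powr real N"
      using N by (simp flip: powr_add) (intro powr_mono, auto)
    also have "\<dots> = (1 + ?r) ^ N" by (rule powr_realpow) (auto intro: add_pos_nonneg)
    also note *
    finally have "exp (- ?r\<^sup>2 / 4) * ((1 + ?r) powr L * (1 + ?r) powr (real DIM('a) + 1))
       \<le> exp (- ?r\<^sup>2 / 4) * (fact N * (exp 2 * exp (?r\<^sup>2 / 4)))"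
      by (rule mult_left_mono) simp
    also have "\<dots> = fact N * exp 2" by (simp add: exp_minus)
    finally have "exp (- ?r\<^sup>2 / 4) * ((1 + ?r) powr L * (1 + ?r) powr (real DIM('a) + 1)) \<le> fact N * exp 2" .
    then have "exp (- ?r\<^sup>2 / 4) \<le> fact N * exp 2 * ((1 + ?r) powr (- L) * (1 + ?r) powr (- (real DIM('a) + 1)))"
    proof -
      have p: "(1 + ?r) powr L * (1 + ?r) powr (real DIM('a) + 1) > 0"
        using norm_ge_zero[of z] by (intro mult_pos_pos) (auto simp: powr_gt_zero simp del: norm_ge_zero)
      assume "exp (- ?r\<^sup>2 / 4) * ((1 + ?r) powr L * (1 + ?r) powr (real DIM('a) + 1)) \<le> fact N * exp 2"
      then have "exp (- ?r\<^sup>2 / 4) \<le> fact N * exp 2 / ((1 + ?r) powr L * (1 + ?r) powr (real DIM('a) + 1))"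
        using p by (simp only: pos_le_divide_eq)
      then show ?thesis by (simp only: powr_minus divide_inverse inverse_mult_distrib)
    qed
    then show ?thesis
      unfolding heat_kernel_def jk_def C_def by (simp add: mult_ac mult_left_mono)
  qed
  moreover have "C > 0" by (simp add: C_def)
  ultimately show ?thesis by blast
qed

text \<open>Peetre's inequality: the weights at x and y differ at most by a power of the distance,
  whatever the sign of k.\<close>

lemma one_plus_norm_powr_le:
  fixes x y :: "'a::real_normed_vector"
  shows "(1 + norm y) powr (- k) \<le> (1 + norm x) powr (- k) * (1 + norm (x - y)) powr \<bar>k\<bar>"
proof (cases "k \<ge> 0")
  case True
  have "1 + norm x \<le> 1 + norm y + norm (x - y)" using norm_triangle_sub[of x y] by simp
  also have "\<dots> \<le> (1 + norm y) * (1 + norm (x - y))" by (simp add: algebra_simps)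
  finally have "(1 + norm x) powr k \<le> ((1 + norm y) * (1 + norm (x - y))) powr k"
    using True by (intro powr_mono2) auto
  then have "(1 + norm x) powr k \<le> (1 + norm y) powr k * (1 + norm (x - y)) powr k"
    by (simp add: powr_mult)
  moreover have "(1 + norm x) powr k > 0" "(1 + norm y) powr k > 0"
    using norm_ge_zero[of x] norm_ge_zero[of y] by (simp_all add: powr_gt_zero del: norm_ge_zero)
  ultimately show ?thesis using True by (simp add: powr_minus field_simps)
next
  case False
  have "1 + norm y \<le> 1 + norm x + norm (x - y)" using norm_triangle_sub[of y x] by (simp add: norm_minus_commute)
  also have "\<dots> \<le> (1 + norm x) * (1 + norm (x - y))" by (simp add: algebra_simps)
  finally have "(1 + norm y) powr (- k) \<le> ((1 + norm x) * (1 + norm (x - y))) powr (- k)"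
    using False by (intro powr_mono2) auto
  then show ?thesis using False by (simp add: powr_mult)
qed

text \<open>Dyadic annuli: inside the ball of radius 2^(-j) the annulus carries a weight of at most
  2^(k(j+1)), and the integral of f is of order 2^(-j n(1 - \<rho>)). The condition
  \<open>k + n * \<rho> < n\<close>, n being the dimension, is what makes the sum converge.\<close>

lemma powr_near_zero_integral:
  assumes \<rho>: "0 \<le> \<rho>" "\<rho> \<le> 1" and k: "0 \<le> k" "k + real DIM('a) * \<rho> < real DIM('a::euclidean_space)"
  shows "\<exists>C>0. \<forall>A (f :: 'a \<Rightarrow> ennreal). ib \<rho> A f \<longrightarrow>
    (\<integral>\<^sup>+y\<in>ball 0 1. ennreal (norm y powr (- k)) * f y \<partial>lborel) \<le> ennreal (C * A)"
proof -
  let ?n = "real DIM('a)"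
  obtain c where c: "c > 0" and
    ball: "\<And>(x::'a) r. 0 \<le> r \<Longrightarrow> emeasure lborel (ball x r) \<le> ennreal (c * r ^ DIM('a))"
    using emeasure_ball_le by blast
  define q :: real where "q = 2 powr (k - ?n * (1 - \<rho>))"
  have q: "0 < q" "q < 1" using k by (auto simp: q_def algebra_simps intro!: powr_less_one)
  define B where "B = c powr (1 - \<rho>) * 2 powr k"
  have B: "B > 0" using c by (simp add: B_def)
  have "(\<integral>\<^sup>+y\<in>ball 0 1. ennreal (norm y powr (- k)) * f y \<partial>lborel) \<le> ennreal (B / (1 - q) * A)"
    if f: "ib \<rho> A f" for A and f :: "'a \<Rightarrow> ennreal"
  proof -
    have [measurable]: "f \<in> borel_measurable borel" and A: "A \<ge> 0" using f by (auto simp: ib_def)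
    have bm2: "(\<lambda>y. f y * indicator (ball 0 r) y) \<in> borel_measurable lborel" for r
      by (intro borel_measurable_times_ennreal borel_measurable_indicator) simp_all
    have bm: "(\<lambda>y. c * (f y * indicator (ball 0 r) y)) \<in> borel_measurable lborel" for r c
      by (rule borel_measurable_times_ennreal[OF borel_measurable_const bm2])
    have "ennreal (norm y powr (- k)) * f y * indicator (ball 0 1) y
        \<le> (\<Sum>n. ennreal (2 powr (k * real (Suc n))) * (f y * indicator (ball 0 (1 / 2 ^ n)) y))" for y :: 'a
    proof (cases "y = 0 \<or> norm y \<ge> 1")
      case True
      then have "ennreal (norm y powr (- k)) * f y * indicator (ball 0 1) y = 0" by auto
      then show ?thesis by (simp only: zero_le)
    next
      case False
      then have y: "0 < norm y" "norm y < 1" by auto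
      define n where "n = (LEAST n. 1 / 2 ^ Suc n \<le> norm y)"
      have "\<exists>n. 1 / 2 ^ Suc n \<le> norm y"
      proof -
        obtain n where "(1/2) ^ n < norm y" using real_arch_pow_inv[of "norm y" "1/2"] y by auto
        moreover have "(1/2 :: real) ^ Suc n \<le> (1/2) ^ n" by (intro power_decreasing) auto
        ultimately have "(1/2) ^ Suc n \<le> norm y" by linarith
        then show ?thesis by (intro exI[of _ n]) (simp add: power_one_over)
      qed
      then have n: "1 / 2 ^ Suc n \<le> norm y" unfolding n_def by (rule LeastI_ex)
      have n': "norm y < 1 / 2 ^ n"
      proof (cases n)
        case (Suc i)
        then show ?thesis using not_less_Least[of i "\<lambda>n. 1 / 2 ^ Suc n \<le> norm y"] by (simp add: n_def)
      qed (use y in simp)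
      have "norm y powr (- k) \<le> (1 / 2 ^ Suc n) powr (- k)"
        using n k by (intro powr_mono2') auto
      also have "(1 / 2 ^ Suc n :: real) = 2 powr (- real (Suc n))"
        by (simp add: powr_minus powr_realpow divide_inverse del: power_Suc of_nat_Suc)
      also have "(2 powr (- real (Suc n)) :: real) powr (- k) = 2 powr (k * real (Suc n))"
        by (simp add: powr_powr mult.commute del: of_nat_Suc)
      finally have "ennreal (norm y powr (- k)) * f y * indicator (ball 0 1) y
          \<le> ennreal (2 powr (k * real (Suc n))) * (f y * indicator (ball 0 (1 / 2 ^ n)) y)"
        using n' y by (simp add: ennreal_leI mult_right_mono)
      also have "\<dots> = (\<Sum>n\<in>{n}. ennreal (2 powr (k * real (Suc n))) * (f y * indicator (ball 0 (1 / 2 ^ n)) y))"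
        by (simp only: sum.insert finite.emptyI empty_iff sum.empty add_0_right not_False_eq_True)
      also have "\<dots> \<le> (\<Sum>n. ennreal (2 powr (k * real (Suc n))) * (f y * indicator (ball 0 (1 / 2 ^ n)) y))"
        by (intro sum_le_suminf) (auto simp: summableI)
      finally show ?thesis .
    qed
    then have "(\<integral>\<^sup>+y\<in>ball 0 1. ennreal (norm y powr (- k)) * f y \<partial>lborel)
       \<le> (\<integral>\<^sup>+y. (\<Sum>n. ennreal (2 powr (k * real (Suc n))) * (f y * indicator (ball 0 (1 / 2 ^ n)) y)) \<partial>lborel)"
      by (intro nn_integral_mono) auto
    also have "\<dots> = (\<Sum>n. ennreal (2 powr (k * real (Suc n))) * (\<integral>\<^sup>+y\<in>ball 0 (1 / 2 ^ n). f y \<partial>lborel))"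
      by (subst nn_integral_suminf, intro bm, subst nn_integral_cmult, intro bm2, rule refl)
    also have "\<dots> \<le> (\<Sum>n. ennreal (2 powr (k * real (Suc n))) * ennreal (A * (c powr (1 - \<rho>) * (1 / 2 ^ n) powr (?n * (1 - \<rho>)))))"
      by (intro suminf_le mult_left_mono ib_ball[OF c ball f \<rho>(2)] summableI) simp_all
    also have "(\<lambda>n. ennreal (2 powr (k * real (Suc n))) * ennreal (A * (c powr (1 - \<rho>) * (1 / 2 ^ n) powr (?n * (1 - \<rho>)))))
        = (\<lambda>n. ennreal (B * A * q ^ n))"
    proof
      fix n
      have 0: "(1 / 2 ^ n :: real) = 2 powr (- real n)"
        by (simp add: powr_minus powr_realpow divide_inverse del: power_Suc of_nat_Suc)
      have 2: "2 powr (k * real (Suc n)) * (1 / 2 ^ n) powr (?n * (1 - \<rho>)) = 2 powr k * q ^ n"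
        unfolding 0 by (simp add: q_def powr_realpow[symmetric] powr_powr flip: powr_add) (simp add: algebra_simps)
      have "2 powr (k * real (Suc n)) * (A * (c powr (1 - \<rho>) * (1 / 2 ^ n) powr (?n * (1 - \<rho>))))
         = A * c powr (1 - \<rho>) * (2 powr (k * real (Suc n)) * (1 / 2 ^ n) powr (?n * (1 - \<rho>)))"
        by (simp only: mult_ac)
      also have "\<dots> = B * A * q ^ n"
        unfolding 2 B_def by (simp only: mult_ac)
      finally have "2 powr (k * real (Suc n)) * (A * (c powr (1 - \<rho>) * (1 / 2 ^ n) powr (?n * (1 - \<rho>)))) = B * A * q ^ n" .
      moreover have "ennreal (2 powr (k * real (Suc n))) * ennreal (A * (c powr (1 - \<rho>) * (1 / 2 ^ n) powr (?n * (1 - \<rho>)))) = ennreal (2 powr (k * real (Suc n)) * (A * (c powr (1 - \<rho>) * (1 / 2 ^ n) powr (?n * (1 - \<rho>)))))"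
        using A by (intro ennreal_mult[symmetric]) auto
      ultimately show "ennreal (2 powr (k * real (Suc n))) * ennreal (A * (c powr (1 - \<rho>) * (1 / 2 ^ n) powr (?n * (1 - \<rho>)))) = ennreal (B * A * q ^ n)"
        by (simp only:)
    qed
    also have "(\<Sum>n. ennreal (B * A * q ^ n)) = ennreal (\<Sum>n. B * A * q ^ n)"
      using A B q by (intro suminf_ennreal2 summable_mult summable_geometric) auto
    also have "(\<Sum>n. B * A * q ^ n) = B / (1 - q) * A"
      using q by (subst suminf_mult) (auto simp: suminf_geometric summable_geometric)
    finally show ?thesis .
  qed
  then show ?thesis using B q by (intro exI[of _ "B / (1 - q)"]) auto
qed

text \<open>At time 1 a weight is moved past the heat kernel at the price of the kernel \<open>jk\<close>, except near
  the origin, where a positive power is integrated against the ball averages.\<close>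

lemma hop_one_pointwise:
  assumes \<rho>: "0 \<le> \<rho>" "\<rho> \<le> 1" and k: "k + real DIM('a) * \<rho> < real DIM('a::euclidean_space)"
  shows "\<exists>C>0. \<forall>A (f :: 'a \<Rightarrow> ennreal) x. ib \<rho> A f \<longrightarrow>
    hop 1 (\<lambda>y. ennreal (norm y powr (- k)) * f y) x
    \<le> ennreal (C * (1 + norm x) powr (- k)) * ((\<integral>\<^sup>+y. ennreal (jk (x - y)) * f y \<partial>lborel) + ennreal (A * jk x))"
proof -
  let ?n = "real DIM('a)"
  obtain G where G: "G > 0" "\<And>z::'a. heat_kernel 1 z \<le> G * (1 + norm z) powr (- \<bar>k\<bar>) * jk z"
    using heat_kernel_le_jk by blast
  \<comment> \<open>The power exceeding |k| by dimension + 1 is for y near the origin. There 1 +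
    norm (x - y) is at least half of 1 + norm x, and the surplus power becomes the factor
    \<open>jk x\<close>.\<close>
  obtain H where H: "H > 0" "\<And>z::'a. heat_kernel 1 z \<le> H * (1 + norm z) powr (- (\<bar>k\<bar> + ?n + 1)) * jk z"
    using heat_kernel_le_jk by blast
  \<comment> \<open>For \<open>k < 0\<close> the weight is bounded near the origin, the far estimate
    covers all y, and the value 1 is a dummy.\<close>
  obtain N where N: "N > 0" "\<And>A (f :: 'a \<Rightarrow> ennreal). k \<ge> 0 \<Longrightarrow> ib \<rho> A f \<Longrightarrow>
    (\<integral>\<^sup>+y\<in>ball 0 1. ennreal (norm y powr (- k)) * f y \<partial>lborel) \<le> ennreal (N * A)"
  proof (cases "k \<ge> 0")
    case True
    then show ?thesis using powr_near_zero_integral[OF \<rho> True k] that by blast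
  next
    case False
    then show ?thesis using that[of 1] by auto
  qed
  define C1 where "C1 = G * 2 powr \<bar>k\<bar>"
  define C2 where "C2 = H * 2 powr (\<bar>k\<bar> + ?n + 1) * N"
  define C where "C = C1 + C2"
  have C: "C1 > 0" "C2 > 0" using G H N by (auto simp: C1_def C2_def)
  have main: "hop 1 (\<lambda>y. ennreal (norm y powr (- k)) * f y) x
    \<le> ennreal (C * (1 + norm x) powr (- k)) * ((\<integral>\<^sup>+y. ennreal (jk (x - y)) * f y \<partial>lborel) + ennreal (A * jk x))"
    if f: "ib \<rho> A f" for A and f :: "'a \<Rightarrow> ennreal" and x
  proof -
    have [measurable]: "f \<in> borel_measurable borel" and A: "A \<ge> 0" using f by (auto simp: ib_def)
    let ?w = "(1 + norm x) powr (- k)"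
    have far: "heat_kernel 1 (x - y) * norm y powr (- k) \<le> C1 * ?w * jk (x - y)"
      if y: "k < 0 \<or> norm y \<ge> 1" for y
    proof -
      have 1: "norm y powr (- k) \<le> 2 powr \<bar>k\<bar> * (1 + norm y) powr (- k)"
      proof (cases "k < 0")
        case True
        then have "norm y powr (- k) \<le> (1 + norm y) powr (- k)" by (intro powr_mono2) auto
        also have "\<dots> \<le> 2 powr \<bar>k\<bar> * (1 + norm y) powr (- k)"
          using mult_right_mono[of 1 "2 powr \<bar>k\<bar>" "(1 + norm y) powr (- k)"] by (simp add: ge_one_powr_ge_zero)
        finally show ?thesis .
      next
        case False
        with y have "norm y \<ge> 1" by simp
        have "(1 + norm y) powr k \<le> (2 * norm y) powr k"
          using \<open>norm y \<ge> 1\<close> False by (intro powr_mono2) auto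
        then have "(1 + norm y) powr k \<le> 2 powr \<bar>k\<bar> * norm y powr k"
          using False by (simp add: powr_mult)
        moreover have "(1 + norm y) powr k > 0" "norm y powr k > 0"
          using \<open>norm y \<ge> 1\<close> by (auto simp: powr_gt_zero)
        ultimately show ?thesis by (simp add: powr_minus field_simps)
      qed
      have "heat_kernel 1 (x - y) * norm y powr (- k)
        \<le> (G * (1 + norm (x - y)) powr (- \<bar>k\<bar>) * jk (x - y)) * (2 powr \<bar>k\<bar> * (?w * (1 + norm (x - y)) powr \<bar>k\<bar>))"
        using G(2)[of "x - y"] 1 one_plus_norm_powr_le[of y k x] G(1)
        by (intro mult_mono) (auto intro: order_trans[OF 1] mult_left_mono)
      also have "\<dots> = G * 2 powr \<bar>k\<bar> * ?w * jk (x - y) * ((1 + norm (x - y)) powr (- \<bar>k\<bar>) * (1 + norm (x - y)) powr \<bar>k\<bar>)"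
        by (simp only: mult_ac)
      also have "(1 + norm (x - y)) powr (- \<bar>k\<bar>) * (1 + norm (x - y)) powr \<bar>k\<bar> = 1"
        by (simp add: powr_add[symmetric]) (smt (verit) norm_ge_zero)
      finally show ?thesis by (simp add: C1_def)
    qed
    have near: "heat_kernel 1 (x - y) \<le> H * 2 powr (\<bar>k\<bar> + ?n + 1) * (?w * jk x)" if y: "norm y < 1" for y
    proof -
      have "(1 + norm (x - y)) powr (- (\<bar>k\<bar> + ?n + 1)) \<le> ((1 + norm x) / 2) powr (- (\<bar>k\<bar> + ?n + 1))"
      proof (rule powr_mono2')
        show "(1 + norm x) / 2 \<le> 1 + norm (x - y)"
          using y norm_triangle_sub[of x y] norm_ge_zero[of "x - y"] by argo
      qed (auto intro: add_pos_nonneg)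
      also have "\<dots> = 2 powr (\<bar>k\<bar> + ?n + 1) * ((1 + norm x) powr (- \<bar>k\<bar>) * jk x)"
      proof -
        have "((1 + norm x) / 2) powr (- (\<bar>k\<bar> + ?n + 1)) = 2 powr (\<bar>k\<bar> + ?n + 1) * (1 + norm x) powr (- (\<bar>k\<bar> + ?n + 1))"
        proof -
          have "((1 + norm x) / 2) powr (- (\<bar>k\<bar> + ?n + 1)) = (1 + norm x) powr (- (\<bar>k\<bar> + ?n + 1)) / 2 powr (- (\<bar>k\<bar> + ?n + 1))"
            by (rule powr_divide)
          then show ?thesis by (simp only: powr_minus divide_inverse inverse_inverse_eq mult.commute)
        qed
        also have "(1 + norm x) powr (- (\<bar>k\<bar> + ?n + 1)) = (1 + norm x) powr (- \<bar>k\<bar>) * jk x"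
          unfolding jk_def powr_add[symmetric] by (simp add: algebra_simps)
        finally show ?thesis .
      qed
      also have "\<dots> \<le> 2 powr (\<bar>k\<bar> + ?n + 1) * (?w * jk x)"
        by (intro mult_left_mono mult_right_mono powr_mono) auto
      finally have 1: "(1 + norm (x - y)) powr (- (\<bar>k\<bar> + ?n + 1)) \<le> 2 powr (\<bar>k\<bar> + ?n + 1) * (?w * jk x)" .
      have "heat_kernel 1 (x - y) \<le> H * (1 + norm (x - y)) powr (- (\<bar>k\<bar> + ?n + 1)) * 1"
        using H jk_le1[of "x - y"] by (intro order_trans[OF H(2)] mult_left_mono) auto
      also have "\<dots> \<le> H * (2 powr (\<bar>k\<bar> + ?n + 1) * (?w * jk x))"
        using H(1) 1 by (simp add: mult_left_mono)
      finally show ?thesis by (simp only: mult_ac)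
    qed
    have "hop 1 (\<lambda>y. ennreal (norm y powr (- k)) * f y) x \<le>
      (\<integral>\<^sup>+y. ennreal (C1 * ?w) * (ennreal (jk (x - y)) * f y) +
         (if k \<ge> 0 then ennreal (H * 2 powr (\<bar>k\<bar> + ?n + 1) * (?w * jk x)) * (ennreal (norm y powr (- k)) * f y * indicator (ball 0 1) y) else 0) \<partial>lborel)"
      unfolding hop_def
    proof (intro nn_integral_mono)
      fix y :: 'a
      show "ennreal (heat_kernel 1 (x - y)) * (ennreal (norm y powr (- k)) * f y)
        \<le> ennreal (C1 * ?w) * (ennreal (jk (x - y)) * f y) +
         (if k \<ge> 0 then ennreal (H * 2 powr (\<bar>k\<bar> + ?n + 1) * (?w * jk x)) * (ennreal (norm y powr (- k)) * f y * indicator (ball 0 1) y) else 0)"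
      proof (cases "k < 0 \<or> norm y \<ge> 1")
        case True
        have "ennreal (heat_kernel 1 (x - y)) * (ennreal (norm y powr (- k)) * f y)
            = ennreal (heat_kernel 1 (x - y) * norm y powr (- k)) * f y"
          by (simp add: ennreal_mult mult.assoc)
        also have "\<dots> \<le> ennreal (C1 * ?w * jk (x - y)) * f y"
          by (intro mult_right_mono ennreal_leI far True) auto
        also have "\<dots> = ennreal (C1 * ?w) * (ennreal (jk (x - y)) * f y)"
          using C by (simp add: ennreal_mult mult.assoc)
        finally show ?thesis by (rule order_trans) simp
      next
        case False
        then have "ennreal (heat_kernel 1 (x - y)) * (ennreal (norm y powr (- k)) * f y)
           \<le> ennreal (H * 2 powr (\<bar>k\<bar> + ?n + 1) * (?w * jk x)) * (ennreal (norm y powr (- k)) * f y * indicator (ball 0 1) y)"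
          using near[of y] by (auto intro!: mult_right_mono ennreal_leI)
        then show ?thesis using False by (simp add: add_increasing)
      qed
    qed
    also have "\<dots> = ennreal (C1 * ?w) * (\<integral>\<^sup>+y. ennreal (jk (x - y)) * f y \<partial>lborel) +
       (if k \<ge> 0 then ennreal (H * 2 powr (\<bar>k\<bar> + ?n + 1) * (?w * jk x)) * (\<integral>\<^sup>+y\<in>ball 0 1. ennreal (norm y powr (- k)) * f y \<partial>lborel) else 0)"
    proof -
      have m1: "(\<lambda>y. ennreal (jk (x - y)) * f y) \<in> borel_measurable lborel" by measurable
      have m2: "(\<lambda>y. ennreal (norm y powr (- k)) * f y * indicator (ball 0 1) y) \<in> borel_measurable lborel"
        by (intro borel_measurable_times_ennreal borel_measurable_indicator) simp_all
      show ?thesis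
      proof (cases "k \<ge> 0")
        case True
        show ?thesis unfolding if_P[OF True]
          by (subst nn_integral_add, intro borel_measurable_times_ennreal borel_measurable_const m1,
              intro borel_measurable_times_ennreal[OF borel_measurable_const m2],
              subst nn_integral_cmult[OF m1], subst nn_integral_cmult[OF m2], rule refl)
      next
        case False
        show ?thesis unfolding if_not_P[OF False] add_0_right by (rule nn_integral_cmult[OF m1])
      qed
    qed
    also have "\<dots> \<le> ennreal (C1 * ?w) * (\<integral>\<^sup>+y. ennreal (jk (x - y)) * f y \<partial>lborel) +
       ennreal (H * 2 powr (\<bar>k\<bar> + ?n + 1) * (?w * jk x)) * ennreal (N * A)"
      using N(2)[OF _ f] by (auto intro!: add_left_mono mult_left_mono)
    also have "ennreal (H * 2 powr (\<bar>k\<bar> + ?n + 1) * (?w * jk x)) * ennreal (N * A) = ennreal (C2 * ?w) * ennreal (A * jk x)"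
      using H N A by (simp add: ennreal_mult[symmetric] C2_def mult_ac)
    also have "ennreal (C1 * ?w) * (\<integral>\<^sup>+y. ennreal (jk (x - y)) * f y \<partial>lborel) + ennreal (C2 * ?w) * ennreal (A * jk x)
      \<le> ennreal (C * ?w) * (\<integral>\<^sup>+y. ennreal (jk (x - y)) * f y \<partial>lborel) + ennreal (C * ?w) * ennreal (A * jk x)"
      using C by (intro add_mono mult_right_mono ennreal_leI) (auto simp: C_def)
    finally show ?thesis by (simp add: distrib_left)
  qed
  then show ?thesis using C by (intro exI[of _ C]) (auto simp: C_def)
qed

text \<open>Interpolation with L^\<infinity> without loss in the constant: for t < 1 the superlevel
  set is empty, for t \<ge> 1 the bound with the larger exponent is the stronger one.\<close>

lemma wk_bounded:
  assumes f: "wk \<rho> A f" and le: "\<And>x. f x \<le> ennreal A" and \<rho>': "0 \<le> \<rho>'" "\<rho>' \<le> \<rho>"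
  shows "wk \<rho>' A f"
proof -
  have [measurable]: "f \<in> borel_measurable borel" and A: "A \<ge> 0" using f by (auto simp: wk_def)
  have "emeasure lborel {x. ennreal (A * t powr (- \<rho>')) < f x} \<le> ennreal t" if t: "t > 0" for t
  proof (cases "t \<ge> 1")
    case True
    have "ennreal (A * t powr (- \<rho>)) \<le> ennreal (A * t powr (- \<rho>'))"
      using True \<rho>' A by (intro ennreal_leI mult_left_mono powr_mono) auto
    then have "emeasure lborel {x. ennreal (A * t powr (- \<rho>')) < f x} \<le> emeasure lborel {x. ennreal (A * t powr (- \<rho>)) < f x}"
      by (intro emeasure_mono) auto
    then show ?thesis using wkD[OF f t] by simp
  next
    case False
    have "1 powr (- \<rho>') \<le> t powr (- \<rho>')" using False t \<rho>' by (intro powr_mono2') auto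
    then have "ennreal A \<le> ennreal (A * t powr (- \<rho>'))"
      using A mult_left_mono[of 1 "t powr (- \<rho>')" A] by (intro ennreal_leI) simp
    then have "{x. ennreal (A * t powr (- \<rho>')) < f x} = {}" using le by (auto simp: not_less intro: order_trans)
    then show ?thesis by (simp only: emeasure_empty zero_le)
  qed
  then show ?thesis using A by (simp add: wk_def)
qed

section \<open>Smoothing between weighted weak Lebesgue spaces\<close>

lemma AE_lborel_nonzero: "AE x in lborel. (x::'a::euclidean_space) \<noteq> 0"
  by (rule AE_lborel_singleton)

abbreviation wt :: "real \<Rightarrow> ('a::euclidean_space \<Rightarrow> ennreal) \<Rightarrow> 'a \<Rightarrow> ennreal" where
  "wt k f \<equiv> (\<lambda>x. ennreal (norm x powr k) * f x)"

text \<open>Near the origin the remaining power is at worst \<open>norm x powr (- r)\<close>; far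
  away the quotient of the two weights is bounded. With r equal to the dimension times \<rho>2, the
  first term is the model function of the target space.\<close>

lemma weight_ratio_le:
  fixes x :: "'a::real_normed_vector"
  assumes x: "x \<noteq> 0" and k: "k2 \<le> k1" and r: "0 \<le> k2 + r"
  shows "norm x powr k2 * (1 + norm x) powr (- k1) \<le> 2 powr \<bar>k1\<bar> * (norm x powr (- r) + 1)"
proof (cases "norm x < 1")
  case True
  have "norm x powr k2 \<le> norm x powr (- r)" using True r by (intro powr_mono') auto
  moreover have "(1 + norm x) powr (- k1) \<le> 2 powr \<bar>k1\<bar>"
  proof -
    have "(1 + norm x) powr (- k1) \<le> (1 + norm x) powr \<bar>k1\<bar>" by (intro powr_mono) auto
    also have "\<dots> \<le> 2 powr \<bar>k1\<bar>" using True by (intro powr_mono2) auto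
    finally show ?thesis .
  qed
  ultimately have "norm x powr k2 * (1 + norm x) powr (- k1) \<le> norm x powr (- r) * 2 powr \<bar>k1\<bar>"
    by (intro mult_mono) auto
  then show ?thesis by (simp add: algebra_simps add_increasing)
next
  case False
  have "norm x powr k2 \<le> norm x powr k1" using False k by (intro powr_mono) auto
  then have "norm x powr k2 * (1 + norm x) powr (- k1) \<le> norm x powr k1 * (1 + norm x) powr (- k1)"
    by (rule mult_right_mono) simp
  also have "\<dots> \<le> 2 powr \<bar>k1\<bar>"
  proof (cases "k1 \<ge> 0")
    case True
    have "norm x powr k1 \<le> (1 + norm x) powr k1" using True by (intro powr_mono2) auto
    moreover have "(1 + norm x) powr k1 > 0" using norm_ge_zero[of x] by (auto simp: powr_gt_zero simp del: norm_ge_zero)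
    ultimately have "norm x powr k1 * (1 + norm x) powr (- k1) \<le> 1" by (simp add: powr_minus divide_simps)
    also have "\<dots> \<le> 2 powr \<bar>k1\<bar>" by (simp add: ge_one_powr_ge_zero)
    finally show ?thesis .
  next
    case k: False
    have "(1 + norm x) powr (- k1) \<le> (2 * norm x) powr (- k1)" using k False by (intro powr_mono2) auto
    then have "norm x powr k1 * (1 + norm x) powr (- k1) \<le> norm x powr k1 * (2 powr (- k1) * norm x powr (- k1))"
      by (intro mult_left_mono) (auto simp: powr_mult)
    also have "\<dots> = 2 powr (- k1)" using x by (simp add: powr_minus)
    finally show ?thesis using k by simp
  qed
  also have "\<dots> \<le> 2 powr \<bar>k1\<bar> * (norm x powr (- r) + 1)" by (simp add: algebra_simps)
  finally show ?thesis .
qed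

text \<open>The function B, a convolution with \<open>jk\<close> plus a multiple of
  \<open>jk\<close>, is bounded and lies in the space with exponent \<rho>1, hence in that with
  exponent \<rho>2. The weight ratio leaves two pieces: the model power times the supremum of B, and
  B itself.\<close>

lemma smoothing_one:
  assumes \<rho>: "0 \<le> \<rho>2" "\<rho>2 \<le> \<rho>1" "\<rho>1 < 1" and k: "k2 \<le> k1" "k1 + real DIM('a) * \<rho>1 < real DIM('a)"
    "0 \<le> k2 + real DIM('a) * \<rho>2"
  shows "\<exists>C>0. \<forall>A (F :: 'a::euclidean_space \<Rightarrow> ennreal). F \<in> borel_measurable borel \<longrightarrow>
    wk \<rho>1 A (wt k1 F) \<longrightarrow> wk \<rho>2 (C * A) (wt k2 (hop 1 F))"
proof -
  let ?n = "real DIM('a)"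
  have \<rho>1: "0 \<le> \<rho>1" "\<rho>1 \<le> 1" using \<rho> by auto
  obtain C1 where C1: "C1 \<ge> 1" "\<And>A (f :: 'a \<Rightarrow> ennreal). wk \<rho>1 A f \<Longrightarrow> ib \<rho>1 (C1 * A) f"
    using wk_imp_ib[OF \<rho>1(1) \<rho>(3)] by blast
  obtain C2 where C2: "C2 > 0" "\<And>A (f :: 'a \<Rightarrow> ennreal) x. ib \<rho>1 A f \<Longrightarrow>
    (\<integral>\<^sup>+y. ennreal (jk (x - y)) * f y \<partial>lborel) \<le> ennreal (C2 * A)" using jk_conv_bound[OF \<rho>1] by blast
  obtain C3 where C3: "C3 > 0" "\<And>A (f :: 'a \<Rightarrow> ennreal). ib \<rho>1 A f \<Longrightarrow>
    ib \<rho>1 (C3 * A) (\<lambda>x. \<integral>\<^sup>+y. ennreal (jk (x - y)) * f y \<partial>lborel)" using ib_jk_conv[OF \<rho>1] by blast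
  obtain C4 where C4: "C4 > 0" "ib \<rho>1 C4 (\<lambda>x::'a. ennreal (jk x))" using ib_jk[OF \<rho>1] by blast
  obtain C5 where C5: "C5 > 0" "\<And>A (f :: 'a \<Rightarrow> ennreal) x. ib \<rho>1 A f \<Longrightarrow>
    hop 1 (\<lambda>y. ennreal (norm y powr (- k1)) * f y) x
    \<le> ennreal (C5 * (1 + norm x) powr (- k1)) * ((\<integral>\<^sup>+y. ennreal (jk (x - y)) * f y \<partial>lborel) + ennreal (A * jk x))"
    using hop_one_pointwise[OF \<rho>1 k(2)] by blast
  obtain C6 where C6: "C6 > 0" "wk \<rho>2 C6 (\<lambda>x::'a. ennreal (norm x powr (- (?n * \<rho>2))))"
    using wk_norm_powr[OF \<rho>(1)] by blast
  \<comment> \<open>One constant for both the weak bound and the supremum of B, as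
    \<open>wk_bounded\<close> requires.\<close>
  define K where "K = max (2 powr \<rho>1 * (C3 + C4)) (C2 + 1) * C1"
  define C where "C = C5 * 2 powr \<bar>k1\<bar> * (2 powr \<rho>2 * (K * C6 + K))"
  have K: "K > 0" using C1 C2 by (auto simp: K_def less_max_iff_disj)
  then have C: "C > 0" using C5 C6 by (simp add: C_def add_pos_pos)
  have "wk \<rho>2 (C * A) (wt k2 (hop 1 F))"
    if [measurable]: "F \<in> borel_measurable borel" and wF: "wk \<rho>1 A (wt k1 F)"
    for A and F :: "'a \<Rightarrow> ennreal"
  proof -
    define f where "f = (wt k1 F)"
    have [measurable]: "f \<in> borel_measurable borel" by (simp add: f_def)
    have A: "A \<ge> 0" using wF by (rule wk_nonneg)
    have f: "ib \<rho>1 (C1 * A) f" using C1(2)[OF wF] by (simp add: f_def)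
    define B where "B = (\<lambda>x. (\<integral>\<^sup>+y. ennreal (jk (x - y)) * f y \<partial>lborel) + ennreal (C1 * A * jk x))"
    have [measurable]: "B \<in> borel_measurable borel" unfolding B_def by measurable
    have "wk \<rho>1 (2 powr \<rho>1 * (C3 * (C1 * A) + C1 * A * C4)) (\<lambda>x. (\<integral>\<^sup>+y. ennreal (jk (x - y)) * f y \<partial>lborel) + ennreal (C1 * A) * ennreal (jk x))"
      using A C1(1) by (intro wk_add wk_cmult ib_imp_wk C3 C4 f \<rho>1) auto
    moreover have "(\<lambda>x. (\<integral>\<^sup>+y. ennreal (jk (x - y)) * f y \<partial>lborel) + ennreal (C1 * A) * ennreal (jk x)) = B"
      using A C1(1) by (simp add: B_def ennreal_mult)
    ultimately have "wk \<rho>1 (2 powr \<rho>1 * (C3 * (C1 * A) + C1 * A * C4)) B" by simp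
    moreover have "2 powr \<rho>1 * (C3 * (C1 * A) + C1 * A * C4) \<le> K * A"
    proof -
      have "2 powr \<rho>1 * (C3 * (C1 * A) + C1 * A * C4) = 2 powr \<rho>1 * (C3 + C4) * (C1 * A)"
        by (simp add: algebra_simps)
      also have "\<dots> \<le> max (2 powr \<rho>1 * (C3 + C4)) (C2 + 1) * (C1 * A)"
        using A C1 by (intro mult_right_mono) auto
      finally show ?thesis by (simp add: K_def mult.assoc)
    qed
    ultimately have wB: "wk \<rho>1 (K * A) B" by (rule wk_weaken)
    have Ble: "B x \<le> ennreal (K * A)" for x
    proof -
      have "B x \<le> ennreal (C2 * (C1 * A)) + ennreal (C1 * A * 1)"
        unfolding B_def using A C1(1) jk_le1 by (intro add_mono C2 f ennreal_leI mult_left_mono) auto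
      also have "\<dots> = ennreal ((C2 + 1) * (C1 * A))" using C2 A C1(1) by (simp add: algebra_simps flip: ennreal_plus)
      also have "\<dots> \<le> ennreal (max (2 powr \<rho>1 * (C3 + C4)) (C2 + 1) * (C1 * A))"
        using A C1 by (intro ennreal_leI mult_right_mono) auto
      finally show ?thesis by (simp add: K_def mult.assoc)
    qed
    have wB2: "wk \<rho>2 (K * A) B" by (rule wk_bounded[OF wB Ble \<rho>(1,2)])
    have w: "wk \<rho>2 (C5 * 2 powr \<bar>k1\<bar> * (2 powr \<rho>2 * (K * A * C6 + K * A)))
      (\<lambda>x. ennreal (C5 * 2 powr \<bar>k1\<bar>) * (ennreal (K * A) * ennreal (norm x powr (- (?n * \<rho>2))) + B x))"
      using C5 A K by (intro wk_cmult wk_add C6 wB2) auto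
    show ?thesis
    proof (rule wk_mono_AE[OF w])
      show "C5 * 2 powr \<bar>k1\<bar> * (2 powr \<rho>2 * (K * A * C6 + K * A)) \<le> C * A"
        by (simp add: C_def algebra_simps)
      show "AE x in lborel. ennreal (norm x powr k2) * hop 1 F x
        \<le> ennreal (C5 * 2 powr \<bar>k1\<bar>) * (ennreal (K * A) * ennreal (norm x powr (- (?n * \<rho>2))) + B x)"
        using AE_lborel_nonzero
      proof eventually_elim
        case (elim x)
        \<comment> \<open>The weight and its inverse cancel only away from the origin, a null set
          that the integral does not see.\<close>
        have "hop 1 F x = hop 1 (\<lambda>y. ennreal (norm y powr (- k1)) * f y) x"
        proof (rule hop_cong_AE)
          show "AE y in lborel. F y = ennreal (norm y powr (- k1)) * f y"
            using AE_lborel_nonzero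
            by eventually_elim (simp add: f_def mult.assoc[symmetric] ennreal_mult[symmetric] powr_minus)
        qed
        also have "\<dots> \<le> ennreal (C5 * (1 + norm x) powr (- k1)) * B x"
          unfolding B_def by (rule C5(2)[OF f])
        finally have "ennreal (norm x powr k2) * hop 1 F x \<le> ennreal (norm x powr k2) * (ennreal (C5 * (1 + norm x) powr (- k1)) * B x)"
          by (rule mult_left_mono) simp
        also have "\<dots> = ennreal (C5 * (norm x powr k2 * (1 + norm x) powr (- k1))) * B x"
        proof -
          have "ennreal (norm x powr k2) * ennreal (C5 * (1 + norm x) powr (- k1)) = ennreal (C5 * (norm x powr k2 * (1 + norm x) powr (- k1)))"
            using C5(1) by (subst ennreal_mult[symmetric]) (auto simp: mult_ac)
          then show ?thesis by (simp only: mult.assoc[symmetric])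
        qed
        also have "\<dots> \<le> ennreal (C5 * (2 powr \<bar>k1\<bar> * (norm x powr (- (?n * \<rho>2)) + 1))) * B x"
          using C5(1) k(3) weight_ratio_le[OF elim k(1), of "?n * \<rho>2"]
          by (intro mult_right_mono ennreal_leI mult_left_mono) auto
        also have "\<dots> = ennreal (C5 * 2 powr \<bar>k1\<bar>) * (ennreal (norm x powr (- (?n * \<rho>2))) * B x + B x)"
        proof -
          have "ennreal (C5 * (2 powr \<bar>k1\<bar> * (norm x powr (- (?n * \<rho>2)) + 1)))
            = ennreal (C5 * 2 powr \<bar>k1\<bar>) * (ennreal (norm x powr (- (?n * \<rho>2))) + 1)"
            using C5(1) by (simp add: mult.assoc[symmetric] ennreal_mult[of "C5 * 2 powr \<bar>k1\<bar>"])
          then show ?thesis by (simp only: mult.assoc distrib_right mult_1)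
        qed
        also have "\<dots> \<le> ennreal (C5 * 2 powr \<bar>k1\<bar>) * (ennreal (K * A) * ennreal (norm x powr (- (?n * \<rho>2))) + B x)"
          unfolding mult.commute[of "ennreal (K * A)"] by (intro mult_left_mono add_right_mono Ble) simp_all
        finally show ?case .
      qed
    qed measurable
  qed
  then show ?thesis using C by blast
qed

lemma hop_unscale:
  fixes F :: "'a::euclidean_space \<Rightarrow> ennreal"
  assumes [measurable]: "F \<in> borel_measurable borel" and t: "t > 0"
    and w: "wk \<rho> A (\<lambda>x. ennreal (norm x powr k) * hop 1 (\<lambda>y. F (sqrt t *\<^sub>R y)) x)"
  shows "wk \<rho> (A * t powr ((k + real DIM('a) * \<rho>) / 2)) (wt k (hop t F))"
proof -
  let ?r = "1 / sqrt t"
  have r: "?r > 0" using t by simp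
  have rp: "?r powr a = t powr (- a / 2)" for a
    using t by (simp add: powr_half_sqrt[symmetric] powr_powr powr_minus_divide[symmetric] powr_divide)
  have w2: "wk \<rho> (t powr (k / 2) * (A * ?r powr (- (real DIM('a) * \<rho>))))
     (\<lambda>x. ennreal (t powr (k / 2)) * (ennreal (norm (?r *\<^sub>R x) powr k) * hop 1 (\<lambda>y. F (sqrt t *\<^sub>R y)) (?r *\<^sub>R x)))"
    by (intro wk_cmult wk_scale[OF w r]) auto
  have eq: "ennreal (t powr (k / 2)) * (ennreal (norm (?r *\<^sub>R x) powr k) * hop 1 (\<lambda>y. F (sqrt t *\<^sub>R y)) (?r *\<^sub>R x))
    = ennreal (norm x powr k) * hop t F x" for x
  proof -
    have "hop 1 (\<lambda>y. F (sqrt t *\<^sub>R y)) (?r *\<^sub>R x) = hop t F x"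
      using hop_scale[of F t "?r *\<^sub>R x"] t by simp
    moreover have "t powr (k / 2) * norm (?r *\<^sub>R x) powr k = norm x powr k"
    proof -
      have "norm (?r *\<^sub>R x) powr k = ?r powr k * norm x powr k"
        using r by (simp add: powr_mult[symmetric])
      then show ?thesis unfolding rp using t by (simp add: mult.assoc[symmetric] flip: powr_add)
    qed
    ultimately show ?thesis by (simp add: mult.assoc[symmetric] ennreal_mult[symmetric])
  qed
  have "t powr (k / 2) * (A * ?r powr (- (real DIM('a) * \<rho>))) = A * t powr ((k + real DIM('a) * \<rho>) / 2)"
    unfolding rp by (simp add: powr_add add_divide_distrib)
  with w2 show ?thesis unfolding eq by simp
qed

text \<open>Half the drop of weight plus dimension times \<rho> is the decay exponent forced by
  parabolic scaling. The strict condition on k1 makes F locally integrable at the origin; the sign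
  condition on k2 puts functions bounded near the origin into the target space.\<close>

theorem smoothing:
  assumes \<rho>: "0 \<le> \<rho>2" "\<rho>2 \<le> \<rho>1" "\<rho>1 < 1" and k: "k2 \<le> k1" "k1 + real DIM('a) * \<rho>1 < real DIM('a)"
    "0 \<le> k2 + real DIM('a) * \<rho>2"
  shows "\<exists>C>0. \<forall>A t (F :: 'a::euclidean_space \<Rightarrow> ennreal). F \<in> borel_measurable borel \<longrightarrow> t > 0 \<longrightarrow>
    wk \<rho>1 A (wt k1 F) \<longrightarrow>
    wk \<rho>2 (C * A * t powr (- ((k1 + real DIM('a) * \<rho>1 - k2 - real DIM('a) * \<rho>2) / 2))) (wt k2 (hop t F))"
proof -
  let ?n = "real DIM('a)"
  obtain C where C: "C > 0" "\<And>A (F :: 'a::euclidean_space \<Rightarrow> ennreal). F \<in> borel_measurable borel \<Longrightarrow>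
    wk \<rho>1 A (wt k1 F) \<Longrightarrow> wk \<rho>2 (C * A) (wt k2 (hop 1 F))"
    using smoothing_one[OF assms] by blast
  have "wk \<rho>2 (C * A * t powr (- ((k1 + ?n * \<rho>1 - k2 - ?n * \<rho>2) / 2))) (wt k2 (hop t F))"
    if [measurable]: "F \<in> borel_measurable borel" and t: "t > 0" and w: "wk \<rho>1 A (wt k1 F)"
    for A t and F :: "'a \<Rightarrow> ennreal"
  proof -
    have st: "sqrt t > 0" using t by simp
    have sp: "sqrt t powr a = t powr (a / 2)" for a
      using t by (simp add: powr_half_sqrt[symmetric] powr_powr)
    have "wk \<rho>1 (t powr (- k1 / 2) * (A * sqrt t powr (- (?n * \<rho>1))))
      (\<lambda>x. ennreal (t powr (- k1 / 2)) * (ennreal (norm (sqrt t *\<^sub>R x) powr k1) * F (sqrt t *\<^sub>R x)))"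
      by (intro wk_cmult wk_scale[OF w st]) auto
    moreover have "ennreal (t powr (- k1 / 2)) * (ennreal (norm (sqrt t *\<^sub>R x) powr k1) * F (sqrt t *\<^sub>R x))
        = ennreal (norm x powr k1) * F (sqrt t *\<^sub>R x)" for x
    proof -
      have "norm (sqrt t *\<^sub>R x) powr k1 = t powr (k1 / 2) * norm x powr k1"
        using st by (simp add: powr_mult sp[symmetric])
      then have "t powr (- k1 / 2) * norm (sqrt t *\<^sub>R x) powr k1 = norm x powr k1"
        using t by (simp add: mult.assoc[symmetric] flip: powr_add)
      then show ?thesis by (simp add: mult.assoc[symmetric] ennreal_mult[symmetric])
    qed
    ultimately have "wk \<rho>1 (t powr (- k1 / 2) * (A * sqrt t powr (- (?n * \<rho>1)))) (\<lambda>x. ennreal (norm x powr k1) * F (sqrt t *\<^sub>R x))"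
      by simp
    then have "wk \<rho>2 (C * (t powr (- k1 / 2) * (A * sqrt t powr (- (?n * \<rho>1))))) (\<lambda>x. ennreal (norm x powr k2) * hop 1 (\<lambda>y. F (sqrt t *\<^sub>R y)) x)"
      by (intro C) measurable
    then have "wk \<rho>2 (C * (t powr (- k1 / 2) * (A * sqrt t powr (- (?n * \<rho>1)))) * t powr ((k2 + ?n * \<rho>2) / 2))
      (wt k2 (hop t F))"
      by (intro hop_unscale t) measurable
    moreover have "C * (t powr (- k1 / 2) * (A * sqrt t powr (- (?n * \<rho>1)))) * t powr ((k2 + ?n * \<rho>2) / 2)
      = C * A * t powr (- ((k1 + ?n * \<rho>1 - k2 - ?n * \<rho>2) / 2))"
    proof -
      have "t powr (- k1 / 2) * t powr (- (?n * \<rho>1) / 2) * t powr ((k2 + ?n * \<rho>2) / 2)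
        = t powr (- ((k1 + ?n * \<rho>1 - k2 - ?n * \<rho>2) / 2))"
        unfolding powr_add[symmetric] by (rule arg_cong[where f="\<lambda>z. t powr z"]) (simp add: field_simps)
      then show ?thesis unfolding sp by (simp only: mult_ac)
    qed
    ultimately show ?thesis by (simp only:)
  qed
  then show ?thesis using C by blast
qed

text \<open>The pointwise bound with the constant function 1, \<rho> = 0 and weight \<sigma> leaves
  at most a multiple of \<open>(1 + norm x) powr (- \<sigma>)\<close> at time 1, and this lies in
  every space with k + dimension * \<rho> between 0 and \<sigma>. Homogeneity of the data supplies
  the power of t.\<close>

lemma hop_homogeneous:
  assumes \<sigma>: "0 \<le> \<sigma>" "\<sigma> < real DIM('a)" and k: "0 \<le> \<rho>" "0 \<le> k + real DIM('a) * \<rho>" "k + real DIM('a) * \<rho> \<le> \<sigma>"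
  shows "\<exists>C>0. \<forall>t>0. wk \<rho> (C * t powr (- ((\<sigma> - k - real DIM('a) * \<rho>) / 2)))
    (\<lambda>x::'a::euclidean_space. ennreal (norm x powr k) * hop t (\<lambda>y. ennreal (norm y powr (- \<sigma>))) x)"
proof -
  let ?n = "real DIM('a)"
  have ib1: "ib 0 1 (\<lambda>_::'a. 1)" by (auto simp: ib_def)
  obtain C2 where C2: "C2 > 0" "\<And>A (f :: 'a \<Rightarrow> ennreal) x. ib 0 A f \<Longrightarrow>
    (\<integral>\<^sup>+y. ennreal (jk (x - y)) * f y \<partial>lborel) \<le> ennreal (C2 * A)" using jk_conv_bound[of 0] by auto
  obtain C5 where C5: "C5 > 0" "\<And>A (f :: 'a \<Rightarrow> ennreal) x. ib 0 A f \<Longrightarrow>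
    hop 1 (\<lambda>y. ennreal (norm y powr (- \<sigma>)) * f y) x
    \<le> ennreal (C5 * (1 + norm x) powr (- \<sigma>)) * ((\<integral>\<^sup>+y. ennreal (jk (x - y)) * f y \<partial>lborel) + ennreal (A * jk x))"
    using hop_one_pointwise[where 'a='a, of 0 \<sigma>] \<sigma> by auto
  obtain C6 where C6: "C6 > 0" "wk \<rho> C6 (\<lambda>x::'a. ennreal (norm x powr (- (?n * \<rho>))))"
    using wk_norm_powr[OF k(1)] by blast
  define K where "K = C5 * (C2 + 1)"
  have K: "K > 0" using C5 C2 by (simp add: K_def)
  have h1: "hop 1 (\<lambda>y. ennreal (norm y powr (- \<sigma>))) x \<le> ennreal (K * (1 + norm x) powr (- \<sigma>))" for x :: 'a
  proof -
    have "hop 1 (\<lambda>y. ennreal (norm y powr (- \<sigma>)) * 1) x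
      \<le> ennreal (C5 * (1 + norm x) powr (- \<sigma>)) * ((\<integral>\<^sup>+y. ennreal (jk (x - y)) * 1 \<partial>lborel) + ennreal (1 * jk x))"
      by (rule C5(2)[OF ib1])
    also have "\<dots> \<le> ennreal (C5 * (1 + norm x) powr (- \<sigma>)) * (ennreal (C2 * 1) + ennreal 1)"
      using jk_le1 by (intro mult_left_mono add_mono C2(2)[OF ib1] ennreal_leI) auto
    also have "\<dots> = ennreal (K * (1 + norm x) powr (- \<sigma>))"
    proof -
      have "ennreal (C2 * 1) + ennreal 1 = ennreal (C2 + 1)" using C2(1) by (subst ennreal_plus) auto
      moreover have "ennreal (C5 * (1 + norm x) powr (- \<sigma>)) * ennreal (C2 + 1) = ennreal (K * (1 + norm x) powr (- \<sigma>))"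
        using C2(1) C5(1) by (subst ennreal_mult[symmetric]) (auto simp: K_def)
      ultimately show ?thesis by (simp only:)
    qed
    finally show ?thesis by simp
  qed
  have w1: "wk \<rho> (K * C6) (\<lambda>x::'a. ennreal (norm x powr k) * hop 1 (\<lambda>y. ennreal (norm y powr (- \<sigma>))) x)"
  proof (rule wk_mono_AE[OF wk_cmult[OF C6(2), of K]])
    show "AE x::'a in lborel. ennreal (norm x powr k) * hop 1 (\<lambda>y. ennreal (norm y powr (- \<sigma>))) x
      \<le> ennreal K * ennreal (norm x powr (- (?n * \<rho>)))"
      using AE_lborel_nonzero
    proof eventually_elim
      case (elim x)
      have "norm x powr (k + ?n * \<rho>) \<le> (1 + norm x) powr (k + ?n * \<rho>)" using k by (intro powr_mono2) auto
      also have "\<dots> \<le> (1 + norm x) powr \<sigma>" using k by (intro powr_mono) auto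
      finally have 1: "norm x powr k * norm x powr (?n * \<rho>) \<le> (1 + norm x) powr \<sigma>" by (simp add: powr_add)
      have p: "(1 + norm x) powr \<sigma> > 0" "norm x powr (?n * \<rho>) > 0"
        using norm_ge_zero[of x] elim by (auto simp: powr_gt_zero simp del: norm_ge_zero)
      have 2: "norm x powr k * (1 + norm x) powr (- \<sigma>) \<le> norm x powr (- (?n * \<rho>))"
        using 1 p by (simp add: powr_minus field_simps)
      have "ennreal (norm x powr k) * hop 1 (\<lambda>y. ennreal (norm y powr (- \<sigma>))) x
         \<le> ennreal (norm x powr k) * ennreal (K * (1 + norm x) powr (- \<sigma>))"
        by (intro mult_left_mono h1) auto
      also have "\<dots> = ennreal (K * (norm x powr k * (1 + norm x) powr (- \<sigma>)))"
        using K by (simp add: ennreal_mult[symmetric] mult_ac)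
      also have "\<dots> \<le> ennreal (K * norm x powr (- (?n * \<rho>)))"
        using K 2 by (intro ennreal_leI mult_left_mono) auto
      finally show ?case using K by (simp add: ennreal_mult)
    qed
  qed (use K in auto)
  have "wk \<rho> (K * C6 * t powr (- ((\<sigma> - k - ?n * \<rho>) / 2)))
    (\<lambda>x::'a. ennreal (norm x powr k) * hop t (\<lambda>y. ennreal (norm y powr (- \<sigma>))) x)" if t: "t > 0" for t
  proof -
    have sp: "sqrt t powr a = t powr (a / 2)" for a
      using t by (simp add: powr_half_sqrt[symmetric] powr_powr)
    have eq: "hop 1 (\<lambda>y. ennreal (norm (sqrt t *\<^sub>R y) powr (- \<sigma>))) x
       = ennreal (t powr (- \<sigma> / 2)) * hop 1 (\<lambda>y. ennreal (norm y powr (- \<sigma>))) x" for x :: 'a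
      using t by (subst hop_cmult[symmetric]) (auto simp: powr_mult sp ennreal_mult[symmetric])
    have "wk \<rho> (t powr (- \<sigma> / 2) * (K * C6)) (\<lambda>x::'a. ennreal (t powr (- \<sigma> / 2)) * (ennreal (norm x powr k) * hop 1 (\<lambda>y. ennreal (norm y powr (- \<sigma>))) x))"
      by (intro wk_cmult w1) auto
    then have "wk \<rho> (t powr (- \<sigma> / 2) * (K * C6)) (\<lambda>x::'a. ennreal (norm x powr k) * hop 1 (\<lambda>y. ennreal (norm (sqrt t *\<^sub>R y) powr (- \<sigma>))) x)"
      unfolding eq by (simp add: mult_ac)
    then have "wk \<rho> (t powr (- \<sigma> / 2) * (K * C6) * t powr ((k + ?n * \<rho>) / 2)) (\<lambda>x::'a. ennreal (norm x powr k) * hop t (\<lambda>y. ennreal (norm y powr (- \<sigma>))) x)"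
      by (intro hop_unscale t) measurable
    moreover have "t powr (- \<sigma> / 2) * (K * C6) * t powr ((k + ?n * \<rho>) / 2) = K * C6 * t powr (- ((\<sigma> - k - ?n * \<rho>) / 2))"
    proof -
      have "t powr (- \<sigma> / 2) * t powr ((k + ?n * \<rho>) / 2) = t powr (- ((\<sigma> - k - ?n * \<rho>) / 2))"
        unfolding powr_add[symmetric] by (rule arg_cong[where f="\<lambda>z. t powr z"]) (simp add: field_simps)
      then show ?thesis by (simp only: mult_ac)
    qed
    ultimately show ?thesis by (simp only:)
  qed
  then show ?thesis using K C6 by (intro exI[of _ "K * C6"]) auto
qed

section \<open>Duhamel integrals\<close>

abbreviation jm :: "(real \<Rightarrow> 'a::euclidean_space \<Rightarrow> ennreal) \<Rightarrow> bool" where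
  "jm F \<equiv> case_prod F \<in> borel_measurable (borel \<Otimes>\<^sub>M borel)"

definition duh :: "(real \<Rightarrow> 'a::euclidean_space \<Rightarrow> ennreal) \<Rightarrow> real \<Rightarrow> 'a \<Rightarrow> ennreal" where
  "duh F t x = (\<integral>\<^sup>+\<tau>\<in>{0<..<t}. hop (t - \<tau>) (F \<tau>) x \<partial>lborel)"

lemma jm_section: "jm F \<Longrightarrow> F t \<in> borel_measurable borel"
  using measurable_compose[OF measurable_Pair1'[of t borel borel], of "case_prod F"] by simp

lemma measurable_hop2 [measurable (raw)]:
  assumes [measurable]: "case_prod F \<in> borel_measurable (borel \<Otimes>\<^sub>M borel)" "s \<in> borel_measurable M"
    "\<tau> \<in> borel_measurable M" "x \<in> borel_measurable M"
  shows "(\<lambda>z. hop (s z) (F (\<tau> z)) (x z :: 'a::euclidean_space)) \<in> borel_measurable M"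
  unfolding hop_def by measurable

lemma measurable_duh:
  assumes [measurable]: "jm F"
  shows "jm (duh F)"
proof -
  have "(\<lambda>z. \<integral>\<^sup>+\<tau>. hop (fst z - \<tau>) (F \<tau>) (snd z) * (if 0 < \<tau> \<and> \<tau> < fst z then 1 else 0) \<partial>lborel)
     \<in> borel_measurable (borel \<Otimes>\<^sub>M borel)"
    by measurable
  moreover have "case_prod (duh F) = (\<lambda>z. \<integral>\<^sup>+\<tau>. hop (fst z - \<tau>) (F \<tau>) (snd z) * (if 0 < \<tau> \<and> \<tau> < fst z then 1 else 0) \<partial>lborel)"
    by (auto simp: duh_def fun_eq_iff indicator_def intro!: nn_integral_cong)
  ultimately show ?thesis by simp
qed

lemma duh_mono_AE:
  assumes "\<And>\<tau>. 0 < \<tau> \<Longrightarrow> \<tau> < t \<Longrightarrow> AE y in lborel. F \<tau> y \<le> G \<tau> y"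
  shows "duh F t x \<le> duh G t x"
  unfolding duh_def
proof (rule nn_integral_mono)
  fix \<tau> show "hop (t - \<tau>) (F \<tau>) x * indicator {0<..<t} \<tau> \<le> hop (t - \<tau>) (G \<tau>) x * indicator {0<..<t} \<tau>"
    using assms[of \<tau>] by (cases "\<tau> \<in> {0<..<t}") (auto intro: hop_mono_AE)
qed

lemma hop_add:
  assumes [measurable]: "F \<in> borel_measurable borel" "G \<in> borel_measurable borel"
  shows "hop t (\<lambda>y. F y + G y) x = hop t F x + hop t G x"
  unfolding hop_def by (subst nn_integral_add[symmetric]) (auto simp: distrib_left)

lemma duh_add:
  assumes [measurable]: "jm F" "jm G"
  shows "duh (\<lambda>t x. F t x + G t x) t x = duh F t x + duh G t x"
  unfolding duh_def
  by (subst nn_integral_add[symmetric], measurable) (simp add: hop_add distrib_right)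

lemma hop_SUP:
  fixes F :: "nat \<Rightarrow> 'a::euclidean_space \<Rightarrow> ennreal"
  assumes [measurable]: "\<And>i. F i \<in> borel_measurable borel" and inc: "\<And>x. incseq (\<lambda>i. F i x)"
  shows "hop t (\<lambda>x. SUP i. F i x) x = (SUP i. hop t (F i) x)"
  unfolding hop_def SUP_mult_left_ennreal
  by (rule nn_integral_monotone_convergence_SUP)
     (use inc in \<open>auto simp: incseq_def le_fun_def intro!: mult_left_mono\<close>)

text \<open>Monotone convergence twice, in y and in \<tau>. It lets the Duhamel operator act on the
  limit of the Neumann sums.\<close>

lemma duh_SUP:
  fixes F :: "nat \<Rightarrow> real \<Rightarrow> 'a::euclidean_space \<Rightarrow> ennreal"
  assumes F[measurable]: "\<And>i. jm (F i)" and inc: "\<And>t x. incseq (\<lambda>i. F i t x)"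
  shows "duh (\<lambda>t x. SUP i. F i t x) t x = (SUP i. duh (F i) t x)"
proof -
  have inc2: "hop s (F i \<tau>) x \<le> hop s (F j \<tau>) x" if "i \<le> j" for i j s \<tau>
    using inc that by (intro hop_mono_AE AE_I2) (auto simp: incseq_def)
  have "duh (\<lambda>t x. SUP i. F i t x) t x = (\<integral>\<^sup>+\<tau>. (SUP i. hop (t - \<tau>) (F i \<tau>) x * indicator {0<..<t} \<tau>) \<partial>lborel)"
    unfolding duh_def
    by (intro nn_integral_cong, subst hop_SUP[OF jm_section[OF F] inc]) (rule SUP_mult_right_ennreal)
  also have "\<dots> = (SUP i. duh (F i) t x)" unfolding duh_def
    by (rule nn_integral_monotone_convergence_SUP)
       (use inc2 in \<open>auto simp: incseq_def le_fun_def intro!: mult_right_mono\<close>)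
  finally show ?thesis .
qed

lemma ib_weaken:
  assumes f: "ib \<rho> A f" and AB: "A \<le> B"
  shows "ib \<rho> B f"
proof -
  have "(\<integral>\<^sup>+x\<in>E. f x \<partial>lborel) \<le> ennreal (B * m powr (1 - \<rho>))"
    if "E \<in> sets borel" "m \<ge> 0" "emeasure lborel E = ennreal m" for E m
    using AB by (intro order_trans[OF ibD[OF f that] ennreal_leI] mult_right_mono) auto
  then show ?thesis using f AB by (simp add: ib_def)
qed

lemma nn_integral_powr_unit:
  assumes b: "b < 1" and t: "t > 0"
  shows "(\<integral>\<^sup>+\<tau>\<in>{0<..<t}. ennreal (\<tau> powr (- b)) \<partial>lborel) \<le> ennreal (t powr (1 - b) / (1 - b))"
proof -
  have "((\<lambda>x. x powr (- b)) has_integral (t powr (- b + 1) / (- b + 1))) {0..t}"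
    using b t by (intro has_integral_powr_from_0) auto
  then have "(\<integral>\<^sup>+x. ennreal (x powr (- b)) * indicator {0..t} x \<partial>lborel) = ennreal (t powr (- b + 1) / (- b + 1))"
    by (intro nn_integral_has_integral_lebesgue') auto
  moreover have "(\<integral>\<^sup>+\<tau>\<in>{0<..<t}. ennreal (\<tau> powr (- b)) \<partial>lborel)
     \<le> (\<integral>\<^sup>+x. ennreal (x powr (- b)) * indicator {0..t} x \<partial>lborel)"
    by (intro nn_integral_mono) (auto simp: indicator_def)
  ultimately show ?thesis by (simp add: algebra_simps)
qed

lemma nn_integral_powr_unit':
  assumes b: "b < 1" and t: "t > 0"
  shows "(\<integral>\<^sup>+\<tau>\<in>{0<..<t}. ennreal ((t - \<tau>) powr (- b)) \<partial>lborel) \<le> ennreal (t powr (1 - b) / (1 - b))"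
proof -
  have "(\<integral>\<^sup>+\<tau>\<in>{0<..<t}. ennreal ((t - \<tau>) powr (- b)) \<partial>lborel)
     = (\<integral>\<^sup>+\<tau>\<in>{0<..<t}. ennreal (\<tau> powr (- b)) \<partial>lborel)"
    by (subst nn_integral_lborel_affine[where c="-1" and t=t], measurable)
       (auto intro!: nn_integral_cong simp: indicator_def)
  with nn_integral_powr_unit[OF assms] show ?thesis by simp
qed

text \<open>The source is measured twice. For \<open>\<tau> \<le> t / 2\<close> the kernel time is
  comparable to t, so any amount of smoothing is harmless and only the singularity at \<tau> = 0
  must be integrable; for later \<tau> the power of \<tau> is comparable to that of t, and the
  smoothing singularity at \<tau> = t must have order below 1. The rates bb and bi enter the
  constant only through b0 and c0, which makes it uniform in the extra decay.\<close>

theorem duhamel: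
  fixes n :: real
  assumes n: "n = real DIM('a::euclidean_space)"
    and \<rho>2: "0 \<le> \<rho>2" "0 \<le> k2 + n * \<rho>2"
    and E: "\<rho>2 \<le> \<rho>b" "\<rho>b < 1" "k2 \<le> kb" "kb + n * \<rho>b < n" and b0: "b0 < 1"
    and L: "\<rho>2 \<le> \<rho>i" "\<rho>i < 1" "k2 \<le> ki" "ki + n * \<rho>i < n"
    and gi: "(ki + n * \<rho>i - k2 - n * \<rho>2) / 2 < 1"
  shows "\<exists>C>0. \<forall>A bb bi e t (F :: real \<Rightarrow> 'a \<Rightarrow> ennreal). jm F \<longrightarrow> t > 0 \<longrightarrow> bb \<le> b0 \<longrightarrow> \<bar>bi\<bar> \<le> c0 \<longrightarrow>
     (kb + n * \<rho>b - k2 - n * \<rho>2) / 2 + bb - 1 = e \<longrightarrow> (ki + n * \<rho>i - k2 - n * \<rho>2) / 2 + bi - 1 = e \<longrightarrow>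
     (\<forall>\<tau>. 0 < \<tau> \<longrightarrow> \<tau> < t \<longrightarrow> wk \<rho>b (A * \<tau> powr (- bb)) (wt kb (F \<tau>))) \<longrightarrow>
     (\<forall>\<tau>. 0 < \<tau> \<longrightarrow> \<tau> < t \<longrightarrow> wk \<rho>i (A * \<tau> powr (- bi)) (wt ki (F \<tau>))) \<longrightarrow>
     wk \<rho>2 (C * A * t powr (- e)) (wt k2 (duh F t))"
proof -
  define gb where "gb = (kb + n * \<rho>b - k2 - n * \<rho>2) / 2"
  define g where "g = (ki + n * \<rho>i - k2 - n * \<rho>2) / 2"
  have n0: "n \<ge> 0" by (simp add: n)
  have "n * \<rho>2 \<le> n * \<rho>b" "n * \<rho>2 \<le> n * \<rho>i" using n0 E(1) L(1) by (auto intro: mult_left_mono)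
  then have gb0: "gb \<ge> 0" and g0: "g \<ge> 0" "g < 1" using E(3) L(3) gi by (auto simp: gb_def g_def)
  obtain Cb where Cb: "Cb > 0" "\<And>A t (F :: 'a \<Rightarrow> ennreal). F \<in> borel_measurable borel \<Longrightarrow> t > 0 \<Longrightarrow>
    wk \<rho>b A (wt kb F) \<Longrightarrow>
    wk \<rho>2 (Cb * A * t powr (- gb)) (wt k2 (hop t F))"
    using smoothing[where 'a='a, OF \<rho>2(1) E(1,2,3) E(4)[unfolded n] \<rho>2(2)[unfolded n]] unfolding gb_def n by blast
  obtain Ci where Ci: "Ci > 0" "\<And>A t (F :: 'a \<Rightarrow> ennreal). F \<in> borel_measurable borel \<Longrightarrow> t > 0 \<Longrightarrow>
    wk \<rho>i A (wt ki F) \<Longrightarrow>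
    wk \<rho>2 (Ci * A * t powr (- g)) (wt k2 (hop t F))"
    using smoothing[where 'a='a, OF \<rho>2(1) L(1,2,3) L(4)[unfolded n] \<rho>2(2)[unfolded n]] unfolding g_def n by blast
  obtain C1 where C1: "C1 \<ge> 1" "\<And>A (f :: 'a \<Rightarrow> ennreal). wk \<rho>2 A f \<Longrightarrow> ib \<rho>2 (C1 * A) f"
    using wk_imp_ib[OF \<rho>2(1) le_less_trans[OF E(1,2)]] by blast
  define Kb where "Kb = C1 * Cb * 2 powr gb"
  define Ki where "Ki = C1 * Ci * 2 powr c0"
  define C where "C = Kb / (1 - b0) + Ki / (1 - g)"
  have K: "Kb > 0" "Ki > 0" using Cb Ci C1 by (auto simp: Kb_def Ki_def)
  have C: "C > 0" using K b0 g0 by (simp add: C_def add_pos_pos)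
  have "wk \<rho>2 (C * A * t powr (- e)) (wt k2 (duh F t))"
    if F[measurable]: "jm F" and t: "t > 0" and bb: "bb \<le> b0" and bi: "\<bar>bi\<bar> \<le> c0"
      and e1: "gb + bb - 1 = e" and e2: "g + bi - 1 = e"
      and wb: "\<And>\<tau>. 0 < \<tau> \<Longrightarrow> \<tau> < t \<Longrightarrow> wk \<rho>b (A * \<tau> powr (- bb)) (wt kb (F \<tau>))"
      and wi: "\<And>\<tau>. 0 < \<tau> \<Longrightarrow> \<tau> < t \<Longrightarrow> wk \<rho>i (A * \<tau> powr (- bi)) (wt ki (F \<tau>))"
    for A bb bi e t and F :: "real \<Rightarrow> 'a \<Rightarrow> ennreal"
  proof (rule ib_imp_wk[OF _ \<rho>2(1)])
    have A: "A \<ge> 0" using wk_nonneg[OF wb[of "t / 2"]] t by (auto simp: zero_le_mult_iff not_le[symmetric])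
    have [measurable]: "F \<tau> \<in> borel_measurable borel" for \<tau> by measurable
    \<comment> \<open>An integrable majorant in \<tau> for the set averages of the integrand, valid
      on both halves. The rate bb is traded for b0 at the price of a power of t, so the integral
      contributes 1 / (1 - b0).\<close>
    define a where "a \<tau> = t powr (- e) * A * (Kb * (t powr (b0 - 1) * \<tau> powr (- b0)) + Ki * (t powr (g - 1) * (t - \<tau>) powr (- g)))" for \<tau>
    have key: "ib \<rho>2 (a \<tau>) (\<lambda>x. ennreal (norm x powr k2) * hop (t - \<tau>) (F \<tau>) x)" if \<tau>: "0 < \<tau>" "\<tau> < t" for \<tau>
    proof (cases "\<tau> \<le> t / 2")
      case True
      have "ib \<rho>2 (C1 * (Cb * (A * \<tau> powr (- bb)) * (t - \<tau>) powr (- gb))) (\<lambda>x. ennreal (norm x powr k2) * hop (t - \<tau>) (F \<tau>) x)"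
        using \<tau> by (intro C1 Cb wb) auto
      moreover have "C1 * (Cb * (A * \<tau> powr (- bb)) * (t - \<tau>) powr (- gb)) \<le> a \<tau>"
      proof -
        have 1: "(t - \<tau>) powr (- gb) \<le> 2 powr gb * t powr (- gb)"
        proof -
          have "(t - \<tau>) powr (- gb) \<le> (t / 2) powr (- gb)" using True t gb0 by (intro powr_mono2') auto
          also have "\<dots> = 2 powr gb * t powr (- gb)" using t by (simp add: powr_divide powr_minus divide_simps)
          finally show ?thesis .
        qed
        \<comment> \<open>Valid for every bb up to b0, negative ones included, since \<tau> / t lies
          below 1.\<close>
        have 2: "\<tau> powr (- bb) \<le> t powr (- bb) * t powr b0 * \<tau> powr (- b0)"
        proof -
          have "(\<tau> / t) powr (b0 - bb) \<le> 1" using \<tau> t bb by (intro powr_le1) auto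
          then have "(\<tau> / t) powr (b0 - bb) * (t powr (- bb) * t powr b0 * \<tau> powr (- b0)) \<le> 1 * (t powr (- bb) * t powr b0 * \<tau> powr (- b0))"
            by (rule mult_right_mono) auto
          moreover have "(\<tau> / t) powr (b0 - bb) * (t powr (- bb) * t powr b0 * \<tau> powr (- b0)) = \<tau> powr (- bb)"
            using \<tau> t by (simp add: powr_divide powr_diff powr_minus field_simps)
          ultimately show ?thesis by simp
        qed
        have "C1 * (Cb * (A * \<tau> powr (- bb)) * (t - \<tau>) powr (- gb))
          \<le> C1 * (Cb * (A * (t powr (- bb) * t powr b0 * \<tau> powr (- b0))) * (2 powr gb * t powr (- gb)))"
          using C1(1) Cb(1) A 1 2 by (intro mult_left_mono mult_mono) auto
        also have "\<dots> = A * Kb * \<tau> powr (- b0) * (t powr (- bb) * t powr b0 * t powr (- gb))"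
          by (simp add: Kb_def mult_ac)
        also have "t powr (- bb) * t powr b0 * t powr (- gb) = t powr (- e) * t powr (b0 - 1)"
          unfolding powr_add[symmetric] e1[symmetric] by (simp add: algebra_simps)
        also have "A * Kb * \<tau> powr (- b0) * (t powr (- e) * t powr (b0 - 1)) = t powr (- e) * A * (Kb * (t powr (b0 - 1) * \<tau> powr (- b0)))"
          by (simp only: mult_ac)
        also have "\<dots> \<le> a \<tau>" unfolding a_def using A K by (intro mult_left_mono) auto
        finally show ?thesis .
      qed
      ultimately show ?thesis by (rule ib_weaken)
    next
      case False
      have "ib \<rho>2 (C1 * (Ci * (A * \<tau> powr (- bi)) * (t - \<tau>) powr (- g))) (\<lambda>x. ennreal (norm x powr k2) * hop (t - \<tau>) (F \<tau>) x)"
        using \<tau> by (intro C1 Ci wi) auto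
      moreover have "C1 * (Ci * (A * \<tau> powr (- bi)) * (t - \<tau>) powr (- g)) \<le> a \<tau>"
      proof -
        have 2: "\<tau> powr (- bi) \<le> t powr (- bi) * 2 powr c0"
        proof (cases "bi \<ge> 0")
          case True
          have "\<tau> powr (- bi) \<le> (t / 2) powr (- bi)" using False t True by (intro powr_mono2') auto
          also have "\<dots> = t powr (- bi) * 2 powr bi" using t by (simp add: powr_divide powr_minus divide_simps)
          also have "\<dots> \<le> t powr (- bi) * 2 powr c0" using bi True by (intro mult_left_mono powr_mono) auto
          finally show ?thesis .
        next
          case neg: False
          have "\<tau> powr (- bi) \<le> t powr (- bi)" using \<tau> neg by (intro powr_mono2) auto
          also have "\<dots> \<le> t powr (- bi) * 2 powr c0"
            using bi mult_left_mono[of 1 "2 powr c0" "t powr (- bi)"] by (simp add: ge_one_powr_ge_zero)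
          finally show ?thesis .
        qed
        have "C1 * (Ci * (A * \<tau> powr (- bi)) * (t - \<tau>) powr (- g))
          \<le> C1 * (Ci * (A * (t powr (- bi) * 2 powr c0)) * (t - \<tau>) powr (- g))"
          using C1(1) Ci(1) A 2 by (intro mult_left_mono mult_right_mono) auto
        also have "\<dots> = A * Ki * (t - \<tau>) powr (- g) * t powr (- bi)"
          by (simp add: Ki_def mult_ac)
        also have "t powr (- bi) = t powr (- e) * t powr (g - 1)"
          unfolding powr_add[symmetric] e2[symmetric] by (simp add: algebra_simps)
        also have "A * Ki * (t - \<tau>) powr (- g) * (t powr (- e) * t powr (g - 1)) = t powr (- e) * A * (Ki * (t powr (g - 1) * (t - \<tau>) powr (- g)))"
          by (simp only: mult_ac)
        also have "\<dots> \<le> a \<tau>" unfolding a_def using A K by (intro mult_left_mono) auto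
        finally show ?thesis .
      qed
      ultimately show ?thesis by (rule ib_weaken)
    qed
    have dm: "duh F t \<in> borel_measurable borel" by (rule jm_section[OF measurable_duh[OF F]])
    have "(\<integral>\<^sup>+x\<in>S. ennreal (norm x powr k2) * duh F t x \<partial>lborel) \<le> ennreal (C * A * t powr (- e) * m powr (1 - \<rho>2))"
      if S[measurable]: "S \<in> sets borel" and m: "m \<ge> 0" "emeasure lborel S = ennreal m" for S m
    proof -
      have "(\<integral>\<^sup>+x\<in>S. ennreal (norm x powr k2) * duh F t x \<partial>lborel)
         = (\<integral>\<^sup>+x. (\<integral>\<^sup>+\<tau>. ennreal (norm x powr k2) * hop (t - \<tau>) (F \<tau>) x * indicator S x * indicator {0<..<t} \<tau> \<partial>lborel) \<partial>lborel)"
      proof (rule nn_integral_cong)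
        fix x :: 'a
        have "(\<integral>\<^sup>+\<tau>. ennreal (norm x powr k2) * hop (t - \<tau>) (F \<tau>) x * indicator S x * indicator {0<..<t} \<tau> \<partial>lborel)
          = (\<integral>\<^sup>+\<tau>. (ennreal (norm x powr k2) * indicator S x) * (hop (t - \<tau>) (F \<tau>) x * indicator {0<..<t} \<tau>) \<partial>lborel)"
          by (simp only: mult_ac)
        also have "\<dots> = (ennreal (norm x powr k2) * indicator S x) * duh F t x"
          unfolding duh_def by (rule nn_integral_cmult) measurable
        finally show "ennreal (norm x powr k2) * duh F t x * indicator S x
          = (\<integral>\<^sup>+\<tau>. ennreal (norm x powr k2) * hop (t - \<tau>) (F \<tau>) x * indicator S x * indicator {0<..<t} \<tau> \<partial>lborel)"
          by (simp only: mult_ac)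
      qed
      \<comment> \<open>The exchange of the set integral with the time integral, for which the bound
        was converted to set averages.\<close>
      also have "\<dots> = (\<integral>\<^sup>+\<tau>. (\<integral>\<^sup>+x. ennreal (norm x powr k2) * hop (t - \<tau>) (F \<tau>) x * indicator S x * indicator {0<..<t} \<tau> \<partial>lborel) \<partial>lborel)"
        by (rule lborel_pair.Fubini') measurable
      also have "\<dots> \<le> (\<integral>\<^sup>+\<tau>. ennreal (a \<tau> * m powr (1 - \<rho>2)) * indicator {0<..<t} \<tau> \<partial>lborel)"
      proof (rule nn_integral_mono)
        fix \<tau> :: real
        show "(\<integral>\<^sup>+x. ennreal (norm x powr k2) * hop (t - \<tau>) (F \<tau>) x * indicator S x * indicator {0<..<t} \<tau> \<partial>lborel)
          \<le> ennreal (a \<tau> * m powr (1 - \<rho>2)) * indicator {0<..<t} \<tau>"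
        proof (cases "0 < \<tau> \<and> \<tau> < t")
          case True
          then have "\<tau> \<in> {0<..<t}" by simp
          then show ?thesis using ibD[OF key S m] True by simp
        qed auto
      qed
      also have "\<dots> = (\<integral>\<^sup>+\<tau>. ennreal (t powr (- e) * A * m powr (1 - \<rho>2)) *
          (ennreal (Kb * t powr (b0 - 1)) * (ennreal (\<tau> powr (- b0)) * indicator {0<..<t} \<tau>)
         + ennreal (Ki * t powr (g - 1)) * (ennreal ((t - \<tau>) powr (- g)) * indicator {0<..<t} \<tau>)) \<partial>lborel)"
      proof (rule nn_integral_cong)
        fix \<tau> :: real
        have "a \<tau> * m powr (1 - \<rho>2) = (t powr (- e) * A * m powr (1 - \<rho>2)) *
           (Kb * t powr (b0 - 1) * \<tau> powr (- b0) + Ki * t powr (g - 1) * (t - \<tau>) powr (- g))"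
          by (simp add: a_def algebra_simps)
        moreover have "ennreal ((t powr (- e) * A * m powr (1 - \<rho>2)) *
           (Kb * t powr (b0 - 1) * \<tau> powr (- b0) + Ki * t powr (g - 1) * (t - \<tau>) powr (- g)))
          = ennreal (t powr (- e) * A * m powr (1 - \<rho>2)) *
          (ennreal (Kb * t powr (b0 - 1)) * ennreal (\<tau> powr (- b0)) + ennreal (Ki * t powr (g - 1)) * ennreal ((t - \<tau>) powr (- g)))"
          using A K by (simp add: ennreal_mult ennreal_plus)
        ultimately have "ennreal (a \<tau> * m powr (1 - \<rho>2)) = ennreal (t powr (- e) * A * m powr (1 - \<rho>2)) *
          (ennreal (Kb * t powr (b0 - 1)) * ennreal (\<tau> powr (- b0)) + ennreal (Ki * t powr (g - 1)) * ennreal ((t - \<tau>) powr (- g)))"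
          by (simp only:)
        then show "ennreal (a \<tau> * m powr (1 - \<rho>2)) * indicator {0<..<t} \<tau> = ennreal (t powr (- e) * A * m powr (1 - \<rho>2)) *
          (ennreal (Kb * t powr (b0 - 1)) * (ennreal (\<tau> powr (- b0)) * indicator {0<..<t} \<tau>)
         + ennreal (Ki * t powr (g - 1)) * (ennreal ((t - \<tau>) powr (- g)) * indicator {0<..<t} \<tau>))"
          by (cases "\<tau> \<in> {0<..<t}") (simp_all add: mult.assoc)
      qed
      also have "\<dots> = ennreal (t powr (- e) * A * m powr (1 - \<rho>2)) *
          (ennreal (Kb * t powr (b0 - 1)) * (\<integral>\<^sup>+\<tau>\<in>{0<..<t}. ennreal (\<tau> powr (- b0)) \<partial>lborel)
         + ennreal (Ki * t powr (g - 1)) * (\<integral>\<^sup>+\<tau>\<in>{0<..<t}. ennreal ((t - \<tau>) powr (- g)) \<partial>lborel))"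
      proof -
        let ?f = "\<lambda>\<tau>. ennreal (\<tau> powr (- b0)) * indicator {0<..<t} \<tau>" and ?g = "\<lambda>\<tau>. ennreal ((t - \<tau>) powr (- g)) * indicator {0<..<t} \<tau>"
        have m1: "?f \<in> borel_measurable lborel" "?g \<in> borel_measurable lborel"
          by (intro borel_measurable_times_ennreal borel_measurable_indicator; simp)+
        have m2: "(\<lambda>\<tau>. c * ?f \<tau>) \<in> borel_measurable lborel" "(\<lambda>\<tau>. c * ?g \<tau>) \<in> borel_measurable lborel" for c :: ennreal
          by (intro borel_measurable_times_ennreal[OF borel_measurable_const] m1)+
        have m3: "(\<lambda>\<tau>. c * ?f \<tau> + c' * ?g \<tau>) \<in> borel_measurable lborel" for c c' :: ennreal
          by (intro borel_measurable_add m2)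
        show ?thesis
          unfolding nn_integral_cmult[OF m3] nn_integral_add[OF m2] nn_integral_cmult[OF m1(1)] nn_integral_cmult[OF m1(2)] ..
      qed
      also have "\<dots> \<le> ennreal (t powr (- e) * A * m powr (1 - \<rho>2)) *
          (ennreal (Kb * t powr (b0 - 1)) * ennreal (t powr (1 - b0) / (1 - b0))
         + ennreal (Ki * t powr (g - 1)) * ennreal (t powr (1 - g) / (1 - g)))"
        using t b0 g0 by (intro mult_left_mono add_mono nn_integral_powr_unit nn_integral_powr_unit') auto
      also have "\<dots> = ennreal (t powr (- e) * A * m powr (1 - \<rho>2) *
          (Kb * t powr (b0 - 1) * (t powr (1 - b0) / (1 - b0)) + Ki * t powr (g - 1) * (t powr (1 - g) / (1 - g))))"
        using A K b0 g0 by (simp add: ennreal_mult[symmetric] ennreal_plus[symmetric] del: ennreal_plus)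
      also have "t powr (- e) * A * m powr (1 - \<rho>2) *
          (Kb * t powr (b0 - 1) * (t powr (1 - b0) / (1 - b0)) + Ki * t powr (g - 1) * (t powr (1 - g) / (1 - g)))
         = C * A * t powr (- e) * m powr (1 - \<rho>2)"
      proof -
        have "t powr (b0 - 1) * t powr (1 - b0) = 1" "t powr (g - 1) * t powr (1 - g) = 1"
          using t by (simp_all flip: powr_add)
        then have "Kb * t powr (b0 - 1) * (t powr (1 - b0) / (1 - b0)) + Ki * t powr (g - 1) * (t powr (1 - g) / (1 - g)) = C"
          by (simp add: C_def mult.assoc)
        then show ?thesis by (simp add: mult_ac)
      qed
      finally show ?thesis .
    qed
    then show "ib \<rho>2 (C * A * t powr (- e)) (wt k2 (duh F t))"
      using A C dm by (simp add: ib_def)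
  qed
  then show ?thesis unfolding gb_def g_def using C by blast
qed

section \<open>The linearised Duhamel operator\<close>

definition kb :: "real set \<Rightarrow> real \<Rightarrow> real \<Rightarrow> real \<Rightarrow> real \<Rightarrow> (real \<Rightarrow> 'a::euclidean_space \<Rightarrow> ennreal) \<Rightarrow> bool" where
  "kb J e k \<rho> A f \<longleftrightarrow> (\<forall>t\<in>J. wk \<rho> (A * t powr (- e)) (wt k (f t)))"

text \<open>Initial segments of the positive half line: the Duhamel integral at a time in J involves
  only earlier times, which again belong to J. Besides the half line, bounded segments are used for
  a priori bounds.\<close>

definition time_set :: "real set \<Rightarrow> bool" where
  "time_set J \<longleftrightarrow> J \<subseteq> {0<..} \<and> (\<forall>t\<in>J. \<forall>s. 0 < s \<longrightarrow> s \<le> t \<longrightarrow> s \<in> J)"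

lemma time_set_pos: "time_set J \<Longrightarrow> t \<in> J \<Longrightarrow> 0 < t"
  by (auto simp: time_set_def)

lemma time_set_down: "time_set J \<Longrightarrow> t \<in> J \<Longrightarrow> 0 < s \<Longrightarrow> s \<le> t \<Longrightarrow> s \<in> J"
  by (auto simp: time_set_def)

lemma time_set_greaterThan [simp]: "time_set {0<..}" and time_set_interval [simp]: "time_set {0<..<T}"
  by (auto simp: time_set_def)

lemma kbD: "kb J e k \<rho> A f \<Longrightarrow> t \<in> J \<Longrightarrow> wk \<rho> (A * t powr (- e)) (wt k (f t))"
  by (simp add: kb_def)

lemma kb_weaken:
  assumes "kb J e k \<rho> A f" "A \<le> B" shows "kb J e k \<rho> B f"
  unfolding kb_def
proof
  fix t assume "t \<in> J"
  then show "wk \<rho> (B * t powr (- e)) (wt k (f t))"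
    using assms(2) by (intro wk_weaken[OF kbD[OF assms(1)]] mult_right_mono) auto
qed

lemma kb_subset: "kb J e k \<rho> A f \<Longrightarrow> I \<subseteq> J \<Longrightarrow> kb I e k \<rho> A f"
  by (auto simp: kb_def)

lemma kb_mono_AE:
  assumes f: "kb J e k \<rho> A f" and g: "\<And>t. t \<in> J \<Longrightarrow> g t \<in> borel_measurable borel"
    and le: "\<And>t. t \<in> J \<Longrightarrow> AE x in lborel. g t x \<le> f t x"
  shows "kb J e k \<rho> A g"
  unfolding kb_def
proof
  fix t assume t: "t \<in> J"
  note [measurable] = g[OF t]
  show "wk \<rho> (A * t powr (- e)) (wt k (g t))"
  proof (rule wk_mono_AE[OF kbD[OF f t]])
    show "AE x in lborel. ennreal (norm x powr k) * g t x \<le> ennreal (norm x powr k) * f t x"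
      using le[OF t] by eventually_elim (rule mult_left_mono, auto)
  qed auto
qed

lemma kb_add:
  assumes "kb J e k \<rho> A f" "kb J e k \<rho> B g"
  shows "kb J e k \<rho> (2 powr \<rho> * (A + B)) (\<lambda>t x. f t x + g t x)"
  unfolding kb_def
proof
  fix t assume t: "t \<in> J"
  show "wk \<rho> (2 powr \<rho> * (A + B) * t powr (- e)) (\<lambda>x. ennreal (norm x powr k) * (f t x + g t x))"
    using wk_add[OF kbD[OF assms(1) t] kbD[OF assms(2) t]] by (simp add: algebra_simps)
qed

lemma kb_cmult:
  assumes "kb J e k \<rho> A f" "0 \<le> c"
  shows "kb J e k \<rho> (c * A) (\<lambda>t x. ennreal c * f t x)"
  unfolding kb_def
proof
  fix t assume t: "t \<in> J"
  show "wk \<rho> (c * A * t powr (- e)) (\<lambda>x. ennreal (norm x powr k) * (ennreal c * f t x))"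
    using wk_cmult[OF kbD[OF assms(1) t] assms(2)] by (simp add: mult.assoc mult.left_commute)
qed

lemma kb_limit:
  assumes J: "time_set J" and A: "0 \<le> A" and f: "\<And>B. A < B \<Longrightarrow> kb J e k \<rho> B f"
  shows "kb J e k \<rho> A f"
  unfolding kb_def
proof
  fix t assume t: "t \<in> J"
  have t0: "t powr (- e) > 0" using time_set_pos[OF J t] by simp
  show "wk \<rho> (A * t powr (- e)) (wt k (f t))"
  proof (rule wk_limit)
    fix B assume "A * t powr (- e) < B"
    then have "A < B / t powr (- e)" using t0 by (simp add: pos_less_divide_eq)
    from kbD[OF f[OF this] t] show "wk \<rho> B (wt k (f t))" using t0 by simp
  qed (use A in simp)
qed

lemma kb_duh:
  fixes F :: "real \<Rightarrow> 'a::euclidean_space \<Rightarrow> ennreal"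
  assumes D: "\<And>A t. t > 0 \<Longrightarrow>
     (\<forall>\<tau>. 0 < \<tau> \<longrightarrow> \<tau> < t \<longrightarrow> wk \<rho>b (A * \<tau> powr (- bb)) (wt k1 (F \<tau>))) \<Longrightarrow>
     (\<forall>\<tau>. 0 < \<tau> \<longrightarrow> \<tau> < t \<longrightarrow> wk \<rho>i (A * \<tau> powr (- bi)) (wt ki (F \<tau>))) \<Longrightarrow>
     wk \<rho>2 (C * A * t powr (- e)) (wt k2 (duh F t))"
    and J: "time_set J" and 1: "kb J bb k1 \<rho>b A F" and 2: "kb J bi ki \<rho>i A F"
  shows "kb J e k2 \<rho>2 (C * A) (duh F)"
  unfolding kb_def
proof
  fix t assume t: "t \<in> J"
  show "wk \<rho>2 (C * A * t powr (- e)) (wt k2 (duh F t))"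
  proof (rule D[OF time_set_pos[OF J t]])
    show "\<forall>\<tau>. 0 < \<tau> \<longrightarrow> \<tau> < t \<longrightarrow> wk \<rho>b (A * \<tau> powr (- bb)) (wt k1 (F \<tau>))"
      using kbD[OF 1] time_set_down[OF J t] by simp
    show "\<forall>\<tau>. 0 < \<tau> \<longrightarrow> \<tau> < t \<longrightarrow> wk \<rho>i (A * \<tau> powr (- bi)) (wt ki (F \<tau>))"
      using kbD[OF 2] time_set_down[OF J t] by simp
  qed
qed

section \<open>Powers, products and weights of space-time bounds\<close>

abbreviation jr :: "(real \<Rightarrow> 'a::euclidean_space \<Rightarrow> real) \<Rightarrow> bool" where
  "jr q \<equiv> case_prod q \<in> borel_measurable (borel \<Otimes>\<^sub>M borel)"

abbreviation enn :: "(real \<Rightarrow> 'a::euclidean_space \<Rightarrow> real) \<Rightarrow> real \<Rightarrow> 'a \<Rightarrow> ennreal" where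
  "enn q \<equiv> (\<lambda>t x. ennreal (q t x))"

abbreviation cnn :: "(real \<Rightarrow> 'a::euclidean_space \<Rightarrow> complex) \<Rightarrow> real \<Rightarrow> 'a \<Rightarrow> ennreal" where
  "cnn u \<equiv> (\<lambda>t x. ennreal (norm (u t x)))"

lemma jr_section: "jr q \<Longrightarrow> q t \<in> borel_measurable borel"
  using measurable_compose[OF measurable_Pair1'[of t borel borel], of "case_prod q"] by simp

lemma kb_const_nonneg:
  assumes "kb J e k \<rho> A f" "time_set J" "t \<in> J" shows "0 \<le> A"
proof -
  have "0 < t powr (- e)" using time_set_pos[OF assms(2,3)] by simp
  moreover have "0 \<le> A * t powr (- e)" by (rule wk_nonneg[OF kbD[OF assms(1,3)]])
  ultimately show ?thesis by (simp add: zero_le_mult_iff)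
qed

text \<open>Together with \<open>kb_mult\<close> this is the whole exponent calculus for sources:
  powers multiply the triple of decay, weight and integrability exponents, products add such
  triples.\<close>

lemma kb_powr:
  assumes f: "kb J e k \<rho> A (enn f)" and nn: "\<And>t x. 0 \<le> f t x" and \<theta>: "0 \<le> \<theta>" and J: "time_set J"
  shows "kb J (\<theta> * e) (\<theta> * k) (\<theta> * \<rho>) (A powr \<theta>) (\<lambda>t x. ennreal (f t x powr \<theta>))"
  unfolding kb_def
proof
  fix t assume t: "t \<in> J"
  have A: "A \<ge> 0" by (rule kb_const_nonneg[OF f J t])
  have "wk \<rho> (A * t powr (- e)) (\<lambda>x. ennreal (norm x powr k * f t x))"
    using kbD[OF f t] nn by (simp add: ennreal_mult)
  from wk_powr[OF this \<theta>] nn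
  have "wk (\<theta> * \<rho>) ((A * t powr (- e)) powr \<theta>) (\<lambda>x. ennreal ((norm x powr k * f t x) powr \<theta>))" by simp
  moreover have "(A * t powr (- e)) powr \<theta> = A powr \<theta> * t powr (- (\<theta> * e))"
    using A by (simp add: powr_mult powr_powr mult.commute)
  moreover have "(norm x powr k * f t x) powr \<theta> = norm x powr (\<theta> * k) * f t x powr \<theta>" for x
    using nn by (simp add: powr_mult powr_powr mult.commute)
  ultimately show "wk (\<theta> * \<rho>) (A powr \<theta> * t powr (- (\<theta> * e))) (\<lambda>x. ennreal (norm x powr (\<theta> * k)) * ennreal (f t x powr \<theta>))"
    by (simp add: ennreal_mult)
qed

lemma kb_mult:
  assumes f: "kb J e k \<rho> A f" and g: "kb J e' k' \<rho>' B g"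
  shows "kb J (e + e') (k + k') (\<rho> + \<rho>') (2 powr (\<rho> + \<rho>') * (A * B)) (\<lambda>t x. f t x * g t x)"
  unfolding kb_def
proof
  fix t assume t: "t \<in> J"
  have "2 powr (\<rho> + \<rho>') * (A * t powr (- e) * (B * t powr (- e'))) = 2 powr (\<rho> + \<rho>') * (A * B) * t powr (- (e + e'))"
    by (simp add: powr_add[symmetric] mult_ac)
  moreover have "(\<lambda>x. ennreal (norm x powr k) * f t x * (ennreal (norm x powr k') * g t x)) = (\<lambda>x. ennreal (norm x powr (k + k')) * (f t x * g t x))"
    by (auto simp: fun_eq_iff powr_add ennreal_mult mult_ac)
  ultimately show "wk (\<rho> + \<rho>') (2 powr (\<rho> + \<rho>') * (A * B) * t powr (- (e + e'))) (\<lambda>x. ennreal (norm x powr (k + k')) * (f t x * g t x))"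
    using wk_mult[OF kbD[OF f t] kbD[OF g t]] by (simp only:)
qed

text \<open>Moving a power of norm x between the function and the weight is exact away from the
  origin, a null set.\<close>

lemma kb_weight:
  assumes f: "kb J e k \<rho> A f" and fm: "\<And>t. f t \<in> borel_measurable borel"
  shows "kb J e (k - \<gamma>) \<rho> A (\<lambda>t x. ennreal (norm x powr \<gamma>) * f t x)"
  unfolding kb_def
proof
  fix t assume t: "t \<in> J"
  note [measurable] = fm[of t]
  show "wk \<rho> (A * t powr (- e)) (\<lambda>x. ennreal (norm x powr (k - \<gamma>)) * (ennreal (norm x powr \<gamma>) * f t x))"
  proof (rule wk_mono_AE[OF kbD[OF f t]])
    show "AE x in lborel. ennreal (norm x powr (k - \<gamma>)) * (ennreal (norm x powr \<gamma>) * f t x) \<le> ennreal (norm x powr k) * f t x"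
      using AE_lborel_nonzero
      by eventually_elim (simp add: mult.assoc[symmetric] ennreal_mult[symmetric] powr_add[symmetric])
  qed auto
qed

text \<open>The decay rate that scaling assigns to data of order
  \<open>norm x powr (- \<sigma>)\<close> in the space with weight k and \<rho> = 1/p. With n the
  dimension it is the exponent of t in \<open>K_norm\<close> for s = \<sigma> / n.\<close>

definition ew :: "real \<Rightarrow> real \<Rightarrow> real \<Rightarrow> real \<Rightarrow> real" where
  "ew n \<sigma> k \<rho> = (\<sigma> - k - n * \<rho>) / 2"

abbreviation kw :: "real \<Rightarrow> real \<Rightarrow> real \<Rightarrow> real \<Rightarrow> real \<Rightarrow> (real \<Rightarrow> 'a::euclidean_space \<Rightarrow> ennreal) \<Rightarrow> bool" where
  "kw n \<sigma> k \<rho> A f \<equiv> kb {0<..} (ew n \<sigma> k \<rho>) k \<rho> A f"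

definition potential :: "real \<Rightarrow> real \<Rightarrow> (real \<Rightarrow> 'a::euclidean_space \<Rightarrow> real) \<Rightarrow> (real \<Rightarrow> 'a \<Rightarrow> ennreal) \<Rightarrow> real \<Rightarrow> 'a \<Rightarrow> ennreal" where
  "potential \<gamma> \<beta> q w t x = ennreal (norm x powr \<gamma>) * (ennreal (q t x powr \<beta>) * w t x)"

lemma measurable_potential:
  assumes [measurable]: "jr q" "jm w" shows "jm (potential \<gamma> \<beta> q w)"
  unfolding potential_def[abs_def] by measurable

text \<open>Here \<beta> stands for \<alpha> - 1, \<rho> for 1/p, and \<sigma>1 is the scaling
  exponent of the equation. \<open>sub\<close> says that multiplication by the potential costs less
  than the two orders of smoothing that are available with an integrable singularity,
  \<open>pos\<close> that this cost is positive, and \<open>k\<gamma>\<close> that the product does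
  not lose weight.\<close>

locale hh =
  fixes ty :: "'a::euclidean_space itself" and n \<beta> \<gamma> \<sigma>1 k \<rho> :: real
  assumes n: "n = real DIM('a)" and \<beta>: "0 < \<beta>" and \<sigma>1: "\<beta> * \<sigma>1 = 2 + \<gamma>"
    and \<rho>0: "0 \<le> \<rho>" and k\<gamma>: "\<gamma> \<le> \<beta> * k" and sub: "\<beta> * (k + n * \<rho>) - \<gamma> < 2"
    and pos: "0 < \<beta> * (k + n * \<rho>) - \<gamma>" and k\<sigma>: "k + n * \<rho> < \<sigma>1" and k0: "0 \<le> k + n * \<rho>"
begin

lemma n0: "n > 0" by (simp add: n)

text \<open>The spaces on which the linearised operator acts. The upper bounds by 1 and n make the
  product of potential and function locally integrable; the last inequality is exactly integrability
  of the source in time at 0, for the rate \<open>ew n \<sigma>d kd \<rho>d\<close>.\<close>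

definition good :: "real \<Rightarrow> real \<Rightarrow> real \<Rightarrow> bool" where
  "good kd \<rho>d \<sigma>d \<longleftrightarrow> 0 \<le> \<rho>d \<and> \<beta> * \<rho> + \<rho>d < 1 \<and> \<beta> * (k + n * \<rho>) - \<gamma> + kd + n * \<rho>d < n
     \<and> 0 \<le> kd + n * \<rho>d \<and> \<gamma> + \<sigma>d < \<beta> * (k + n * \<rho>) + kd + n * \<rho>d"

text \<open>The scaling relation \<open>\<beta> \<sigma>1 = 2 + \<gamma>\<close> makes the operator preserve the decay exponent.\<close>

lemma contraction:
  assumes g: "good kd \<rho>d \<sigma>d"
  shows "\<exists>C>0. \<exists>\<delta>0>0. \<forall>J M B \<delta> q (w :: real \<Rightarrow> 'a \<Rightarrow> ennreal). time_set J \<longrightarrow> 0 \<le> \<delta> \<longrightarrow> \<delta> \<le> \<delta>0 \<longrightarrow>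
     jr q \<longrightarrow> jm w \<longrightarrow> (\<forall>t x. 0 \<le> q t x) \<longrightarrow> kb J (ew n \<sigma>1 k \<rho>) k \<rho> M (enn q) \<longrightarrow>
     kb J (ew n \<sigma>d kd \<rho>d + \<delta>) kd \<rho>d B w \<longrightarrow>
     kb J (ew n \<sigma>d kd \<rho>d + \<delta>) kd \<rho>d (C * (M powr \<beta> * B)) (duh (potential \<gamma> \<beta> q w))"
proof -
  have g': "0 \<le> \<rho>d" "\<beta> * \<rho> + \<rho>d < 1" "\<beta> * (k + n * \<rho>) - \<gamma> + kd + n * \<rho>d < n"
     "0 \<le> kd + n * \<rho>d" "\<gamma> + \<sigma>d < \<beta> * (k + n * \<rho>) + kd + n * \<rho>d"
    using g by (auto simp: good_def)
  let ?e = "ew n \<sigma>1 k \<rho>" and ?ed = "ew n \<sigma>d kd \<rho>d"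
  let ?ks = "\<beta> * k + kd - \<gamma>" and ?\<rho>s = "\<beta> * \<rho> + \<rho>d"
  have b1: "\<beta> * ?e + ?ed < 1" using g'(5) \<sigma>1 by (simp add: ew_def field_simps)
  \<comment> \<open>Half of the room below 1 is reserved for the extra rate \<delta>, so that b0 and
    c0, and with them the constant, are common to all
    \<open>\<delta> \<le> \<delta>0\<close>.\<close>
  define \<delta>0 where "\<delta>0 = (1 - (\<beta> * ?e + ?ed)) / 2"
  have \<delta>0: "\<delta>0 > 0" using b1 by (simp add: \<delta>0_def)
  define b0 where "b0 = \<beta> * ?e + ?ed + \<delta>0"
  define c0 where "c0 = \<bar>\<beta> * ?e + ?ed\<bar> + \<delta>0"
  have scal: "(?ks + n * ?\<rho>s - kd - n * \<rho>d) / 2 + (\<beta> * ?e + (?ed + \<delta>)) - 1 = ?ed + \<delta>" for \<delta>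
    using \<sigma>1 by (simp add: ew_def field_simps)
  have c1: "\<rho>d \<le> ?\<rho>s" using \<beta> \<rho>0 by simp
  have c2: "kd \<le> ?ks" using k\<gamma> by simp
  have c3: "?ks + n * ?\<rho>s < n" using g'(3) by (simp add: algebra_simps)
  have c4: "b0 < 1" using b1 by (simp add: b0_def \<delta>0_def field_simps)
  have c5: "(?ks + n * ?\<rho>s - kd - n * \<rho>d) / 2 < 1" using sub by (simp add: algebra_simps)
  obtain C where C: "C > 0" "\<And>A bb bi e t (F :: real \<Rightarrow> 'a \<Rightarrow> ennreal). jm F \<Longrightarrow> t > 0 \<Longrightarrow> bb \<le> b0 \<Longrightarrow> \<bar>bi\<bar> \<le> c0 \<Longrightarrow>
     (?ks + n * ?\<rho>s - kd - n * \<rho>d) / 2 + bb - 1 = e \<Longrightarrow> (?ks + n * ?\<rho>s - kd - n * \<rho>d) / 2 + bi - 1 = e \<Longrightarrow>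
     (\<forall>\<tau>. 0 < \<tau> \<longrightarrow> \<tau> < t \<longrightarrow> wk ?\<rho>s (A * \<tau> powr (- bb)) (wt ?ks (F \<tau>))) \<Longrightarrow>
     (\<forall>\<tau>. 0 < \<tau> \<longrightarrow> \<tau> < t \<longrightarrow> wk ?\<rho>s (A * \<tau> powr (- bi)) (wt ?ks (F \<tau>))) \<Longrightarrow>
     wk \<rho>d (C * A * t powr (- e)) (wt kd (duh F t))"
    using duhamel[OF n g'(1,4) c1 g'(2) c2 c3 c4 c1 g'(2) c2 c3 c5, of c0] by blast
  define C' where "C' = C * 2 powr ?\<rho>s"
  have "kb J (?ed + \<delta>) kd \<rho>d (C' * (M powr \<beta> * B)) (duh (potential \<gamma> \<beta> q w))"
    if J: "time_set J" and \<delta>: "0 \<le> \<delta>" "\<delta> \<le> \<delta>0" and qm: "jr q" and wm: "jm w" and q0: "\<forall>t x. 0 \<le> q t x"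
      and q: "kb J ?e k \<rho> M (enn q)" and w: "kb J (?ed + \<delta>) kd \<rho>d B w"
    for J M B \<delta> q and w :: "real \<Rightarrow> 'a \<Rightarrow> ennreal"
  proof -
    note [measurable] = jr_section[OF qm] jm_section[OF wm]
    have "kb J (\<beta> * ?e + (?ed + \<delta>)) (\<beta> * k + kd) ?\<rho>s (2 powr ?\<rho>s * (M powr \<beta> * B)) (\<lambda>t x. ennreal (q t x powr \<beta>) * w t x)"
      using \<beta> q0 by (intro kb_mult kb_powr q w J) auto
    then have P: "kb J (\<beta> * ?e + (?ed + \<delta>)) ?ks ?\<rho>s (2 powr ?\<rho>s * (M powr \<beta> * B)) (potential \<gamma> \<beta> q w)"
      unfolding potential_def[abs_def] by (rule kb_weight) measurable
    have "kb J (?ed + \<delta>) kd \<rho>d (C * (2 powr ?\<rho>s * (M powr \<beta> * B))) (duh (potential \<gamma> \<beta> q w))"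
    proof (rule kb_duh[OF C(2)[OF measurable_potential[OF qm wm] _ _ _ scal scal] J P P])
      show "\<beta> * ?e + (?ed + \<delta>) \<le> b0" using \<delta> by (simp add: b0_def)
      show "\<bar>\<beta> * ?e + (?ed + \<delta>)\<bar> \<le> c0" using \<delta> by (simp add: c0_def)
    qed
    then show ?thesis by (simp add: C'_def mult.assoc)
  qed
  moreover have "C' > 0" using C(1) by (simp add: C'_def)
  ultimately show ?thesis using \<delta>0 by blast
qed

text \<open>The bound B must be finite but drops out: the operator returns at most half of the old
  constant, so each application moves it half way towards \<open>2 * 2 powr \<rho>d * A\<close>, and
  the admissible constants form a closed set. M0 depends neither on J nor on \<delta>.\<close>

lemma absorption:
  assumes g: "good kd \<rho>d \<sigma>d"
  shows "\<exists>M0>0. \<exists>\<delta>0>0. \<forall>J A B \<delta> q (D :: real \<Rightarrow> 'a \<Rightarrow> ennreal) R. time_set J \<longrightarrow> 0 \<le> A \<longrightarrow> 0 \<le> \<delta> \<longrightarrow> \<delta> \<le> \<delta>0 \<longrightarrow>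
     jr q \<longrightarrow> jm D \<longrightarrow> (\<forall>t x. 0 \<le> q t x) \<longrightarrow> kb J (ew n \<sigma>1 k \<rho>) k \<rho> M0 (enn q) \<longrightarrow>
     kb J (ew n \<sigma>d kd \<rho>d + \<delta>) kd \<rho>d A R \<longrightarrow> kb J (ew n \<sigma>d kd \<rho>d + \<delta>) kd \<rho>d B D \<longrightarrow>
     (\<forall>t\<in>J. AE x in lborel. D t x \<le> R t x + duh (potential \<gamma> \<beta> q D) t x) \<longrightarrow>
     kb J (ew n \<sigma>d kd \<rho>d + \<delta>) kd \<rho>d (2 * 2 powr \<rho>d * A) D"
proof -
  let ?e = "ew n \<sigma>1 k \<rho>" and ?ed = "ew n \<sigma>d kd \<rho>d"
  obtain C \<delta>0 where C: "C > 0" "\<delta>0 > 0" "\<And>J M B \<delta> q (w :: real \<Rightarrow> 'a \<Rightarrow> ennreal). time_set J \<Longrightarrow> 0 \<le> \<delta> \<Longrightarrow> \<delta> \<le> \<delta>0 \<Longrightarrow>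
     jr q \<Longrightarrow> jm w \<Longrightarrow> (\<forall>t x. 0 \<le> q t x) \<Longrightarrow> kb J ?e k \<rho> M (enn q) \<Longrightarrow>
     kb J (?ed + \<delta>) kd \<rho>d B w \<Longrightarrow>
     kb J (?ed + \<delta>) kd \<rho>d (C * (M powr \<beta> * B)) (duh (potential \<gamma> \<beta> q w))"
    using contraction[OF g] by blast
  \<comment> \<open>Chosen so that the contraction constant times the quasi-triangle factor
    \<open>2 powr \<rho>d\<close> equals 1/2.\<close>
  define M0 where "M0 = (1 / (2 * 2 powr \<rho>d * C)) powr (1 / \<beta>)"
  have M0: "M0 > 0" "2 powr \<rho>d * (C * M0 powr \<beta>) = 1 / 2"
    using C \<beta> by (simp_all add: M0_def powr_powr)
  have "kb J (?ed + \<delta>) kd \<rho>d (2 * 2 powr \<rho>d * A) D"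
    if J: "time_set J" and A: "0 \<le> A" and \<delta>: "0 \<le> \<delta>" "\<delta> \<le> \<delta>0" and qm: "jr q" and Dm: "jm D" and q0: "\<forall>t x. 0 \<le> q t x"
      and q: "kb J ?e k \<rho> M0 (enn q)" and R: "kb J (?ed + \<delta>) kd \<rho>d A R"
      and D: "kb J (?ed + \<delta>) kd \<rho>d B D"
      and le: "\<forall>t\<in>J. AE x in lborel. D t x \<le> R t x + duh (potential \<gamma> \<beta> q D) t x"
    for J A B \<delta> q and D :: "real \<Rightarrow> 'a \<Rightarrow> ennreal" and R
  proof (cases "J = {}")
    case True
    then show ?thesis by (simp add: kb_def)
  next
    case False
    have B: "B \<ge> 0" using kb_const_nonneg[OF D J] False by auto
    define a where "a = 2 * 2 powr \<rho>d * A"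
    have a: "a \<ge> 0" using A by (simp add: a_def)
    have step: "kb J (?ed + \<delta>) kd \<rho>d ((a + b) / 2) D" if b: "kb J (?ed + \<delta>) kd \<rho>d b D" for b
    proof -
      have X: "kb J (?ed + \<delta>) kd \<rho>d (2 powr \<rho>d * (A + C * (M0 powr \<beta> * b))) (\<lambda>t x. R t x + duh (potential \<gamma> \<beta> q D) t x)"
        by (intro kb_add R C J \<delta> qm Dm q0 q b)
      have "kb J (?ed + \<delta>) kd \<rho>d (2 powr \<rho>d * (A + C * (M0 powr \<beta> * b))) D"
        by (rule kb_mono_AE[OF X jm_section[OF Dm] le[rule_format]])
      moreover have "2 powr \<rho>d * (A + C * (M0 powr \<beta> * b)) = 2 powr \<rho>d * A + (2 powr \<rho>d * (C * M0 powr \<beta>)) * b"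
        by (simp add: algebra_simps)
      ultimately have "kb J (?ed + \<delta>) kd \<rho>d (2 powr \<rho>d * A + 1 / 2 * b) D" unfolding M0(2) by (simp only:)
      then show ?thesis by (simp add: a_def add_divide_distrib)
    qed
    have it: "kb J (?ed + \<delta>) kd \<rho>d (a + B / 2 ^ i) D" for i
    proof (induction i)
      case 0
      show ?case using a by (intro kb_weaken[OF D]) simp
    next
      case (Suc i)
      from step[OF this] show ?case by (simp add: field_simps)
    qed
    have "kb J (?ed + \<delta>) kd \<rho>d a D"
    proof (rule kb_limit[OF J a])
      fix b assume b: "a < b"
      obtain i where "B / (b - a) < 2 ^ i" using real_arch_pow[of 2 "B / (b - a)"] by auto
      then have "a + B / 2 ^ i \<le> b" using b by (simp add: field_simps)
      then show "kb J (?ed + \<delta>) kd \<rho>d b D" by (rule kb_weaken[OF it])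
    qed
    then show ?thesis by (simp add: a_def)
  qed
  then show ?thesis using M0(1) C(2) by blast
qed

lemma potential_mono: "w t x \<le> w' t x \<Longrightarrow> potential \<gamma> \<beta> q w t x \<le> potential \<gamma> \<beta> q w' t x"
  unfolding potential_def by (intro mult_left_mono) auto

text \<open>A subsolution is dominated by the Neumann series of the linear problem: the positive part of the
  difference is absorbed in the first space, and the series is summed in the second.\<close>

definition transferring where
  "transferring kd \<rho>d \<sigma>d kf \<rho>f \<sigma>f M0 \<longleftrightarrow> (\<forall>A B q (w :: real \<Rightarrow> 'a \<Rightarrow> ennreal) f.
     jr q \<longrightarrow> jm w \<longrightarrow> (\<forall>t x. 0 \<le> q t x) \<longrightarrow> (\<forall>t x. w t x < \<infinity>) \<longrightarrow> kw n \<sigma>1 k \<rho> M0 (enn q) \<longrightarrow>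
     kw n \<sigma>d kd \<rho>d B w \<longrightarrow> kw n \<sigma>f kf \<rho>f A f \<longrightarrow>
     (\<forall>t>0. AE x in lborel. w t x \<le> f t x + duh (potential \<gamma> \<beta> q w) t x) \<longrightarrow>
     kw n \<sigma>f kf \<rho>f (2 * 2 powr \<rho>f * A) w)"

lemma transferringD:
  fixes w :: "real \<Rightarrow> 'a \<Rightarrow> ennreal"
  assumes "transferring kd \<rho>d \<sigma>d kf \<rho>f \<sigma>f M0" "jr q" "jm w" "\<forall>t x. 0 \<le> q t x" "\<forall>t x. w t x < \<infinity>"
    "kw n \<sigma>1 k \<rho> M0 (enn q)" "kw n \<sigma>d kd \<rho>d B w" "kw n \<sigma>f kf \<rho>f A f"
    and "\<forall>t>0. AE x in lborel. w t x \<le> f t x + duh (potential \<gamma> \<beta> q w) t x"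
  shows "kw n \<sigma>f kf \<rho>f (2 * 2 powr \<rho>f * A) w"
  using assms unfolding transferring_def by blast

lemma transfer:
  assumes g: "good kd \<rho>d \<sigma>d" "good kf \<rho>f \<sigma>f"
  shows "\<exists>M0>0. transferring kd \<rho>d \<sigma>d kf \<rho>f \<sigma>f M0"
proof -
  let ?e = "ew n \<sigma>1 k \<rho>" and ?ed = "ew n \<sigma>d kd \<rho>d" and ?ef = "ew n \<sigma>f kf \<rho>f"
  obtain M1 \<delta>1 where M1: "M1 > 0" "\<delta>1 > 0" "\<And>J A B \<delta> q (D :: real \<Rightarrow> 'a \<Rightarrow> ennreal) R. time_set J \<Longrightarrow> 0 \<le> A \<Longrightarrow> 0 \<le> \<delta> \<Longrightarrow> \<delta> \<le> \<delta>1 \<Longrightarrow>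
     jr q \<Longrightarrow> jm D \<Longrightarrow> (\<forall>t x. 0 \<le> q t x) \<Longrightarrow> kb J ?e k \<rho> M1 (enn q) \<Longrightarrow>
     kb J (?ed + \<delta>) kd \<rho>d A R \<Longrightarrow> kb J (?ed + \<delta>) kd \<rho>d B D \<Longrightarrow>
     (\<forall>t\<in>J. AE x in lborel. D t x \<le> R t x + duh (potential \<gamma> \<beta> q D) t x) \<Longrightarrow>
     kb J (?ed + \<delta>) kd \<rho>d (2 * 2 powr \<rho>d * A) D"
    using absorption[OF g(1)] by blast
  obtain C \<delta>0 where C: "C > 0" "\<delta>0 > 0" "\<And>J M B \<delta> q (w :: real \<Rightarrow> 'a \<Rightarrow> ennreal). time_set J \<Longrightarrow> 0 \<le> \<delta> \<Longrightarrow> \<delta> \<le> \<delta>0 \<Longrightarrow>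
     jr q \<Longrightarrow> jm w \<Longrightarrow> (\<forall>t x. 0 \<le> q t x) \<Longrightarrow> kb J ?e k \<rho> M (enn q) \<Longrightarrow>
     kb J (?ef + \<delta>) kf \<rho>f B w \<Longrightarrow>
     kb J (?ef + \<delta>) kf \<rho>f (C * (M powr \<beta> * B)) (duh (potential \<gamma> \<beta> q w))"
    using contraction[OF g(2)] by blast
  define M2 where "M2 = (1 / (2 * 2 powr \<rho>f * C)) powr (1 / \<beta>)"
  have M2: "M2 > 0" "2 powr \<rho>f * (C * M2 powr \<beta>) = 1 / 2"
    using C \<beta> by (simp_all add: M2_def powr_powr)
  define M0 where "M0 = min M1 M2"
  have "kb {0<..} ?ef kf \<rho>f (2 * 2 powr \<rho>f * A) w"
    if qm: "jr q" and wm: "jm w" and q0: "\<forall>t x. 0 \<le> q t x" and fin: "\<forall>t x. w t x < \<infinity>"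
      and q: "kb {0<..} ?e k \<rho> M0 (enn q)"
      and w: "kb {0<..} ?ed kd \<rho>d B w" and f0: "kb {0<..} ?ef kf \<rho>f A f0"
      and le0: "\<forall>t>0. AE x in lborel. w t x \<le> f0 t x + duh (potential \<gamma> \<beta> q w) t x"
    for A B q f0 and w :: "real \<Rightarrow> 'a \<Rightarrow> ennreal"
  proof -
    \<comment> \<open>Truncated subtraction gives a jointly measurable f that lies below f0 almost
      everywhere, because w is finite, and for which the inequality for w holds at every point. The
      Neumann series is built from this f.\<close>
    define f where "f = (\<lambda>t x. w t x - duh (potential \<gamma> \<beta> q w) t x)"
    have fm: "jm f"
    proof -
      note [measurable] = measurable_duh[OF measurable_potential[OF qm wm]] wm
      show ?thesis unfolding f_def by measurable
    qed
    have A: "0 \<le> A" by (rule kb_const_nonneg[OF f0 time_set_greaterThan, of 1]) simp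
    have f: "kb {0<..} ?ef kf \<rho>f A f"
    proof (rule kb_mono_AE[OF f0 jm_section[OF fm]])
      fix t :: real assume "t \<in> {0<..}"
      then have "AE x in lborel. w t x \<le> f0 t x + duh (potential \<gamma> \<beta> q w) t x" using le0 by simp
      then show "AE x in lborel. f t x \<le> f0 t x"
      proof eventually_elim
        case (elim x)
        have "w t x \<noteq> top" using fin[rule_format, of t x] by auto
        then show ?case using elim by (simp add: f_def ennreal_minus_le_iff add.commute)
      qed
    qed
    have le: "\<forall>t>0. AE x in lborel. w t x \<le> f t x + duh (potential \<gamma> \<beta> q w) t x"
    proof (intro allI impI AE_I2)
      fix t x
      show "w t x \<le> f t x + duh (potential \<gamma> \<beta> q w) t x"
        unfolding f_def by (cases "duh (potential \<gamma> \<beta> q w) t x \<le> w t x") (auto simp: diff_add_cancel_ennreal intro: add_increasing)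
    qed
    have q1: "kb {0<..} ?e k \<rho> M1 (enn q)" and q2: "kb {0<..} ?e k \<rho> M2 (enn q)"
      by (rule kb_weaken[OF q], simp add: M0_def)+
    \<comment> \<open>Partial sums of the Neumann series, started at 0. The bound a is its own image
      under the iteration, because the operator with M2 halves it.\<close>
    define S where "S = rec_nat (\<lambda>t x. 0) (\<lambda>_ s t x. f t x + duh (potential \<gamma> \<beta> q s) t x)"
    have S0: "S 0 = (\<lambda>t x. 0)" and SS: "S (Suc i) = (\<lambda>t x. f t x + duh (potential \<gamma> \<beta> q (S i)) t x)" for i
      by (simp_all add: S_def)
    have Sm: "jm (S i)" for i
    proof (induction i)
      case (Suc i)
      note [measurable] = measurable_duh[OF measurable_potential[OF qm Suc]] fm
      show ?case unfolding SS by measurable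
    qed (simp add: S0)
    have inc1: "S i t x \<le> S (Suc i) t x" for i t x
    proof (induction i arbitrary: t x)
      case (Suc i)
      show ?case unfolding SS[of "Suc i"] SS[of i]
        by (intro add_left_mono duh_mono_AE AE_I2 potential_mono) (rule Suc[unfolded SS[of i]])
    qed (simp add: S0)
    have inc: "incseq (\<lambda>i. S i t x)" for t x by (rule incseq_SucI) (rule inc1)
    define a where "a = 2 * 2 powr \<rho>f * A"
    have a: "a \<ge> 0" using A by (simp add: a_def)
    have Sb: "kb {0<..} ?ef kf \<rho>f a (S i)" for i
    proof (induction i)
      case 0
      show ?case using a by (simp add: S0 kb_def wk_def)
    next
      case (Suc i)
      have "kb {0<..} (?ef + 0) kf \<rho>f (C * (M2 powr \<beta> * a)) (duh (potential \<gamma> \<beta> q (S i)))"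
        using C(2) Suc by (intro C(3) qm Sm q0 q2) auto
      then have "kb {0<..} ?ef kf \<rho>f (2 powr \<rho>f * (A + C * (M2 powr \<beta> * a))) (S (Suc i))"
        unfolding SS by (intro kb_add f) auto
      moreover have "2 powr \<rho>f * (A + C * (M2 powr \<beta> * a)) = 2 powr \<rho>f * A + (2 powr \<rho>f * (C * M2 powr \<beta>)) * a"
        by (simp add: algebra_simps)
      ultimately have "kb {0<..} ?ef kf \<rho>f (2 powr \<rho>f * A + 1 / 2 * a) (S (Suc i))" unfolding M2(2) by (simp only:)
      then show ?case by (simp add: a_def mult_ac)
    qed
    define T where "T = (\<lambda>t x. SUP i. S i t x)"
    have Tm: "jm T"
    proof -
      have "(\<lambda>z. SUP i. case_prod (S i) z) \<in> borel_measurable (borel \<Otimes>\<^sub>M borel)" using Sm by measurable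
      then show ?thesis by (simp add: T_def case_prod_unfold)
    qed
    have Tb: "kb {0<..} ?ef kf \<rho>f a T"
      unfolding kb_def
    proof
      fix t :: real assume t: "t \<in> {0<..}"
      have "wk \<rho>f (a * t powr (- ?ef)) (\<lambda>x. SUP i. ennreal (norm x powr kf) * S i t x)"
        using inc by (intro wk_SUP kbD[OF Sb t]) (auto simp: incseq_def intro!: mult_left_mono)
      then show "wk \<rho>f (a * t powr (- ?ef)) (wt kf (T t))"
        by (simp add: T_def SUP_mult_left_ennreal)
    qed
    have Teq: "f t x + duh (potential \<gamma> \<beta> q T) t x \<le> T t x" for t x
    proof -
      have "potential \<gamma> \<beta> q T = (\<lambda>t x. SUP i. potential \<gamma> \<beta> q (S i) t x)"
        by (simp add: potential_def T_def fun_eq_iff SUP_mult_left_ennreal)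
      then have "duh (potential \<gamma> \<beta> q T) t x = (SUP i. duh (potential \<gamma> \<beta> q (S i)) t x)"
        using inc by (simp only:) (intro duh_SUP measurable_potential qm Sm, auto simp: incseq_def intro: potential_mono)
      then have "f t x + duh (potential \<gamma> \<beta> q T) t x = (SUP i. f t x + duh (potential \<gamma> \<beta> q (S i)) t x)"
        by (simp add: ennreal_SUP_add_right)
      also have "\<dots> = (SUP i. S (Suc i) t x)" by (simp add: SS)
      also have "\<dots> \<le> T t x" unfolding T_def by (intro SUP_mono) auto
      finally show ?thesis .
    qed
    \<comment> \<open>The positive part of w - T. It is a subsolution with zero source and lies
      below w, hence is bounded in the first space; absorption with A = 0 forces it to vanish almost
      everywhere.\<close>
    define h where "h = (\<lambda>t x. w t x - T t x)"
    have hm: "jm h"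
    proof -
      note [measurable] = Tm wm
      show ?thesis unfolding h_def by measurable
    qed
    have hw: "h t x \<le> w t x" for t x by (simp add: h_def diff_le_self_ennreal)
    have wTh: "w t x \<le> T t x + h t x" for t x
      by (cases "T t x \<le> w t x") (auto simp: h_def add_diff_inverse_ennreal intro: add_increasing2)
    have hle: "AE x in lborel. h t x \<le> 0 + duh (potential \<gamma> \<beta> q h) t x" if "t > 0" for t
      using le[rule_format, OF that]
    proof eventually_elim
      case (elim x)
      have "duh (potential \<gamma> \<beta> q w) t x \<le> duh (\<lambda>t x. potential \<gamma> \<beta> q T t x + potential \<gamma> \<beta> q h t x) t x"
        using wTh by (intro duh_mono_AE AE_I2) (auto simp: potential_def distrib_left[symmetric] intro!: mult_left_mono)
      also have "\<dots> = duh (potential \<gamma> \<beta> q T) t x + duh (potential \<gamma> \<beta> q h) t x"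
        by (intro duh_add measurable_potential qm Tm hm)
      finally have "w t x \<le> f t x + (duh (potential \<gamma> \<beta> q T) t x + duh (potential \<gamma> \<beta> q h) t x)"
        using elim by (meson add_left_mono order_trans)
      also have "\<dots> \<le> T t x + duh (potential \<gamma> \<beta> q h) t x"
        using Teq[of t x] by (simp add: add.assoc[symmetric] add_right_mono)
      finally have "w t x \<le> T t x + duh (potential \<gamma> \<beta> q h) t x" .
      moreover have "w t x \<noteq> top" using fin[rule_format, of t x] by auto
      ultimately show ?case by (simp add: h_def ennreal_minus_le_iff)
    qed
    have w0: "kb {0<..} (?ed + 0) kd \<rho>d B w" using w by simp
    have hb: "kb {0<..} (?ed + 0) kd \<rho>d B h"
      by (rule kb_mono_AE[OF w0 jm_section[OF hm] AE_I2[OF hw]])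
    have z: "kb {0<..} (?ed + 0) kd \<rho>d 0 (\<lambda>t x::'a. 0::ennreal)" by (simp add: kb_def wk_def)
    have hle': "\<forall>t\<in>{0<..}. AE x in lborel. h t x \<le> 0 + duh (potential \<gamma> \<beta> q h) t x"
      using hle by blast
    have hz: "kb {0<..} (?ed + 0) kd \<rho>d (2 * 2 powr \<rho>d * 0) h"
      by (rule M1(3)[OF time_set_greaterThan order_refl order_refl less_imp_le[OF M1(2)] qm hm q0 q1 z hb hle'])
    have h0: "AE x in lborel. h t x = 0" if t: "t > 0" for t
    proof -
      have "t \<in> {0<..}" using t by simp
      from kbD[OF hz this] have "wk \<rho>d 0 (wt kd (h t))" by simp
      from wk_zero_AE[OF this] AE_lborel_nonzero show ?thesis
      proof eventually_elim
        case (elim x)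
        then have "ennreal (norm x powr kd) \<noteq> 0" by simp
        with elim(1) show ?case by simp
      qed
    qed
    have "kb {0<..} ?ef kf \<rho>f a w"
    proof (rule kb_mono_AE[OF Tb jm_section[OF wm]])
      fix t :: real assume "t \<in> {0<..}"
      then have "AE x in lborel. h t x = 0" using h0 by simp
      then show "AE x in lborel. w t x \<le> T t x"
      proof eventually_elim
        case (elim x)
        then show ?case using wTh[of t x] by simp
      qed
    qed
    then show ?thesis by (simp add: a_def)
  qed
  moreover have "M0 > 0" using M1 M2 by (simp add: M0_def)
  ultimately show ?thesis unfolding transferring_def by blast
qed

end

section \<open>Decay of differences\<close>

text \<open>The Duhamel bound for one fixed pair of rates; b0 = bb and c0 = \<bar>bi\<bar> are the
  tightest admissible choices.\<close>

lemma duh_kb: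
  fixes F :: "real \<Rightarrow> 'a::euclidean_space \<Rightarrow> ennreal"
  assumes n: "n = real DIM('a)" and t: "0 \<le> \<rho>t" "0 \<le> kt + n * \<rho>t"
    and E: "\<rho>t \<le> \<rho>b" "\<rho>b < 1" "kt \<le> k1" "k1 + n * \<rho>b < n" "bb < 1"
    and L: "\<rho>t \<le> \<rho>i" "\<rho>i < 1" "kt \<le> ki" "ki + n * \<rho>i < n" "(ki + n * \<rho>i - kt - n * \<rho>t) / 2 < 1"
    and e: "(k1 + n * \<rho>b - kt - n * \<rho>t) / 2 + bb - 1 = e" "(ki + n * \<rho>i - kt - n * \<rho>t) / 2 + bi - 1 = e"
    and F: "jm F" "kb {0<..} bb k1 \<rho>b A F" "kb {0<..} bi ki \<rho>i B F"
  shows "\<exists>C. kb {0<..} e kt \<rho>t C (duh F)"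
proof -
  obtain C where C: "C > 0" "\<And>A b b' e t (F :: real \<Rightarrow> 'a \<Rightarrow> ennreal). jm F \<Longrightarrow> t > 0 \<Longrightarrow> b \<le> bb \<Longrightarrow> \<bar>b'\<bar> \<le> \<bar>bi\<bar> \<Longrightarrow>
     (k1 + n * \<rho>b - kt - n * \<rho>t) / 2 + b - 1 = e \<Longrightarrow> (ki + n * \<rho>i - kt - n * \<rho>t) / 2 + b' - 1 = e \<Longrightarrow>
     (\<forall>\<tau>. 0 < \<tau> \<longrightarrow> \<tau> < t \<longrightarrow> wk \<rho>b (A * \<tau> powr (- b)) (wt k1 (F \<tau>))) \<Longrightarrow>
     (\<forall>\<tau>. 0 < \<tau> \<longrightarrow> \<tau> < t \<longrightarrow> wk \<rho>i (A * \<tau> powr (- b')) (wt ki (F \<tau>))) \<Longrightarrow>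
     wk \<rho>t (C * A * t powr (- e)) (wt kt (duh F t))"
    using duhamel[OF n t E(1-5) L, of "\<bar>bi\<bar>"] by blast
  have "kb {0<..} e kt \<rho>t (C * max A B) (duh F)"
  proof (rule kb_duh[OF C(2)[OF F(1) _ order_refl order_refl e]])
    show "kb {0<..} bb k1 \<rho>b (max A B) F" by (rule kb_weaken[OF F(2)]) simp
    show "kb {0<..} bi ki \<rho>i (max A B) F" by (rule kb_weaken[OF F(3)]) simp
  qed simp_all
  then show ?thesis by blast
qed

text \<open>Up to t = 1 the original rate already gives more than the intermediate one, afterwards
  the faster rate does.\<close>

lemma kb_interpolate_time:
  assumes "kb {0<..} e k \<rho> A f" "kb {0<..} (e + d) k \<rho> B f" "0 \<le> d'" "d' \<le> d"
  shows "kb {0<..} (e + d') k \<rho> (max A B) f"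
  unfolding kb_def
proof
  fix t :: real assume t: "t \<in> {0<..}"
  have A: "A \<ge> 0" by (rule kb_const_nonneg[OF assms(1) time_set_greaterThan t])
  have B: "B \<ge> 0" by (rule kb_const_nonneg[OF assms(2) time_set_greaterThan t])
  show "wk \<rho> (max A B * t powr (- (e + d'))) (wt k (f t))"
  proof (cases "t \<le> 1")
    case True
    have "t powr (- e) \<le> t powr (- (e + d'))" using t True assms by (intro powr_mono') auto
    then have "A * t powr (- e) \<le> max A B * t powr (- (e + d'))" using A by (intro mult_mono) auto
    then show ?thesis by (rule wk_weaken[OF kbD[OF assms(1) t]])
  next
    case False
    have "t powr (- (e + d)) \<le> t powr (- (e + d'))" using False assms by (intro powr_mono) auto
    then have "B * t powr (- (e + d)) \<le> max A B * t powr (- (e + d'))" using B by (intro mult_mono) auto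
    then show ?thesis by (rule wk_weaken[OF kbD[OF assms(2) t]])
  qed
qed

text \<open>On bounded times an extra rate d is free up to the factor \<open>T powr d\<close>. This
  supplies the finite bound from which absorption starts and which disappears from its
  result.\<close>

lemma kb_gain_bounded:
  assumes "kb {0<..} e k \<rho> A f" "0 \<le> d"
  shows "kb {0<..<T} (e + d) k \<rho> (A * T powr d) f"
  unfolding kb_def
proof
  fix t :: real assume t: "t \<in> {0<..<T}"
  then have t': "t \<in> {0<..}" by simp
  have A: "A \<ge> 0" by (rule kb_const_nonneg[OF assms(1) time_set_greaterThan t'])
  have "t powr d \<le> T powr d" using t assms by (intro powr_mono2) auto
  moreover have "t powr (- e) = t powr d * t powr (- (e + d))" unfolding powr_add[symmetric] by simp
  ultimately have "A * t powr (- e) \<le> A * T powr d * t powr (- (e + d))"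
    using A by (simp add: mult.assoc mult_left_mono mult_right_mono)
  then show "wk \<rho> (A * T powr d * t powr (- (e + d))) (wt k (f t))"
    by (rule wk_weaken[OF kbD[OF assms(1) t']])
qed

text \<open>The potential applied to Z, in which the power \<theta> of q has been exchanged for the
  same power of a faster decaying X.\<close>

definition source :: "real \<Rightarrow> real \<Rightarrow> (real \<Rightarrow> 'a::euclidean_space \<Rightarrow> real) \<Rightarrow> (real \<Rightarrow> 'a \<Rightarrow> real) \<Rightarrow> (real \<Rightarrow> 'a \<Rightarrow> real) \<Rightarrow> real \<Rightarrow> real \<Rightarrow> 'a \<Rightarrow> ennreal" where
  "source \<gamma> \<beta> q X Z \<theta> t x = ennreal (norm x powr \<gamma>) * (ennreal (q t x powr (\<beta> - \<theta>)) * (ennreal (X t x powr \<theta>) * ennreal (Z t x)))"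

lemma measurable_source:
  assumes [measurable]: "jr q" "jr X" "jr Z" shows "jm (source \<gamma> \<beta> q X Z \<theta>)"
  unfolding source_def[abs_def] by measurable

text \<open>Extra decay of every sufficiently small order. The filter formulation lets finitely many
  smallness conditions on \<delta> be combined without naming thresholds.\<close>

definition decaying :: "real \<Rightarrow> real \<Rightarrow> real \<Rightarrow> (real \<Rightarrow> 'a::euclidean_space \<Rightarrow> ennreal) \<Rightarrow> bool" where
  "decaying e k \<rho> f \<longleftrightarrow> (\<forall>\<^sub>F \<delta> in at_right 0. \<exists>C. kb {0<..} (e + \<delta>) k \<rho> C f)"

abbreviation dec :: "real \<Rightarrow> real \<Rightarrow> real \<Rightarrow> real \<Rightarrow> (real \<Rightarrow> 'a::euclidean_space \<Rightarrow> ennreal) \<Rightarrow> bool" where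
  "dec n \<sigma> k \<rho> f \<equiv> decaying (ew n \<sigma> k \<rho>) k \<rho> f"

lemma decayingI:
  assumes "kb {0<..} e k \<rho> A f" "kb {0<..} (e + d) k \<rho> B f" "0 < d"
  shows "decaying e k \<rho> f"
  unfolding decaying_def
proof -
  have "\<forall>\<^sub>F \<delta> in at_right 0. \<delta> < d \<and> 0 < \<delta>"
    using assms(3) by (auto simp: eventually_at_right_less eventually_at_right[of 0 1])
  then show "\<forall>\<^sub>F \<delta> in at_right 0. \<exists>C. kb {0<..} (e + \<delta>) k \<rho> C f"
    by eventually_elim (meson kb_interpolate_time[OF assms(1,2)] less_imp_le)
qed

text \<open>The segment from (kd, \<rho>d) to the target is cut into N equal pieces, so that k + n *
  \<rho> drops by less than s0 in each. The intermediate pairs stay admissible because both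
  coordinates decrease towards the target.\<close>

lemma chain_induct:
  fixes n s0 kd \<rho>d :: real
  assumes n: "n > 0" and s0: "s0 > 0" and base: "Pr kd \<rho>d"
    and step: "\<And>kp \<rho>p kt \<rho>t. kt \<le> kp \<Longrightarrow> kp \<le> kd \<Longrightarrow> \<rho>t \<le> \<rho>p \<Longrightarrow> \<rho>p \<le> \<rho>d \<Longrightarrow> 0 \<le> \<rho>t \<Longrightarrow> 0 \<le> kt + n * \<rho>t \<Longrightarrow>
       kp + n * \<rho>p - (kt + n * \<rho>t) < s0 \<Longrightarrow> Pr kp \<rho>p \<Longrightarrow> Pr kt \<rho>t"
    and t: "k' \<le> kd" "\<rho>' \<le> \<rho>d" "0 \<le> \<rho>'" "0 \<le> k' + n * \<rho>'"
  shows "Pr k' \<rho>'"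
proof -
  define g where "g = kd + n * \<rho>d - (k' + n * \<rho>')"
  have "n * \<rho>' \<le> n * \<rho>d" using n t by (intro mult_left_mono) auto
  then have g: "g \<ge> 0" using t by (simp add: g_def)
  obtain N :: nat where N: "g / s0 < real N" using reals_Archimedean2 by blast
  then have N0: "N > 0" using g s0 by (metis divide_nonneg_pos gr0I not_le of_nat_0)
  have Ng: "g / real N < s0" using N N0 s0 by (simp add: field_simps)
  define kk where "kk j = kd - (real j / real N) * (kd - k')" for j
  define rr where "rr j = \<rho>d - (real j / real N) * (\<rho>d - \<rho>')" for j
  have kS: "kk (Suc j) = kk j - (kd - k') / real N" and rS: "rr (Suc j) = rr j - (\<rho>d - \<rho>') / real N" for j
    by (simp_all add: kk_def rr_def add_divide_distrib algebra_simps)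
  have ends: "kk N = k'" "rr N = \<rho>'" "kk 0 = kd" "rr 0 = \<rho>d" using N0 by (simp_all add: kk_def rr_def)
  have bounds: "k' \<le> kk j \<and> kk j \<le> kd \<and> \<rho>' \<le> rr j \<and> rr j \<le> \<rho>d" if "j \<le> N" for j
  proof -
    have f: "0 \<le> real j / real N" "real j / real N \<le> 1" using that N0 by auto
    have "real j / real N * (kd - k') \<le> 1 * (kd - k')" "real j / real N * (\<rho>d - \<rho>') \<le> 1 * (\<rho>d - \<rho>')"
      using f t by (intro mult_right_mono; simp)+
    moreover have "0 \<le> real j / real N * (kd - k')" "0 \<le> real j / real N * (\<rho>d - \<rho>')"
      using f t by simp_all
    ultimately show ?thesis by (simp add: kk_def rr_def)
  qed
  have "j \<le> N \<longrightarrow> Pr (kk j) (rr j)" for j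
  proof (induction j)
    case 0
    show ?case using base by (simp add: ends)
  next
    case (Suc j)
    show ?case
    proof
      assume j: "Suc j \<le> N"
      note b1 = bounds[of j] and b2 = bounds[OF j]
      show "Pr (kk (Suc j)) (rr (Suc j))"
      proof (rule step[of _ "kk j" _ "rr j"])
        show "kk (Suc j) \<le> kk j" "rr (Suc j) \<le> rr j" using t by (simp_all add: kS rS)
        show "kk j \<le> kd" "rr j \<le> \<rho>d" using b1 j by simp_all
        show "0 \<le> rr (Suc j)" using b2 t by simp
        have "n * \<rho>' \<le> n * rr (Suc j)" using b2 n by (intro mult_left_mono) auto
        then show "0 \<le> kk (Suc j) + n * rr (Suc j)" using b2 t by simp
        have "kk j + n * rr j - (kk (Suc j) + n * rr (Suc j)) = g / real N"
          by (simp add: kS rS g_def diff_divide_distrib add_divide_distrib algebra_simps)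
        then show "kk j + n * rr j - (kk (Suc j) + n * rr (Suc j)) < s0" using Ng by simp
        show "Pr (kk j) (rr j)" using Suc j by simp
      qed
    qed
  qed
  from this[of N] show ?thesis by (simp add: ends)
qed

section \<open>Small steps in the exponents, and the gain of decay\<close>

context hh
begin

text \<open>For early times the good pair (kd, \<rho>d) is used, however far it is from the target.
  For late times the nearby pair (kp, \<rho>p) is used, and \<open>gap\<close> keeps the order of
  the singularity at \<tau> = t below 1.\<close>

lemma potential_step:
  assumes g: "good kd \<rho>d \<sigma>d" and p: "kp \<le> kd" "\<rho>p \<le> \<rho>d" "kt \<le> kp" "\<rho>t \<le> \<rho>p" "0 \<le> \<rho>t" "0 \<le> kt + n * \<rho>t"
    and gap: "kp + n * \<rho>p - (kt + n * \<rho>t) < 2 - (\<beta> * (k + n * \<rho>) - \<gamma>)"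
    and qm: "jr q" and q0: "\<And>t x. 0 \<le> q t x" and q: "kw n \<sigma>1 k \<rho> M (enn q)"
  shows "\<exists>\<delta>0>0. \<forall>\<delta> A B (w :: real \<Rightarrow> 'a \<Rightarrow> ennreal). 0 \<le> \<delta> \<longrightarrow> \<delta> \<le> \<delta>0 \<longrightarrow> jm w \<longrightarrow>
     kb {0<..} (ew n \<sigma>d kd \<rho>d + \<delta>) kd \<rho>d A w \<longrightarrow> kb {0<..} (ew n \<sigma>d kp \<rho>p + \<delta>) kp \<rho>p B w \<longrightarrow>
     (\<exists>C. kb {0<..} (ew n \<sigma>d kt \<rho>t + \<delta>) kt \<rho>t C (duh (potential \<gamma> \<beta> q w)))"
proof -
  have g': "0 \<le> \<rho>d" "\<beta> * \<rho> + \<rho>d < 1" "\<beta> * (k + n * \<rho>) - \<gamma> + kd + n * \<rho>d < n"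
     "0 \<le> kd + n * \<rho>d" "\<gamma> + \<sigma>d < \<beta> * (k + n * \<rho>) + kd + n * \<rho>d"
    using g by (auto simp: good_def)
  let ?e = "ew n \<sigma>1 k \<rho>"
  have b1: "\<beta> * ?e + ew n \<sigma>d kd \<rho>d < 1" using g'(5) \<sigma>1 by (simp add: ew_def field_simps)
  define \<delta>0 where "\<delta>0 = (1 - (\<beta> * ?e + ew n \<sigma>d kd \<rho>d)) / 2"
  have \<delta>0: "\<delta>0 > 0" using b1 by (simp add: \<delta>0_def)
  have \<beta>\<rho>: "\<beta> * \<rho> \<ge> 0" using \<beta> \<rho>0 by simp
  have "n * \<rho>p \<le> n * \<rho>d" using n0 p by (intro mult_left_mono) auto
  then have kp: "kp + n * \<rho>p \<le> kd + n * \<rho>d" using p by simp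
  have P: "kb {0<..} (\<beta> * ?e + e) (\<beta> * k + k' - \<gamma>) (\<beta> * \<rho> + r) (2 powr (\<beta> * \<rho> + r) * (M powr \<beta> * A)) (potential \<gamma> \<beta> q w)"
    if w: "kb {0<..} e k' r A w" and wm: "jm w" for e k' r A and w :: "real \<Rightarrow> 'a \<Rightarrow> ennreal"
  proof -
    note [measurable] = jr_section[OF qm] jm_section[OF wm]
    have "kb {0<..} (\<beta> * ?e + e) (\<beta> * k + k') (\<beta> * \<rho> + r) (2 powr (\<beta> * \<rho> + r) * (M powr \<beta> * A)) (\<lambda>t x. ennreal (q t x powr \<beta>) * w t x)"
      using \<beta> q0 by (intro kb_mult kb_powr q w) auto
    then show ?thesis unfolding potential_def[abs_def] by (rule kb_weight) measurable
  qed
  have scal: "(\<beta> * k + k' - \<gamma> + n * (\<beta> * \<rho> + r) - kt - n * \<rho>t) / 2 + (\<beta> * ?e + (ew n \<sigma>d k' r + \<delta>)) - 1 = ew n \<sigma>d kt \<rho>t + \<delta>" for k' r \<delta>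
    using \<sigma>1 by (simp add: ew_def field_simps)
  have "\<exists>C. kb {0<..} (ew n \<sigma>d kt \<rho>t + \<delta>) kt \<rho>t C (duh (potential \<gamma> \<beta> q w))"
    if \<delta>: "0 \<le> \<delta>" "\<delta> \<le> \<delta>0" and wm: "jm w" and w1: "kb {0<..} (ew n \<sigma>d kd \<rho>d + \<delta>) kd \<rho>d A w"
      and w2: "kb {0<..} (ew n \<sigma>d kp \<rho>p + \<delta>) kp \<rho>p B w" for \<delta> A B and w :: "real \<Rightarrow> 'a \<Rightarrow> ennreal"
  proof (rule duh_kb[OF n p(5,6) _ g'(2) _ _ _ _ _ _ _ _ scal scal measurable_potential[OF qm wm] P[OF w1 wm] P[OF w2 wm]])
    show "\<rho>t \<le> \<beta> * \<rho> + \<rho>d" "\<rho>t \<le> \<beta> * \<rho> + \<rho>p" "\<beta> * \<rho> + \<rho>p < 1" using \<beta>\<rho> p g'(2) by simp_all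
    show "kt \<le> \<beta> * k + kd - \<gamma>" "kt \<le> \<beta> * k + kp - \<gamma>" using k\<gamma> p by simp_all
    show "\<beta> * k + kd - \<gamma> + n * (\<beta> * \<rho> + \<rho>d) < n" using g'(3) by (simp add: algebra_simps)
    then show "\<beta> * k + kp - \<gamma> + n * (\<beta> * \<rho> + \<rho>p) < n" using kp by (simp add: algebra_simps)
    show "\<beta> * ?e + (ew n \<sigma>d kd \<rho>d + \<delta>) < 1" using \<delta> b1 by (simp add: \<delta>0_def field_simps)
    show "(\<beta> * k + kp - \<gamma> + n * (\<beta> * \<rho> + \<rho>p) - kt - n * \<rho>t) / 2 < 1" using gap by (simp add: algebra_simps)
  qed
  then show ?thesis using \<delta>0 by blast
qed

text \<open>As \<theta> tends to 0 the exponents of the source tend to those of the potential term,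
  so strict conditions persist, while replacing q by X in the power \<theta> gains the rate
  (\<sigma>X - \<sigma>1) / 2 * \<theta>. The non-strict conditions on weight and integrability do
  not survive a perturbation by themselves; they are met by measuring the power L * \<theta> of Z in
  the space (ka, \<rho>a).\<close>

lemma source_step:
  fixes X Z :: "real \<Rightarrow> 'a \<Rightarrow> real"
  assumes g: "good kd \<rho>d \<sigma>d" and p: "kp \<le> kd" "\<rho>p \<le> \<rho>d" "kt \<le> kp" "\<rho>t \<le> \<rho>p" "0 \<le> \<rho>t" "0 \<le> kt + n * \<rho>t"
    and gap: "kp + n * \<rho>p - (kt + n * \<rho>t) < 2 - (\<beta> * (k + n * \<rho>) - \<gamma>)"
    and qm: "jr q" and q0: "\<And>t x. 0 \<le> q t x" and q: "kw n \<sigma>1 k \<rho> M (enn q)"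
    and Xm: "jr X" and X0: "\<And>t x. 0 \<le> X t x" and X: "kw n \<sigma>X kX \<rho>X MX (enn X)"
    and \<sigma>X: "\<sigma>1 < \<sigma>X"
    and Zm: "jr Z" and Z0: "\<And>t x. 0 \<le> Z t x" and Zd: "kw n \<sigma>d kd \<rho>d MZ (enn Z)"
    and Zp: "kw n \<sigma>d kp \<rho>p MP (enn Z)"
    and Za: "kw n \<sigma>d ka \<rho>a MA (enn Z)"
    and L: "0 \<le> L" "0 \<le> kX - k + L * (ka - kd)"
    and \<rho>c: "0 < \<rho> \<or> L * \<rho>d \<le> \<rho>X + L * \<rho>a"
  shows "\<forall>\<^sub>F \<delta> in at_right 0. \<exists>C. kb {0<..} (ew n \<sigma>d kt \<rho>t + \<delta>) kt \<rho>t C (duh (source \<gamma> \<beta> q X Z (2 / (\<sigma>X - \<sigma>1) * \<delta>)))"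
proof -
  have g': "0 \<le> \<rho>d" "\<beta> * \<rho> + \<rho>d < 1" "\<beta> * (k + n * \<rho>) - \<gamma> + kd + n * \<rho>d < n"
     "0 \<le> kd + n * \<rho>d" "\<gamma> + \<sigma>d < \<beta> * (k + n * \<rho>) + kd + n * \<rho>d"
    using g by (auto simp: good_def)
  let ?e = "ew n \<sigma>1 k \<rho>"
  have b1: "\<beta> * ?e + ew n \<sigma>d kd \<rho>d < 1" using g'(5) \<sigma>1 by (simp add: ew_def field_simps)
  have "n * \<rho>p \<le> n * \<rho>d" using n0 p by (intro mult_left_mono) auto
  then have kp: "kp + n * \<rho>p \<le> kd + n * \<rho>d" using p by simp
  \<comment> \<open>Weight (already reduced by \<gamma>), integrability and decay exponents of the
    product of the powers \<beta> - \<theta> of q, \<theta> of X, and 1 - L * \<theta> and L *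
    \<theta> of Z, the last two taken in different spaces.\<close>
  define ks where "ks \<theta> k' = (\<beta> - \<theta>) * k + (\<theta> * kX + ((1 - L * \<theta>) * k' + L * \<theta> * ka)) - \<gamma>" for \<theta> k'
  define rs where "rs \<theta> r = (\<beta> - \<theta>) * \<rho> + (\<theta> * \<rho>X + ((1 - L * \<theta>) * r + L * \<theta> * \<rho>a))" for \<theta> r
  define bs where "bs \<theta> e = (\<beta> - \<theta>) * ?e + (\<theta> * ew n \<sigma>X kX \<rho>X + ((1 - L * \<theta>) * e + L * \<theta> * ew n \<sigma>d ka \<rho>a))" for \<theta> e
  have S: "\<exists>C. kb {0<..} (bs \<theta> (ew n \<sigma>d k' r)) (ks \<theta> k') (rs \<theta> r) C (source \<gamma> \<beta> q X Z \<theta>)"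
    if Z: "kw n \<sigma>d k' r MZ' (enn Z)" and \<theta>: "0 < \<theta>" "\<theta> < \<beta>" "L * \<theta> \<le> 1" for k' r MZ' \<theta>
  proof -
    note [measurable] = jr_section[OF qm] jr_section[OF Xm] jr_section[OF Zm]
    have L\<theta>: "0 \<le> L * \<theta>" using L \<theta> by simp
    have Zeq: "ennreal (Z t x powr (1 - L * \<theta>)) * ennreal (Z t x powr (L * \<theta>)) = ennreal (Z t x)" for t x
      using Z0 by (simp add: ennreal_mult[symmetric] powr_add[symmetric])
    obtain C where "kb {0<..} (bs \<theta> (ew n \<sigma>d k' r)) ((\<beta> - \<theta>) * k + (\<theta> * kX + ((1 - L * \<theta>) * k' + L * \<theta> * ka))) (rs \<theta> r) C
      (\<lambda>t x. ennreal (q t x powr (\<beta> - \<theta>)) * (ennreal (X t x powr \<theta>) * (ennreal (Z t x powr (1 - L * \<theta>)) * ennreal (Z t x powr (L * \<theta>)))))"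
      unfolding bs_def rs_def
      using kb_mult[OF kb_powr[OF q q0, of "\<beta> - \<theta>"] kb_mult[OF kb_powr[OF X X0, of \<theta>] kb_mult[OF kb_powr[OF Z Z0, of "1 - L * \<theta>"] kb_powr[OF Za Z0 L\<theta>]]]] \<theta>
      by auto
    then have "kb {0<..} (bs \<theta> (ew n \<sigma>d k' r)) (ks \<theta> k') (rs \<theta> r) C (source \<gamma> \<beta> q X Z \<theta>)"
      unfolding Zeq source_def[abs_def] ks_def by (rule kb_weight) measurable
    then show ?thesis by blast
  qed
  have scal: "(ks \<theta> k' + n * rs \<theta> r - kt - n * \<rho>t) / 2 + bs \<theta> (ew n \<sigma>d k' r) - 1 = ew n \<sigma>d kt \<rho>t + (\<sigma>X - \<sigma>1) / 2 * \<theta>" for k' r \<theta>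
    using \<sigma>1 by (simp add: ks_def rs_def bs_def ew_def field_simps)
  have tk: "((\<lambda>\<theta>. ks \<theta> k') \<longlongrightarrow> \<beta> * k + k' - \<gamma>) (at_right 0)" for k'
    unfolding ks_def by (auto intro!: tendsto_eq_intros)
  have tr: "((\<lambda>\<theta>. rs \<theta> r) \<longlongrightarrow> \<beta> * \<rho> + r) (at_right 0)" for r
    unfolding rs_def by (auto intro!: tendsto_eq_intros)
  have tb: "((\<lambda>\<theta>. bs \<theta> e) \<longlongrightarrow> \<beta> * ?e + e) (at_right 0)" for e
    unfolding bs_def by (auto intro!: tendsto_eq_intros)
  have tkr: "((\<lambda>\<theta>. ks \<theta> k' + n * rs \<theta> r) \<longlongrightarrow> \<beta> * k + k' - \<gamma> + n * (\<beta> * \<rho> + r)) (at_right 0)" for k' r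
    by (intro tendsto_intros tk tr)
  \<comment> \<open>No limit argument is available: at \<theta> = 0 this may be an equality. The
    expression is affine in \<theta>, and the hypothesis on L makes its slope nonnegative.\<close>
  have kse: "kt \<le> ks \<theta> k'" if "0 \<le> \<theta>" "kt \<le> k'" "k' \<le> kd" for \<theta> k'
  proof -
    have "L * (ka - kd) \<le> L * (ka - k')" using L that by (intro mult_left_mono) auto
    then have "0 \<le> \<theta> * (kX - k + L * (ka - k'))" using L that by (intro mult_nonneg_nonneg) auto
    moreover have "ks \<theta> k' = (\<beta> * k - \<gamma>) + k' + \<theta> * (kX - k + L * (ka - k'))"
      by (simp add: ks_def algebra_simps)
    ultimately show ?thesis using k\<gamma> that by simp
  qed
  \<comment> \<open>For \<rho> > 0 there is the strict margin \<open>\<beta> * \<rho>\<close>. For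
    \<rho> = 0 the slope in \<theta> is nonnegative by the second alternative of
    \<open>\<rho>c\<close>.\<close>
  have rse: "\<forall>\<^sub>F \<theta> in at_right 0. \<rho>t \<le> rs \<theta> r" if r: "\<rho>t \<le> r" "r \<le> \<rho>d" for r
  proof (cases "\<rho> > 0")
    case True
    then have "\<rho>t < \<beta> * \<rho> + r" using \<beta> r by (simp add: add_pos_nonneg add_strict_increasing)
    from order_tendstoD(1)[OF tr this] show ?thesis by eventually_elim simp
  next
    case False
    then have \<rho>: "\<rho> = 0" using \<rho>0 by simp
    have "L * r \<le> L * \<rho>d" using L r by (intro mult_left_mono) auto
    then have 1: "0 \<le> \<rho>X + L * (\<rho>a - r)" using \<rho>c \<rho> by (simp add: algebra_simps)
    have "\<forall>\<^sub>F \<theta> in at_right (0::real). 0 < \<theta>" by (rule eventually_at_right_less)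
    then show ?thesis
    proof eventually_elim
      case (elim \<theta>)
      have "rs \<theta> r = r + \<theta> * (\<rho>X + L * (\<rho>a - r))" by (simp add: rs_def \<rho> algebra_simps)
      moreover have "0 \<le> \<theta> * (\<rho>X + L * (\<rho>a - r))" using 1 elim by simp
      ultimately show ?case using r by simp
    qed
  qed
  have u1: "\<beta> * k + kd - \<gamma> + n * (\<beta> * \<rho> + \<rho>d) < n" using g'(3) by (simp add: algebra_simps)
  then have u2: "\<beta> * k + kp - \<gamma> + n * (\<beta> * \<rho> + \<rho>p) < n" using kp by (simp add: algebra_simps)
  have u3: "\<beta> * k + kp - \<gamma> + n * (\<beta> * \<rho> + \<rho>p) < 2 + kt + n * \<rho>t" using gap by (simp add: algebra_simps)
  have u4: "\<beta> * \<rho> + \<rho>p < 1" using g' p by simp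
  have l0: "\<forall>\<^sub>F \<theta> in at_right (0::real). L * \<theta> < 1"
  proof -
    have "((\<lambda>\<theta>. L * \<theta>) \<longlongrightarrow> 0) (at_right 0)" by (auto intro!: tendsto_eq_intros)
    from order_tendstoD(2)[OF this, of 1] show ?thesis by simp
  qed
  have "\<forall>\<^sub>F \<theta> in at_right 0. \<theta> < \<beta>" using \<beta> by (auto simp: eventually_at_right[of 0 1])
  with eventually_at_right_less[of 0] l0 rse[OF order_trans[OF p(4,2)] order_refl] rse[OF p(4,2)]
    order_tendstoD(2)[OF tr g'(2)] order_tendstoD(2)[OF tr u4] order_tendstoD(2)[OF tkr u1] order_tendstoD(2)[OF tkr u2]
    order_tendstoD(2)[OF tkr u3] order_tendstoD(2)[OF tb b1]
  have "\<forall>\<^sub>F \<theta> in at_right 0. \<exists>C. kb {0<..} (ew n \<sigma>d kt \<rho>t + (\<sigma>X - \<sigma>1) / 2 * \<theta>) kt \<rho>t C (duh (source \<gamma> \<beta> q X Z \<theta>))"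
  proof eventually_elim
    case (elim \<theta>)
    then have th: "0 < \<theta>" "\<theta> < \<beta>" "L * \<theta> \<le> 1" by simp_all
    obtain C1 where C1: "kb {0<..} (bs \<theta> (ew n \<sigma>d kd \<rho>d)) (ks \<theta> kd) (rs \<theta> \<rho>d) C1 (source \<gamma> \<beta> q X Z \<theta>)"
      using S[OF Zd th] by blast
    obtain C2 where C2: "kb {0<..} (bs \<theta> (ew n \<sigma>d kp \<rho>p)) (ks \<theta> kp) (rs \<theta> \<rho>p) C2 (source \<gamma> \<beta> q X Z \<theta>)"
      using S[OF Zp th] by blast
    show ?case
      using elim p kse[of \<theta> kd] kse[of \<theta> kp]
      by (intro duh_kb[OF n p(5,6) _ _ _ _ _ _ _ _ _ _ scal scal measurable_source[OF qm Xm Zm] C1 C2]) auto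
  qed
  \<comment> \<open>Reparametrisation by \<theta> = 2 / (\<sigma>X - \<sigma>1) * \<delta>, which
    makes the gain exactly \<delta>.\<close>
  moreover have "filterlim (\<lambda>\<delta>. 2 / (\<sigma>X - \<sigma>1) * \<delta>) (at_right 0) (at_right (0::real))"
  proof (rule filterlim_at_withinI)
    show "((\<lambda>\<delta>. 2 / (\<sigma>X - \<sigma>1) * \<delta>) \<longlongrightarrow> 0) (at_right 0)" using \<sigma>X by (auto intro!: tendsto_eq_intros)
    have "0 < 2 / (\<sigma>X - \<sigma>1)" using \<sigma>X by simp
    then have "2 / (\<sigma>X - \<sigma>1) * \<delta> \<in> {0<..} - {0}" if "0 < \<delta>" for \<delta>
      using that mult_pos_pos by fastforce
    with eventually_at_right_less[of 0] show "\<forall>\<^sub>F \<delta> in at_right 0. 2 / (\<sigma>X - \<sigma>1) * \<delta> \<in> {0<..} - {0}"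
      by (rule eventually_mono)
  qed
  ultimately have "\<forall>\<^sub>F \<delta> in at_right 0. \<exists>C. kb {0<..} (ew n \<sigma>d kt \<rho>t + (\<sigma>X - \<sigma>1) / 2 * (2 / (\<sigma>X - \<sigma>1) * \<delta>)) kt \<rho>t C (duh (source \<gamma> \<beta> q X Z (2 / (\<sigma>X - \<sigma>1) * \<delta>)))"
    by (rule eventually_compose_filterlim)
  moreover have "(\<sigma>X - \<sigma>1) / 2 * (2 / (\<sigma>X - \<sigma>1) * \<delta>) = \<delta>" for \<delta>
  proof -
    have "\<sigma>X - \<sigma>1 \<noteq> 0" using \<sigma>X by linarith
    then show ?thesis by (simp del: right_minus_eq)
  qed
  ultimately show ?thesis by (simp only:)
qed

text \<open>X decays faster than the scaling rate, in a space (kX, \<rho>X) whose weight may be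
  smaller than k. The number L measures how much of Z in the space (ka, \<rho>a) makes up for the
  deficit.\<close>

definition src_ok :: "real \<Rightarrow> real \<Rightarrow> real \<Rightarrow> (real \<Rightarrow> 'a \<Rightarrow> real) \<Rightarrow> (real \<Rightarrow> 'a \<Rightarrow> real) \<Rightarrow> bool" where
  "src_ok kd \<rho>d \<sigma>d X Z \<longleftrightarrow> jr X \<and> jr Z \<and> (\<forall>t x. 0 \<le> X t x) \<and> (\<forall>t x. 0 \<le> Z t x) \<and>
     (\<exists>M. kw n \<sigma>d kd \<rho>d M (enn Z)) \<and>
     (\<exists>\<sigma>X kX \<rho>X MX ka \<rho>a MA L. kw n \<sigma>X kX \<rho>X MX (enn X) \<and> \<sigma>1 < \<sigma>X \<and>
       kw n \<sigma>d ka \<rho>a MA (enn Z) \<and> 0 \<le> L \<and> 0 \<le> kX - k + L * (ka - kd) \<and>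
       (0 < \<rho> \<or> L * \<rho>d \<le> \<rho>X + L * \<rho>a))"

lemma src_ok_step:
  assumes g: "good kd \<rho>d \<sigma>d" and p: "kp \<le> kd" "\<rho>p \<le> \<rho>d" "kt \<le> kp" "\<rho>t \<le> \<rho>p" "0 \<le> \<rho>t" "0 \<le> kt + n * \<rho>t"
    and gap: "kp + n * \<rho>p - (kt + n * \<rho>t) < 2 - (\<beta> * (k + n * \<rho>) - \<gamma>)"
    and qm: "jr q" and q0: "\<And>t x. 0 \<le> q t x" and q: "kw n \<sigma>1 k \<rho> M (enn q)"
    and X: "src_ok kd \<rho>d \<sigma>d X Z"
    and Zp: "kw n \<sigma>d kp \<rho>p MP (enn Z)"
  shows "\<exists>\<kappa>>0. \<forall>\<^sub>F \<delta> in at_right 0. \<exists>C. kb {0<..} (ew n \<sigma>d kt \<rho>t + \<delta>) kt \<rho>t C (duh (source \<gamma> \<beta> q X Z (\<kappa> * \<delta>)))"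
proof -
  obtain \<sigma>X kX \<rho>X MX ka \<rho>a MA L MZ where 1: "kw n \<sigma>X kX \<rho>X MX (enn X)" "\<sigma>1 < \<sigma>X"
     "kw n \<sigma>d ka \<rho>a MA (enn Z)" "0 \<le> L" "0 \<le> kX - k + L * (ka - kd)"
     "0 < \<rho> \<or> L * \<rho>d \<le> \<rho>X + L * \<rho>a" "kw n \<sigma>d kd \<rho>d MZ (enn Z)"
    using X unfolding src_ok_def by blast
  have 2: "jr X" "jr Z" "\<And>t x. 0 \<le> X t x" "\<And>t x. 0 \<le> Z t x" using X by (simp_all add: src_ok_def)
  from source_step[OF g p gap qm q0 q 2(1,3) 1(1,2) 2(2,4) 1(7) Zp 1(3-6)] 1(2)
  show ?thesis by (intro exI[of _ "2 / (\<sigma>X - \<sigma>1)"]) simp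
qed

text \<open>The two powers are independent, because sources whose factors X1 and X2 decay
  differently need different multiples of \<delta> to produce the same gain \<delta>.\<close>

definition diff_ineq :: "real \<Rightarrow> (real \<Rightarrow> 'a \<Rightarrow> real) \<Rightarrow> (real \<Rightarrow> 'a \<Rightarrow> ennreal) \<Rightarrow> (real \<Rightarrow> 'a \<Rightarrow> ennreal) \<Rightarrow>
    (real \<Rightarrow> 'a \<Rightarrow> real) \<Rightarrow> (real \<Rightarrow> 'a \<Rightarrow> real) \<Rightarrow> (real \<Rightarrow> 'a \<Rightarrow> real) \<Rightarrow> bool" where
  "diff_ineq c q D H X1 X2 Z \<longleftrightarrow> (\<exists>\<theta>0>0. \<forall>\<theta>1 \<theta>2. 0 < \<theta>1 \<longrightarrow> \<theta>1 < \<theta>0 \<longrightarrow> 0 < \<theta>2 \<longrightarrow> \<theta>2 < \<theta>0 \<longrightarrow>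
     (\<forall>t>0. AE x in lborel. D t x \<le> H t x + duh (potential \<gamma> \<beta> q D) t x
        + (ennreal c * duh (source \<gamma> \<beta> q X1 Z \<theta>1) t x + ennreal c * duh (source \<gamma> \<beta> q X2 Z \<theta>2) t x)))"

lemma diff_ineqD:
  assumes "diff_ineq c q D H X1 X2 Z" "\<kappa>1 > 0" "\<kappa>2 > 0"
  shows "\<forall>\<^sub>F \<delta> in at_right 0. \<forall>t>0. AE x in lborel. D t x \<le> H t x + duh (potential \<gamma> \<beta> q D) t x
        + (ennreal c * duh (source \<gamma> \<beta> q X1 Z (\<kappa>1 * \<delta>)) t x + ennreal c * duh (source \<gamma> \<beta> q X2 Z (\<kappa>2 * \<delta>)) t x)"
proof -
  obtain \<theta>0 where \<theta>0: "\<theta>0 > 0" "\<And>\<theta>1 \<theta>2 t. 0 < \<theta>1 \<Longrightarrow> \<theta>1 < \<theta>0 \<Longrightarrow> 0 < \<theta>2 \<Longrightarrow> \<theta>2 < \<theta>0 \<Longrightarrow> t > 0 \<Longrightarrow>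
     AE x in lborel. D t x \<le> H t x + duh (potential \<gamma> \<beta> q D) t x
        + (ennreal c * duh (source \<gamma> \<beta> q X1 Z \<theta>1) t x + ennreal c * duh (source \<gamma> \<beta> q X2 Z \<theta>2) t x)"
    using assms(1) unfolding diff_ineq_def by blast
  have t: "((\<lambda>\<delta>. \<kappa> * \<delta>) \<longlongrightarrow> 0) (at_right (0::real))" for \<kappa> by (auto intro!: tendsto_eq_intros)
  from eventually_at_right_less[of 0] order_tendstoD(2)[OF t[of \<kappa>1] \<theta>0(1)] order_tendstoD(2)[OF t[of \<kappa>2] \<theta>0(1)]
  show ?thesis
    by eventually_elim (use assms \<theta>0(2) in simp)
qed

lemma kb_sum3:
  assumes "kb J e k' r A f" "kb J e k' r B g" "kb J e k' r C h" "0 \<le> c"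
  shows "\<exists>K\<ge>0. kb J e k' r K (\<lambda>t x. f t x + (ennreal c * g t x + ennreal c * h t x))"
proof -
  let ?K = "2 powr r * (A + 2 powr r * (c * B + c * C))"
  have "kb J e k' r ?K (\<lambda>t x. f t x + (ennreal c * g t x + ennreal c * h t x))"
    by (intro kb_add kb_cmult assms)
  then have "kb J e k' r (max 0 ?K) (\<lambda>t x. f t x + (ennreal c * g t x + ennreal c * h t x))"
    by (rule kb_weaken) simp
  then show ?thesis by (intro exI[of _ "max 0 ?K"]) simp
qed

text \<open>Absorption is applied at the rate improved by \<delta> on (0, T), where D has a bound
  that grows with T. The constant obtained is free of T, so it holds for all times. The threshold M0
  is fixed before \<delta> becomes small.\<close>

lemma decay_base:
  assumes g: "good kd \<rho>d \<sigma>d"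
  shows "\<exists>M0>0. \<forall>q D H X1 X2 Z B c. jr q \<longrightarrow> (\<forall>t x. 0 \<le> q t x) \<longrightarrow> 0 \<le> c \<longrightarrow> jm D \<longrightarrow>
     kw n \<sigma>1 k \<rho> M0 (enn q) \<longrightarrow> kw n \<sigma>d kd \<rho>d B D \<longrightarrow>
     dec n \<sigma>d kd \<rho>d H \<longrightarrow> src_ok kd \<rho>d \<sigma>d X1 Z \<longrightarrow> src_ok kd \<rho>d \<sigma>d X2 Z \<longrightarrow> diff_ineq c q D H X1 X2 Z \<longrightarrow>
     dec n \<sigma>d kd \<rho>d D"
proof -
  let ?ed = "ew n \<sigma>d kd \<rho>d"
  obtain M0 \<delta>0 where M0: "M0 > 0" "\<delta>0 > 0" "\<And>J A B \<delta> q (D :: real \<Rightarrow> 'a \<Rightarrow> ennreal) R. time_set J \<Longrightarrow> 0 \<le> A \<Longrightarrow> 0 \<le> \<delta> \<Longrightarrow> \<delta> \<le> \<delta>0 \<Longrightarrow>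
     jr q \<Longrightarrow> jm D \<Longrightarrow> (\<forall>t x. 0 \<le> q t x) \<Longrightarrow> kb J (ew n \<sigma>1 k \<rho>) k \<rho> M0 (enn q) \<Longrightarrow>
     kb J (?ed + \<delta>) kd \<rho>d A R \<Longrightarrow> kb J (?ed + \<delta>) kd \<rho>d B D \<Longrightarrow>
     (\<forall>t\<in>J. AE x in lborel. D t x \<le> R t x + duh (potential \<gamma> \<beta> q D) t x) \<Longrightarrow>
     kb J (?ed + \<delta>) kd \<rho>d (2 * 2 powr \<rho>d * A) D"
    using absorption[OF g] by blast
  have gap: "kd + n * \<rho>d - (kd + n * \<rho>d) < 2 - (\<beta> * (k + n * \<rho>) - \<gamma>)" using sub by simp
  have p: "0 \<le> \<rho>d" "0 \<le> kd + n * \<rho>d" using g by (simp_all add: good_def)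
  have "decaying ?ed kd \<rho>d D"
    if qm: "jr q" and q0: "\<forall>t x. 0 \<le> q t x" and c: "0 \<le> c" and Dm: "jm D" and q: "kw n \<sigma>1 k \<rho> M0 (enn q)"
      and D: "kb {0<..} ?ed kd \<rho>d B D" and H: "decaying ?ed kd \<rho>d H"
      and X1: "src_ok kd \<rho>d \<sigma>d X1 Z" and X2: "src_ok kd \<rho>d \<sigma>d X2 Z" and ineq: "diff_ineq c q D H X1 X2 Z" for q D H X1 X2 Z B c
  proof -
    obtain MZ where Z: "kb {0<..} ?ed kd \<rho>d MZ (enn Z)" using X1 unfolding src_ok_def by blast
    note st = src_ok_step[OF g order_refl order_refl order_refl order_refl p gap qm q0[rule_format] q _ Z]
    obtain \<kappa>1 where \<kappa>1: "\<kappa>1 > 0" "\<forall>\<^sub>F \<delta> in at_right 0. \<exists>C. kb {0<..} (?ed + \<delta>) kd \<rho>d C (duh (source \<gamma> \<beta> q X1 Z (\<kappa>1 * \<delta>)))"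
      using st[OF X1] by blast
    obtain \<kappa>2 where \<kappa>2: "\<kappa>2 > 0" "\<forall>\<^sub>F \<delta> in at_right 0. \<exists>C. kb {0<..} (?ed + \<delta>) kd \<rho>d C (duh (source \<gamma> \<beta> q X2 Z (\<kappa>2 * \<delta>)))"
      using st[OF X2] by blast
    have "\<forall>\<^sub>F \<delta> in at_right 0. \<delta> < \<delta>0" using M0(2) by (auto simp: eventually_at_right[of 0 1])
    with \<kappa>1(2) \<kappa>2(2) H[unfolded decaying_def] diff_ineqD[OF ineq \<kappa>1(1) \<kappa>2(1)] eventually_at_right_less[of 0]
    show ?thesis unfolding decaying_def
    proof eventually_elim
      case (elim \<delta>)
      let ?s1 = "duh (source \<gamma> \<beta> q X1 Z (\<kappa>1 * \<delta>))" and ?s2 = "duh (source \<gamma> \<beta> q X2 Z (\<kappa>2 * \<delta>))"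
      obtain C1 C2 C3 where "kb {0<..} (?ed + \<delta>) kd \<rho>d C3 H" "kb {0<..} (?ed + \<delta>) kd \<rho>d C1 ?s1" "kb {0<..} (?ed + \<delta>) kd \<rho>d C2 ?s2"
        using elim by blast
      from kb_sum3[OF this c] obtain K where K: "K \<ge> 0" "kb {0<..} (?ed + \<delta>) kd \<rho>d K (\<lambda>t x. H t x + (ennreal c * ?s1 t x + ennreal c * ?s2 t x))"
        by blast
      have "kb {0<..<T} (?ed + \<delta>) kd \<rho>d (2 * 2 powr \<rho>d * K) D" for T
      proof (rule M0(3)[OF time_set_interval K(1) _ _ qm Dm q0])
        show "0 \<le> \<delta>" "\<delta> \<le> \<delta>0" using elim by simp_all
        show "kb {0<..<T} (ew n \<sigma>1 k \<rho>) k \<rho> M0 (enn q)" by (rule kb_subset[OF q]) auto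
        show "kb {0<..<T} (?ed + \<delta>) kd \<rho>d K (\<lambda>t x. H t x + (ennreal c * ?s1 t x + ennreal c * ?s2 t x))"
          by (rule kb_subset[OF K(2)]) auto
        show "kb {0<..<T} (?ed + \<delta>) kd \<rho>d (B * T powr \<delta>) D" using elim by (intro kb_gain_bounded D) simp
        show "\<forall>t\<in>{0<..<T}. AE x in lborel. D t x \<le> H t x + (ennreal c * ?s1 t x + ennreal c * ?s2 t x) + duh (potential \<gamma> \<beta> q D) t x"
        proof
          fix t assume "t \<in> {0<..<T}"
          then have "t > 0" by simp
          then have "AE x in lborel. D t x \<le> H t x + duh (potential \<gamma> \<beta> q D) t x + (ennreal c * ?s1 t x + ennreal c * ?s2 t x)"
            using elim by blast
          then show "AE x in lborel. D t x \<le> H t x + (ennreal c * ?s1 t x + ennreal c * ?s2 t x) + duh (potential \<gamma> \<beta> q D) t x"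
            by eventually_elim (simp only: add_ac)
        qed
      qed
      then have "kb {0<..} (?ed + \<delta>) kd \<rho>d (2 * 2 powr \<rho>d * K) D"
        unfolding kb_def using greaterThanLessThan_iff gt_ex by (metis greaterThan_iff)
      then show ?case by blast
    qed
  qed
  then show ?thesis using M0(1) by blast
qed

text \<open>Nothing is absorbed, so M may be any bound: each step inserts the bounds at (kd,
  \<rho>d) and at the pair just reached into one Duhamel integral, which is then controlled at a
  slightly lower pair.\<close>

lemma bounded_chain:
  fixes w f :: "real \<Rightarrow> 'a \<Rightarrow> ennreal"
  assumes g: "good kd \<rho>d \<sigma>d" and qm: "jr q" and q0: "\<And>t x. 0 \<le> q t x"
    and q: "kw n \<sigma>1 k \<rho> M (enn q)"
    and wm: "jm w" and w: "kw n \<sigma>d kd \<rho>d B w"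
    and f: "\<And>k' \<rho>'. k' \<le> kd \<Longrightarrow> \<rho>' \<le> \<rho>d \<Longrightarrow> 0 \<le> \<rho>' \<Longrightarrow> 0 \<le> k' + n * \<rho>' \<Longrightarrow> \<exists>C. kw n \<sigma>d k' \<rho>' C f"
    and le: "\<And>t. t > 0 \<Longrightarrow> AE x in lborel. w t x \<le> f t x + duh (potential \<gamma> \<beta> q w) t x"
    and t: "k' \<le> kd" "\<rho>' \<le> \<rho>d" "0 \<le> \<rho>'" "0 \<le> k' + n * \<rho>'"
  shows "\<exists>C. kw n \<sigma>d k' \<rho>' C w"
proof -
  have s0: "2 - (\<beta> * (k + n * \<rho>) - \<gamma>) > 0" using sub by simp
  have b: "\<exists>C. kw n \<sigma>d kd \<rho>d C w" using w by blast
  show ?thesis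
  proof (rule chain_induct[where Pr="\<lambda>k' \<rho>'. \<exists>C. kw n \<sigma>d k' \<rho>' C w", OF n0 s0 b _ t])
    fix kp \<rho>p kt \<rho>t
    assume p: "kt \<le> kp" "kp \<le> kd" "\<rho>t \<le> \<rho>p" "\<rho>p \<le> \<rho>d" "0 \<le> \<rho>t" "0 \<le> kt + n * \<rho>t"
      and gap: "kp + n * \<rho>p - (kt + n * \<rho>t) < 2 - (\<beta> * (k + n * \<rho>) - \<gamma>)"
      and "\<exists>C. kw n \<sigma>d kp \<rho>p C w"
    then obtain C where C: "kw n \<sigma>d kp \<rho>p C w" by blast
    obtain \<delta>0 where \<delta>0: "\<delta>0 > 0" "\<And>\<delta> A B (w :: real \<Rightarrow> 'a \<Rightarrow> ennreal). 0 \<le> \<delta> \<Longrightarrow> \<delta> \<le> \<delta>0 \<Longrightarrow> jm w \<Longrightarrow>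
     kb {0<..} (ew n \<sigma>d kd \<rho>d + \<delta>) kd \<rho>d A w \<Longrightarrow> kb {0<..} (ew n \<sigma>d kp \<rho>p + \<delta>) kp \<rho>p B w \<Longrightarrow>
     (\<exists>C. kb {0<..} (ew n \<sigma>d kt \<rho>t + \<delta>) kt \<rho>t C (duh (potential \<gamma> \<beta> q w)))"
      using potential_step[OF g p(2,4,1,3,5,6) gap qm q0 q] by blast
    have w': "kb {0<..} (ew n \<sigma>d kd \<rho>d + 0) kd \<rho>d B w" "kb {0<..} (ew n \<sigma>d kp \<rho>p + 0) kp \<rho>p C w" using w C by simp_all
    obtain C1 where C1: "kb {0<..} (ew n \<sigma>d kt \<rho>t + 0) kt \<rho>t C1 (duh (potential \<gamma> \<beta> q w))"
      using \<delta>0(2)[OF order_refl less_imp_le[OF \<delta>0(1)] wm w'] by blast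
    obtain C2 where C2: "kw n \<sigma>d kt \<rho>t C2 f" using f[of kt \<rho>t] p by auto
    have S: "kw n \<sigma>d kt \<rho>t (2 powr \<rho>t * (C2 + C1)) (\<lambda>t x. f t x + duh (potential \<gamma> \<beta> q w) t x)"
      using C1 by (intro kb_add C2) simp
    have "kw n \<sigma>d kt \<rho>t (2 powr \<rho>t * (C2 + C1)) w"
      by (rule kb_mono_AE[OF S jm_section[OF wm]]) (use le in simp)
    then show "\<exists>C. kw n \<sigma>d kt \<rho>t C w" by blast
  qed
qed

text \<open>The same ladder at the improved rate. Potential and source terms are evaluated at a
  slightly lower pair for all small \<delta> at once, with the multiples of \<delta> in the two
  sources chosen afresh in each step.\<close>

lemma decay_chain:
  assumes g: "good kd \<rho>d \<sigma>d" and qm: "jr q" and q0: "\<And>t x. 0 \<le> q t x" and c: "0 \<le> c"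
    and q: "kw n \<sigma>1 k \<rho> M (enn q)"
    and Dm: "jm D" and D: "dec n \<sigma>d kd \<rho>d D"
    and H: "\<And>k' \<rho>'. k' \<le> kd \<Longrightarrow> \<rho>' \<le> \<rho>d \<Longrightarrow> 0 \<le> \<rho>' \<Longrightarrow> 0 \<le> k' + n * \<rho>' \<Longrightarrow> dec n \<sigma>d k' \<rho>' H"
    and Z: "\<And>k' \<rho>'. k' \<le> kd \<Longrightarrow> \<rho>' \<le> \<rho>d \<Longrightarrow> 0 \<le> \<rho>' \<Longrightarrow> 0 \<le> k' + n * \<rho>' \<Longrightarrow> \<exists>C. kw n \<sigma>d k' \<rho>' C (enn Z)"
    and X1: "src_ok kd \<rho>d \<sigma>d X1 Z" and X2: "src_ok kd \<rho>d \<sigma>d X2 Z" and ineq: "diff_ineq c q D H X1 X2 Z"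
    and t: "k' \<le> kd" "\<rho>' \<le> \<rho>d" "0 \<le> \<rho>'" "0 \<le> k' + n * \<rho>'"
  shows "dec n \<sigma>d k' \<rho>' D"
proof -
  have s0: "2 - (\<beta> * (k + n * \<rho>) - \<gamma>) > 0" using sub by simp
  show ?thesis
  proof (rule chain_induct[where Pr="\<lambda>k' \<rho>'. dec n \<sigma>d k' \<rho>' D", OF n0 s0 D _ t])
    fix kp \<rho>p kt \<rho>t
    assume p: "kt \<le> kp" "kp \<le> kd" "\<rho>t \<le> \<rho>p" "\<rho>p \<le> \<rho>d" "0 \<le> \<rho>t" "0 \<le> kt + n * \<rho>t"
      and gap: "kp + n * \<rho>p - (kt + n * \<rho>t) < 2 - (\<beta> * (k + n * \<rho>) - \<gamma>)"
      and Dp: "dec n \<sigma>d kp \<rho>p D"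
    have "n * \<rho>t \<le> n * \<rho>p" using p n0 by (intro mult_left_mono) auto
    then have "0 \<le> kp + n * \<rho>p" "0 \<le> \<rho>p" using p by auto
    then obtain MP where Zp: "kw n \<sigma>d kp \<rho>p MP (enn Z)" using Z[of kp \<rho>p] p by blast
    obtain \<delta>0 where \<delta>0: "\<delta>0 > 0" "\<And>\<delta> A B (w :: real \<Rightarrow> 'a \<Rightarrow> ennreal). 0 \<le> \<delta> \<Longrightarrow> \<delta> \<le> \<delta>0 \<Longrightarrow> jm w \<Longrightarrow>
     kb {0<..} (ew n \<sigma>d kd \<rho>d + \<delta>) kd \<rho>d A w \<Longrightarrow> kb {0<..} (ew n \<sigma>d kp \<rho>p + \<delta>) kp \<rho>p B w \<Longrightarrow>
     (\<exists>C. kb {0<..} (ew n \<sigma>d kt \<rho>t + \<delta>) kt \<rho>t C (duh (potential \<gamma> \<beta> q w)))"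
      using potential_step[OF g p(2,4,1,3,5,6) gap qm q0 q] by blast
    note st = src_ok_step[OF g p(2,4,1,3,5,6) gap qm q0 q _ Zp]
    obtain \<kappa>1 where \<kappa>1: "\<kappa>1 > 0" "\<forall>\<^sub>F \<delta> in at_right 0. \<exists>C. kb {0<..} (ew n \<sigma>d kt \<rho>t + \<delta>) kt \<rho>t C (duh (source \<gamma> \<beta> q X1 Z (\<kappa>1 * \<delta>)))"
      using st[OF X1] by blast
    obtain \<kappa>2 where \<kappa>2: "\<kappa>2 > 0" "\<forall>\<^sub>F \<delta> in at_right 0. \<exists>C. kb {0<..} (ew n \<sigma>d kt \<rho>t + \<delta>) kt \<rho>t C (duh (source \<gamma> \<beta> q X2 Z (\<kappa>2 * \<delta>)))"
      using st[OF X2] by blast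
    have "kt \<le> kd" "\<rho>t \<le> \<rho>d" using p by auto
    from H[OF this p(5,6)] have Ht: "dec n \<sigma>d kt \<rho>t H" .
    have "\<forall>\<^sub>F \<delta> in at_right 0. \<delta> < \<delta>0" using \<delta>0(1) by (auto simp: eventually_at_right[of 0 1])
    with \<kappa>1(2) \<kappa>2(2) D[unfolded decaying_def] Dp[unfolded decaying_def] Ht[unfolded decaying_def] diff_ineqD[OF ineq \<kappa>1(1) \<kappa>2(1)] eventually_at_right_less[of 0]
    show "dec n \<sigma>d kt \<rho>t D" unfolding decaying_def
    proof eventually_elim
      case (elim \<delta>)
      let ?e = "ew n \<sigma>d kt \<rho>t + \<delta>"
      let ?s1 = "duh (source \<gamma> \<beta> q X1 Z (\<kappa>1 * \<delta>))" and ?s2 = "duh (source \<gamma> \<beta> q X2 Z (\<kappa>2 * \<delta>))"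
      obtain C1 C2 C3 where "kb {0<..} ?e kt \<rho>t C3 H" "kb {0<..} ?e kt \<rho>t C1 ?s1" "kb {0<..} ?e kt \<rho>t C2 ?s2"
        using elim by blast
      from kb_sum3[OF this c] obtain K where K: "kb {0<..} ?e kt \<rho>t K (\<lambda>t x. H t x + (ennreal c * ?s1 t x + ennreal c * ?s2 t x))"
        by blast
      obtain A B where AB: "kb {0<..} (ew n \<sigma>d kd \<rho>d + \<delta>) kd \<rho>d A D" "kb {0<..} (ew n \<sigma>d kp \<rho>p + \<delta>) kp \<rho>p B D"
        using elim by blast
      obtain C4 where C4: "kb {0<..} ?e kt \<rho>t C4 (duh (potential \<gamma> \<beta> q D))"
        using \<delta>0(2)[OF _ _ Dm AB] elim by auto
      have "kb {0<..} ?e kt \<rho>t (2 powr \<rho>t * (K + C4)) D"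
      proof (rule kb_mono_AE[OF kb_add[OF K C4] jm_section[OF Dm]])
        fix t :: real assume "t \<in> {0<..}"
        then have "t > 0" by simp
        then have "AE x in lborel. D t x \<le> H t x + duh (potential \<gamma> \<beta> q D) t x + (ennreal c * ?s1 t x + ennreal c * ?s2 t x)"
          using elim by blast
        then show "AE x in lborel. D t x \<le> H t x + (ennreal c * ?s1 t x + ennreal c * ?s2 t x) + duh (potential \<gamma> \<beta> q D) t x"
          by eventually_elim (simp only: add_ac)
      qed
      then show ?case by blast
    qed
  qed
qed

text \<open>The second half of the evolution smooths, so a rate known at one pair passes to all
  lower pairs. A one-sided inequality is the natural form, since H will be the modulus of a free
  evolution.\<close>

lemma kb_semigroup:
  fixes H :: "real \<Rightarrow> 'a \<Rightarrow> ennreal"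
  assumes d: "\<rho>d < 1" "kd + n * \<rho>d < n" and t: "k' \<le> kd" "\<rho>' \<le> \<rho>d" "0 \<le> \<rho>'" "0 \<le> k' + n * \<rho>'"
    and Hm: "\<And>t. t > 0 \<Longrightarrow> H t \<in> borel_measurable borel"
    and le: "\<And>t. t > 0 \<Longrightarrow> AE x in lborel. H t x \<le> hop (t / 2) (H (t / 2)) x"
    and H: "kb {0<..} (ew n \<sigma>d kd \<rho>d + \<delta>) kd \<rho>d A H"
  shows "\<exists>C. kb {0<..} (ew n \<sigma>d k' \<rho>' + \<delta>) k' \<rho>' C H"
proof -
  obtain C where C: "C > 0" "\<And>A t (F :: 'a \<Rightarrow> ennreal). F \<in> borel_measurable borel \<Longrightarrow> t > 0 \<Longrightarrow>
    wk \<rho>d A (wt kd F) \<Longrightarrow>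
    wk \<rho>' (C * A * t powr (- ((kd + real DIM('a) * \<rho>d - k' - real DIM('a) * \<rho>') / 2))) (wt k' (hop t F))"
    using smoothing[where 'a='a, OF t(3,2) d(1) t(1) d(2)[unfolded n] t(4)[unfolded n]] by blast
  let ?g = "(kd + n * \<rho>d - k' - n * \<rho>') / 2" and ?e = "ew n \<sigma>d kd \<rho>d + \<delta>"
  have "kb {0<..} (ew n \<sigma>d k' \<rho>' + \<delta>) k' \<rho>' (C * A * 2 powr (?e + ?g)) H"
    unfolding kb_def
  proof
    fix t :: real assume "t \<in> {0<..}"
    then have t0: "t > 0" by simp
    note [measurable] = Hm[OF t0] Hm[of "t / 2"]
    have h: "wk \<rho>' (C * (A * (t / 2) powr (- ?e)) * (t / 2) powr (- ?g)) (\<lambda>x. ennreal (norm x powr k') * hop (t / 2) (H (t / 2)) x)"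
      using t0 kbD[OF H, of "t / 2"] C(2)[of "H (t / 2)" "t / 2"] Hm[of "t / 2"] unfolding n[symmetric] by simp
    have eq: "C * (A * (t / 2) powr (- ?e)) * (t / 2) powr (- ?g) = C * A * 2 powr (?e + ?g) * t powr (- (ew n \<sigma>d k' \<rho>' + \<delta>))"
    proof -
      have "(t / 2) powr (- ?e) * (t / 2) powr (- ?g) = (t / 2) powr (- (?e + ?g))" unfolding powr_add[symmetric] by simp
      also have "\<dots> = 2 powr (?e + ?g) * t powr (- (?e + ?g))" using t0 by (simp add: powr_divide powr_minus divide_simps)
      finally have 1: "(t / 2) powr (- ?e) * (t / 2) powr (- ?g) = 2 powr (?e + ?g) * t powr (- (?e + ?g))" .
      have 2: "?e + ?g = ew n \<sigma>d k' \<rho>' + \<delta>" by (simp add: ew_def field_simps)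
      have "C * (A * (t / 2) powr (- ?e)) * (t / 2) powr (- ?g) = C * A * ((t / 2) powr (- ?e) * (t / 2) powr (- ?g))"
        by (simp only: mult_ac)
      also note 1
      also have "C * A * (2 powr (?e + ?g) * t powr (- (?e + ?g))) = C * A * 2 powr (?e + ?g) * t powr (- (ew n \<sigma>d k' \<rho>' + \<delta>))"
        unfolding 2 by (simp only: mult.assoc)
      finally show ?thesis .
    qed
    show "wk \<rho>' (C * A * 2 powr (?e + ?g) * t powr (- (ew n \<sigma>d k' \<rho>' + \<delta>))) (wt k' (H t))"
    proof (rule wk_mono_AE[OF h])
      show "AE x in lborel. ennreal (norm x powr k') * H t x \<le> ennreal (norm x powr k') * hop (t / 2) (H (t / 2)) x"
        using le[OF t0] by eventually_elim (rule mult_left_mono, auto)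
      show "C * (A * (t / 2) powr (- ?e)) * (t / 2) powr (- ?g) \<le> C * A * 2 powr (?e + ?g) * t powr (- (ew n \<sigma>d k' \<rho>' + \<delta>))"
        by (simp only: eq order_refl)
    qed measurable
  qed
  then show ?thesis by blast
qed

end

section \<open>The nonlinearity\<close>

text \<open>By homogeneity only c = y / x matters: 1 - c^\<beta> is at most max(1, \<beta>) (1 - c),
  by the mean value theorem for \<beta> \<ge> 1 and by c \<le> c^\<beta> otherwise, and 1 - c is at
  most its power \<theta>. The power of x may be negative; \<theta> = 1 is used below also for
  \<beta> < 1.\<close>

lemma powr_diff_le:
  fixes x y :: real
  assumes y: "0 \<le> y" "y \<le> x" and \<beta>: "0 < \<beta>" and \<theta>: "0 < \<theta>" "\<theta> \<le> 1"
  shows "x powr \<beta> - y powr \<beta> \<le> max 1 \<beta> * (x powr (\<beta> - \<theta>) * (x - y) powr \<theta>)"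
proof (cases "x = 0")
  case True
  then show ?thesis using y by simp
next
  case False
  then have x: "x > 0" using y by simp
  define c where "c = y / x"
  have c: "0 \<le> c" "c \<le> 1" "y = c * x" using x y by (simp_all add: c_def)
  have 1: "1 - c powr \<beta> \<le> max 1 \<beta> * (1 - c)"
  proof (cases "\<beta> \<ge> 1")
    case True
    consider "c = 0" | "c = 1" | "0 < c" "c < 1" using c by linarith
    then show ?thesis
    proof cases
      case 3
      obtain z where z: "c < z" "z < 1" "1 powr \<beta> - c powr \<beta> = (1 - c) * (\<beta> * z powr (\<beta> - 1))"
        using MVT2[of c 1 "\<lambda>x. x powr \<beta>" "\<lambda>x. \<beta> * x powr (\<beta> - 1)"] 3 has_real_derivative_powr by auto
      have "z powr (\<beta> - 1) \<le> 1" using z 3 True by (intro powr_le1) auto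
      then have "(1 - c) * (\<beta> * z powr (\<beta> - 1)) \<le> (1 - c) * (\<beta> * 1)" using 3 \<beta> by (intro mult_left_mono) auto
      then show ?thesis using z True by (simp add: max_def mult.commute)
    qed (use True in \<open>simp_all add: max_def\<close>)
  next
    case False
    have "c powr 1 \<le> c powr \<beta>" using powr_mono'[of \<beta> 1 c] c False by simp
    then show ?thesis using False c by (simp add: max_def)
  qed
  also have "\<dots> \<le> max 1 \<beta> * (1 - c) powr \<theta>"
  proof (rule mult_left_mono)
    show "1 - c \<le> (1 - c) powr \<theta>"
    proof (cases "c = 1")
      case False
      then have "(1 - c) powr 1 \<le> (1 - c) powr \<theta>" using c \<theta> by (intro powr_mono') auto
      then show ?thesis using c by simp
    qed simp
  qed simp
  finally have "x powr \<beta> * (1 - c powr \<beta>) \<le> x powr \<beta> * (max 1 \<beta> * (1 - c) powr \<theta>)"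
    by (rule mult_left_mono) simp
  moreover have "x powr \<beta> * (1 - c powr \<beta>) = x powr \<beta> - y powr \<beta>"
    using c x by (simp add: powr_mult algebra_simps)
  moreover have "x powr \<beta> * (max 1 \<beta> * (1 - c) powr \<theta>) = max 1 \<beta> * (x powr (\<beta> - \<theta>) * (x - y) powr \<theta>)"
  proof -
    have "x - y = x * (1 - c)" using c by (simp add: algebra_simps)
    then have "(x - y) powr \<theta> = x powr \<theta> * (1 - c) powr \<theta>" using x c by (simp add: powr_mult)
    moreover have "x powr \<beta> = x powr (\<beta> - \<theta>) * x powr \<theta>" unfolding powr_add[symmetric] by simp
    ultimately show ?thesis by (simp add: mult_ac)
  qed
  ultimately show ?thesis by simp
qed

text \<open>The condition \<open>\<theta> \<le> \<beta>\<close> allows the larger of x and y to be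
  replaced by their sum.\<close>

lemma abs_powr_diff_le:
  fixes x y :: real
  assumes xy: "0 \<le> x" "0 \<le> y" and \<beta>: "0 < \<beta>" and \<theta>: "0 < \<theta>" "\<theta> \<le> 1" "\<theta> \<le> \<beta>" and e: "\<bar>x - y\<bar> \<le> e"
  shows "\<bar>x powr \<beta> - y powr \<beta>\<bar> \<le> max 1 \<beta> * ((x + y) powr (\<beta> - \<theta>) * e powr \<theta>)"
proof -
  have *: "\<bar>x powr \<beta> - y powr \<beta>\<bar> \<le> max 1 \<beta> * ((x + y) powr (\<beta> - \<theta>) * e powr \<theta>)"
    if xy: "0 \<le> y" "y \<le> x" and e: "x - y \<le> e" for x y
  proof -
    have "y powr \<beta> \<le> x powr \<beta>" using xy \<beta> by (intro powr_mono2) auto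
    then have "\<bar>x powr \<beta> - y powr \<beta>\<bar> \<le> max 1 \<beta> * (x powr (\<beta> - \<theta>) * (x - y) powr \<theta>)"
      using powr_diff_le[OF xy \<beta> \<theta>(1,2)] by simp
    also have "\<dots> \<le> max 1 \<beta> * ((x + y) powr (\<beta> - \<theta>) * e powr \<theta>)"
      using xy e \<theta> by (intro mult_left_mono mult_mono powr_mono2) auto
    finally show ?thesis .
  qed
  show ?thesis
  proof (cases "y \<le> x")
    case True
    then show ?thesis using *[of y x] xy e by simp
  next
    case False
    then show ?thesis using *[of x y] xy e by (simp add: abs_minus_commute add.commute)
  qed
qed

lemma double_powr_le: "0 \<le> (w::real) \<Longrightarrow> 0 < \<theta> \<Longrightarrow> \<theta> \<le> 1 \<Longrightarrow> (2 * w) powr \<theta> \<le> 2 * w powr \<theta>"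
proof -
  assume w: "0 \<le> w" "0 < \<theta>" "\<theta> \<le> 1"
  have "2 powr \<theta> \<le> 2 powr (1::real)" using w by (intro powr_mono) auto
  then have "2 powr \<theta> * w powr \<theta> \<le> 2 * w powr \<theta>" by (intro mult_right_mono) auto
  then show ?thesis using w by (simp add: powr_mult)
qed

text \<open>If \<open>w \<le> norm (a - v)\<close>, the increment is made linear in the unknown
  difference: with power 1 the factor \<open>m powr (\<beta> - 1)\<close>, possibly singular, is
  compensated by \<open>norm v \<le> m\<close>. Otherwise the increment is at most 2 * w and a power
  of w alone appears. Thus the unknown difference contributes to the potential term but not to the
  source.\<close>

lemma nonlinearity_diff_self:
  fixes a v :: "'b::real_normed_vector"
  assumes U: "0 \<le> U" and e: "\<bar>U - norm v\<bar> \<le> norm (a - v) + w" "0 \<le> w" and \<beta>: "0 < \<beta>" and \<theta>: "0 < \<theta>" "\<theta> \<le> 1" "\<theta> \<le> \<beta>"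
  shows "norm (U powr \<beta> *\<^sub>R a - norm v powr \<beta> *\<^sub>R v) \<le> (1 + 2 * max 1 \<beta>) * ((U + norm v) powr \<beta> * norm (a - v))
     + 2 * max 1 \<beta> * ((U + norm v) powr (\<beta> - \<theta>) * (w powr \<theta> * norm v))"
proof -
  let ?K = "max 1 \<beta>" and ?Q = "U + norm v" and ?d = "norm (a - v)"
  have K: "?K \<ge> 0" by simp
  have "U powr \<beta> *\<^sub>R a - norm v powr \<beta> *\<^sub>R v = U powr \<beta> *\<^sub>R (a - v) + (U powr \<beta> - norm v powr \<beta>) *\<^sub>R v"
    by (simp add: algebra_simps)
  then have "norm (U powr \<beta> *\<^sub>R a - norm v powr \<beta> *\<^sub>R v) \<le> U powr \<beta> * ?d + \<bar>U powr \<beta> - norm v powr \<beta>\<bar> * norm v"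
    using norm_triangle_ineq[of "U powr \<beta> *\<^sub>R (a - v)" "(U powr \<beta> - norm v powr \<beta>) *\<^sub>R v"] by simp
  moreover have "U powr \<beta> * ?d \<le> ?Q powr \<beta> * ?d" using U \<beta> by (intro mult_right_mono powr_mono2) auto
  moreover have "\<bar>U powr \<beta> - norm v powr \<beta>\<bar> * norm v \<le> 2 * ?K * (?Q powr \<beta> * ?d) + 2 * ?K * (?Q powr (\<beta> - \<theta>) * (w powr \<theta> * norm v))"
  proof (cases "w \<le> ?d")
    case True
    have "\<bar>U powr \<beta> - norm v powr \<beta>\<bar> * norm v \<le> ?K * (?Q powr \<beta> * (2 * ?d))"
    proof -
      define m where "m = max U (norm v)"
      have m: "0 \<le> m" "m \<le> ?Q" "norm v \<le> m" using U by (auto simp: m_def)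
      have 1: "\<bar>U powr \<beta> - norm v powr \<beta>\<bar> \<le> ?K * (m powr (\<beta> - 1) * \<bar>U - norm v\<bar>)"
      proof (cases "norm v \<le> U")
        case True
        have "norm v powr \<beta> \<le> U powr \<beta>" using True \<beta> by (intro powr_mono2) auto
        then show ?thesis using powr_diff_le[of "norm v" U \<beta> 1] True \<beta> by (simp add: m_def max_absorb1)
      next
        case False
        have "U powr \<beta> \<le> norm v powr \<beta>" using False U \<beta> by (intro powr_mono2) auto
        then show ?thesis using powr_diff_le[of U "norm v" \<beta> 1] False U \<beta> by (simp add: m_def max_absorb2 abs_minus_commute)
      qed
      have "\<bar>U powr \<beta> - norm v powr \<beta>\<bar> * norm v \<le> ?K * (m powr (\<beta> - 1) * \<bar>U - norm v\<bar>) * m"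
        using 1 m by (intro mult_mono) auto
      also have "\<dots> = ?K * (m powr (\<beta> - 1) * m * \<bar>U - norm v\<bar>)" by (simp only: mult_ac)
      also have "m powr (\<beta> - 1) * m = m powr \<beta>" using m(1) by (cases "m = 0") (simp_all add: powr_diff)
      also have "?K * (m powr \<beta> * \<bar>U - norm v\<bar>) \<le> ?K * (?Q powr \<beta> * (2 * ?d))"
        using e True m \<beta> by (intro mult_left_mono mult_mono powr_mono2) auto
      finally show ?thesis .
    qed
    then show ?thesis by (simp add: add_increasing2)
  next
    case False
    then have "\<bar>U - norm v\<bar> \<le> 2 * w" using e by simp
    then have "\<bar>U powr \<beta> - norm v powr \<beta>\<bar> \<le> ?K * (?Q powr (\<beta> - \<theta>) * (2 * w) powr \<theta>)"
      using U \<beta> \<theta> by (intro abs_powr_diff_le) auto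
    also have "\<dots> \<le> ?K * (?Q powr (\<beta> - \<theta>) * (2 * w powr \<theta>))"
      using e \<theta> by (intro mult_left_mono double_powr_le) auto
    finally have "\<bar>U powr \<beta> - norm v powr \<beta>\<bar> * norm v \<le> ?K * (?Q powr (\<beta> - \<theta>) * (2 * w powr \<theta>)) * norm v"
      by (rule mult_right_mono) simp
    also have "\<dots> = 2 * ?K * (?Q powr (\<beta> - \<theta>) * (w powr \<theta> * norm v))" by simp
    finally show ?thesis by (simp add: add_increasing)
  qed
  ultimately show ?thesis by (simp add: algebra_simps)
qed

lemma nonlinearity_diff_linear:
  fixes b z :: "'b::real_normed_vector"
  assumes U: "0 \<le> U" "0 \<le> y" and e: "\<bar>U - y\<bar> \<le> d + w" "0 \<le> w" "0 \<le> d" and \<beta>: "0 < \<beta>"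
    and \<theta>: "0 < \<theta>1" "\<theta>1 \<le> 1" "\<theta>1 \<le> \<beta>" "0 < \<theta>2" "\<theta>2 \<le> 1" "\<theta>2 \<le> \<beta>"
  shows "norm (U powr \<beta> *\<^sub>R b - y powr \<beta> *\<^sub>R z) \<le> (U + y) powr \<beta> * norm (b - z)
     + (2 * max 1 \<beta> * ((U + y) powr (\<beta> - \<theta>1) * (d powr \<theta>1 * norm z)) + 2 * max 1 \<beta> * ((U + y) powr (\<beta> - \<theta>2) * (w powr \<theta>2 * norm z)))"
proof -
  let ?K = "max 1 \<beta>" and ?Q = "U + y"
  have "U powr \<beta> *\<^sub>R b - y powr \<beta> *\<^sub>R z = U powr \<beta> *\<^sub>R (b - z) + (U powr \<beta> - y powr \<beta>) *\<^sub>R z"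
    by (simp add: algebra_simps)
  then have "norm (U powr \<beta> *\<^sub>R b - y powr \<beta> *\<^sub>R z) \<le> U powr \<beta> * norm (b - z) + \<bar>U powr \<beta> - y powr \<beta>\<bar> * norm z"
    using norm_triangle_ineq[of "U powr \<beta> *\<^sub>R (b - z)" "(U powr \<beta> - y powr \<beta>) *\<^sub>R z"] by simp
  moreover have "U powr \<beta> * norm (b - z) \<le> ?Q powr \<beta> * norm (b - z)" using U \<beta> by (intro mult_right_mono powr_mono2) auto
  moreover have aux: "\<bar>U powr \<beta> - y powr \<beta>\<bar> * norm z \<le> 2 * ?K * (?Q powr (\<beta> - \<theta>) * (s powr \<theta> * norm z))"
    if s: "\<bar>U - y\<bar> \<le> 2 * s" "0 \<le> s" and \<theta>: "0 < \<theta>" "\<theta> \<le> 1" "\<theta> \<le> \<beta>" for s \<theta>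
  proof -
    have "\<bar>U powr \<beta> - y powr \<beta>\<bar> \<le> ?K * (?Q powr (\<beta> - \<theta>) * (2 * s) powr \<theta>)"
      using U \<beta> \<theta> s by (intro abs_powr_diff_le) auto
    also have "\<dots> \<le> ?K * (?Q powr (\<beta> - \<theta>) * (2 * s powr \<theta>))"
      using s \<theta> by (intro mult_left_mono double_powr_le) auto
    finally have "\<bar>U powr \<beta> - y powr \<beta>\<bar> * norm z \<le> ?K * (?Q powr (\<beta> - \<theta>) * (2 * s powr \<theta>)) * norm z"
      by (rule mult_right_mono) simp
    then show ?thesis by (simp add: mult_ac)
  qed
  have "\<bar>U powr \<beta> - y powr \<beta>\<bar> * norm z \<le> 2 * ?K * (?Q powr (\<beta> - \<theta>1) * (d powr \<theta>1 * norm z)) + 2 * ?K * (?Q powr (\<beta> - \<theta>2) * (w powr \<theta>2 * norm z))"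
  proof (cases "w \<le> d")
    case True
    then show ?thesis using aux[of d \<theta>1] e \<theta> by (simp add: add_increasing2)
  next
    case False
    then show ?thesis using aux[of w \<theta>2] e \<theta> by (simp add: add_increasing)
  qed
  with calculation(1,2) show ?thesis by linarith
qed

section \<open>The heat semigroup on tempered distributions\<close>

lemma heat_kernel_prod_normal:
  fixes x :: "'a::euclidean_space"
  assumes t: "t > 0"
  shows "heat_kernel t x = (\<Prod>b\<in>Basis. normal_density 0 (sqrt (2 * t)) (x \<bullet> b))"
proof -
  have "(\<Prod>b\<in>Basis. normal_density 0 (sqrt (2 * t)) (x \<bullet> b))
    = (\<Prod>b\<in>(Basis::'a set). 1 / sqrt (4 * pi * t)) * (\<Prod>b\<in>Basis. exp (- (x \<bullet> b)\<^sup>2 / (4 * t)))"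
    unfolding normal_density_def prod.distrib[symmetric] using t by (intro prod.cong) (auto simp: mult_ac)
  also have "(\<Prod>b\<in>Basis. exp (- (x \<bullet> b)\<^sup>2 / (4 * t))) = exp (- (norm x)\<^sup>2 / (4 * t))"
    by (simp add: exp_sum[symmetric] norm_eq_sqrt_inner euclidean_inner[of x x] power2_eq_square sum_divide_distrib sum_negf sum_nonneg)
  also have "(\<Prod>b\<in>(Basis::'a set). 1 / sqrt (4 * pi * t)) = (4 * pi * t) powr (- real DIM('a) / 2)"
  proof -
    have "1 / sqrt (4 * pi * t) = (4 * pi * t) powr (- 1 / 2)"
      using t by (simp add: powr_half_sqrt[symmetric] powr_minus_divide)
    then have "(\<Prod>b\<in>(Basis::'a set). 1 / sqrt (4 * pi * t)) = ((4 * pi * t) powr (- 1 / 2)) powr real DIM('a)"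
      using t by (simp add: powr_realpow)
    then show ?thesis by (simp add: powr_powr)
  qed
  finally show ?thesis by (simp add: heat_kernel_def)
qed

lemma nn_integral_heat_kernel:
  assumes t: "t > 0"
  shows "(\<integral>\<^sup>+x. ennreal (heat_kernel t (x - m :: 'a::euclidean_space)) \<partial>lborel) = 1"
proof -
  have 1: "(\<integral>\<^sup>+r. ennreal (normal_density 0 (sqrt (2 * t)) r) \<partial>lborel) = 1"
    using t by (subst nn_integral_eq_integral) (auto simp: integrable_normal_density integral_normal_density)
  have "(\<integral>\<^sup>+x. ennreal (heat_kernel t (x - m)) \<partial>lborel) = (\<integral>\<^sup>+x. ennreal (heat_kernel t (x :: 'a)) \<partial>lborel)"
    using nn_integral_lborel_affine[of "\<lambda>x. ennreal (heat_kernel t (x - m))" 1 m] by simp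
  also have "\<dots> = nn_integral lborel (\<lambda>x::'a. \<Prod>b\<in>Basis. ennreal (normal_density 0 (sqrt (2 * t)) (x \<bullet> b)))"
    using t by (simp add: heat_kernel_prod_normal prod_ennreal)
  also have "\<dots> = (\<Prod>b\<in>(Basis::'a set). (\<integral>\<^sup>+r. ennreal (normal_density 0 (sqrt (2 * t)) r) \<partial>lborel))"
    by (rule nn_integral_lborel_prod) auto
  finally show ?thesis by (simp add: 1)
qed

text \<open>Completing the square in y: the new centre is the mean of x and z with crossed times as
  weights, and the new time is s * t / (s + t). Integration over y then gives the semigroup law
  directly.\<close>

lemma heat_kernel_mult:
  fixes x y z :: "'a::euclidean_space"
  assumes s: "s > 0" and t: "t > 0"
  shows "heat_kernel s (x - y) * heat_kernel t (y - z)
    = heat_kernel (s + t) (x - z) * heat_kernel (s * t / (s + t)) (y - (1 / (s + t)) *\<^sub>R (t *\<^sub>R x + s *\<^sub>R z))"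
proof -
  let ?u = "s * t / (s + t)" and ?m = "(1 / (s + t)) *\<^sub>R (t *\<^sub>R x + s *\<^sub>R z)"
  have st: "s + t > 0" "?u > 0" using s t by simp_all
  have "(4 * pi * s) * (4 * pi * t) = (4 * pi * (s + t)) * (4 * pi * ?u)" using st by (simp add: field_simps)
  then have "((4 * pi * s) * (4 * pi * t)) powr (- real DIM('a) / 2) = ((4 * pi * (s + t)) * (4 * pi * ?u)) powr (- real DIM('a) / 2)"
    by simp
  then have pre: "(4 * pi * s) powr (- real DIM('a) / 2) * (4 * pi * t) powr (- real DIM('a) / 2)
    = (4 * pi * (s + t)) powr (- real DIM('a) / 2) * (4 * pi * ?u) powr (- real DIM('a) / 2)"
    using s t st by (simp only: powr_mult)
  define a where "a = x - y"
  define c where "c = y - z"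
  have ac: "x - z = a + c" "y - ?m = (1 / (s + t)) *\<^sub>R (s *\<^sub>R c - t *\<^sub>R a)"
  proof -
    show "x - z = a + c" by (simp add: a_def c_def)
    have "(s + t) *\<^sub>R ?m = t *\<^sub>R x + s *\<^sub>R z" using st by simp
    then have "(s + t) *\<^sub>R (y - ?m) = (s + t) *\<^sub>R y - (t *\<^sub>R x + s *\<^sub>R z)" by (simp only: scaleR_diff_right)
    also have "\<dots> = s *\<^sub>R c - t *\<^sub>R a" by (simp add: a_def c_def algebra_simps)
    finally have "(s + t) *\<^sub>R (y - ?m) = s *\<^sub>R c - t *\<^sub>R a" .
    then have "(1 / (s + t)) *\<^sub>R ((s + t) *\<^sub>R (y - ?m)) = (1 / (s + t)) *\<^sub>R (s *\<^sub>R c - t *\<^sub>R a)" by simp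
    then show "y - ?m = (1 / (s + t)) *\<^sub>R (s *\<^sub>R c - t *\<^sub>R a)" using st by simp
  qed
  have "- (norm a)\<^sup>2 / (4 * s) + - (norm c)\<^sup>2 / (4 * t)
    = - (norm (a + c))\<^sup>2 / (4 * (s + t)) + - (norm ((1 / (s + t)) *\<^sub>R (s *\<^sub>R c - t *\<^sub>R a)))\<^sup>2 / (4 * ?u)"
  proof -
    define A where "A = a \<bullet> a" define B where "B = a \<bullet> c" define D where "D = c \<bullet> c"
    have 1: "(norm (a + c))\<^sup>2 = A + 2 * B + D"
      by (simp add: power2_norm_eq_inner inner_add inner_commute A_def B_def D_def)
    have 2: "(norm ((1 / (s + t)) *\<^sub>R (s *\<^sub>R c - t *\<^sub>R a)))\<^sup>2 = (s\<^sup>2 * D - 2 * s * t * B + t\<^sup>2 * A) / (s + t)\<^sup>2"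
    proof -
      have "(norm (s *\<^sub>R c - t *\<^sub>R a))\<^sup>2 = s\<^sup>2 * D - 2 * s * t * B + t\<^sup>2 * A"
        unfolding power2_norm_eq_inner by (simp add: inner_diff inner_commute A_def B_def D_def power2_eq_square algebra_simps)
      then show ?thesis by (simp add: power_mult_distrib power_divide)
    qed
    have 3: "(norm a)\<^sup>2 = A" "(norm c)\<^sup>2 = D" by (simp_all add: power2_norm_eq_inner A_def D_def)
    show ?thesis unfolding 1 2 3 using s t st by (simp add: divide_simps) (simp add: power2_eq_square algebra_simps)
  qed
  then have "exp (- (norm a)\<^sup>2 / (4 * s)) * exp (- (norm c)\<^sup>2 / (4 * t))
    = exp (- (norm (a + c))\<^sup>2 / (4 * (s + t))) * exp (- (norm ((1 / (s + t)) *\<^sub>R (s *\<^sub>R c - t *\<^sub>R a)))\<^sup>2 / (4 * ?u))"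
    by (simp only: exp_add[symmetric])
  with pre have "((4 * pi * s) powr (- real DIM('a) / 2) * (4 * pi * t) powr (- real DIM('a) / 2)) * (exp (- (norm a)\<^sup>2 / (4 * s)) * exp (- (norm c)\<^sup>2 / (4 * t)))
    = ((4 * pi * (s + t)) powr (- real DIM('a) / 2) * (4 * pi * ?u) powr (- real DIM('a) / 2)) * (exp (- (norm (a + c))\<^sup>2 / (4 * (s + t))) * exp (- (norm ((1 / (s + t)) *\<^sub>R (s *\<^sub>R c - t *\<^sub>R a)))\<^sup>2 / (4 * ?u)))"
    by (simp only:)
  then show ?thesis
    unfolding heat_kernel_def ac a_def[symmetric] c_def[symmetric] by (simp only: mult_ac)
qed

lemma heat_kernel_convolution:
  fixes x z :: "'a::euclidean_space"
  assumes s: "s > 0" and t: "t > 0"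
  shows "(\<integral>\<^sup>+y. ennreal (heat_kernel s (x - y)) * ennreal (heat_kernel t (y - z)) \<partial>lborel) = ennreal (heat_kernel (s + t) (x - z))"
proof -
  have u: "s * t / (s + t) > 0" using s t by simp
  have "(\<integral>\<^sup>+y. ennreal (heat_kernel s (x - y)) * ennreal (heat_kernel t (y - z)) \<partial>lborel)
    = (\<integral>\<^sup>+y. ennreal (heat_kernel (s + t) (x - z)) * ennreal (heat_kernel (s * t / (s + t)) (y - (1 / (s + t)) *\<^sub>R (t *\<^sub>R x + s *\<^sub>R z))) \<partial>lborel)"
    by (intro nn_integral_cong) (simp add: ennreal_mult[symmetric] heat_kernel_mult[OF s t])
  also have "\<dots> = ennreal (heat_kernel (s + t) (x - z))"
    by (subst nn_integral_cmult) (simp_all add: nn_integral_heat_kernel[OF u])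
  finally show ?thesis .
qed

section \<open>Polynomials times Gaussians, and the derivatives of heat kernels\<close>

lemma gauss_decay:
  fixes t r :: real
  assumes "t > 0" "0 \<le> r"
  shows "(1 + r) ^ N * exp (- r\<^sup>2 / (4 * t)) \<le> fact N * exp (1 + t)"
proof -
  have "(\<Sum>n\<in>{N}. (1 + r) ^ n /\<^sub>R fact n) \<le> (\<Sum>n. (1 + r) ^ n /\<^sub>R fact n)"
    by (intro sum_le_suminf summable_exp_generic) (use assms in auto)
  then have "(1 + r) ^ N / fact N \<le> exp (1 + r)"
    by (simp add: exp_def divide_inverse mult.commute)
  then have "(1 + r) ^ N \<le> fact N * exp (1 + r)" by (simp add: field_simps)
  then have "(1 + r) ^ N * exp (- r\<^sup>2 / (4 * t)) \<le> fact N * exp (1 + r) * exp (- r\<^sup>2 / (4 * t))"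
    by (rule mult_right_mono) simp
  also have "\<dots> = fact N * exp (1 + r + - r\<^sup>2 / (4 * t))" by (simp only: mult.assoc exp_add[symmetric])
  also have "\<dots> \<le> fact N * exp (1 + t)"
  proof -
    \<comment> \<open>This square gives r \<le> t + r^2 / (4 * t), which trades the linear exponent
      for the Gaussian one.\<close>
    have "0 \<le> (r - 2 * t)\<^sup>2" by simp
    then have "r * (4 * t) \<le> t * (4 * t) + r\<^sup>2" by (simp add: power2_eq_square algebra_simps)
    then have "r \<le> t + r\<^sup>2 / (4 * t)" using assms by (simp add: field_simps)
    then show ?thesis by (intro mult_left_mono) auto
  qed
  finally show ?thesis .
qed

text \<open>All facts are proved in one induction because the product rule uses values and
  derivatives of both factors. Polynomial derivatives make the class of polynomials times Gaussians
  closed under differentiation, and the growth bounds make it rapidly decaying.\<close>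

lemma real_polynomial_function_props:
  fixes P :: "'a::euclidean_space \<Rightarrow> real"
  assumes "real_polynomial_function P"
  shows "\<exists>P' C m. (\<forall>w. (P has_derivative P' w) (at w)) \<and> (\<forall>b. real_polynomial_function (\<lambda>w. P' w b)) \<and> 0 \<le> C \<and>
    (\<forall>w. \<bar>P w\<bar> \<le> C * (1 + norm w) ^ m) \<and> (\<forall>w v. \<bar>P' w v\<bar> \<le> C * (1 + norm w) ^ m * norm v)"
  using assms
proof induction
  case (linear f)
  obtain K where K: "K > 0" "\<And>x. \<bar>f x\<bar> \<le> norm x * K" using bounded_linear.pos_bounded[OF linear] by auto
  have "\<bar>f w\<bar> \<le> K * (1 + norm w) ^ 1" for w using K(2)[of w] K(1) by (simp add: algebra_simps)
  moreover have "\<bar>f v\<bar> \<le> K * (1 + norm w) ^ 1 * norm v" for w v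
  proof -
    have "K * norm v \<le> K * (1 + norm w) * norm v" using K(1) by (intro mult_right_mono) auto
    then show ?thesis using K(2)[of v] by (simp add: mult.commute)
  qed
  ultimately show ?case using K(1) linear
    by (intro exI[of _ "\<lambda>_. f"] exI[of _ K] exI[of _ 1]) (auto intro: bounded_linear_imp_has_derivative)
next
  case (const c)
  show ?case by (intro exI[of _ "\<lambda>_ _. 0"] exI[of _ "\<bar>c\<bar>"] exI[of _ 0]) auto
next
  case (add f g)
  obtain f' C m where f: "\<And>w. (f has_derivative f' w) (at w)" "\<And>b. real_polynomial_function (\<lambda>w. f' w b)" "0 \<le> C"
    "\<And>w. \<bar>f w\<bar> \<le> C * (1 + norm w) ^ m" "\<And>w v. \<bar>f' w v\<bar> \<le> C * (1 + norm w) ^ m * norm v" using add.IH(1) by blast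
  obtain g' D l where g: "\<And>w. (g has_derivative g' w) (at w)" "\<And>b. real_polynomial_function (\<lambda>w. g' w b)" "0 \<le> D"
    "\<And>w. \<bar>g w\<bar> \<le> D * (1 + norm w) ^ l" "\<And>w v. \<bar>g' w v\<bar> \<le> D * (1 + norm w) ^ l * norm v" using add.IH(2) by blast
  have p: "(1 + norm w) ^ m \<le> (1 + norm w) ^ (m + l)" "(1 + norm w) ^ l \<le> (1 + norm w) ^ (m + l)" for w :: 'a
    by (auto intro!: power_increasing)
  have b: "C * (1 + norm w) ^ m + D * (1 + norm w) ^ l \<le> (C + D) * (1 + norm w) ^ (m + l)" for w :: 'a
    using mult_left_mono[OF p(1)[of w] f(3)] mult_left_mono[OF p(2)[of w] g(3)] by (simp add: algebra_simps)
  have "\<bar>f w + g w\<bar> \<le> (C + D) * (1 + norm w) ^ (m + l)" for w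
    using f(4)[of w] g(4)[of w] b[of w] by linarith
  moreover have "\<bar>f' w v + g' w v\<bar> \<le> (C + D) * (1 + norm w) ^ (m + l) * norm v" for w v
    using f(5)[of w v] g(5)[of w v] mult_right_mono[OF b[of w] norm_ge_zero[of v]] by (simp add: distrib_right)
  ultimately show ?case using f g
    by (intro exI[of _ "\<lambda>w v. f' w v + g' w v"] exI[of _ "C + D"] exI[of _ "m + l"]) (auto intro!: has_derivative_add)
next
  case (mult f g)
  obtain f' C m where f: "\<And>w. (f has_derivative f' w) (at w)" "\<And>b. real_polynomial_function (\<lambda>w. f' w b)" "0 \<le> C"
    "\<And>w. \<bar>f w\<bar> \<le> C * (1 + norm w) ^ m" "\<And>w v. \<bar>f' w v\<bar> \<le> C * (1 + norm w) ^ m * norm v" using mult.IH(1) by blast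
  obtain g' D l where g: "\<And>w. (g has_derivative g' w) (at w)" "\<And>b. real_polynomial_function (\<lambda>w. g' w b)" "0 \<le> D"
    "\<And>w. \<bar>g w\<bar> \<le> D * (1 + norm w) ^ l" "\<And>w v. \<bar>g' w v\<bar> \<le> D * (1 + norm w) ^ l * norm v" using mult.IH(2) by blast
  have b: "\<bar>f w * g w\<bar> \<le> C * D * (1 + norm w) ^ (m + l)" for w
    using mult_mono[OF f(4)[of w] g(4)[of w]] f(3) by (simp add: abs_mult power_add mult_ac)
  have b1: "\<bar>f w * g' w v\<bar> \<le> C * D * (1 + norm w) ^ (m + l) * norm v" for w v
    using mult_mono[OF f(4)[of w] g(5)[of w v]] f(3) by (simp add: abs_mult power_add mult_ac)
  have b2: "\<bar>f' w v * g w\<bar> \<le> C * D * (1 + norm w) ^ (m + l) * norm v" for w v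
    using mult_mono[OF f(5)[of w v] g(4)[of w]] f(3) by (simp add: abs_mult power_add mult_ac)
  have "\<bar>f w * g w\<bar> \<le> 2 * (C * D) * (1 + norm w) ^ (m + l)" for w
    using b[of w] abs_ge_zero[of "f w * g w"] by linarith
  moreover have "\<bar>f w * g' w v + f' w v * g w\<bar> \<le> 2 * (C * D) * (1 + norm w) ^ (m + l) * norm v" for w v
    using b1[of w v] b2[of w v] by (simp add: algebra_simps)
  ultimately show ?case using f g mult.hyps
    by (intro exI[of _ "\<lambda>w v. f w * g' w v + f' w v * g w"] exI[of _ "2 * (C * D)"] exI[of _ "m + l"]) (auto intro!: has_derivative_mult real_polynomial_function.intros(3) real_polynomial_function.intros(4))
qed

text \<open>The minus sign in the second part anticipates that kernels
  \<open>heat_kernel t (y - z)\<close> are differentiated in z, not in y.\<close>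

lemma poly_gauss_props:
  fixes P :: "'a::euclidean_space \<Rightarrow> real"
  assumes P: "real_polynomial_function P" and t: "t > 0"
  shows "\<exists>Q'. (\<forall>w. ((\<lambda>w. P w * heat_kernel t w) has_derivative Q' w) (at w)) \<and>
     (\<forall>b. \<exists>P2. real_polynomial_function P2 \<and> (\<forall>w. - Q' w b = P2 w * heat_kernel t w)) \<and>
     (\<forall>N. \<exists>C\<ge>0. (\<forall>w. (1 + norm w) ^ N * \<bar>P w * heat_kernel t w\<bar> \<le> C) \<and> (\<forall>w v. (1 + norm w) ^ N * \<bar>Q' w v\<bar> \<le> C * norm v))"
proof -
  obtain P' C m where P': "\<And>w. (P has_derivative P' w) (at w)" "\<And>b. real_polynomial_function (\<lambda>w. P' w b)" "0 \<le> C"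
    "\<And>w. \<bar>P w\<bar> \<le> C * (1 + norm w) ^ m" "\<And>w v. \<bar>P' w v\<bar> \<le> C * (1 + norm w) ^ m * norm v"
    using real_polynomial_function_props[OF P] by blast
  define Q' where "Q' w v = (P' w v - P w * ((w \<bullet> v) / (2 * t))) * heat_kernel t w" for w v
  have G': "(heat_kernel t has_derivative (\<lambda>v. - ((w \<bullet> v) / (2 * t)) * heat_kernel t w)) (at w)" for w :: 'a
  proof -
    have "((\<lambda>w. (4 * pi * t) powr (- real DIM('a) / 2) * exp (- (w \<bullet> w) / (4 * t))) has_derivative
       (\<lambda>v. (4 * pi * t) powr (- real DIM('a) / 2) * (exp (- (w \<bullet> w) / (4 * t)) * (- (w \<bullet> v + v \<bullet> w) / (4 * t))))) (at w)"
      using t by (auto intro!: derivative_eq_intros simp: fun_eq_iff inner_commute field_simps)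
    moreover have "(\<lambda>v. (4 * pi * t) powr (- real DIM('a) / 2) * (exp (- (w \<bullet> w) / (4 * t)) * (- (w \<bullet> v + v \<bullet> w) / (4 * t))))
       = (\<lambda>v. - ((w \<bullet> v) / (2 * t)) * heat_kernel t w)"
      by (simp add: heat_kernel_def power2_norm_eq_inner inner_commute fun_eq_iff)
    moreover have "(\<lambda>w::'a. (4 * pi * t) powr (- real DIM('a) / 2) * exp (- (w \<bullet> w) / (4 * t))) = heat_kernel t"
      by (simp add: heat_kernel_def power2_norm_eq_inner fun_eq_iff)
    ultimately show ?thesis by simp
  qed
  have D: "((\<lambda>w. P w * heat_kernel t w) has_derivative Q' w) (at w)" for w
  proof -
    have "(\<lambda>v. P w * (- ((w \<bullet> v) / (2 * t)) * heat_kernel t w) + P' w v * heat_kernel t w) = Q' w"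
      by (simp add: Q'_def fun_eq_iff algebra_simps)
    with has_derivative_mult[OF P'(1) G'] show ?thesis by metis
  qed
  have poly: "\<exists>P2. real_polynomial_function P2 \<and> (\<forall>w. - Q' w b = P2 w * heat_kernel t w)" for b
  proof (intro exI conjI allI)
    show "real_polynomial_function (\<lambda>w. P w * ((1 / (2 * t)) * (w \<bullet> b)) - P' w b)"
      by (intro real_polynomial_function_diff real_polynomial_function.intros(4) real_polynomial_function.intros(2)
          real_polynomial_function.intros(1) P P'(2) bounded_linear_inner_left)
    show "- Q' w b = (P w * ((1 / (2 * t)) * (w \<bullet> b)) - P' w b) * heat_kernel t w" for w
      by (simp add: Q'_def algebra_simps)
  qed
  define c where "c = (4 * pi * t) powr (- real DIM('a) / 2)"
  have bound: "(1 + norm w) ^ M * heat_kernel t w \<le> c * (fact M * exp (1 + t))" for w :: 'a and M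
    using mult_left_mono[OF gauss_decay[OF t norm_ge_zero[of w], of M], of c] by (simp add: heat_kernel_def c_def mult_ac)
  have "\<exists>K\<ge>0. (\<forall>w. (1 + norm w) ^ N * \<bar>P w * heat_kernel t w\<bar> \<le> K) \<and> (\<forall>w v. (1 + norm w) ^ N * \<bar>Q' w v\<bar> \<le> K * norm v)" for N
  proof -
    define B where "B M = c * (fact M * exp (1 + t))" for M
    have B: "B M \<ge> 0" for M by (simp add: B_def c_def)
    define K where "K = C * B (N + m) + C * B (N + (m + 1)) / (2 * t)"
    have K0: "K \<ge> 0" using P'(3) B t by (simp add: K_def)
    have 1: "(1 + norm w) ^ N * (C * (1 + norm w) ^ m * heat_kernel t w) \<le> C * B (N + m)" for w :: 'a
      using mult_left_mono[OF bound[of w "N + m"] P'(3)] by (simp add: B_def power_add mult_ac)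
    have 2: "(1 + norm w) ^ N * (C * (1 + norm w) ^ m * (1 + norm w) * heat_kernel t w) \<le> C * B (N + (m + 1))" for w :: 'a
      using mult_left_mono[OF bound[of w "N + (m + 1)"] P'(3)] by (simp add: B_def power_add mult_ac)
    have a1: "(1 + norm w) ^ N * \<bar>P w * heat_kernel t w\<bar> \<le> K" for w
    proof -
      have "(1 + norm w) ^ N * \<bar>P w * heat_kernel t w\<bar> \<le> (1 + norm w) ^ N * (C * (1 + norm w) ^ m * heat_kernel t w)"
        using P'(4)[of w] by (intro mult_left_mono) (auto simp: abs_mult intro: mult_right_mono)
      also note 1
      also have "C * B (N + m) \<le> K" using P'(3) B t by (simp add: K_def)
      finally show ?thesis .
    qed
    have a2: "(1 + norm w) ^ N * \<bar>Q' w v\<bar> \<le> K * norm v" for w v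
    proof -
      have i: "\<bar>(w \<bullet> v) / (2 * t)\<bar> \<le> (1 + norm w) * norm v / (2 * t)"
      proof -
        have "\<bar>w \<bullet> v\<bar> \<le> (1 + norm w) * norm v"
          by (rule order_trans[OF Cauchy_Schwarz_ineq2 mult_right_mono]) auto
        then show ?thesis using t by (simp add: divide_right_mono)
      qed
      have "\<bar>P' w v - P w * ((w \<bullet> v) / (2 * t))\<bar> \<le> \<bar>P' w v\<bar> + \<bar>P w\<bar> * \<bar>(w \<bullet> v) / (2 * t)\<bar>"
        by (metis abs_mult abs_triangle_ineq4)
      also have "\<dots> \<le> C * (1 + norm w) ^ m * norm v + C * (1 + norm w) ^ m * ((1 + norm w) * norm v / (2 * t))"
        using P'(3) by (intro add_mono P'(5) mult_mono P'(4) i) auto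
      finally have "\<bar>Q' w v\<bar> \<le> (C * (1 + norm w) ^ m * norm v + C * (1 + norm w) ^ m * ((1 + norm w) * norm v / (2 * t))) * heat_kernel t w"
        unfolding Q'_def abs_mult by (simp add: mult_right_mono)
      then have "(1 + norm w) ^ N * \<bar>Q' w v\<bar> \<le> (1 + norm w) ^ N * ((C * (1 + norm w) ^ m * norm v + C * (1 + norm w) ^ m * ((1 + norm w) * norm v / (2 * t))) * heat_kernel t w)"
        by (rule mult_left_mono) simp
      also have "\<dots> = (1 + norm w) ^ N * (C * (1 + norm w) ^ m * heat_kernel t w) * norm v + (1 + norm w) ^ N * (C * (1 + norm w) ^ m * (1 + norm w) * heat_kernel t w) / (2 * t) * norm v"
        by (simp add: algebra_simps)
      also have "\<dots> \<le> C * B (N + m) * norm v + C * B (N + (m + 1)) / (2 * t) * norm v"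
        using t by (intro add_mono mult_right_mono divide_right_mono 1 2) auto
      finally show ?thesis by (simp add: K_def algebra_simps)
    qed
    show ?thesis using K0 a1 a2 by blast
  qed
  with D poly show ?thesis by blast
qed

definition hk_poly :: "real \<Rightarrow> ('a::euclidean_space \<Rightarrow> real) \<Rightarrow> 'a \<Rightarrow> real" where
  "hk_poly t P w = P w * heat_kernel t w"

abbreviation hk_fun :: "real \<Rightarrow> 'a::euclidean_space \<Rightarrow> 'a \<Rightarrow> complex" where
  "hk_fun t y \<equiv> (\<lambda>z. complex_of_real (heat_kernel t (y - z)))"

text \<open>One polynomial serves all centres y. This uniformity turns a translation of the kernel
  into estimates in every Schwartz seminorm.\<close>

lemma iter_partial_hk_fun:
  assumes t: "t > 0"
  shows "\<exists>P. real_polynomial_function P \<and> (\<forall>y::'a::euclidean_space. iter_partial bs (hk_fun t y) = (\<lambda>z. complex_of_real (hk_poly t P (y - z))))"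
proof (induction bs)
  case Nil
  show ?case by (intro exI[of _ "\<lambda>_. 1"]) (auto simp: hk_poly_def intro: real_polynomial_function.intros(2))
next
  case (Cons b bs)
  then obtain P where P: "real_polynomial_function P" "\<And>y::'a. iter_partial bs (hk_fun t y) = (\<lambda>z. complex_of_real (hk_poly t P (y - z)))"
    by blast
  obtain Q' where Q': "\<And>w. (hk_poly t P has_derivative Q' w) (at w)" "\<And>b. \<exists>P2. real_polynomial_function P2 \<and> (\<forall>w. - Q' w b = hk_poly t P2 w)"
    using poly_gauss_props[OF P(1) t] unfolding hk_poly_def[abs_def] by blast
  obtain P2 where P2: "real_polynomial_function P2" "\<And>w. - Q' w b = hk_poly t P2 w" using Q'(2)[of b] by blast
  have "iter_partial (b # bs) (hk_fun t y) = (\<lambda>z. complex_of_real (hk_poly t P2 (y - z)))" for y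
  proof
    fix z
    have 1: "((\<lambda>z. y - z) has_derivative (\<lambda>v. - v)) (at z)" by (auto intro!: derivative_eq_intros)
    have "((\<lambda>z. complex_of_real (hk_poly t P (y - z))) has_derivative (\<lambda>v. complex_of_real (Q' (y - z) (- v)))) (at z)"
      by (intro has_derivative_of_real has_derivative_compose[OF 1 Q'(1)])
    then have "frechet_derivative (\<lambda>z. complex_of_real (hk_poly t P (y - z))) (at z) = (\<lambda>v. complex_of_real (Q' (y - z) (- v)))"
      by (rule frechet_derivative_at[symmetric])
    moreover have "Q' (y - z) (- b) = - Q' (y - z) b"
      using linear_neg[OF has_derivative_linear[OF Q'(1)]] .
    ultimately show "iter_partial (b # bs) (hk_fun t y) z = complex_of_real (hk_poly t P2 (y - z))"
      by (simp add: P(2) P2(2)[symmetric])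
  qed
  then show ?case using P2(1) by blast
qed

lemma one_plus_norm_mult: "1 + norm (z::'a::real_normed_vector) \<le> (1 + norm y) * (1 + norm (y - z))"
proof -
  have "norm z \<le> norm y + norm (y - z)" using norm_triangle_sub[of z y] by (simp add: norm_minus_commute)
  moreover have "(1 + norm y) * (1 + norm (y - z)) = 1 + norm y + norm (y - z) + norm y * norm (y - z)"
    by (simp add: algebra_simps)
  moreover have "0 \<le> norm y * norm (y - z)" by simp
  ultimately show ?thesis by linarith
qed

text \<open>Growth and Lipschitz dependence on the centre, weighted in z. For centres at distance at
  most 1 the mean value theorem on the segment applies, and moving the weight to the intermediate
  point costs a factor 2 per power; for distant centres the triangle inequality suffices, because
  the distance exceeds 1.\<close>

lemma hk_poly_bounds:
  fixes P :: "'a::euclidean_space \<Rightarrow> real"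
  assumes P: "real_polynomial_function P" and t: "t > 0"
  shows "\<exists>C\<ge>0. (\<forall>y z. (1 + norm z) ^ N * \<bar>hk_poly t P (y - z)\<bar> \<le> C * (1 + norm y) ^ N) \<and>
     (\<forall>y y' z. (1 + norm z) ^ N * \<bar>hk_poly t P (y' - z) - hk_poly t P (y - z)\<bar> \<le> C * ((1 + norm y) ^ N * (1 + norm y') ^ N * norm (y' - y)))"
proof -
  obtain Q' where Q': "\<And>w. (hk_poly t P has_derivative Q' w) (at w)" and
    QC: "\<And>N. \<exists>C\<ge>0. (\<forall>w. (1 + norm w) ^ N * \<bar>hk_poly t P w\<bar> \<le> C) \<and> (\<forall>w v. (1 + norm w) ^ N * \<bar>Q' w v\<bar> \<le> C * norm v)"
    using poly_gauss_props[OF P t] unfolding hk_poly_def[abs_def] by blast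
  obtain C where C: "C \<ge> 0"
     "\<And>w. (1 + norm w) ^ N * \<bar>hk_poly t P w\<bar> \<le> C" "\<And>w v. (1 + norm w) ^ N * \<bar>Q' w v\<bar> \<le> C * norm v"
    using QC[of N] by blast
  have 1: "(1 + norm z) ^ N * \<bar>hk_poly t P (y - z)\<bar> \<le> C * (1 + norm y) ^ N" for y z
  proof -
    have "(1 + norm z) ^ N * \<bar>hk_poly t P (y - z)\<bar> \<le> ((1 + norm y) * (1 + norm (y - z))) ^ N * \<bar>hk_poly t P (y - z)\<bar>"
      by (intro mult_right_mono power_mono one_plus_norm_mult) auto
    also have "\<dots> = (1 + norm y) ^ N * ((1 + norm (y - z)) ^ N * \<bar>hk_poly t P (y - z)\<bar>)" by (simp add: power_mult_distrib)
    also have "\<dots> \<le> (1 + norm y) ^ N * C" by (intro mult_left_mono C) auto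
    finally show ?thesis by (simp add: mult.commute)
  qed
  have 2: "(1 + norm z) ^ N * \<bar>hk_poly t P (y' - z) - hk_poly t P (y - z)\<bar> \<le> 2 ^ Suc N * C * ((1 + norm y) ^ N * (1 + norm y') ^ N * norm (y' - y))" for y y' z
  proof (cases "norm (y' - y) \<le> 1")
    case True
    let ?g = "\<lambda>r. hk_poly t P (y - z + r *\<^sub>R (y' - y))"
    have "((\<lambda>r. y - z + r *\<^sub>R (y' - y)) has_derivative (\<lambda>h. h *\<^sub>R (y' - y))) (at r)" for r :: real
      by (auto intro!: derivative_eq_intros)
    then have gd: "(?g has_derivative (\<lambda>h. Q' (y - z + r *\<^sub>R (y' - y)) (h *\<^sub>R (y' - y)))) (at r)" for r
      by (rule has_derivative_compose) (rule Q')
    obtain r where r: "0 < r" "r < 1" "?g 1 - ?g 0 = Q' (y - z + r *\<^sub>R (y' - y)) ((1 - 0) *\<^sub>R (y' - y))"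
      using mvt_simple[of 0 1 ?g "\<lambda>r h. Q' (y - z + r *\<^sub>R (y' - y)) (h *\<^sub>R (y' - y))"] gd
      by (auto simp: has_derivative_at_withinI)
    let ?\<xi> = "y - z + r *\<^sub>R (y' - y)"
    have eq: "hk_poly t P (y' - z) - hk_poly t P (y - z) = Q' ?\<xi> (y' - y)" using r(3) by simp
    have n1: "norm (y - z) \<le> norm ?\<xi> + norm (r *\<^sub>R (y' - y))"
      using norm_triangle_ineq4[of ?\<xi> "r *\<^sub>R (y' - y)"] by simp
    have n2: "norm (r *\<^sub>R (y' - y)) \<le> 1 * 1" unfolding norm_scaleR using r True by (intro mult_mono) auto
    have "1 + norm (y - z) \<le> 2 * (1 + norm ?\<xi>)" using n1 n2 norm_ge_zero[of ?\<xi>] by argo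
    then have "1 + norm z \<le> (1 + norm y) * (2 * (1 + norm ?\<xi>))"
      by (intro order_trans[OF one_plus_norm_mult[of z y]] mult_left_mono) auto
    then have "(1 + norm z) ^ N \<le> ((1 + norm y) * (2 * (1 + norm ?\<xi>))) ^ N" by (intro power_mono) auto
    then have "(1 + norm z) ^ N * \<bar>Q' ?\<xi> (y' - y)\<bar> \<le> ((1 + norm y) * (2 * (1 + norm ?\<xi>))) ^ N * \<bar>Q' ?\<xi> (y' - y)\<bar>"
      by (rule mult_right_mono) simp
    also have "\<dots> = (1 + norm y) ^ N * 2 ^ N * ((1 + norm ?\<xi>) ^ N * \<bar>Q' ?\<xi> (y' - y)\<bar>)" by (simp only: power_mult_distrib mult_ac)
    also have "\<dots> \<le> (1 + norm y) ^ N * 2 ^ N * (C * norm (y' - y))" by (intro mult_left_mono C) auto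
    also have "\<dots> = 2 ^ N * C * ((1 + norm y) ^ N * 1 * norm (y' - y))" by simp
    also have "\<dots> \<le> 2 ^ Suc N * C * ((1 + norm y) ^ N * (1 + norm y') ^ N * norm (y' - y))"
      using C(1) by (intro mult_mono) auto
    finally show ?thesis unfolding eq .
  next
    case False
    have "(1 + norm z) ^ N * \<bar>hk_poly t P (y' - z) - hk_poly t P (y - z)\<bar>
      \<le> (1 + norm z) ^ N * \<bar>hk_poly t P (y' - z)\<bar> + (1 + norm z) ^ N * \<bar>hk_poly t P (y - z)\<bar>"
      unfolding distrib_left[symmetric] by (intro mult_left_mono) auto
    also have "\<dots> \<le> C * (1 + norm y') ^ N + C * (1 + norm y) ^ N" by (intro add_mono 1)
    also have "\<dots> \<le> C * ((1 + norm y) ^ N * (1 + norm y') ^ N) + C * ((1 + norm y) ^ N * (1 + norm y') ^ N)"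
    proof (intro add_mono mult_left_mono C(1))
      have "1 * (1 + norm y') ^ N \<le> (1 + norm y) ^ N * (1 + norm y') ^ N" "(1 + norm y) ^ N * 1 \<le> (1 + norm y) ^ N * (1 + norm y') ^ N"
        by (intro mult_right_mono mult_left_mono one_le_power; simp)+
      then show "(1 + norm y') ^ N \<le> (1 + norm y) ^ N * (1 + norm y') ^ N" "(1 + norm y) ^ N \<le> (1 + norm y) ^ N * (1 + norm y') ^ N" by simp_all
    qed
    also have "\<dots> = 2 * C * ((1 + norm y) ^ N * (1 + norm y') ^ N * 1)" by simp
    also have "\<dots> \<le> 2 ^ Suc N * C * ((1 + norm y) ^ N * (1 + norm y') ^ N * norm (y' - y))"
      using False C(1) by (intro mult_mono) auto
    finally show ?thesis .
  qed
  have 3: "C * (1 + norm y) ^ N \<le> 2 ^ Suc N * C * (1 + norm y) ^ N" for y :: 'a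
  proof -
    have "1 * C \<le> 2 ^ Suc N * C" using C(1) by (intro mult_right_mono one_le_power) auto
    then show ?thesis by (intro mult_right_mono) auto
  qed
  show ?thesis
    using C(1) 2 order_trans[OF 1 3] by (intro exI[of _ "2 ^ Suc N * C"]) auto
qed

lemma hk_fun_schwartz:
  assumes t: "t > 0"
  shows "hk_fun t (y::'a::euclidean_space) \<in> schwartz"
  unfolding schwartz_def
proof (intro CollectI allI impI conjI)
  fix bs :: "'a list" and x :: 'a and N :: nat
  obtain P where P: "real_polynomial_function P" "iter_partial bs (hk_fun t y) = (\<lambda>z. complex_of_real (hk_poly t P (y - z)))"
    using iter_partial_hk_fun[OF t] by metis
  obtain Q' where Q': "\<And>w. (hk_poly t P has_derivative Q' w) (at w)"
    using poly_gauss_props[OF P(1) t] unfolding hk_poly_def[abs_def] by blast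
  have "((\<lambda>z. y - z) has_derivative (\<lambda>v. - v)) (at x)" by (auto intro!: derivative_eq_intros)
  from has_derivative_of_real[OF has_derivative_compose[OF this Q']]
  show "iter_partial bs (hk_fun t y) differentiable (at x)" unfolding P(2) differentiable_def by blast
  obtain C where C: "\<And>y z. (1 + norm z) ^ N * \<bar>hk_poly t P (y - z)\<bar> \<le> C * (1 + norm y) ^ N"
    using hk_poly_bounds[OF P(1) t, of N] by blast
  show "bounded (range (\<lambda>x. (1 + norm x) ^ N * norm (iter_partial bs (hk_fun t y) x)))"
    by (rule boundedI[of _ "C * (1 + norm y) ^ N"]) (auto simp: P(2) abs_mult C)
qed

section \<open>Finite linear combinations of Schwartz functions\<close>

lemma iter_partial_add:
  fixes f g :: "'a::euclidean_space \<Rightarrow> complex"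
  assumes "f \<in> schwartz" "g \<in> schwartz" "set bs \<subseteq> Basis"
  shows "iter_partial bs (\<lambda>x. f x + g x) = (\<lambda>x. iter_partial bs f x + iter_partial bs g x)"
  using assms(3)
proof (induction bs)
  case (Cons b bs)
  then have "iter_partial bs f differentiable (at x)" "iter_partial bs g differentiable (at x)" for x
    using assms by (simp_all add: schwartz_def)
  then have "frechet_derivative (\<lambda>x. iter_partial bs f x + iter_partial bs g x) (at x)
     = (\<lambda>v. frechet_derivative (iter_partial bs f) (at x) v + frechet_derivative (iter_partial bs g) (at x) v)" for x
    by (intro frechet_derivative_at[symmetric] has_derivative_add frechet_derivative_works[THEN iffD1])
  then show ?case using Cons.prems by (simp add: Cons.IH)
qed simp

lemma iter_partial_cmult:
  fixes f :: "'a::euclidean_space \<Rightarrow> complex"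
  assumes "f \<in> schwartz" "set bs \<subseteq> Basis"
  shows "iter_partial bs (\<lambda>x. c * f x) = (\<lambda>x. c * iter_partial bs f x)"
  using assms(2)
proof (induction bs)
  case (Cons b bs)
  then have "iter_partial bs f differentiable (at x)" for x
    using assms by (simp_all add: schwartz_def)
  then have "frechet_derivative (\<lambda>x. c * iter_partial bs f x) (at x)
     = (\<lambda>v. c * frechet_derivative (iter_partial bs f) (at x) v)" for x
    by (intro frechet_derivative_at[symmetric] has_derivative_mult_right frechet_derivative_works[THEN iffD1])
  then show ?case using Cons.prems by (simp add: Cons.IH)
qed simp

lemma schwartz_add:
  fixes f g :: "'a::euclidean_space \<Rightarrow> complex"
  assumes f: "f \<in> schwartz" and g: "g \<in> schwartz"
  shows "(\<lambda>x. f x + g x) \<in> schwartz"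
  unfolding schwartz_def
proof (intro CollectI allI impI conjI)
  fix bs :: "'a list" and x :: 'a and N :: nat
  assume bs: "set bs \<subseteq> Basis"
  show "iter_partial bs (\<lambda>x. f x + g x) differentiable (at x)"
    unfolding iter_partial_add[OF f g bs] using f g bs by (intro differentiable_add) (simp_all add: schwartz_def)
  obtain A B where "\<And>x. (1 + norm x) ^ N * norm (iter_partial bs f x) \<le> A" "\<And>x. (1 + norm x) ^ N * norm (iter_partial bs g x) \<le> B"
    using f g bs unfolding schwartz_def bounded_iff by (auto simp: abs_mult) blast
  then have "(1 + norm x) ^ N * norm (iter_partial bs f x + iter_partial bs g x) \<le> A + B" for x
    using mult_left_mono[OF norm_triangle_ineq[of "iter_partial bs f x" "iter_partial bs g x"], of "(1 + norm x) ^ N"]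
    by (simp add: distrib_left) (meson add_mono order_trans)
  then show "bounded (range (\<lambda>x. (1 + norm x) ^ N * norm (iter_partial bs (\<lambda>x. f x + g x) x)))"
    unfolding iter_partial_add[OF f g bs] by (intro boundedI[of _ "A + B"]) (auto simp: abs_mult)
qed

lemma schwartz_cmult:
  fixes f :: "'a::euclidean_space \<Rightarrow> complex"
  assumes f: "f \<in> schwartz"
  shows "(\<lambda>x. c * f x) \<in> schwartz"
  unfolding schwartz_def
proof (intro CollectI allI impI conjI)
  fix bs :: "'a list" and x :: 'a and N :: nat
  assume bs: "set bs \<subseteq> Basis"
  show "iter_partial bs (\<lambda>x. c * f x) differentiable (at x)"
    unfolding iter_partial_cmult[OF f bs] using f bs by (intro differentiable_cmult_left_iff[THEN iffD2] disjI2) (simp add: schwartz_def)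
  obtain A where "\<And>x. (1 + norm x) ^ N * norm (iter_partial bs f x) \<le> A"
    using f bs unfolding schwartz_def bounded_iff by (auto simp: abs_mult) blast
  then have "norm c * ((1 + norm x) ^ N * norm (iter_partial bs f x)) \<le> norm c * A" for x
    by (intro mult_left_mono) auto
  then show "bounded (range (\<lambda>x. (1 + norm x) ^ N * norm (iter_partial bs (\<lambda>x. c * f x) x)))"
    unfolding iter_partial_cmult[OF f bs] by (intro boundedI[of _ "norm c * A"]) (auto simp: norm_mult abs_mult mult_ac)
qed

lemma schwartz_zero: "(\<lambda>x::'a::euclidean_space. 0) \<in> schwartz"
proof -
  have "(\<lambda>x::'a. 0 * hk_fun 1 0 x) \<in> schwartz" by (intro schwartz_cmult hk_fun_schwartz) simp
  then show ?thesis by simp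
qed

lemma schwartz_sum:
  fixes f :: "'i \<Rightarrow> 'a::euclidean_space \<Rightarrow> complex"
  assumes "finite I" "\<And>i. i \<in> I \<Longrightarrow> f i \<in> schwartz"
  shows "(\<lambda>x. \<Sum>i\<in>I. c i * f i x) \<in> schwartz"
  using assms
proof (induction I)
  case (insert i I)
  then have "(\<lambda>x. c i * f i x + (\<Sum>i\<in>I. c i * f i x)) \<in> schwartz"
    by (intro schwartz_add schwartz_cmult) auto
  then show ?case using insert by simp
qed (simp add: schwartz_zero)

lemma iter_partial_sum:
  fixes f :: "'i \<Rightarrow> 'a::euclidean_space \<Rightarrow> complex"
  assumes "finite I" "\<And>i. i \<in> I \<Longrightarrow> f i \<in> schwartz" "set bs \<subseteq> Basis"
  shows "iter_partial bs (\<lambda>x. \<Sum>i\<in>I. c i * f i x) = (\<lambda>x. \<Sum>i\<in>I. c i * iter_partial bs (f i) x)"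
  using assms(1,2)
proof (induction I)
  case empty
  have "iter_partial bs (\<lambda>x::'a. 0 * hk_fun 1 0 x) = (\<lambda>x. 0 * iter_partial bs (hk_fun 1 0) x)"
    by (intro iter_partial_cmult hk_fun_schwartz assms) simp
  then show ?case by simp
next
  case (insert i I)
  have "iter_partial bs (\<lambda>x. c i * f i x + (\<Sum>i\<in>I. c i * f i x)) = (\<lambda>x. iter_partial bs (\<lambda>x. c i * f i x) x + iter_partial bs (\<lambda>x. \<Sum>i\<in>I. c i * f i x) x)"
    using insert by (intro iter_partial_add schwartz_cmult schwartz_sum assms(3)) auto
  then show ?case using insert by (simp add: iter_partial_cmult[OF _ assms(3)])
qed

lemma tempered_sum:
  fixes f :: "'i \<Rightarrow> 'a::euclidean_space \<Rightarrow> complex"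
  assumes \<phi>: "tempered_distribution \<phi>" and I: "finite I" "\<And>i. i \<in> I \<Longrightarrow> f i \<in> schwartz"
  shows "\<phi> (\<lambda>x. \<Sum>i\<in>I. c i * f i x) = (\<Sum>i\<in>I. c i * \<phi> (f i))"
  using I
proof (induction I)
  case empty
  have "hk_fun 1 (0::'a) \<in> schwartz" by (rule hk_fun_schwartz) simp
  from \<phi>[unfolded tempered_distribution_def, THEN conjunct2, THEN conjunct1, rule_format, OF this, of 0]
  show ?case by simp
next
  case (insert i I)
  have fi: "f i \<in> schwartz" and S: "(\<lambda>x. \<Sum>i\<in>I. c i * f i x) \<in> schwartz"
    using insert by (auto intro: schwartz_sum)
  have "\<phi> (\<lambda>x. c i * f i x + (\<Sum>i\<in>I. c i * f i x)) = \<phi> (\<lambda>x. c i * f i x) + \<phi> (\<lambda>x. \<Sum>i\<in>I. c i * f i x)"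
    using \<phi>[unfolded tempered_distribution_def, THEN conjunct1, rule_format, OF schwartz_cmult[OF fi] S] .
  moreover have "\<phi> (\<lambda>x. c i * f i x) = c i * \<phi> (f i)"
    using \<phi>[unfolded tempered_distribution_def, THEN conjunct2, THEN conjunct1, rule_format, OF fi] .
  ultimately show ?case using insert by simp
qed

lemma tempered_diff:
  assumes \<phi>: "tempered_distribution \<phi>" and f: "f \<in> schwartz" "g \<in> schwartz"
  shows "\<phi> f - \<phi> g = \<phi> (\<lambda>x. f x - g x)" "(\<lambda>x. f x - g x) \<in> schwartz"
    "set bs \<subseteq> Basis \<Longrightarrow> iter_partial bs (\<lambda>x. f x - g x) = (\<lambda>x. iter_partial bs f x - iter_partial bs g x)"
proof -
  have g': "(\<lambda>x. - 1 * g x) \<in> schwartz" by (rule schwartz_cmult[OF f(2)])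
  have eq: "(\<lambda>x. f x + - 1 * g x) = (\<lambda>x. f x - g x)" by simp
  have "\<phi> (\<lambda>x. f x + - 1 * g x) = \<phi> f + \<phi> (\<lambda>x. - 1 * g x)"
    using \<phi>[unfolded tempered_distribution_def, THEN conjunct1, rule_format, OF f(1) g'] .
  moreover have "\<phi> (\<lambda>x. - 1 * g x) = - 1 * \<phi> g"
    using \<phi>[unfolded tempered_distribution_def, THEN conjunct2, THEN conjunct1, rule_format, OF f(2)] .
  ultimately show "\<phi> f - \<phi> g = \<phi> (\<lambda>x. f x - g x)" unfolding eq by simp
  show "(\<lambda>x. f x - g x) \<in> schwartz" using schwartz_add[OF f(1) g'] by simp
  show "set bs \<subseteq> Basis \<Longrightarrow> iter_partial bs (\<lambda>x. f x - g x) = (\<lambda>x. iter_partial bs f x - iter_partial bs g x)"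
    using iter_partial_add[OF f(1) g', of bs] iter_partial_cmult[OF f(2), of bs "- 1"] by simp
qed

lemma schwartz_seminorm_le:
  fixes f :: "'a::euclidean_space \<Rightarrow> complex"
  assumes "\<And>bs x. set bs \<subseteq> Basis \<Longrightarrow> length bs \<le> N \<Longrightarrow> (1 + norm x) ^ N * norm (iter_partial bs f x) \<le> B bs"
  shows "schwartz_seminorm N f \<le> (\<Sum>bs | set bs \<subseteq> Basis \<and> length bs \<le> N. B bs)"
  unfolding schwartz_seminorm_def using assms by (intro sum_mono cSUP_least) auto

section \<open>Convolution of a heat kernel with derivatives of heat kernels\<close>

lemma hk_poly_measurable [measurable]:
  fixes P :: "'a::euclidean_space \<Rightarrow> real"
  assumes "real_polynomial_function P" "t > 0"
  shows "hk_poly t P \<in> borel_measurable borel"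
proof -
  obtain Q' where "\<And>w. (hk_poly t P has_derivative Q' w) (at w)"
    using poly_gauss_props[OF assms] unfolding hk_poly_def[abs_def] by blast
  then have "continuous_on UNIV (hk_poly t P)"
    by (intro continuous_at_imp_continuous_on ballI) (auto intro: has_derivative_continuous)
  then show ?thesis by (rule borel_measurable_continuous_onI)
qed

text \<open>Half of the Gaussian exponent absorbs the polynomial; the other half is a heat kernel at
  time 2 * s, which has mass 1.\<close>

lemma integrable_heat_kernel_poly:
  fixes x :: "'a::euclidean_space"
  assumes s: "s > 0"
  shows "integrable lborel (\<lambda>y. heat_kernel s (x - y) * (1 + norm y) ^ N)"
proof -
  define c where "c = (4 * pi * s) powr (- real DIM('a) / 2) / (4 * pi * (2 * s)) powr (- real DIM('a) / 2)"
  have c: "c \<ge> 0" by (simp add: c_def)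
  have ratio: "heat_kernel s z = c * exp (- (norm z)\<^sup>2 / (4 * (2 * s))) * heat_kernel (2 * s) z" for z :: 'a
  proof -
    have "exp (- (norm z)\<^sup>2 / (4 * s)) = exp (- (norm z)\<^sup>2 / (4 * (2 * s))) * exp (- (norm z)\<^sup>2 / (4 * (2 * s)))"
      unfolding exp_add[symmetric] using s by (simp add: field_simps)
    then show ?thesis using s by (simp add: heat_kernel_def c_def)
  qed
  have bound: "heat_kernel s (x - y) * (1 + norm y) ^ N \<le> c * (1 + norm x) ^ N * (fact N * exp (1 + 2 * s)) * heat_kernel (2 * s) (x - y)" for y
  proof -
    have "(1 + norm y) ^ N \<le> ((1 + norm x) * (1 + norm (x - y))) ^ N" by (intro power_mono one_plus_norm_mult) auto
    then have "heat_kernel s (x - y) * (1 + norm y) ^ N \<le> heat_kernel s (x - y) * ((1 + norm x) * (1 + norm (x - y))) ^ N"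
      by (rule mult_left_mono) simp
    also have "\<dots> = (c * (1 + norm x) ^ N * heat_kernel (2 * s) (x - y)) * ((1 + norm (x - y)) ^ N * exp (- (norm (x - y))\<^sup>2 / (4 * (2 * s))))"
      by (simp add: ratio power_mult_distrib)
    also have "\<dots> \<le> (c * (1 + norm x) ^ N * heat_kernel (2 * s) (x - y)) * (fact N * exp (1 + 2 * s))"
      using s c by (intro mult_left_mono gauss_decay) auto
    finally show ?thesis by (simp add: mult_ac)
  qed
  have fin: "(\<integral>\<^sup>+y. ennreal (heat_kernel (2 * s) (x - y)) \<partial>lborel) = 1"
    using nn_integral_heat_kernel[of "2 * s" x] s by (simp add: heat_kernel_minus)
  have "integrable lborel (\<lambda>y. heat_kernel (2 * s) (x - y))"
    by (rule integrableI_nonneg) (auto simp: fin)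
  then have "integrable lborel (\<lambda>y. c * (1 + norm x) ^ N * (fact N * exp (1 + 2 * s)) * heat_kernel (2 * s) (x - y))"
    by (rule integrable_mult_right)
  then show ?thesis
    by (rule Bochner_Integration.integrable_bound) (use bound c in \<open>auto simp: abs_mult\<close>)
qed

text \<open>Differentiation of the convolution identity under the integral sign.\<close>

lemma iter_partial_convolution:
  assumes s: "s > 0" and t: "t > 0" and P: "real_polynomial_function P"
    and it: "\<And>y::'a::euclidean_space. iter_partial bs (hk_fun t y) = (\<lambda>z. complex_of_real (hk_poly t P (y - z)))"
    and bs: "set bs \<subseteq> Basis"
  shows "iter_partial bs (hk_fun (s + t) x) = (\<lambda>z. complex_of_real (LINT y|lborel. heat_kernel s (x - y) * hk_poly t P (y - z)))"
  using P it bs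
proof (induction bs arbitrary: P)
  case Nil
  have st: "s + t > 0" using s t by simp
  \<comment> \<open>P is known only through the function it represents, so it is identified by
    comparing values.\<close>
  have eq: "hk_poly t P (y - z) = heat_kernel t (y - z)" for y z
    using fun_cong[OF Nil(2)[of y], of z] by (simp del: of_real_eq_iff) (metis of_real_eq_iff)
  have "(LINT y|lborel. heat_kernel s (x - y) * heat_kernel t (y - z)) = heat_kernel (s + t) (x - z)" for z
    using heat_kernel_convolution[OF s t, of x z]
    by (intro integral_eq_nn_integral[THEN trans]) (auto simp: ennreal_mult)
  then show ?case by (simp add: eq)
next
  case (Cons b bs)
  have st: "s + t > 0" using s t by simp
  obtain R where R: "real_polynomial_function R" "\<And>y::'a. iter_partial bs (hk_fun t y) = (\<lambda>z. complex_of_real (hk_poly t R (y - z)))"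
    using iter_partial_hk_fun[OF t] by blast
  have bs: "set bs \<subseteq> Basis" "b \<in> Basis" using Cons.prems by auto
  obtain Q' where Q': "\<And>w. (hk_poly t R has_derivative Q' w) (at w)"
    using poly_gauss_props[OF R(1) t] unfolding hk_poly_def[abs_def] by blast
  note [measurable] = hk_poly_measurable[OF R(1) t] hk_poly_measurable[OF Cons.prems(1) t]
  have Qb: "- Q' (y - z) b = hk_poly t P (y - z)" for y z
  proof -
    have 1: "((\<lambda>z. y - z) has_derivative (\<lambda>v. - v)) (at z)" by (auto intro!: derivative_eq_intros)
    have "((\<lambda>z. complex_of_real (hk_poly t R (y - z))) has_derivative (\<lambda>v. complex_of_real (Q' (y - z) (- v)))) (at z)"
      by (intro has_derivative_of_real has_derivative_compose[OF 1 Q'])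
    then have "frechet_derivative (\<lambda>z. complex_of_real (hk_poly t R (y - z))) (at z) = (\<lambda>v. complex_of_real (Q' (y - z) (- v)))"
      by (rule frechet_derivative_at[symmetric])
    moreover have "Q' (y - z) (- b) = - Q' (y - z) b"
      using linear_neg[OF has_derivative_linear[OF Q']] .
    ultimately have "iter_partial (b # bs) (hk_fun t y) z = complex_of_real (- Q' (y - z) b)"
      by (simp add: R(2))
    then have "complex_of_real (- Q' (y - z) b) = complex_of_real (hk_poly t P (y - z))"
      using fun_cong[OF Cons.prems(2)[of y], of z] by (simp only:)
    then show ?thesis by (simp only: of_real_eq_iff)
  qed
  define A where "A z = (LINT y|lborel. heat_kernel s (x - y) * hk_poly t R (y - z))" for z
  have IH: "iter_partial bs (hk_fun (s + t) x) = (\<lambda>z. complex_of_real (A z))"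
    unfolding A_def by (rule Cons.IH[OF R bs(1)])
  obtain C where C: "C \<ge> 0" "\<And>y z. (1 + norm z) ^ 0 * \<bar>hk_poly t R (y - z)\<bar> \<le> C * (1 + norm y) ^ 0"
     "\<And>y y' z. (1 + norm z) ^ 0 * \<bar>hk_poly t R (y' - z) - hk_poly t R (y - z)\<bar> \<le> C * ((1 + norm y) ^ 0 * (1 + norm y') ^ 0 * norm (y' - y))"
    using hk_poly_bounds[OF R(1) t, of 0] by blast
  have hki: "integrable lborel (\<lambda>y. heat_kernel s (x - y))"
    using integrable_heat_kernel_poly[OF s, of x 0] by simp
  have Ri: "integrable lborel (\<lambda>y. heat_kernel s (x - y) * hk_poly t R (y - z))" for z
  proof (rule Bochner_Integration.integrable_bound[OF integrable_mult_right[OF hki, of C]])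
    show "AE y in lborel. norm (heat_kernel s (x - y) * hk_poly t R (y - z)) \<le> norm (C * heat_kernel s (x - y))"
      using C(1) C(2)[of z] by (auto simp: abs_mult mult.commute[of C] intro!: mult_left_mono)
  qed measurable
  have "iter_partial (b # bs) (hk_fun (s + t) x) z = complex_of_real (LINT y|lborel. heat_kernel s (x - y) * hk_poly t P (y - z))" for z
  proof -
    have "iter_partial bs (hk_fun (s + t) x) differentiable (at z)"
      using hk_fun_schwartz[OF st, of x] bs by (simp add: schwartz_def)
    then have D: "((\<lambda>z. complex_of_real (A z)) has_derivative frechet_derivative (\<lambda>z. complex_of_real (A z)) (at z)) (at z)"
      unfolding IH by (rule frechet_derivative_works[THEN iffD1])
    \<comment> \<open>Differentiability is already known, because heat kernels are Schwartz
      functions. Only the value of the derivative is missing, and a sequence of increments suffices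
      for that and suits dominated convergence.\<close>
    define h where "h n = 1 / real (Suc n)" for n
    have h: "h \<longlonglongrightarrow> 0" "\<And>n. h n > 0"
      unfolding h_def using lim_const_over_n[of 1, THEN LIMSEQ_Suc] by simp_all
    have lin: "((\<lambda>r. f (z0 + r *\<^sub>R v)) has_vector_derivative f' v) (at 0)" if "(f has_derivative f') (at z0)"
      for f :: "'a \<Rightarrow> 'c::real_normed_vector" and f' z0 v
    proof -
      have "((\<lambda>r::real. z0 + r *\<^sub>R v) has_derivative (\<lambda>r. r *\<^sub>R v)) (at 0)" by (auto intro!: derivative_eq_intros)
      moreover have "(f has_derivative f') (at (z0 + 0 *\<^sub>R v))" using that by simp
      ultimately have "((\<lambda>r. f (z0 + r *\<^sub>R v)) has_derivative (\<lambda>r. f' (r *\<^sub>R v))) (at 0)" by (rule has_derivative_compose)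
      then show ?thesis unfolding has_vector_derivative_def using linear_scale[OF has_derivative_linear[OF that]] by simp
    qed
    have seq: "(\<lambda>n. (f (z0 + h n *\<^sub>R v) - f z0) /\<^sub>R h n) \<longlonglongrightarrow> f' v" if "(f has_derivative f') (at z0)"
      for f :: "'a \<Rightarrow> 'c::real_normed_vector" and f' z0 v
    proof -
      have lim: "(\<lambda>r. norm (f (z0 + r *\<^sub>R v) - f z0 - r *\<^sub>R f' v) / norm r) \<midarrow>0\<rightarrow> 0"
        using lin[OF that, of v] unfolding has_vector_derivative_def has_derivative_at by simp
      have "filterlim h (at 0) sequentially"
        using h by (intro filterlim_atI) (auto simp: less_imp_neq[symmetric] intro!: always_eventually)
      from filterlim_compose[OF lim this]
      have "(\<lambda>n. norm (f (z0 + h n *\<^sub>R v) - f z0 - h n *\<^sub>R f' v) / norm (h n)) \<longlonglongrightarrow> 0" .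
      moreover have "norm (f (z0 + h n *\<^sub>R v) - f z0 - h n *\<^sub>R f' v) / norm (h n) = norm ((f (z0 + h n *\<^sub>R v) - f z0) /\<^sub>R h n - f' v)" for n
      proof -
        have "(f (z0 + h n *\<^sub>R v) - f z0) /\<^sub>R h n - f' v = (f (z0 + h n *\<^sub>R v) - f z0 - h n *\<^sub>R f' v) /\<^sub>R h n"
          using h(2)[of n] by (simp add: scaleR_diff_right)
        then show ?thesis by (simp add: divide_inverse mult.commute)
      qed
      ultimately have "(\<lambda>n. norm ((f (z0 + h n *\<^sub>R v) - f z0) /\<^sub>R h n - f' v)) \<longlonglongrightarrow> 0" by simp
      then show ?thesis by (rule LIM_zero_cancel[OF tendsto_norm_zero_cancel])
    qed
    have "(\<lambda>n. complex_of_real ((A (z + h n *\<^sub>R b) - A z) / h n)) \<longlonglongrightarrow> frechet_derivative (\<lambda>z. complex_of_real (A z)) (at z) b"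
      using seq[OF D, of b] by (simp add: scaleR_conv_of_real divide_inverse mult.commute)
    moreover have "(\<lambda>n. (A (z + h n *\<^sub>R b) - A z) / h n) \<longlonglongrightarrow> (LINT y|lborel. heat_kernel s (x - y) * hk_poly t P (y - z))"
    proof -
      have Aeq: "(A (z + h n *\<^sub>R b) - A z) / h n = (LINT y|lborel. heat_kernel s (x - y) * ((hk_poly t R (y - (z + h n *\<^sub>R b)) - hk_poly t R (y - z)) / h n))" for n
        unfolding A_def by (subst Bochner_Integration.integral_diff[symmetric, OF Ri Ri], subst integral_divide_zero[symmetric])
           (simp add: right_diff_distrib diff_divide_distrib)
      show ?thesis unfolding Aeq
      proof (rule integral_dominated_convergence[where w="\<lambda>y. C * heat_kernel s (x - y)"])
        show "integrable lborel (\<lambda>y. C * heat_kernel s (x - y))" by (rule integrable_mult_right[OF hki])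
        show "AE y in lborel. (\<lambda>n. heat_kernel s (x - y) * ((hk_poly t R (y - (z + h n *\<^sub>R b)) - hk_poly t R (y - z)) / h n)) \<longlonglongrightarrow> heat_kernel s (x - y) * hk_poly t P (y - z)"
        proof (intro AE_I2 tendsto_mult_left)
          fix y
          have "(\<lambda>n. (hk_poly t R ((y - z) + h n *\<^sub>R (- b)) - hk_poly t R (y - z)) /\<^sub>R h n) \<longlonglongrightarrow> Q' (y - z) (- b)"
            by (rule seq[OF Q'])
          moreover have "Q' (y - z) (- b) = hk_poly t P (y - z)"
            using linear_neg[OF has_derivative_linear[OF Q'], of "y - z" b] Qb by simp
          ultimately show "(\<lambda>n. (hk_poly t R (y - (z + h n *\<^sub>R b)) - hk_poly t R (y - z)) / h n) \<longlonglongrightarrow> hk_poly t P (y - z)"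
            by (simp add: divide_inverse mult.commute diff_diff_eq2 algebra_simps)
        qed
        show "AE y in lborel. norm (heat_kernel s (x - y) * ((hk_poly t R (y - (z + h n *\<^sub>R b)) - hk_poly t R (y - z)) / h n)) \<le> C * heat_kernel s (x - y)" for n
        proof (rule AE_I2)
          fix y
          have "\<bar>hk_poly t R (y - h n *\<^sub>R b - z) - hk_poly t R (y - z)\<bar> \<le> C * norm ((y - h n *\<^sub>R b) - y)"
            using C(3)[of z "y - h n *\<^sub>R b" y] by simp
          also have "norm ((y - h n *\<^sub>R b) - y) = h n" using h(2)[of n] bs by simp
          finally have "\<bar>(hk_poly t R (y - (z + h n *\<^sub>R b)) - hk_poly t R (y - z)) / h n\<bar> \<le> C"
            using h(2)[of n] by (simp add: abs_divide pos_divide_le_eq algebra_simps)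
          then have "heat_kernel s (x - y) * \<bar>(hk_poly t R (y - (z + h n *\<^sub>R b)) - hk_poly t R (y - z)) / h n\<bar> \<le> heat_kernel s (x - y) * C"
            by (rule mult_left_mono) simp
          then show "norm (heat_kernel s (x - y) * ((hk_poly t R (y - (z + h n *\<^sub>R b)) - hk_poly t R (y - z)) / h n)) \<le> C * heat_kernel s (x - y)"
            by (simp only: real_norm_def abs_mult abs_of_nonneg[OF heat_kernel_nonneg] mult.commute)
        qed
      qed measurable
    qed
    then have "(\<lambda>n. complex_of_real ((A (z + h n *\<^sub>R b) - A z) / h n)) \<longlonglongrightarrow> complex_of_real (LINT y|lborel. heat_kernel s (x - y) * hk_poly t P (y - z))"
      by (rule tendsto_of_real)
    ultimately have "frechet_derivative (\<lambda>z. complex_of_real (A z)) (at z) b = complex_of_real (LINT y|lborel. heat_kernel s (x - y) * hk_poly t P (y - z))"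
      by (rule LIMSEQ_unique)
    then show ?thesis by (simp add: IH)
  qed
  then show ?case by blast
qed

section \<open>Tempered distributions applied to heat kernels\<close>

lemma hk_fun_partials:
  assumes t: "t > 0"
  shows "\<exists>P C. \<forall>bs. real_polynomial_function (P bs) \<and>
     (\<forall>y::'a::euclidean_space. iter_partial bs (hk_fun t y) = (\<lambda>z. complex_of_real (hk_poly t (P bs) (y - z)))) \<and> 0 \<le> C bs \<and>
     (\<forall>y z. (1 + norm z) ^ N * \<bar>hk_poly t (P bs) (y - z)\<bar> \<le> C bs * (1 + norm y) ^ N) \<and>
     (\<forall>y y' z. (1 + norm z) ^ N * \<bar>hk_poly t (P bs) (y' - z) - hk_poly t (P bs) (y - z)\<bar> \<le> C bs * ((1 + norm y) ^ N * (1 + norm y') ^ N * norm (y' - y)))"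
proof -
  have "\<exists>P C. real_polynomial_function P \<and>
     (\<forall>y::'a. iter_partial bs (hk_fun t y) = (\<lambda>z. complex_of_real (hk_poly t P (y - z)))) \<and> 0 \<le> C \<and>
     (\<forall>y z. (1 + norm z) ^ N * \<bar>hk_poly t P (y - z)\<bar> \<le> C * (1 + norm y) ^ N) \<and>
     (\<forall>y y' z. (1 + norm z) ^ N * \<bar>hk_poly t P (y' - z) - hk_poly t P (y - z)\<bar> \<le> C * ((1 + norm y) ^ N * (1 + norm y') ^ N * norm (y' - y)))" for bs
  proof -
    obtain P where P: "real_polynomial_function P" "\<And>y::'a. iter_partial bs (hk_fun t y) = (\<lambda>z. complex_of_real (hk_poly t P (y - z)))"
      using iter_partial_hk_fun[OF t] by blast
    from hk_poly_bounds[OF P(1) t, of N] P show ?thesis by blast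
  qed
  then show ?thesis by metis
qed

text \<open>Pointwise bounds on weighted derivatives replace the suprema in the seminorm. The
  constant is made nonnegative by \<open>max C 0\<close>, so that it can be used
  monotonically.\<close>

lemma tempered_bound:
  fixes \<phi> :: "'a::euclidean_space dist"
  assumes "tempered_distribution \<phi>"
  shows "\<exists>N C. C \<ge> 0 \<and> (\<forall>f\<in>schwartz. \<forall>B. (\<forall>bs x. set bs \<subseteq> Basis \<longrightarrow> length bs \<le> N \<longrightarrow> (1 + norm x) ^ N * norm (iter_partial bs f x) \<le> B bs) \<longrightarrow>
     norm (\<phi> f) \<le> C * (\<Sum>bs | set bs \<subseteq> Basis \<and> length bs \<le> N. B bs))"
proof -
  obtain N C where NC: "\<And>f. f \<in> schwartz \<Longrightarrow> norm (\<phi> f) \<le> C * schwartz_seminorm N f"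
    using assms unfolding tempered_distribution_def by blast
  have "norm (\<phi> f) \<le> max C 0 * (\<Sum>bs | set bs \<subseteq> (Basis :: 'a set) \<and> length bs \<le> N. B bs)"
    if f: "f \<in> schwartz" and B: "\<forall>bs x. set bs \<subseteq> Basis \<longrightarrow> length bs \<le> N \<longrightarrow> (1 + norm x) ^ N * norm (iter_partial bs f x) \<le> B bs" for f :: "'a \<Rightarrow> complex" and B
  proof -
    have bdd: "bdd_above (range (\<lambda>x::'a. (1 + norm x) ^ N * norm (iter_partial bs f x)))" if "set bs \<subseteq> Basis" "length bs \<le> N" for bs :: "'a list"
      using B that by (intro bdd_aboveI2[of _ _ "B bs"]) auto
    have "0 \<le> schwartz_seminorm N f" unfolding schwartz_seminorm_def
    proof (intro sum_nonneg)
      fix bs :: "'a list" assume "bs \<in> {bs. set bs \<subseteq> Basis \<and> length bs \<le> N}"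
      then have "bdd_above (range (\<lambda>x. (1 + norm x) ^ N * norm (iter_partial bs f x)))" by (intro bdd) auto
      then show "0 \<le> (SUP x. (1 + norm x) ^ N * norm (iter_partial bs f x))"
        by (rule cSUP_upper2[of _ _ _ 0]) auto
    qed
    then have "C * schwartz_seminorm N f \<le> max C 0 * schwartz_seminorm N f" by (intro mult_right_mono) auto
    also have "\<dots> \<le> max C 0 * (\<Sum>bs | set bs \<subseteq> Basis \<and> length bs \<le> N. B bs)"
      using B by (intro mult_left_mono schwartz_seminorm_le) auto
    finally show ?thesis using NC[OF f] by linarith
  qed
  then show ?thesis by (intro exI[of _ N] exI[of _ "max C 0"]) auto
qed

text \<open>Continuity of the distribution, applied to one kernel and to a difference of two.
  Polynomial growth makes the convolution with a Gaussian converge; the Lipschitz bound gives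
  continuity in space.\<close>

lemma heat_tempered_bounds:
  assumes \<phi>: "tempered_distribution (\<phi> :: 'a::euclidean_space dist)" and t: "t > 0"
  shows "\<exists>N C. C \<ge> 0 \<and> (\<forall>y. norm (heat t \<phi> y) \<le> C * (1 + norm y) ^ N) \<and>
    (\<forall>y y'. norm (heat t \<phi> y' - heat t \<phi> y) \<le> C * ((1 + norm y) ^ N * (1 + norm y') ^ N * norm (y' - y)))"
proof -
  obtain N C0 where C0: "C0 \<ge> 0" "\<And>f B. f \<in> schwartz \<Longrightarrow> (\<forall>bs x. set bs \<subseteq> Basis \<longrightarrow> length bs \<le> N \<longrightarrow> (1 + norm x) ^ N * norm (iter_partial bs f x) \<le> B bs) \<Longrightarrow>
     norm (\<phi> f) \<le> C0 * (\<Sum>bs | set bs \<subseteq> Basis \<and> length bs \<le> N. B bs)" using tempered_bound[OF \<phi>] by blast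
  obtain P C where PC: "\<And>bs. real_polynomial_function (P bs)" "\<And>bs (y::'a). iter_partial bs (hk_fun t y) = (\<lambda>z. complex_of_real (hk_poly t (P bs) (y - z)))"
     "\<And>bs. 0 \<le> C bs"
     "\<And>bs (y::'a) z. (1 + norm z) ^ N * \<bar>hk_poly t (P bs) (y - z)\<bar> \<le> C bs * (1 + norm y) ^ N"
     "\<And>bs (y::'a) y' z. (1 + norm z) ^ N * \<bar>hk_poly t (P bs) (y' - z) - hk_poly t (P bs) (y - z)\<bar> \<le> C bs * ((1 + norm y) ^ N * (1 + norm y') ^ N * norm (y' - y))"
    using hk_fun_partials[OF t, of N] by blast
  let ?K = "C0 * (\<Sum>bs | set bs \<subseteq> Basis \<and> length bs \<le> N. C bs)"
  have "norm (heat t \<phi> y) \<le> ?K * (1 + norm y) ^ N" for y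
  proof -
    have "norm (\<phi> (hk_fun t y)) \<le> C0 * (\<Sum>bs | set bs \<subseteq> Basis \<and> length bs \<le> N. C bs * (1 + norm y) ^ N)"
      by (rule C0(2)[OF hk_fun_schwartz[OF t]]) (simp add: PC(2,4))
    then show ?thesis by (simp add: heat_def sum_distrib_right[symmetric] mult.assoc)
  qed
  moreover have "norm (heat t \<phi> y' - heat t \<phi> y) \<le> ?K * ((1 + norm y) ^ N * (1 + norm y') ^ N * norm (y' - y))" for y y'
  proof -
    note d = tempered_diff[OF \<phi> hk_fun_schwartz[OF t, of y'] hk_fun_schwartz[OF t, of y]]
    have "norm (\<phi> (\<lambda>x. hk_fun t y' x - hk_fun t y x)) \<le> C0 * (\<Sum>bs | set bs \<subseteq> Basis \<and> length bs \<le> N. C bs * ((1 + norm y) ^ N * (1 + norm y') ^ N * norm (y' - y)))"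
    proof (rule C0(2)[OF d(2)], intro allI impI)
      fix bs :: "'a list" and x :: 'a assume bs: "set bs \<subseteq> Basis"
      show "(1 + norm x) ^ N * norm (iter_partial bs (\<lambda>x. hk_fun t y' x - hk_fun t y x) x) \<le> C bs * ((1 + norm y) ^ N * (1 + norm y') ^ N * norm (y' - y))"
        unfolding d(3)[OF bs] PC(2) unfolding of_real_diff[symmetric] norm_of_real by (rule PC(5))
    qed
    then show ?thesis by (simp add: heat_def d(1) sum_distrib_right[symmetric] mult.assoc)
  qed
  moreover have "?K \<ge> 0" using C0(1) PC(3) by (simp add: sum_nonneg)
  ultimately show ?thesis by blast
qed

lemma continuous_on_heat:
  assumes \<phi>: "tempered_distribution (\<phi> :: 'a::euclidean_space dist)" and t: "t > 0"
  shows "continuous_on UNIV (heat t \<phi>)"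
proof -
  obtain N C where C: "C \<ge> 0" "\<And>y y'. norm (heat t \<phi> y' - heat t \<phi> y) \<le> C * ((1 + norm y) ^ N * (1 + norm y') ^ N * norm (y' - y))"
    using heat_tempered_bounds[OF \<phi> t] by blast
  have "(heat t \<phi> \<longlongrightarrow> heat t \<phi> y) (at y)" for y
  proof -
    have "((\<lambda>y'. C * ((1 + norm y) ^ N * (1 + norm y') ^ N * norm (y' - y))) \<longlongrightarrow> C * ((1 + norm y) ^ N * (1 + norm y) ^ N * norm (y - y))) (at y)"
      by (intro tendsto_intros)
    then have "((\<lambda>y'. C * ((1 + norm y) ^ N * (1 + norm y') ^ N * norm (y' - y))) \<longlongrightarrow> 0) (at y)" by simp
    then have "((\<lambda>y'. heat t \<phi> y' - heat t \<phi> y) \<longlongrightarrow> 0) (at y)"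
      by (rule Lim_null_comparison[rotated]) (use C in auto)
    then show ?thesis by (rule LIM_zero_cancel)
  qed
  then show ?thesis by (simp add: continuous_on_def)
qed

text \<open>A Riemann sum whose nodes are the values of F and whose masses are the integrals of h
  over the level sets equals the integral with y rounded to F y. This is how finite combinations of
  kernels approximate a convolution.\<close>

lemma simple_function_integral_sum:
  fixes F :: "'a::euclidean_space \<Rightarrow> 'a" and g :: "'a \<Rightarrow> complex" and h :: "'a \<Rightarrow> real"
  assumes F: "simple_function lborel F" and h: "integrable lborel h"
  shows "(\<Sum>v\<in>range F. complex_of_real (LINT y|lborel. h y * indicator (F -` {v}) y) * g v) = (LINT y|lborel. complex_of_real (h y) * g (F y))"
    and "integrable lborel (\<lambda>y. complex_of_real (h y) * g (F y))"
proof -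
  have fin: "finite (range F)" using simple_functionD(1)[OF F] by simp
  have m: "F -` {v} \<in> sets borel" for v using simple_functionD(2)[OF F, of "{v}"] by simp
  have int: "integrable lborel (\<lambda>y. h y * indicator (F -` {v}) y)" for v
    using integrable_mult_indicator[OF _ h, of "F -` {v}"] m[of v] by (simp add: mult.commute)
  have intc: "integrable lborel (\<lambda>y. complex_of_real (h y * indicator (F -` {v}) y) * g v)" for v
    by (intro integrable_mult_left integrable_of_real int)
  have eq: "(\<Sum>v\<in>range F. complex_of_real (h y * indicator (F -` {v}) y) * g v) = complex_of_real (h y) * g (F y)" for y
  proof -
    have "(\<Sum>v\<in>range F. complex_of_real (h y * indicator (F -` {v}) y) * g v) = (\<Sum>v\<in>range F. if v = F y then complex_of_real (h y) * g v else 0)"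
      by (intro sum.cong) (auto simp: indicator_def)
    then show ?thesis using fin by simp
  qed
  have "(\<Sum>v\<in>range F. complex_of_real (LINT y|lborel. h y * indicator (F -` {v}) y) * g v)
    = (\<Sum>v\<in>range F. (LINT y|lborel. complex_of_real (h y * indicator (F -` {v}) y) * g v))"
    using integral_of_real[of lborel] by (intro sum.cong refl) (simp add: Bochner_Integration.integral_mult_left_zero del: of_real_mult)
  also have "\<dots> = (LINT y|lborel. (\<Sum>v\<in>range F. complex_of_real (h y * indicator (F -` {v}) y) * g v))"
    by (rule Bochner_Integration.integral_sum[symmetric]) (rule intc)
  finally show "(\<Sum>v\<in>range F. complex_of_real (LINT y|lborel. h y * indicator (F -` {v}) y) * g v) = (LINT y|lborel. complex_of_real (h y) * g (F y))"
    by (simp only: eq)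
  have "integrable lborel (\<lambda>y. \<Sum>v\<in>range F. complex_of_real (h y * indicator (F -` {v}) y) * g v)"
    by (rule Bochner_Integration.integrable_sum) (rule intc)
  then show "integrable lborel (\<lambda>y. complex_of_real (h y) * g (F y))" by (simp only: eq)
qed

text \<open>The convolution is a limit, in every Schwartz seminorm, of finite combinations of heat kernels,
  so it may be interchanged with a tempered distribution.\<close>

lemma heat_semigroup_tempered:
  fixes \<phi> :: "'a::euclidean_space dist"
  assumes \<phi>: "tempered_distribution \<phi>" and s: "s > 0" and t: "t > 0"
  shows "integrable lborel (\<lambda>y. complex_of_real (heat_kernel s (x - y)) * heat t \<phi> y)"
    and "heat (s + t) \<phi> x = (LINT y|lborel. complex_of_real (heat_kernel s (x - y)) * heat t \<phi> y)"
proof -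
  have st: "s + t > 0" using s t by simp
  obtain N C0 where C0: "C0 \<ge> 0" "\<And>f B. f \<in> schwartz \<Longrightarrow> (\<forall>bs x. set bs \<subseteq> Basis \<longrightarrow> length bs \<le> N \<longrightarrow> (1 + norm x) ^ N * norm (iter_partial bs f x) \<le> B bs) \<Longrightarrow>
     norm (\<phi> f) \<le> C0 * (\<Sum>bs | set bs \<subseteq> Basis \<and> length bs \<le> N. B bs)" using tempered_bound[OF \<phi>] by blast
  obtain P C where PC: "\<And>bs. real_polynomial_function (P bs)" "\<And>bs (y::'a). iter_partial bs (hk_fun t y) = (\<lambda>z. complex_of_real (hk_poly t (P bs) (y - z)))"
     "\<And>bs. 0 \<le> C bs"
     "\<And>bs (y::'a) z. (1 + norm z) ^ N * \<bar>hk_poly t (P bs) (y - z)\<bar> \<le> C bs * (1 + norm y) ^ N"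
     "\<And>bs (y::'a) y' z. (1 + norm z) ^ N * \<bar>hk_poly t (P bs) (y' - z) - hk_poly t (P bs) (y - z)\<bar> \<le> C bs * ((1 + norm y) ^ N * (1 + norm y') ^ N * norm (y' - y))"
    using hk_fun_partials[OF t, of N] by blast
  obtain K D where K: "D \<ge> 0" "\<And>y. norm (heat t \<phi> y) \<le> D * (1 + norm y) ^ K"
    using heat_tempered_bounds[OF \<phi> t] by blast
  let ?h = "\<lambda>y. heat_kernel s (x - y)"
  have hp: "integrable lborel (\<lambda>y. ?h y * (1 + norm y) ^ M)" for M by (rule integrable_heat_kernel_poly[OF s])
  have hi: "integrable lborel ?h" using hp[of 0] by simp
  have cont: "continuous_on UNIV (heat t \<phi>)" by (rule continuous_on_heat[OF \<phi> t])
  then have [measurable]: "heat t \<phi> \<in> borel_measurable borel" by (rule borel_measurable_continuous_onI)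
  note [measurable] = hk_poly_measurable[OF PC(1) t]
  show "integrable lborel (\<lambda>y. complex_of_real (?h y) * heat t \<phi> y)"
  proof (rule Bochner_Integration.integrable_bound[OF integrable_mult_right[OF hp[of K], of D]])
    show "AE y in lborel. norm (complex_of_real (?h y) * heat t \<phi> y) \<le> norm (D * (?h y * (1 + norm y) ^ K))"
    proof (rule AE_I2)
      fix y
      have "?h y * norm (heat t \<phi> y) \<le> ?h y * (D * (1 + norm y) ^ K)" by (intro mult_left_mono K) simp
      then show "norm (complex_of_real (?h y) * heat t \<phi> y) \<le> norm (D * (?h y * (1 + norm y) ^ K))"
        using K(1) by (simp add: norm_mult abs_mult mult_ac)
    qed
  qed measurable
  \<comment> \<open>Simple functions that round each point to a node converging to it, with norm at
    most twice that of the point. The factor 2 provides a common dominating function.\<close>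
  obtain F where F: "\<And>i. simple_function (lborel :: 'a measure) (F i)" "\<And>y. (\<lambda>i. F i y) \<longlonglongrightarrow> y"
    "\<And>i y. dist (F i y) 0 \<le> 2 * dist y (0 :: 'a)"
    using borel_measurable_implies_sequence_metric[of "\<lambda>y::'a. y" lborel 0] by auto
  have Fb: "1 + norm (F i y) \<le> 2 * (1 + norm y)" for i y using F(3)[of i y] by (simp add: dist_norm)
  have [measurable]: "F i \<in> borel_measurable borel" for i using borel_measurable_simple_function[OF F(1)[of i]] by simp
  define m where "m i v = complex_of_real (LINT y|lborel. ?h y * indicator (F i -` {v}) y)" for i v
  define f where "f i = (\<lambda>z. \<Sum>v\<in>range (F i). m i v * hk_fun t v z)" for i
  have fin: "finite (range (F i))" for i using simple_functionD(1)[OF F(1)[of i]] by simp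
  have fS: "f i \<in> schwartz" for i unfolding f_def by (intro schwartz_sum fin hk_fun_schwartz t)
  have "\<phi> (f i) = (\<Sum>v\<in>range (F i). m i v * heat t \<phi> v)" for i
    unfolding f_def heat_def by (intro tempered_sum \<phi> fin hk_fun_schwartz t)
  then have \<phi>f: "\<phi> (f i) = (LINT y|lborel. complex_of_real (?h y) * heat t \<phi> (F i y))" for i
    unfolding m_def by (simp only: simple_function_integral_sum(1)[OF F(1) hi])
  have lim1: "(\<lambda>i. \<phi> (f i)) \<longlonglongrightarrow> (LINT y|lborel. complex_of_real (?h y) * heat t \<phi> y)"
    unfolding \<phi>f
  proof (rule integral_dominated_convergence[where w="\<lambda>y. D * 2 ^ K * (?h y * (1 + norm y) ^ K)"])
    show "integrable lborel (\<lambda>y. D * 2 ^ K * (?h y * (1 + norm y) ^ K))" by (rule integrable_mult_right[OF hp])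
    show "AE y in lborel. (\<lambda>i. complex_of_real (?h y) * heat t \<phi> (F i y)) \<longlonglongrightarrow> complex_of_real (?h y) * heat t \<phi> y"
    proof (intro AE_I2 tendsto_mult_left)
      fix y
      show "(\<lambda>i. heat t \<phi> (F i y)) \<longlonglongrightarrow> heat t \<phi> y"
        using continuous_on_tendsto_compose[OF cont F(2)] by simp
    qed
    show "AE y in lborel. norm (complex_of_real (?h y) * heat t \<phi> (F i y)) \<le> D * 2 ^ K * (?h y * (1 + norm y) ^ K)" for i
    proof (rule AE_I2)
      fix y
      have "norm (heat t \<phi> (F i y)) \<le> D * (1 + norm (F i y)) ^ K" by (rule K)
      also have "\<dots> \<le> D * (2 * (1 + norm y)) ^ K" by (intro mult_left_mono power_mono Fb K) auto
      finally have "norm (heat t \<phi> (F i y)) \<le> D * (2 * (1 + norm y)) ^ K" .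
      then have "?h y * norm (heat t \<phi> (F i y)) \<le> ?h y * (D * (2 * (1 + norm y)) ^ K)" by (rule mult_left_mono) simp
      also have "?h y * (D * (2 * (1 + norm y)) ^ K) = D * 2 ^ K * (?h y * (1 + norm y) ^ K)"
        by (simp only: power_mult_distrib mult_ac)
      finally show "norm (complex_of_real (?h y) * heat t \<phi> (F i y)) \<le> D * 2 ^ K * (?h y * (1 + norm y) ^ K)"
        by (simp add: norm_mult)
    qed
  qed measurable
  \<comment> \<open>One scalar that controls the error in all derivatives simultaneously: the
    Lipschitz estimate in the centre, averaged over y with the kernel.\<close>
  define \<omega> where "\<omega> i = (LINT y|lborel. ?h y * ((1 + norm y) ^ N * (1 + norm (F i y)) ^ N * norm (F i y - y)))" for i
  have dom: "(1 + norm y) ^ N * (1 + norm (F i y)) ^ N * norm (F i y - y) \<le> 2 ^ N * 3 * (1 + norm y) ^ (2 * N + 1)" for i y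
  proof -
    have "norm (F i y - y) \<le> norm (F i y) + norm y" by (rule norm_triangle_ineq4)
    also have "\<dots> \<le> 3 * (1 + norm y)" using F(3)[of i y] by (simp add: dist_norm)
    finally have "(1 + norm y) ^ N * (1 + norm (F i y)) ^ N * norm (F i y - y) \<le> (1 + norm y) ^ N * (2 * (1 + norm y)) ^ N * (3 * (1 + norm y))"
      by (intro mult_mono power_mono Fb) auto
    also have "\<dots> = 2 ^ N * 3 * (1 + norm y) ^ (2 * N + 1)"
    proof -
      have "a ^ N * (2 * a) ^ N * (3 * a) = 2 ^ N * 3 * a ^ (2 * N + 1)" for a :: real
        by (simp add: power_add power_mult power2_eq_square power_mult_distrib)
      then show ?thesis .
    qed
    finally show ?thesis .
  qed
  have wint: "integrable lborel (\<lambda>y. 2 ^ N * 3 * (?h y * (1 + norm y) ^ (2 * N + 1)))" by (rule integrable_mult_right[OF hp])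
  have hdom: "?h y * ((1 + norm y) ^ N * (1 + norm (F i y)) ^ N * norm (F i y - y)) \<le> 2 ^ N * 3 * (?h y * (1 + norm y) ^ (2 * N + 1))" for i y
    using mult_left_mono[OF dom[of y i], of "?h y"] by (simp only: heat_kernel_nonneg mult_ac)
  have \<omega>int: "integrable lborel (\<lambda>y. ?h y * ((1 + norm y) ^ N * (1 + norm (F i y)) ^ N * norm (F i y - y)))" for i
  proof (rule Bochner_Integration.integrable_bound[OF wint])
    show "AE y in lborel. norm (?h y * ((1 + norm y) ^ N * (1 + norm (F i y)) ^ N * norm (F i y - y))) \<le> norm (2 ^ N * 3 * (?h y * (1 + norm y) ^ (2 * N + 1)))"
    proof (rule AE_I2)
      fix y
      show "norm (?h y * ((1 + norm y) ^ N * (1 + norm (F i y)) ^ N * norm (F i y - y))) \<le> norm (2 ^ N * 3 * (?h y * (1 + norm y) ^ (2 * N + 1)))"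
        using hdom[of y i] by (simp add: abs_mult)
    qed
  qed measurable
  have "\<omega> \<longlonglongrightarrow> (LINT y::'a|lborel. 0)"
    unfolding \<omega>_def[abs_def]
  proof (rule integral_dominated_convergence[OF _ _ wint])
    show "AE y in lborel. (\<lambda>i. ?h y * ((1 + norm y) ^ N * (1 + norm (F i y)) ^ N * norm (F i y - y))) \<longlonglongrightarrow> 0"
    proof (rule AE_I2)
      fix y
      have "(\<lambda>i. ?h y * ((1 + norm y) ^ N * (1 + norm (F i y)) ^ N * norm (F i y - y))) \<longlonglongrightarrow> ?h y * ((1 + norm y) ^ N * (1 + norm y) ^ N * norm (y - y))"
        by (intro tendsto_intros F(2))
      then show "(\<lambda>i. ?h y * ((1 + norm y) ^ N * (1 + norm (F i y)) ^ N * norm (F i y - y))) \<longlonglongrightarrow> 0" by simp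
    qed
    show "AE y in lborel. norm (?h y * ((1 + norm y) ^ N * (1 + norm (F i y)) ^ N * norm (F i y - y))) \<le> 2 ^ N * 3 * (?h y * (1 + norm y) ^ (2 * N + 1))" for i
      using hdom by (intro AE_I2) (simp add: abs_mult)
  qed measurable
  then have \<omega>0: "\<omega> \<longlonglongrightarrow> 0" by simp
  have bound: "norm (\<phi> (f i) - \<phi> (hk_fun (s + t) x)) \<le> C0 * (\<Sum>bs | set bs \<subseteq> Basis \<and> length bs \<le> N. C bs * \<omega> i)" for i
  proof -
    note d = tempered_diff[OF \<phi> fS[of i] hk_fun_schwartz[OF st, of x]]
    show ?thesis unfolding d(1)
    proof (rule C0(2)[OF d(2)], intro allI impI)
      fix bs :: "'a list" and z :: 'a assume bs: "set bs \<subseteq> Basis"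
      let ?q = "hk_poly t (P bs)"
      have "iter_partial bs (f i) z = (\<Sum>v\<in>range (F i). m i v * complex_of_real (?q (v - z)))"
        unfolding f_def by (subst iter_partial_sum[OF fin hk_fun_schwartz[OF t] bs]) (simp add: PC(2))
      also have "\<dots> = (LINT y|lborel. complex_of_real (?h y) * complex_of_real (?q (F i y - z)))"
        unfolding m_def by (rule simple_function_integral_sum(1)[OF F(1) hi])
      finally have 1: "iter_partial bs (f i) z = (LINT y|lborel. complex_of_real (?h y) * complex_of_real (?q (F i y - z)))" .
      have i1: "integrable lborel (\<lambda>y. complex_of_real (?h y) * complex_of_real (?q (F i y - z)))"
        by (rule simple_function_integral_sum(2)[OF F(1) hi])
      have i1': "integrable lborel (\<lambda>y. ?h y * ?q (F i y - z))"
        using integrable_Re[OF i1] by simp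
      obtain c where c: "\<And>y. \<bar>?q (y - z)\<bar> \<le> c"
      proof -
        obtain C' where "\<And>(y::'a) z. (1 + norm z) ^ 0 * \<bar>?q (y - z)\<bar> \<le> C' * (1 + norm y) ^ 0"
          using hk_poly_bounds[OF PC(1)[of bs] t, of 0] by blast
        then show ?thesis using that[of C'] by simp
      qed
      have i2': "integrable lborel (\<lambda>y. ?h y * ?q (y - z))"
      proof (rule Bochner_Integration.integrable_bound[OF integrable_mult_right[OF hi, of c]])
        show "AE y in lborel. norm (?h y * ?q (y - z)) \<le> norm (c * ?h y)"
        proof (rule AE_I2)
          fix y
          have "?h y * \<bar>?q (y - z)\<bar> \<le> ?h y * \<bar>c\<bar>" using c[of y] by (intro mult_left_mono) auto
          then show "norm (?h y * ?q (y - z)) \<le> norm (c * ?h y)" by (simp add: abs_mult mult.commute)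
        qed
      qed measurable
      have 2: "iter_partial bs (hk_fun (s + t) x) z = complex_of_real (LINT y|lborel. ?h y * ?q (y - z))"
        by (subst iter_partial_convolution[OF s t PC(1) PC(2) bs]) simp
      have "iter_partial bs (\<lambda>x'. f i x' - hk_fun (s + t) x x') z = complex_of_real (LINT y|lborel. ?h y * (?q (F i y - z) - ?q (y - z)))"
        unfolding d(3)[OF bs] 1 2 right_diff_distrib
        by (subst Bochner_Integration.integral_diff[OF i1' i2']) (simp flip: of_real_mult)
      then have "norm (iter_partial bs (\<lambda>x'. f i x' - hk_fun (s + t) x x') z) = \<bar>LINT y|lborel. ?h y * (?q (F i y - z) - ?q (y - z))\<bar>"
        by (simp only: norm_of_real)
      also have "\<dots> \<le> (LINT y|lborel. \<bar>?h y * (?q (F i y - z) - ?q (y - z))\<bar>)"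
        using integral_norm_bound[of lborel "\<lambda>y. ?h y * (?q (F i y - z) - ?q (y - z))"] by simp
      finally have "(1 + norm z) ^ N * norm (iter_partial bs (\<lambda>x'. f i x' - hk_fun (s + t) x x') z)
        \<le> (1 + norm z) ^ N * (LINT y|lborel. \<bar>?h y * (?q (F i y - z) - ?q (y - z))\<bar>)"
        by (rule mult_left_mono) simp
      also have "\<dots> = (LINT y|lborel. (1 + norm z) ^ N * \<bar>?h y * (?q (F i y - z) - ?q (y - z))\<bar>)" by simp
      also have "\<dots> \<le> (LINT y|lborel. C bs * (?h y * ((1 + norm y) ^ N * (1 + norm (F i y)) ^ N * norm (F i y - y))))"
      proof (rule integral_mono)
        have "integrable lborel (\<lambda>y. ?h y * (?q (F i y - z) - ?q (y - z)))"
          unfolding right_diff_distrib by (rule Bochner_Integration.integrable_diff[OF i1' i2'])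
        then show "integrable lborel (\<lambda>y. (1 + norm z) ^ N * \<bar>?h y * (?q (F i y - z) - ?q (y - z))\<bar>)"
          by (intro integrable_mult_right integrable_abs)
        show "integrable lborel (\<lambda>y. C bs * (?h y * ((1 + norm y) ^ N * (1 + norm (F i y)) ^ N * norm (F i y - y))))"
          by (rule integrable_mult_right[OF \<omega>int])
        fix y
        have "?h y * ((1 + norm z) ^ N * \<bar>?q (F i y - z) - ?q (y - z)\<bar>) \<le> ?h y * (C bs * ((1 + norm y) ^ N * (1 + norm (F i y)) ^ N * norm (F i y - y)))"
          by (intro mult_left_mono PC(5)) simp
        then show "(1 + norm z) ^ N * \<bar>?h y * (?q (F i y - z) - ?q (y - z))\<bar> \<le> C bs * (?h y * ((1 + norm y) ^ N * (1 + norm (F i y)) ^ N * norm (F i y - y)))"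
          by (simp only: abs_mult abs_of_nonneg[OF heat_kernel_nonneg] mult.left_commute)
      qed
      also have "\<dots> = C bs * \<omega> i" by (simp add: \<omega>_def)
      finally show "(1 + norm z) ^ N * norm (iter_partial bs (\<lambda>x'. f i x' - hk_fun (s + t) x x') z) \<le> C bs * \<omega> i" .
    qed
  qed
  have "(\<lambda>i. C0 * (\<Sum>bs | set bs \<subseteq> Basis \<and> length bs \<le> N. C bs * \<omega> i)) \<longlonglongrightarrow> C0 * (\<Sum>bs | set bs \<subseteq> (Basis::'a set) \<and> length bs \<le> N. C bs * 0)"
    by (intro tendsto_intros \<omega>0)
  then have "(\<lambda>i. C0 * (\<Sum>bs | set bs \<subseteq> Basis \<and> length bs \<le> N. C bs * \<omega> i)) \<longlonglongrightarrow> 0" by simp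
  then have "(\<lambda>i. \<phi> (f i) - \<phi> (hk_fun (s + t) x)) \<longlonglongrightarrow> 0"
    by (rule Lim_null_comparison[rotated]) (intro always_eventually allI bound)
  then have "(\<lambda>i. \<phi> (f i)) \<longlonglongrightarrow> \<phi> (hk_fun (s + t) x)" by (rule LIM_zero_cancel)
  from LIMSEQ_unique[OF this lim1] show "heat (s + t) \<phi> x = (LINT y|lborel. complex_of_real (?h y) * heat t \<phi> y)"
    by (simp add: heat_def)
qed

text \<open>The semigroup law is kept as a property almost everywhere, with absolutely convergent
  integrals. In this form it covers tempered distributions as well as \<open>dist_of\<close> of
  homogeneous data, where convergence is established only almost everywhere, and it passes to
  differences.\<close>

definition sg :: "(real \<Rightarrow> 'a::euclidean_space \<Rightarrow> complex) \<Rightarrow> bool" where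
  "sg h \<longleftrightarrow> (\<forall>t>0. h t \<in> borel_measurable borel) \<and>
     (\<forall>s>0. \<forall>t>0. AE x in lborel. integrable lborel (\<lambda>y. complex_of_real (heat_kernel s (x - y)) * h t y) \<and>
        h (s + t) x = (LINT y|lborel. complex_of_real (heat_kernel s (x - y)) * h t y))"

lemma sg_tempered: "tempered_distribution \<phi> \<Longrightarrow> sg (\<lambda>t. heat t \<phi>)"
  unfolding sg_def
  using heat_semigroup_tempered[of \<phi>] borel_measurable_continuous_onI[OF continuous_on_heat[of \<phi>]] by auto

lemma sg_diff:
  assumes g: "sg g" and h: "sg h"
  shows "sg (\<lambda>t x. g t x - h t x)"
  unfolding sg_def
proof (intro conjI allI impI)
  fix t :: real assume t: "t > 0"
  show "(\<lambda>x. g t x - h t x) \<in> borel_measurable borel" using g h t by (intro borel_measurable_diff) (auto simp: sg_def)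
next
  fix s t :: real assume s: "s > 0" and t: "t > 0"
  have "AE x in lborel. integrable lborel (\<lambda>y. complex_of_real (heat_kernel s (x - y)) * g t y) \<and>
        g (s + t) x = (LINT y|lborel. complex_of_real (heat_kernel s (x - y)) * g t y)"
    "AE x in lborel. integrable lborel (\<lambda>y. complex_of_real (heat_kernel s (x - y)) * h t y) \<and>
        h (s + t) x = (LINT y|lborel. complex_of_real (heat_kernel s (x - y)) * h t y)"
    using g h s t by (auto simp: sg_def)
  then show "AE x in lborel. integrable lborel (\<lambda>y. complex_of_real (heat_kernel s (x - y)) * (g t y - h t y)) \<and>
        g (s + t) x - h (s + t) x = (LINT y|lborel. complex_of_real (heat_kernel s (x - y)) * (g t y - h t y))"
    by eventually_elim (simp add: right_diff_distrib)
qed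

text \<open>Real part, imaginary part and identity at once: maps that commute with real kernels and
  with integrals and do not increase the modulus.\<close>

definition real_lin :: "(complex \<Rightarrow> complex) \<Rightarrow> bool" where
  "real_lin c \<longleftrightarrow> bounded_linear c \<and> (\<forall>r z. c (complex_of_real r * z) = complex_of_real r * c z) \<and> (\<forall>z. norm (c z) \<le> norm z)"

lemma real_lin_Re: "real_lin (\<lambda>z. complex_of_real (Re z))" and real_lin_Im: "real_lin (\<lambda>z. complex_of_real (Im z))"
  and real_lin_id: "real_lin (\<lambda>z. z)"
  unfolding real_lin_def
  by (auto intro: bounded_linear_compose[OF bounded_linear_of_real bounded_linear_Re] bounded_linear_compose[OF bounded_linear_of_real bounded_linear_Im]
      abs_Re_le_cmod abs_Im_le_cmod)

lemma sg_real_lin: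
  assumes c: "real_lin c" and h: "sg h"
  shows "sg (\<lambda>t x. c (h t x))"
  unfolding sg_def
proof (intro conjI allI impI)
  have bl: "bounded_linear c" and cr: "\<And>r z. c (complex_of_real r * z) = complex_of_real r * c z" using c by (auto simp: real_lin_def)
  have cm: "c \<in> borel_measurable borel" by (intro borel_measurable_continuous_onI linear_continuous_on bl)
  fix t :: real assume t: "t > 0"
  show "(\<lambda>x. c (h t x)) \<in> borel_measurable borel" using h t by (auto simp: sg_def intro: measurable_compose[OF _ cm])
next
  have bl: "bounded_linear c" and cr: "\<And>r z. c (complex_of_real r * z) = complex_of_real r * c z" using c by (auto simp: real_lin_def)
  fix s t :: real assume s: "s > 0" and t: "t > 0"
  have "AE x in lborel. integrable lborel (\<lambda>y. complex_of_real (heat_kernel s (x - y)) * h t y) \<and>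
        h (s + t) x = (LINT y|lborel. complex_of_real (heat_kernel s (x - y)) * h t y)"
    using h s t by (auto simp: sg_def)
  then show "AE x in lborel. integrable lborel (\<lambda>y. complex_of_real (heat_kernel s (x - y)) * c (h t y)) \<and>
        c (h (s + t) x) = (LINT y|lborel. complex_of_real (heat_kernel s (x - y)) * c (h t y))"
    unfolding cr[symmetric]
    by eventually_elim (auto simp: integral_bounded_linear[OF bl] intro: integrable_bounded_linear[OF bl])
qed

lemma norm_integral_le_nn:
  fixes f :: "'b \<Rightarrow> complex"
  assumes "integrable M f"
  shows "ennreal (norm (integral\<^sup>L M f)) \<le> (\<integral>\<^sup>+x. ennreal (norm (f x)) \<partial>M)"
  using integral_norm_bound_ennreal[OF assms] by simp

lemma sg_hop:
  assumes h: "sg h" and t: "t > 0"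
  shows "AE x in lborel. ennreal (norm (h t x)) \<le> hop (t / 2) (\<lambda>y. ennreal (norm (h (t / 2) y))) x"
proof -
  have "t / 2 > 0" using t by simp
  then have "AE x in lborel. integrable lborel (\<lambda>y. complex_of_real (heat_kernel (t / 2) (x - y)) * h (t / 2) y) \<and>
        h (t / 2 + t / 2) x = (LINT y|lborel. complex_of_real (heat_kernel (t / 2) (x - y)) * h (t / 2) y)"
    using h unfolding sg_def by blast
  then show ?thesis
  proof eventually_elim
    case (elim x)
    have "ennreal (norm (h t x)) \<le> (\<integral>\<^sup>+y. ennreal (norm (complex_of_real (heat_kernel (t / 2) (x - y)) * h (t / 2) y)) \<partial>lborel)"
      using norm_integral_le_nn[of lborel "\<lambda>y. complex_of_real (heat_kernel (t / 2) (x - y)) * h (t / 2) y"] elim by simp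
    then show ?case by (simp add: hop_def norm_mult ennreal_mult)
  qed
qed

lemma heat_dist_of_le:
  fixes \<Phi> :: "'a::euclidean_space \<Rightarrow> complex"
  assumes [measurable]: "\<Phi> \<in> borel_measurable borel" and b: "AE y in lborel. norm (\<Phi> y) \<le> \<epsilon> * norm y powr (- \<sigma>)" and \<epsilon>: "0 \<le> \<epsilon>"
  shows "ennreal (norm (heat t (dist_of \<Phi>) x)) \<le> ennreal \<epsilon> * hop t (\<lambda>y. ennreal (norm y powr (- \<sigma>))) x"
    and "(\<integral>\<^sup>+y. ennreal (norm (\<Phi> y * complex_of_real (heat_kernel t (x - y)))) \<partial>lborel) \<le> ennreal \<epsilon> * hop t (\<lambda>y. ennreal (norm y powr (- \<sigma>))) x"
proof -
  show 2: "(\<integral>\<^sup>+y. ennreal (norm (\<Phi> y * complex_of_real (heat_kernel t (x - y)))) \<partial>lborel) \<le> ennreal \<epsilon> * hop t (\<lambda>y. ennreal (norm y powr (- \<sigma>))) x"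
  proof -
    have "(\<integral>\<^sup>+y. ennreal (norm (\<Phi> y * complex_of_real (heat_kernel t (x - y)))) \<partial>lborel)
      \<le> (\<integral>\<^sup>+y. ennreal (heat_kernel t (x - y)) * (ennreal \<epsilon> * ennreal (norm y powr (- \<sigma>))) \<partial>lborel)"
    proof (rule nn_integral_mono_AE)
      show "AE y in lborel. ennreal (norm (\<Phi> y * complex_of_real (heat_kernel t (x - y)))) \<le> ennreal (heat_kernel t (x - y)) * (ennreal \<epsilon> * ennreal (norm y powr (- \<sigma>)))"
        using b
      proof eventually_elim
        case (elim y)
        have "heat_kernel t (x - y) * norm (\<Phi> y) \<le> heat_kernel t (x - y) * (\<epsilon> * norm y powr (- \<sigma>))" using elim by (intro mult_left_mono) auto
        then show ?case using \<epsilon> by (simp add: norm_mult ennreal_mult[symmetric] mult.commute ennreal_leI)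
      qed
    qed
    also have "\<dots> = ennreal \<epsilon> * hop t (\<lambda>y. ennreal (norm y powr (- \<sigma>))) x"
      unfolding hop_def[symmetric] by (rule hop_cmult) measurable
    finally show ?thesis .
  qed
  show "ennreal (norm (heat t (dist_of \<Phi>) x)) \<le> ennreal \<epsilon> * hop t (\<lambda>y. ennreal (norm y powr (- \<sigma>))) x"
  proof (cases "integrable lborel (\<lambda>y. \<Phi> y * complex_of_real (heat_kernel t (x - y)))")
    case True
    from order_trans[OF norm_integral_le_nn[OF True] 2] show ?thesis by (simp add: heat_def dist_of_def)
  next
    \<comment> \<open>Without integrability the integral has the default value 0, and the bound is
      trivial.\<close>
    case False
    then show ?thesis by (simp add: heat_def dist_of_def not_integrable_integral_eq)
  qed
qed

lemma hop_homogeneous_finite: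
  assumes \<sigma>: "0 \<le> \<sigma>" "\<sigma> < real DIM('a::euclidean_space)" and t: "t > 0"
  shows "AE x::'a in lborel. hop t (\<lambda>y. ennreal (norm y powr (- \<sigma>))) x < \<infinity>"
proof -
  obtain C where "\<And>t. t > 0 \<Longrightarrow> wk 0 (C * t powr (- ((\<sigma> - 0 - real DIM('a) * 0) / 2)))
    (\<lambda>x::'a. ennreal (norm x powr 0) * hop t (\<lambda>y. ennreal (norm y powr (- \<sigma>))) x)"
    using hop_homogeneous[where 'a='a, OF \<sigma>, of 0 0] \<sigma> by auto
  from wk_AE_finite[OF this[OF t]] AE_lborel_nonzero show ?thesis
    by eventually_elim (simp add: powr_zero_eq_one)
qed

text \<open>Fubini's theorem for the double kernel. The absolute integral is at most \<epsilon>
  times the evolution of the homogeneous power at time s + t, so the law holds wherever the latter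
  is finite, which is almost everywhere.\<close>

lemma sg_dist_of:
  fixes \<Phi> :: "'a::euclidean_space \<Rightarrow> complex"
  assumes [measurable]: "\<Phi> \<in> borel_measurable borel" and b: "AE y in lborel. norm (\<Phi> y) \<le> \<epsilon> * norm y powr (- \<sigma>)" and \<epsilon>: "0 \<le> \<epsilon>"
    and \<sigma>: "0 \<le> \<sigma>" "\<sigma> < real DIM('a)"
  shows "sg (\<lambda>t. heat t (dist_of \<Phi>))"
  unfolding sg_def
proof (intro conjI allI impI)
  fix t :: real assume "t > 0"
  show "heat t (dist_of \<Phi>) \<in> borel_measurable borel"
    unfolding heat_def dist_of_def by measurable
next
  fix s t :: real assume s: "s > 0" and t: "t > 0"
  then have "s + t > 0" by simp
  from hop_homogeneous_finite[OF \<sigma> this]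
  show "AE x in lborel. integrable lborel (\<lambda>y. complex_of_real (heat_kernel s (x - y)) * heat t (dist_of \<Phi>) y) \<and>
        heat (s + t) (dist_of \<Phi>) x = (LINT y|lborel. complex_of_real (heat_kernel s (x - y)) * heat t (dist_of \<Phi>) y)"
  proof eventually_elim
    case (elim x)
    let ?f = "\<lambda>(z, y). complex_of_real (heat_kernel s (x - y)) * (\<Phi> z * complex_of_real (heat_kernel t (y - z)))"
    have [measurable]: "?f \<in> borel_measurable (lborel \<Otimes>\<^sub>M lborel)" by measurable
    have conv: "(\<integral>\<^sup>+y. ennreal (norm (?f (z, y))) \<partial>lborel) = ennreal (norm (\<Phi> z * complex_of_real (heat_kernel (s + t) (x - z))))" for z
    proof -
      have "(\<integral>\<^sup>+y. ennreal (norm (?f (z, y))) \<partial>lborel)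
        = (\<integral>\<^sup>+y. ennreal (norm (\<Phi> z)) * (ennreal (heat_kernel s (x - y)) * ennreal (heat_kernel t (y - z))) \<partial>lborel)"
        by (intro nn_integral_cong) (simp add: norm_mult ennreal_mult mult_ac)
      also have "\<dots> = ennreal (norm (\<Phi> z)) * ennreal (heat_kernel (s + t) (x - z))"
        by (subst nn_integral_cmult) (simp_all add: heat_kernel_convolution[OF s t])
      finally show ?thesis by (simp add: norm_mult ennreal_mult)
    qed
    have int: "integrable (lborel \<Otimes>\<^sub>M lborel) ?f"
    proof (rule integrableI_bounded)
      have "(\<integral>\<^sup>+p. ennreal (norm (?f p)) \<partial>(lborel \<Otimes>\<^sub>M lborel)) = (\<integral>\<^sup>+z. (\<integral>\<^sup>+y. ennreal (norm (?f (z, y))) \<partial>lborel) \<partial>lborel)"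
        by (rule lborel.nn_integral_fst[symmetric]) measurable
      also have "\<dots> = (\<integral>\<^sup>+z. ennreal (norm (\<Phi> z * complex_of_real (heat_kernel (s + t) (x - z)))) \<partial>lborel)"
        by (simp only: conv)
      also have "\<dots> \<le> ennreal \<epsilon> * hop (s + t) (\<lambda>y. ennreal (norm y powr (- \<sigma>))) x"
        by (rule heat_dist_of_le(2)[OF assms(1) b \<epsilon>])
      also have "\<dots> < \<infinity>" using elim by (simp add: ennreal_mult_less_top)
      finally show "(\<integral>\<^sup>+p. ennreal (norm (?f p)) \<partial>(lborel \<Otimes>\<^sub>M lborel)) < \<infinity>" .
    qed measurable
    have 1: "(LINT z|lborel. LINT y|lborel. ?f (z, y)) = (LINT y|lborel. LINT z|lborel. ?f (z, y))"
      using lborel_pair.Fubini_integral[of "\<lambda>z y. ?f (z, y)"] int by simp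
    have 2: "(LINT z|lborel. ?f (z, y)) = complex_of_real (heat_kernel s (x - y)) * heat t (dist_of \<Phi>) y" for y
      by (simp add: heat_def dist_of_def)
    have 3: "(LINT y|lborel. ?f (z, y)) = \<Phi> z * complex_of_real (heat_kernel (s + t) (x - z))" for z
    proof -
      have "(LINT y|lborel. heat_kernel s (x - y) * heat_kernel t (y - z)) = heat_kernel (s + t) (x - z)"
        using heat_kernel_convolution[OF s t, of x z]
        by (intro integral_eq_nn_integral[THEN trans]) (auto simp: ennreal_mult)
      moreover have "(LINT y|lborel. ?f (z, y)) = (LINT y|lborel. \<Phi> z * complex_of_real (heat_kernel s (x - y) * heat_kernel t (y - z)))"
        by (intro Bochner_Integration.integral_cong) (auto simp: mult_ac)
      ultimately show ?thesis by (simp only: integral_mult_right_zero integral_complex_of_real)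
    qed
    have "integrable lborel (\<lambda>y. LINT z|lborel. ?f (z, y))"
      using lborel_pair.integrable_snd[of "\<lambda>z y. ?f (z, y)"] int by simp
    moreover have "heat (s + t) (dist_of \<Phi>) x = (LINT z|lborel. LINT y|lborel. ?f (z, y))"
      unfolding 3 by (simp add: heat_def dist_of_def)
    ultimately show ?case unfolding 1 2 by simp
  qed
qed

section \<open>Mild solutions\<close>

text \<open>The Duhamel integrand as one function on space-time, zero outside (0, t). By the
  integrability clause of \<open>mild_solution\<close> the iterated integral becomes one Bochner
  integral, to which linear maps and norm bounds apply directly.\<close>

definition dker :: "real \<Rightarrow> 'a::euclidean_space \<Rightarrow> (real \<Rightarrow> 'a \<Rightarrow> complex) \<Rightarrow> real \<times> 'a \<Rightarrow> complex" where
  "dker t x F = (\<lambda>(\<tau>, y). indicator {0<..<t} \<tau> *\<^sub>R (complex_of_real (heat_kernel (t - \<tau>) (x - y)) * F \<tau> y))"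

lemma mild_solution_dker:
  assumes m: "mild_solution a \<phi> F u" and t: "t > 0"
  shows "AE x in lborel. integrable (lborel \<Otimes>\<^sub>M lborel) (dker t x F) \<and>
    u t x = heat t \<phi> x + complex_of_real a * integral\<^sup>L (lborel \<Otimes>\<^sub>M lborel) (dker t x F)"
proof -
  have "AE x in lborel.
        set_integrable lborel ({0<..<t} \<times> UNIV)
          (\<lambda>(\<tau>, y). complex_of_real (heat_kernel (t - \<tau>) (x - y)) * F \<tau> y) \<and>
        u t x = heat t \<phi> x
          + complex_of_real a * (LINT \<tau>:{0<..<t}|lborel. heat_fun (t - \<tau>) (F \<tau>) x)"
    using m t by (simp add: mild_solution_def)
  then show ?thesis
  proof eventually_elim
    case (elim x)
    have "(\<lambda>p. indicator ({0<..<t} \<times> UNIV) p *\<^sub>R (case p of (\<tau>, y) \<Rightarrow> complex_of_real (heat_kernel (t - \<tau>) (x - y)) * F \<tau> y)) = dker t x F"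
      by (auto simp: dker_def fun_eq_iff indicator_def)
    then have int: "integrable (lborel \<Otimes>\<^sub>M lborel) (dker t x F)"
      using elim by (simp add: set_integrable_def lborel_prod)
    have "(LINT \<tau>:{0<..<t}|lborel. heat_fun (t - \<tau>) (F \<tau>) x) = (LINT \<tau>|lborel. LINT y|lborel. dker t x F (\<tau>, y))"
      unfolding set_lebesgue_integral_def heat_fun_def dker_def by (intro Bochner_Integration.integral_cong) auto
    also have "\<dots> = integral\<^sup>L (lborel \<Otimes>\<^sub>M lborel) (dker t x F)"
      using lborel_pair.integral_fst'[OF int] by simp
    finally show ?case using elim int by simp
  qed
qed

lemma nn_integral_dker:
  assumes "integrable (lborel \<Otimes>\<^sub>M lborel) (dker t x F)"
  shows "(\<integral>\<^sup>+p. ennreal (norm (dker t x F p)) \<partial>(lborel \<Otimes>\<^sub>M lborel)) = duh (\<lambda>\<tau> y. ennreal (norm (F \<tau> y))) t x"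
proof -
  have [measurable]: "dker t x F \<in> borel_measurable (lborel \<Otimes>\<^sub>M lborel)" using assms by auto
  have "(\<integral>\<^sup>+p. ennreal (norm (dker t x F p)) \<partial>(lborel \<Otimes>\<^sub>M lborel)) = (\<integral>\<^sup>+\<tau>. (\<integral>\<^sup>+y. ennreal (norm (dker t x F (\<tau>, y))) \<partial>lborel) \<partial>lborel)"
    by (rule lborel.nn_integral_fst[symmetric]) measurable
  also have "\<dots> = duh (\<lambda>\<tau> y. ennreal (norm (F \<tau> y))) t x"
    unfolding duh_def hop_def dker_def
    by (intro nn_integral_cong) (auto simp: indicator_def norm_mult ennreal_mult)
  finally show ?thesis .
qed

text \<open>As c is bounded, linear and commutes with the real kernel, it passes through the
  integral to the source, and \<bar>a\<bar> = 1 removes the sign. The map acts on the first solution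
  only, since the second is the profile with which a component is compared.\<close>

lemma mild_diff_le:
  assumes u: "mild_solution a \<phi> F u" and v: "mild_solution a \<theta> G v" and a: "\<bar>a\<bar> = 1" and c: "real_lin c" and t: "t > 0"
  shows "AE x in lborel. ennreal (norm (c (u t x) - v t x)) \<le> ennreal (norm (c (heat t \<phi> x) - heat t \<theta> x))
     + duh (\<lambda>\<tau> y. ennreal (norm (c (F \<tau> y) - G \<tau> y))) t x"
  using mild_solution_dker[OF u t] mild_solution_dker[OF v t]
proof eventually_elim
  case (elim x)
  let ?M = "lborel \<Otimes>\<^sub>M lborel :: (real \<times> 'a) measure"
  have bl: "bounded_linear c" and cr: "\<And>r z. c (complex_of_real r * z) = complex_of_real r * c z" using c by (auto simp: real_lin_def)
  have cs: "c (r *\<^sub>R z) = r *\<^sub>R c z" for r z using cr[of r z] by (simp add: scaleR_conv_of_real)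
  have cr': "c (z * complex_of_real r) = c z * complex_of_real r" for r z using cr[of r z] by (simp add: mult.commute)
  have cd: "(\<lambda>p. c (dker t x F p) - dker t x G p) = dker t x (\<lambda>\<tau> y. c (F \<tau> y) - G \<tau> y)"
    by (auto simp: dker_def fun_eq_iff cs cr cr' algebra_simps)
  have ic: "integrable ?M (\<lambda>p. c (dker t x F p))" using elim by (intro integrable_bounded_linear[OF bl]) simp
  have id: "integrable ?M (dker t x (\<lambda>\<tau> y. c (F \<tau> y) - G \<tau> y))"
    unfolding cd[symmetric] using elim ic by (intro Bochner_Integration.integrable_diff) auto
  have "c (u t x) - v t x = (c (heat t \<phi> x) - heat t \<theta> x) + complex_of_real a * integral\<^sup>L ?M (dker t x (\<lambda>\<tau> y. c (F \<tau> y) - G \<tau> y))"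
  proof -
    have e1: "c (u t x) = c (heat t \<phi> x) + complex_of_real a * integral\<^sup>L ?M (\<lambda>p. c (dker t x F p))"
      using elim by (simp add: linear_add[OF bounded_linear.linear[OF bl]] cr integral_bounded_linear[OF bl])
    have e2: "integral\<^sup>L ?M (dker t x (\<lambda>\<tau> y. c (F \<tau> y) - G \<tau> y)) = integral\<^sup>L ?M (\<lambda>p. c (dker t x F p)) - integral\<^sup>L ?M (dker t x G)"
      unfolding cd[symmetric] using elim ic by (intro Bochner_Integration.integral_diff) auto
    have e3: "v t x = heat t \<theta> x + complex_of_real a * integral\<^sup>L ?M (dker t x G)" using elim by simp
    show ?thesis unfolding e1 e2 e3 by (simp only: right_diff_distrib) simp
  qed
  then have "norm (c (u t x) - v t x) \<le> norm (c (heat t \<phi> x) - heat t \<theta> x) + norm (integral\<^sup>L ?M (dker t x (\<lambda>\<tau> y. c (F \<tau> y) - G \<tau> y)))"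
    using norm_triangle_ineq[of "c (heat t \<phi> x) - heat t \<theta> x" "complex_of_real a * integral\<^sup>L ?M (dker t x (\<lambda>\<tau> y. c (F \<tau> y) - G \<tau> y))"] a
    by (simp add: norm_mult)
  then have "ennreal (norm (c (u t x) - v t x)) \<le> ennreal (norm (c (heat t \<phi> x) - heat t \<theta> x)) + ennreal (norm (integral\<^sup>L ?M (dker t x (\<lambda>\<tau> y. c (F \<tau> y) - G \<tau> y))))"
    by (simp add: ennreal_plus[symmetric] ennreal_leI del: ennreal_plus)
  also have "ennreal (norm (integral\<^sup>L ?M (dker t x (\<lambda>\<tau> y. c (F \<tau> y) - G \<tau> y)))) \<le> duh (\<lambda>\<tau> y. ennreal (norm (c (F \<tau> y) - G \<tau> y))) t x"
    using norm_integral_le_nn[OF id] nn_integral_dker[OF id] by simp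
  finally show ?case by (simp add: add_left_mono)
qed

text \<open>Comparison with the zero solution turns the estimate for differences into one for a
  single solution.\<close>

lemma mild_solution_zero: "mild_solution a (\<lambda>_. 0) (\<lambda>_ _. 0) (\<lambda>_ _. 0)"
  by (simp add: mild_solution_def heat_def heat_fun_def set_lebesgue_integral_def set_integrable_def case_prod_unfold)

lemma mild_le:
  assumes u: "mild_solution a \<phi> F u" and a: "\<bar>a\<bar> = 1" and c: "real_lin c" and t: "t > 0"
  shows "AE x in lborel. ennreal (norm (c (u t x))) \<le> ennreal (norm (c (heat t \<phi> x))) + duh (\<lambda>\<tau> y. ennreal (norm (c (F \<tau> y)))) t x"
  using mild_diff_le[OF u mild_solution_zero a c t] by (simp add: heat_def)

text \<open>The equation read backwards: it recovers a bound for the free evolution from one for the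
  solution, in a space where the data are not estimated directly.\<close>

lemma mild_heat_le:
  assumes u: "mild_solution a \<phi> F u" and a: "\<bar>a\<bar> = 1" and t: "t > 0"
  shows "AE x in lborel. ennreal (norm (heat t \<phi> x)) \<le> ennreal (norm (u t x)) + duh (\<lambda>\<tau> y. ennreal (norm (F \<tau> y))) t x"
  using mild_solution_dker[OF u t]
proof eventually_elim
  case (elim x)
  let ?M = "lborel \<Otimes>\<^sub>M lborel :: (real \<times> 'a) measure"
  have "heat t \<phi> x = u t x - complex_of_real a * integral\<^sup>L ?M (dker t x F)" using elim by simp
  then have "norm (heat t \<phi> x) \<le> norm (u t x) + norm (integral\<^sup>L ?M (dker t x F))"
    using norm_triangle_ineq4[of "u t x" "complex_of_real a * integral\<^sup>L ?M (dker t x F)"] a by (simp add: norm_mult)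
  then have "ennreal (norm (heat t \<phi> x)) \<le> ennreal (norm (u t x)) + ennreal (norm (integral\<^sup>L ?M (dker t x F)))"
    by (simp add: ennreal_plus[symmetric] ennreal_leI del: ennreal_plus)
  also have "ennreal (norm (integral\<^sup>L ?M (dker t x F))) \<le> duh (\<lambda>\<tau> y. ennreal (norm (F \<tau> y))) t x"
    using norm_integral_le_nn[of ?M "dker t x F"] nn_integral_dker[of t x F] elim by simp
  finally show ?case by (simp add: add_left_mono)
qed

lemma norm_hh_source: "norm (hh_source \<gamma> \<alpha> v w t x) = norm x powr \<gamma> * (norm (v t x) powr (\<alpha> - 1) * norm (w t x))"
  by (simp add: hh_source_def norm_mult mult.assoc)

section \<open>Measurable representatives and pointwise bounds for the sources\<close>

lemma duh_cmult:
  assumes F: "jm F"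
  shows "duh (\<lambda>t x. c * F t x) t x = c * duh F t x"
proof -
  note [measurable] = F jm_section[OF F]
  have "duh (\<lambda>t x. c * F t x) t x = (\<integral>\<^sup>+\<tau>. c * (hop (t - \<tau>) (F \<tau>) x * indicator {0<..<t} \<tau>) \<partial>lborel)"
    unfolding duh_def by (intro nn_integral_cong) (simp add: hop_cmult mult.assoc)
  also have "\<dots> = c * duh F t x" unfolding duh_def by (rule nn_integral_cmult) measurable
  finally show ?thesis .
qed

text \<open>Elements of \<open>K_space\<close> are measurable only for positive times. Extension by
  0 makes them jointly measurable over all times, as \<open>jr\<close> and \<open>jm\<close>
  require.\<close>

definition cut :: "(real \<Rightarrow> 'a \<Rightarrow> real) \<Rightarrow> real \<Rightarrow> 'a \<Rightarrow> real" where
  "cut f t x = (if 0 < t then f t x else 0)"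

abbreviation mz :: "(real \<Rightarrow> 'a::euclidean_space \<Rightarrow> complex) \<Rightarrow> bool" where
  "mz u \<equiv> (\<lambda>(t, x). u t x) \<in> borel_measurable (restrict_space borel ({0<..} \<times> UNIV))"

lemma mz_diff: "mz u \<Longrightarrow> mz v \<Longrightarrow> mz (\<lambda>t x. u t x - v t x)"
  using borel_measurable_diff[of "\<lambda>(t, x). u t x" _ "\<lambda>(t, x). v t x"] by (simp add: case_prod_unfold)

lemma mz_real_lin:
  assumes "real_lin c" "mz u" shows "mz (\<lambda>t x. c (u t x))"
proof -
  have "c \<in> borel_measurable borel"
    using assms(1) by (intro borel_measurable_continuous_onI linear_continuous_on) (simp add: real_lin_def)
  from measurable_compose[OF assms(2) this] show ?thesis by (simp add: case_prod_unfold)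
qed

lemma jr_cut:
  fixes u :: "real \<Rightarrow> 'a::euclidean_space \<Rightarrow> complex"
  assumes "mz u" shows "jr (cut (\<lambda>t x. norm (u t x)))"
proof -
  have "{0::real<..} \<times> (UNIV :: 'a set) \<in> sets borel" by (intro borel_open open_Times) auto
  moreover have "(\<lambda>p. norm (case p of (t, x) \<Rightarrow> u t x)) \<in> borel_measurable (restrict_space borel ({0<..} \<times> UNIV))"
    using assms by measurable
  ultimately have "(\<lambda>p. indicator ({0<..} \<times> UNIV) p *\<^sub>R norm (case p of (t, x) \<Rightarrow> u t x)) \<in> borel_measurable borel"
    by (subst borel_measurable_restrict_space_iff[symmetric]) auto
  moreover have "(\<lambda>p. indicator ({0<..} \<times> UNIV) p *\<^sub>R norm (case p of (t, x) \<Rightarrow> u t x)) = case_prod (cut (\<lambda>t x. norm (u t x)))"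
    by (auto simp: cut_def fun_eq_iff indicator_def)
  ultimately show ?thesis by (simp add: borel_prod)
qed

lemma kb_cut: "kb {0<..} e k \<rho> A (\<lambda>t x. ennreal (cut f t x)) \<longleftrightarrow> kb {0<..} e k \<rho> A (enn f)"
  by (simp add: kb_def cut_def)

lemma jm_ennreal: "jr f \<Longrightarrow> jm (enn f)"
  using measurable_compose[OF _ measurable_ennreal, of "case_prod f"] by (simp add: case_prod_unfold)

lemma real_lin_le:
  assumes "real_lin c" shows "norm (c z) \<le> norm z" "c (complex_of_real r * z) = complex_of_real r * c z"
  using assms by (auto simp: real_lin_def)

lemma duh_add3:
  assumes "jm P" "jm S" "jm T"
  shows "duh (\<lambda>t x. P t x + (c * S t x + c * T t x)) t x = duh P t x + (c * duh S t x + c * duh T t x)"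
proof -
  note [measurable] = assms
  have 1: "jm (\<lambda>t x. c * S t x)" "jm (\<lambda>t x. c * T t x)" "jm (\<lambda>t x. c * S t x + c * T t x)" by measurable
  show ?thesis by (simp only: duh_add[OF assms(1) 1(3)] duh_add[OF 1(1,2)] duh_cmult assms)
qed

lemma ennreal_source_le:
  assumes le: "N \<le> norm x powr \<gamma> * (q t x powr \<beta> * D t x) + (c * (norm x powr \<gamma> * (q t x powr (\<beta> - \<theta>1) * (X1 t x powr \<theta>1 * Z t x)))
      + c * (norm x powr \<gamma> * (q t x powr (\<beta> - \<theta>2) * (X2 t x powr \<theta>2 * Z t x))))"
    and nn: "0 \<le> c" "0 \<le> D t x" "0 \<le> Z t x"
  shows "ennreal N \<le> potential \<gamma> \<beta> q (enn D) t x + (ennreal c * source \<gamma> \<beta> q X1 Z \<theta>1 t x + ennreal c * source \<gamma> \<beta> q X2 Z \<theta>2 t x)"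
  using ennreal_leI[OF le] nn by (simp add: potential_def source_def ennreal_mult ennreal_plus)

text \<open>The factor \<kappa> is inflated until \<open>\<kappa> powr \<beta>\<close> equals the
  constant of the linear term, so that the potential is exactly \<open>q powr \<beta>\<close>. The
  second source term is a nonnegative addition that gives both differences the common form of
  \<open>diff_ineq\<close>.\<close>

lemma source_diff_self:
  fixes b v :: "'b::real_normed_vector"
  assumes q: "q = \<kappa> * (U + norm v)" and \<kappa>: "1 \<le> \<kappa>" "\<kappa> powr \<beta> = 1 + 2 * max 1 \<beta>" and r: "0 \<le> r"
    and U: "0 \<le> U" and e: "\<bar>U - norm v\<bar> \<le> norm (b - v) + w" "0 \<le> w" and \<beta>: "0 < \<beta>"
    and \<theta>: "0 < \<theta>1" "\<theta>1 < min 1 \<beta>" "0 < \<theta>2" "\<theta>2 < min 1 \<beta>"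
  shows "norm (r *\<^sub>R (U powr \<beta> *\<^sub>R b) - r *\<^sub>R (norm v powr \<beta> *\<^sub>R v)) \<le> r * (q powr \<beta> * norm (b - v))
     + (2 * max 1 \<beta> * (r * (q powr (\<beta> - \<theta>1) * (w powr \<theta>1 * norm v))) + 2 * max 1 \<beta> * (r * (q powr (\<beta> - \<theta>2) * (w powr \<theta>2 * norm v))))"
proof -
  let ?K = "max 1 \<beta>" and ?Q = "U + norm v"
  have K: "0 \<le> ?K" by simp
  have qQ: "?Q \<le> q" using mult_right_mono[OF \<kappa>(1), of ?Q] U by (simp add: q)
  have q\<beta>: "q powr \<beta> = (1 + 2 * ?K) * ?Q powr \<beta>" using \<kappa> U by (simp add: q powr_mult)
  have "?Q powr (\<beta> - \<theta>1) * (w powr \<theta>1 * norm v) \<le> q powr (\<beta> - \<theta>1) * (w powr \<theta>1 * norm v)"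
    using qQ U \<theta> by (intro mult_right_mono powr_mono2) auto
  then have s: "2 * ?K * (?Q powr (\<beta> - \<theta>1) * (w powr \<theta>1 * norm v)) \<le> 2 * ?K * (q powr (\<beta> - \<theta>1) * (w powr \<theta>1 * norm v))"
    using K by (intro mult_left_mono) auto
  have p: "0 \<le> 2 * ?K * (r * (q powr (\<beta> - \<theta>2) * (w powr \<theta>2 * norm v)))" using K r by simp
  have "norm (r *\<^sub>R (U powr \<beta> *\<^sub>R b) - r *\<^sub>R (norm v powr \<beta> *\<^sub>R v)) = r * norm (U powr \<beta> *\<^sub>R b - norm v powr \<beta> *\<^sub>R v)"
    unfolding scaleR_diff_right[symmetric] using r by simp
  also have "\<dots> \<le> r * ((1 + 2 * ?K) * (?Q powr \<beta> * norm (b - v)) + 2 * ?K * (?Q powr (\<beta> - \<theta>1) * (w powr \<theta>1 * norm v)))"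
    using \<theta> by (intro mult_left_mono nonlinearity_diff_self U e \<beta> r) auto
  also have "\<dots> \<le> r * (q powr \<beta> * norm (b - v) + 2 * ?K * (q powr (\<beta> - \<theta>1) * (w powr \<theta>1 * norm v)))"
    unfolding q\<beta> using s r by (intro mult_left_mono) auto
  also have "\<dots> = r * (q powr \<beta> * norm (b - v)) + 2 * ?K * (r * (q powr (\<beta> - \<theta>1) * (w powr \<theta>1 * norm v)))"
    by (simp only: distrib_left mult.left_commute)
  finally show ?thesis using p by linarith
qed

lemma source_diff_linear:
  fixes b z :: "'b::real_normed_vector"
  assumes q: "U + y \<le> q" and r: "0 \<le> r"
    and U: "0 \<le> U" "0 \<le> y" and e: "\<bar>U - y\<bar> \<le> d + w" "0 \<le> w" "0 \<le> d" and \<beta>: "0 < \<beta>"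
    and \<theta>: "0 < \<theta>1" "\<theta>1 < min 1 \<beta>" "0 < \<theta>2" "\<theta>2 < min 1 \<beta>"
  shows "norm (r *\<^sub>R (U powr \<beta> *\<^sub>R b) - r *\<^sub>R (y powr \<beta> *\<^sub>R z)) \<le> r * (q powr \<beta> * norm (b - z))
     + (2 * max 1 \<beta> * (r * (q powr (\<beta> - \<theta>1) * (d powr \<theta>1 * norm z))) + 2 * max 1 \<beta> * (r * (q powr (\<beta> - \<theta>2) * (w powr \<theta>2 * norm z))))"
proof -
  let ?K = "max 1 \<beta>" and ?Q = "U + y"
  have K: "0 \<le> ?K" by simp
  have "?Q powr (\<beta> - \<theta>) * s \<le> q powr (\<beta> - \<theta>) * s" if "0 \<le> s" "\<theta> \<le> \<beta>" for \<theta> s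
    using q U that by (intro mult_right_mono powr_mono2) auto
  then have "2 * ?K * (?Q powr (\<beta> - \<theta>) * s) \<le> 2 * ?K * (q powr (\<beta> - \<theta>) * s)" if "0 \<le> s" "\<theta> \<le> \<beta>" for \<theta> s
    using K that by (intro mult_left_mono) auto
  then have s: "2 * ?K * (?Q powr (\<beta> - \<theta>1) * (d powr \<theta>1 * norm z)) \<le> 2 * ?K * (q powr (\<beta> - \<theta>1) * (d powr \<theta>1 * norm z))"
    "2 * ?K * (?Q powr (\<beta> - \<theta>2) * (w powr \<theta>2 * norm z)) \<le> 2 * ?K * (q powr (\<beta> - \<theta>2) * (w powr \<theta>2 * norm z))"
    using \<theta> by auto
  have b: "?Q powr \<beta> * norm (b - z) \<le> q powr \<beta> * norm (b - z)" using q U \<beta> by (intro mult_right_mono powr_mono2) auto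
  have "norm (r *\<^sub>R (U powr \<beta> *\<^sub>R b) - r *\<^sub>R (y powr \<beta> *\<^sub>R z)) = r * norm (U powr \<beta> *\<^sub>R b - y powr \<beta> *\<^sub>R z)"
    unfolding scaleR_diff_right[symmetric] using r by simp
  also have "\<dots> \<le> r * (?Q powr \<beta> * norm (b - z) + (2 * ?K * (?Q powr (\<beta> - \<theta>1) * (d powr \<theta>1 * norm z)) + 2 * ?K * (?Q powr (\<beta> - \<theta>2) * (w powr \<theta>2 * norm z))))"
    using \<theta> by (intro mult_left_mono nonlinearity_diff_linear U e \<beta> r) auto
  also have "\<dots> \<le> r * (q powr \<beta> * norm (b - z) + (2 * ?K * (q powr (\<beta> - \<theta>1) * (d powr \<theta>1 * norm z)) + 2 * ?K * (q powr (\<beta> - \<theta>2) * (w powr \<theta>2 * norm z))))"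
    using r by (intro mult_left_mono add_mono b s) auto
  also have "\<dots> = r * (q powr \<beta> * norm (b - z)) + (2 * ?K * (r * (q powr (\<beta> - \<theta>1) * (d powr \<theta>1 * norm z))) + 2 * ?K * (r * (q powr (\<beta> - \<theta>2) * (w powr \<theta>2 * norm z))))"
    by (simp only: distrib_left mult.left_commute)
  finally show ?thesis .
qed

lemma heat_homogeneous_bounded:
  fixes \<Phi> :: "'a::euclidean_space \<Rightarrow> complex"
  assumes n: "n = real DIM('a)" and \<Phi>: "\<Phi> \<in> borel_measurable borel" "AE y in lborel. norm (\<Phi> y) \<le> \<epsilon> * norm y powr (- \<sigma>)" "0 \<le> \<epsilon>"
    and \<sigma>: "0 \<le> \<sigma>" "\<sigma> < n" and k: "0 \<le> \<rho>" "0 \<le> k + n * \<rho>" "k + n * \<rho> \<le> \<sigma>"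
    and sg: "sg (\<lambda>t. heat t (dist_of \<Phi>))"
  shows "\<exists>C. kw n \<sigma> k \<rho> C (\<lambda>t x. ennreal (norm (heat t (dist_of \<Phi>) x)))"
proof -
  obtain C where C: "\<And>t. t > 0 \<Longrightarrow> wk \<rho> (C * t powr (- ((\<sigma> - k - real DIM('a) * \<rho>) / 2)))
    (\<lambda>x::'a. ennreal (norm x powr k) * hop t (\<lambda>y. ennreal (norm y powr (- \<sigma>))) x)"
    using hop_homogeneous[where 'a='a, of \<sigma> \<rho> k] \<sigma> k n by blast
  have "kw n \<sigma> k \<rho> C (\<lambda>t x::'a. hop t (\<lambda>y. ennreal (norm y powr (- \<sigma>))) x)"
    using C by (simp add: kb_def ew_def n)
  from kb_cmult[OF this \<Phi>(3)] have "kw n \<sigma> k \<rho> (\<epsilon> * C) (\<lambda>t x::'a. ennreal \<epsilon> * hop t (\<lambda>y. ennreal (norm y powr (- \<sigma>))) x)" .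
  then have "kw n \<sigma> k \<rho> (\<epsilon> * C) (\<lambda>t x. ennreal (norm (heat t (dist_of \<Phi>) x)))"
  proof (rule kb_mono_AE)
    fix t :: real assume "t \<in> {0<..}"
    then have [measurable]: "heat t (dist_of \<Phi>) \<in> borel_measurable borel" using sg by (simp add: sg_def)
    show "(\<lambda>x. ennreal (norm (heat t (dist_of \<Phi>) x))) \<in> borel_measurable borel" by measurable
  qed (intro AE_I2 heat_dist_of_le(1) \<Phi>)
  then show ?thesis by blast
qed

section \<open>Reserve weights and the estimate of both differences\<close>

context hh
begin

text \<open>A number s strictly between max (\<sigma> - b) (k + n * \<rho>) and min \<sigma> (n - b)
  exists because b > 0, \<sigma> < n, k + n * \<rho> < \<sigma>1 \<le> \<sigma> and (k, \<rho>) is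
  good; \<eta> is its distance from k + n * \<rho>. The gained weight is the reserve spent in
  \<open>source_step\<close>.\<close>

lemma exists_weight:
  assumes g: "good k \<rho> \<sigma>1" and \<sigma>: "\<sigma>1 \<le> \<sigma>" "\<sigma> < n"
  shows "\<exists>\<eta>>0. good (k + \<eta>) \<rho> \<sigma> \<and> k + \<eta> + n * \<rho> \<le> \<sigma>"
proof -
  define b where "b = \<beta> * (k + n * \<rho>) - \<gamma>"
  have g': "\<beta> * \<rho> + \<rho> < 1" "b + k + n * \<rho> < n" using g by (auto simp: good_def b_def)
  have b: "b > 0" using pos by (simp add: b_def)
  have "max (\<sigma> - b) (k + n * \<rho>) < min \<sigma> (n - b)" using \<sigma> k\<sigma> g' b by auto
  then obtain s where s: "max (\<sigma> - b) (k + n * \<rho>) < s" "s < min \<sigma> (n - b)" using dense by blast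
  define \<eta> where "\<eta> = s - (k + n * \<rho>)"
  have \<eta>: "\<eta> > 0" "k + \<eta> + n * \<rho> = s" using s by (auto simp: \<eta>_def)
  have "good (k + \<eta>) \<rho> \<sigma>" using g' \<eta> s k0 \<rho>0 by (auto simp: good_def b_def)
  then show ?thesis using \<eta> s by auto
qed

lemma decaying_semigroup:
  assumes h: "sg h" and g: "good kd \<rho>d \<sigma>d" and t: "k' \<le> kd" "\<rho>' \<le> \<rho>d" "0 \<le> \<rho>'" "0 \<le> k' + n * \<rho>'"
    and d: "dec n \<sigma>d kd \<rho>d (\<lambda>t x::'a. ennreal (norm (h t x)))"
  shows "dec n \<sigma>d k' \<rho>' (cnn h)"
proof -
  have 1: "\<rho>d < 1" "kd + n * \<rho>d < n" using g pos \<beta> \<rho>0 by (auto simp: good_def intro: le_less_trans[of _ "\<beta> * \<rho> + \<rho>d"])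
  have hm: "(\<lambda>x. ennreal (norm (h t x))) \<in> borel_measurable borel" if "t > 0" for t
  proof -
    have [measurable]: "h t \<in> borel_measurable borel" using h that by (simp add: sg_def)
    show ?thesis by measurable
  qed
  show ?thesis using d unfolding decaying_def
  proof eventually_elim
    case (elim \<delta>)
    then obtain A where "kb {0<..} (ew n \<sigma>d kd \<rho>d + \<delta>) kd \<rho>d A (cnn h)" by blast
    from kb_semigroup[OF 1 t hm sg_hop[OF h] this] show ?case .
  qed
qed

lemma bounded_semigroup:
  assumes h: "sg h" and g: "good kd \<rho>d \<sigma>d" and t: "k' \<le> kd" "\<rho>' \<le> \<rho>d" "0 \<le> \<rho>'" "0 \<le> k' + n * \<rho>'"
    and d: "kw n \<sigma>d kd \<rho>d A (\<lambda>t x::'a. ennreal (norm (h t x)))"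
  shows "\<exists>C. kw n \<sigma>d k' \<rho>' C (cnn h)"
proof -
  have 1: "\<rho>d < 1" "kd + n * \<rho>d < n" using g pos \<beta> \<rho>0 by (auto simp: good_def intro: le_less_trans[of _ "\<beta> * \<rho> + \<rho>d"])
  have hm: "(\<lambda>x. ennreal (norm (h t x))) \<in> borel_measurable borel" if "t > 0" for t
  proof -
    have [measurable]: "h t \<in> borel_measurable borel" using h that by (simp add: sg_def)
    show ?thesis by measurable
  qed
  have "kb {0<..} (ew n \<sigma>d kd \<rho>d + 0) kd \<rho>d A (\<lambda>t x::'a. ennreal (norm (h t x)))" using d by simp
  from kb_semigroup[OF 1 t hm sg_hop[OF h] this] show ?thesis by simp
qed

lemma potential_bounded:
  assumes g: "good kd \<rho>d \<sigma>d" and qm: "jr q" and q0: "\<And>t x. 0 \<le> q t x" and q: "kw n \<sigma>1 k \<rho> M (enn q)"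
    and wm: "jm w" and w: "kw n \<sigma>d kd \<rho>d B w"
  shows "\<exists>C. kw n \<sigma>d kd \<rho>d C (duh (potential \<gamma> \<beta> q (w :: real \<Rightarrow> 'a \<Rightarrow> ennreal)))"
proof -
  have "0 \<le> \<rho>d" "0 \<le> kd + n * \<rho>d" using g by (simp_all add: good_def)
  moreover have "kd + n * \<rho>d - (kd + n * \<rho>d) < 2 - (\<beta> * (k + n * \<rho>) - \<gamma>)" using sub by simp
  ultimately obtain \<delta>0 where \<delta>0: "\<delta>0 > 0" "\<And>\<delta> A B (w :: real \<Rightarrow> 'a \<Rightarrow> ennreal). 0 \<le> \<delta> \<Longrightarrow> \<delta> \<le> \<delta>0 \<Longrightarrow> jm w \<Longrightarrow>
     kb {0<..} (ew n \<sigma>d kd \<rho>d + \<delta>) kd \<rho>d A w \<Longrightarrow> kb {0<..} (ew n \<sigma>d kd \<rho>d + \<delta>) kd \<rho>d B w \<Longrightarrow>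
     (\<exists>C. kb {0<..} (ew n \<sigma>d kd \<rho>d + \<delta>) kd \<rho>d C (duh (potential \<gamma> \<beta> q w)))"
    using potential_step[OF g order_refl order_refl order_refl order_refl _ _ _ qm q0 q] by blast
  have w': "kb {0<..} (ew n \<sigma>d kd \<rho>d + 0) kd \<rho>d B w" using w by simp
  from \<delta>0(2)[OF order_refl less_imp_le[OF \<delta>0(1)] wm w' w'] show ?thesis by simp
qed

lemma diff_ineqI:
  fixes u v :: "real \<Rightarrow> 'a \<Rightarrow> complex"
  assumes u: "mild_solution a \<phi> F u" and v: "mild_solution a \<theta> G v" and a: "\<bar>a\<bar> = 1" and c': "real_lin c'"
    and m: "jr q" "jr D" "jr X1" "jr X2" "jr Z" and nn: "0 \<le> c" "\<And>t x. 0 \<le> D t x" "\<And>t x. 0 \<le> Z t x"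
    and D: "\<And>t x. 0 < t \<Longrightarrow> D t x = norm (c' (u t x) - v t x)"
    and le: "\<And>\<theta>1 \<theta>2 t x. 0 < \<theta>1 \<Longrightarrow> \<theta>1 < min 1 \<beta> \<Longrightarrow> 0 < \<theta>2 \<Longrightarrow> \<theta>2 < min 1 \<beta> \<Longrightarrow> 0 < t \<Longrightarrow> norm (c' (F t x) - G t x) \<le>
       norm x powr \<gamma> * (q t x powr \<beta> * D t x) + (c * (norm x powr \<gamma> * (q t x powr (\<beta> - \<theta>1) * (X1 t x powr \<theta>1 * Z t x)))
      + c * (norm x powr \<gamma> * (q t x powr (\<beta> - \<theta>2) * (X2 t x powr \<theta>2 * Z t x))))"
  shows "diff_ineq c q (enn D) (\<lambda>t x. ennreal (norm (c' (heat t \<phi> x) - heat t \<theta> x))) X1 X2 Z"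
  unfolding diff_ineq_def
proof (intro exI[of _ "min 1 \<beta>"] conjI allI impI)
  show "0 < min 1 \<beta>" using \<beta> by simp
  fix \<theta>1 \<theta>2 t :: real assume \<theta>: "0 < \<theta>1" "\<theta>1 < min 1 \<beta>" "0 < \<theta>2" "\<theta>2 < min 1 \<beta>" and t: "0 < t"
  show "AE x in lborel. ennreal (D t x) \<le> ennreal (norm (c' (heat t \<phi> x) - heat t \<theta> x)) + duh (potential \<gamma> \<beta> q (enn D)) t x
      + (ennreal c * duh (source \<gamma> \<beta> q X1 Z \<theta>1) t x + ennreal c * duh (source \<gamma> \<beta> q X2 Z \<theta>2) t x)"
    using mild_diff_le[OF u v a c' t]
  proof eventually_elim
    case (elim x)
    have "duh (\<lambda>\<tau> y. ennreal (norm (c' (F \<tau> y) - G \<tau> y))) t x \<le> duh (\<lambda>\<tau> y. potential \<gamma> \<beta> q (enn D) \<tau> y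
       + (ennreal c * source \<gamma> \<beta> q X1 Z \<theta>1 \<tau> y + ennreal c * source \<gamma> \<beta> q X2 Z \<theta>2 \<tau> y)) t x"
      by (intro duh_mono_AE AE_I2 ennreal_source_le le \<theta> nn)
    also have "\<dots> = duh (potential \<gamma> \<beta> q (enn D)) t x
      + (ennreal c * duh (source \<gamma> \<beta> q X1 Z \<theta>1) t x + ennreal c * duh (source \<gamma> \<beta> q X2 Z \<theta>2) t x)"
      by (rule duh_add3[OF measurable_potential[OF m(1) jm_ennreal[OF m(2)]] measurable_source[OF m(1,3,5)] measurable_source[OF m(1,4,5)]])
    finally show ?case using order_trans[OF elim[folded D[OF t]] add_left_mono] by (simp add: add.assoc)
  qed
qed

text \<open>Here v is the nonlinear profile to be compared with c1 u, and z the linear profile to be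
  compared with c2 u. The bound M for u and v is the one that will be small; every other constant is
  merely finite.\<close>

definition core_hyps where
  "core_hyps M \<sigma>2 kz \<rho>z a \<phi> \<Phi>1 \<Phi>2 c1 c2 (u :: real \<Rightarrow> 'a \<Rightarrow> complex) v z \<longleftrightarrow>
     tempered_distribution \<phi> \<and> \<Phi>1 \<in> borel_measurable borel \<and> \<Phi>2 \<in> borel_measurable borel \<and>
     (\<exists>\<epsilon>\<ge>0. AE y in lborel. norm (\<Phi>1 y :: complex) \<le> \<epsilon> * norm y powr (- \<sigma>1)) \<and>
     (\<exists>\<epsilon>\<ge>0. AE y in lborel. norm (\<Phi>2 y :: complex) \<le> \<epsilon> * norm y powr (- \<sigma>2)) \<and>
     real_lin c1 \<and> real_lin c2 \<and> (\<forall>w. norm w \<le> norm (c1 w) + norm (c2 w)) \<and> \<bar>a\<bar> = 1 \<and>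
     mz u \<and> mz v \<and> mz z \<and>
     kw n \<sigma>1 k \<rho> M (cnn u) \<and>
     kw n \<sigma>1 k \<rho> M (cnn v) \<and>
     (\<exists>B. kw n \<sigma>2 kz \<rho>z B (cnn z)) \<and>
     mild_solution a \<phi> (hh_source \<gamma> (\<beta> + 1) u u) u \<and>
     mild_solution a (dist_of \<Phi>1) (hh_source \<gamma> (\<beta> + 1) v v) v \<and>
     mild_solution a (dist_of \<Phi>2) (hh_source \<gamma> (\<beta> + 1) v z) z \<and>
     (\<exists>B. kw n \<sigma>1 k \<rho> B (\<lambda>t x. ennreal (norm (c1 (heat t \<phi> x))))) \<and>
     (\<exists>B d. 0 < d \<and> kb {0<..} (ew n \<sigma>1 k \<rho> + d) k \<rho> B (\<lambda>t x. ennreal (norm (c1 (heat t \<phi> x) - heat t (dist_of \<Phi>1) x)))) \<and>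
     (\<exists>B. kw n \<sigma>2 kz \<rho>z B (\<lambda>t x. ennreal (norm (c2 (heat t \<phi> x))))) \<and>
     (\<exists>B d. 0 < d \<and> kb {0<..} (ew n \<sigma>2 kz \<rho>z + d) kz \<rho>z B (\<lambda>t x. ennreal (norm (c2 (heat t \<phi> x) - heat t (dist_of \<Phi>2) x))))"

definition core_conclusion where
  "core_conclusion \<sigma>2 kz \<rho>z c1 c2 (u :: real \<Rightarrow> 'a \<Rightarrow> complex) v z \<longleftrightarrow>
    (\<forall>k' \<rho>'. k' \<le> k \<longrightarrow> \<rho>' \<le> \<rho> \<longrightarrow> 0 \<le> \<rho>' \<longrightarrow> 0 \<le> k' + n * \<rho>' \<longrightarrow>
       dec n \<sigma>1 k' \<rho>' (\<lambda>t x. ennreal (norm (c1 (u t x) - v t x)))) \<and>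
    (\<forall>k' \<rho>'. k' \<le> kz \<longrightarrow> \<rho>' \<le> \<rho>z \<longrightarrow> 0 \<le> \<rho>' \<longrightarrow> 0 \<le> k' + n * \<rho>' \<longrightarrow>
       dec n \<sigma>2 k' \<rho>' (\<lambda>t x. ennreal (norm (c2 (u t x) - z t x))))"

text \<open>The order is forced: the source in the inequality for c1 u - v contains the faster
  component c2 u but not the other difference, so this inequality is closed by itself. The improved
  decay of c1 u - v then makes it an admissible source factor for c2 u - z.\<close>

theorem core:
  assumes g1: "good k \<rho> \<sigma>1" and g2: "good kz \<rho>z \<sigma>2" and \<sigma>2: "\<sigma>1 < \<sigma>2" "\<sigma>2 < n"
  shows "\<exists>M0>0. \<forall>M a \<phi> \<Phi>1 \<Phi>2 c1 c2 u v z. M \<le> M0 \<longrightarrow> core_hyps M \<sigma>2 kz \<rho>z a \<phi> \<Phi>1 \<Phi>2 c1 c2 u v z \<longrightarrow> core_conclusion \<sigma>2 kz \<rho>z c1 c2 u v z"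
proof -
  have \<sigma>1p: "0 \<le> \<sigma>1" using k\<sigma> k0 by simp
  obtain \<eta>1 where \<eta>1: "\<eta>1 > 0" "good (k + \<eta>1) \<rho> \<sigma>1" "k + \<eta>1 + n * \<rho> \<le> \<sigma>1"
    using exists_weight[OF g1, of \<sigma>1] \<sigma>2 by auto
  obtain \<eta>2 where \<eta>2: "\<eta>2 > 0" "good (k + \<eta>2) \<rho> \<sigma>2" "k + \<eta>2 + n * \<rho> \<le> \<sigma>2"
    using exists_weight[OF g1, of \<sigma>2] \<sigma>2 by auto
  obtain Ma where Ma: "Ma > 0" "transferring k \<rho> \<sigma>1 kz \<rho>z \<sigma>2 Ma" using transfer[OF g1 g2] by blast
  obtain Mb where Mb: "Mb > 0" "transferring k \<rho> \<sigma>1 (k + \<eta>1) \<rho> \<sigma>1 Mb" using transfer[OF g1 \<eta>1(2)] by blast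
  obtain Mc where Mc: "Mc > 0" "transferring kz \<rho>z \<sigma>2 (k + \<eta>2) \<rho> \<sigma>2 Mc" using transfer[OF g2 \<eta>2(2)] by blast
  obtain Md where Md: "Md > 0" "\<And>q D H X1 X2 Z B c. jr q \<Longrightarrow> (\<forall>t x. 0 \<le> q t x) \<Longrightarrow> 0 \<le> c \<Longrightarrow> jm D \<Longrightarrow>
     kw n \<sigma>1 k \<rho> Md (enn q) \<Longrightarrow> kw n \<sigma>1 k \<rho> B D \<Longrightarrow>
     dec n \<sigma>1 k \<rho> H \<Longrightarrow> src_ok k \<rho> \<sigma>1 X1 Z \<Longrightarrow> src_ok k \<rho> \<sigma>1 X2 Z \<Longrightarrow> diff_ineq c q D H X1 X2 Z \<Longrightarrow>
     dec n \<sigma>1 k \<rho> D"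
    using decay_base[OF g1] by blast
  obtain Me where Me: "Me > 0" "\<And>q D H X1 X2 Z B c. jr q \<Longrightarrow> (\<forall>t x. 0 \<le> q t x) \<Longrightarrow> 0 \<le> c \<Longrightarrow> jm D \<Longrightarrow>
     kw n \<sigma>1 k \<rho> Me (enn q) \<Longrightarrow> kw n \<sigma>2 kz \<rho>z B D \<Longrightarrow>
     dec n \<sigma>2 kz \<rho>z H \<Longrightarrow> src_ok kz \<rho>z \<sigma>2 X1 Z \<Longrightarrow> src_ok kz \<rho>z \<sigma>2 X2 Z \<Longrightarrow> diff_ineq c q D H X1 X2 Z \<Longrightarrow>
     dec n \<sigma>2 kz \<rho>z D"
    using decay_base[OF g2] by blast
  define K where "K = max 1 \<beta>"
  \<comment> \<open>The solution of \<kappa>^\<beta> = 1 + 2 * K, the constant produced by the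
    self-interaction.\<close>
  define \<kappa> where "\<kappa> = (1 + 2 * K) powr (1 / \<beta>)"
  have K: "K \<ge> 1" by (simp add: K_def)
  have \<kappa>: "\<kappa> \<ge> 1" using K \<beta> by (simp add: \<kappa>_def ge_one_powr_ge_zero)
  have \<kappa>\<beta>: "\<kappa> powr \<beta> = 1 + 2 * K" using K \<beta> by (simp add: \<kappa>_def powr_powr)
  \<comment> \<open>The combined size q must lie below all five thresholds. M0 is m divided by
    \<kappa> and by the quasi-triangle factor of the sum U + Y.\<close>
  define m where "m = min Ma (min Mb (min Mc (min Md Me)))"
  have m: "m > 0" using Ma Mb Mc Md Me by (simp add: m_def)
  define M0 where "M0 = m / (\<kappa> * (2 powr \<rho> * 2))"
  have M0: "M0 > 0" "\<kappa> * (2 powr \<rho> * (M0 + M0)) = m" using m \<kappa> by (simp_all add: M0_def)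
  have "core_conclusion \<sigma>2 kz \<rho>z c1 c2 u v z"
    if MM: "M \<le> M0" and hyp: "core_hyps M \<sigma>2 kz \<rho>z a \<phi> \<Phi>1 \<Phi>2 c1 c2 u v z" for M a \<phi> \<Phi>1 \<Phi>2 c1 c2 u v z
  proof -
    have \<phi>: "tempered_distribution \<phi>" and \<Phi>m: "\<Phi>1 \<in> borel_measurable borel" "\<Phi>2 \<in> borel_measurable borel"
      and c: "real_lin c1" "real_lin c2" "\<And>w. norm w \<le> norm (c1 w) + norm (c2 w)" and a: "\<bar>a\<bar> = 1"
      and mz: "mz u" "mz v" "mz z"
      and ub: "kw n \<sigma>1 k \<rho> M (cnn u)"
      and vb: "kw n \<sigma>1 k \<rho> M (cnn v)"
      and mu: "mild_solution a \<phi> (hh_source \<gamma> (\<beta> + 1) u u) u"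
      and mv: "mild_solution a (dist_of \<Phi>1) (hh_source \<gamma> (\<beta> + 1) v v) v"
      and mzz: "mild_solution a (dist_of \<Phi>2) (hh_source \<gamma> (\<beta> + 1) v z) z"
      using hyp unfolding core_hyps_def by blast+
    obtain \<epsilon>1 where \<epsilon>1: "\<epsilon>1 \<ge> 0" "AE y in lborel. norm (\<Phi>1 y) \<le> \<epsilon>1 * norm y powr (- \<sigma>1)"
      using hyp unfolding core_hyps_def by blast
    obtain \<epsilon>2 where \<epsilon>2: "\<epsilon>2 \<ge> 0" "AE y in lborel. norm (\<Phi>2 y) \<le> \<epsilon>2 * norm y powr (- \<sigma>2)"
      using hyp unfolding core_hyps_def by blast
    obtain Bz where zb: "kw n \<sigma>2 kz \<rho>z Bz (cnn z)"
      using hyp unfolding core_hyps_def by blast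
    obtain B1 where B1: "kw n \<sigma>1 k \<rho> B1 (\<lambda>t x. ennreal (norm (c1 (heat t \<phi> x))))"
      using hyp unfolding core_hyps_def by blast
    obtain B2 d1 where B2: "0 < d1" "kb {0<..} (ew n \<sigma>1 k \<rho> + d1) k \<rho> B2 (\<lambda>t x. ennreal (norm (c1 (heat t \<phi> x) - heat t (dist_of \<Phi>1) x)))"
      using hyp unfolding core_hyps_def by blast
    obtain B3 where B3: "kw n \<sigma>2 kz \<rho>z B3 (\<lambda>t x. ennreal (norm (c2 (heat t \<phi> x))))"
      using hyp unfolding core_hyps_def by blast
    obtain B4 d2 where B4: "0 < d2" "kb {0<..} (ew n \<sigma>2 kz \<rho>z + d2) kz \<rho>z B4 (\<lambda>t x. ennreal (norm (c2 (heat t \<phi> x) - heat t (dist_of \<Phi>2) x)))"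
      using hyp unfolding core_hyps_def by blast
    define U where "U = cut (\<lambda>t x. norm (u t x))"
    define Y where "Y = cut (\<lambda>t x. norm (v t x))"
    define Z where "Z = cut (\<lambda>t x. norm (z t x))"
    define W where "W = cut (\<lambda>t x. norm (c2 (u t x)))"
    define D1 where "D1 = cut (\<lambda>t x. norm (c1 (u t x) - v t x))"
    define D2 where "D2 = cut (\<lambda>t x. norm (c2 (u t x) - z t x))"
    define q where "q = (\<lambda>t x. \<kappa> * (U t x + Y t x))"
    have Um: "jr U" and Ym: "jr Y" and Zm: "jr Z" and Wm: "jr W" and D1m: "jr D1" and D2m: "jr D2"
      unfolding U_def Y_def Z_def W_def D1_def D2_def
      by (fact jr_cut[OF mz(1)], fact jr_cut[OF mz(2)], fact jr_cut[OF mz(3)], fact jr_cut[OF mz_real_lin[OF c(2) mz(1)]],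
        fact jr_cut[OF mz_diff[OF mz_real_lin[OF c(1) mz(1)] mz(2)]], fact jr_cut[OF mz_diff[OF mz_real_lin[OF c(2) mz(1)] mz(3)]])
    have qm: "jr q"
    proof -
      note [measurable] = Um Ym
      show ?thesis unfolding q_def by measurable
    qed
    have U0: "0 \<le> U t x" and Y0: "0 \<le> Y t x" and Z0: "0 \<le> Z t x" and W0: "0 \<le> W t x" and D10: "0 \<le> D1 t x" and D20: "0 \<le> D2 t x" for t x
      unfolding U_def Y_def Z_def W_def D1_def D2_def by (simp_all add: cut_def)
    have Uq: "U t x \<le> q t x" and Yq: "Y t x \<le> q t x" and UYq: "U t x + Y t x \<le> q t x" and q0: "0 \<le> q t x" for t x
    proof -
      have "1 * (U t x + Y t x) \<le> \<kappa> * (U t x + Y t x)" using \<kappa> U0[of t x] Y0[of t x] by (intro mult_right_mono) auto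
      then show "U t x + Y t x \<le> q t x" by (simp add: q_def)
      then show "U t x \<le> q t x" "Y t x \<le> q t x" "0 \<le> q t x" using U0[of t x] Y0[of t x] by linarith+
    qed
    have Ub: "kw n \<sigma>1 k \<rho> M0 (enn U)" and Yb: "kw n \<sigma>1 k \<rho> M0 (enn Y)"
      using kb_weaken[OF ub MM] kb_weaken[OF vb MM] by (simp_all add: U_def Y_def kb_cut)
    have qb: "kw n \<sigma>1 k \<rho> m (enn q)"
    proof -
      have "kw n \<sigma>1 k \<rho> (\<kappa> * (2 powr \<rho> * (M0 + M0))) (\<lambda>t x. ennreal \<kappa> * (ennreal (U t x) + ennreal (Y t x)))"
        using \<kappa> by (intro kb_cmult kb_add Ub Yb) auto
      then show ?thesis unfolding M0(2) using \<kappa> U0 Y0 by (simp add: q_def ennreal_mult ennreal_plus)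
    qed
    have qa: "kw n \<sigma>1 k \<rho> Ma (enn q)" "kw n \<sigma>1 k \<rho> Mb (enn q)"
      "kw n \<sigma>1 k \<rho> Mc (enn q)" "kw n \<sigma>1 k \<rho> Md (enn q)"
      "kw n \<sigma>1 k \<rho> Me (enn q)"
      by (rule kb_weaken[OF qb], simp add: m_def)+
    have q0': "\<forall>t x. 0 \<le> q t x" using q0 by blast
    have fin: "\<forall>t x. ennreal (f t x) < \<infinity>" for f :: "real \<Rightarrow> 'a \<Rightarrow> real" by simp
    have hs: "norm (hh_source \<gamma> (\<beta> + 1) f g t x) = norm x powr \<gamma> * (norm (f t x) powr \<beta> * norm (g t x))" for f g t and x :: 'a
      by (simp add: norm_hh_source)
    have chs: "c' (hh_source \<gamma> (\<beta> + 1) f g t x) = (norm x powr \<gamma>) *\<^sub>R (norm (f t x) powr \<beta> *\<^sub>R c' (g t x))" if "real_lin c'" for c' f g t and x :: 'a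
      using real_lin_le(2)[OF that, of "norm x powr \<gamma> * norm (f t x) powr \<beta>" "g t x"]
      by (simp add: hh_source_def scaleR_conv_of_real mult.assoc del: of_real_mult) (simp add: mult.assoc)
    have WU: "W t x \<le> U t x" for t x using real_lin_le(1)[OF c(2)] by (simp add: W_def U_def cut_def)
    have pot: "ennreal (norm x powr \<gamma> * (r * s)) \<le> potential \<gamma> \<beta> q (enn w) t x"
      if "0 \<le> r" "r \<le> q t x powr \<beta>" "0 \<le> s" "s \<le> w t x" for r s t x and w :: "real \<Rightarrow> 'a \<Rightarrow> real"
    proof -
      have "norm x powr \<gamma> * (r * s) \<le> norm x powr \<gamma> * (q t x powr \<beta> * w t x)" using that by (intro mult_left_mono mult_mono) auto
      moreover have "potential \<gamma> \<beta> q (enn w) t x = ennreal (norm x powr \<gamma> * (q t x powr \<beta> * w t x))"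
        using that by (simp add: potential_def ennreal_mult)
      ultimately show ?thesis by (simp add: ennreal_leI)
    qed
    have Uqp: "U t x powr \<beta> \<le> q t x powr \<beta>" and Yqp: "Y t x powr \<beta> \<le> q t x powr \<beta>" for t x
      using Uq Yq U0 Y0 \<beta> by (auto intro!: powr_mono2)
    have s1: "sg (\<lambda>t. heat t (dist_of \<Phi>1))" "sg (\<lambda>t. heat t (dist_of \<Phi>2))"
      using \<sigma>1p \<sigma>2 n by (auto intro!: sg_dist_of[OF \<Phi>m(1) \<epsilon>1(2,1)] sg_dist_of[OF \<Phi>m(2) \<epsilon>2(2,1)])
    have sH1: "sg (\<lambda>t x. c1 (heat t \<phi> x) - heat t (dist_of \<Phi>1) x)" and sH3: "sg (\<lambda>t x. c2 (heat t \<phi> x) - heat t (dist_of \<Phi>2) x)"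
      by (rule sg_diff[OF sg_real_lin[OF c(1) sg_tempered[OF \<phi>]] s1(1)], rule sg_diff[OF sg_real_lin[OF c(2) sg_tempered[OF \<phi>]] s1(2)])
    have Wle: "AE x in lborel. ennreal (W t x) \<le> ennreal (norm (c2 (heat t \<phi> x))) + duh (potential \<gamma> \<beta> q (enn W)) t x" if t: "t > 0" for t
      using mild_le[OF mu a c(2) t]
    proof eventually_elim
      case (elim x)
      have "duh (\<lambda>\<tau> y. ennreal (norm (c2 (hh_source \<gamma> (\<beta> + 1) u u \<tau> y)))) t x \<le> duh (potential \<gamma> \<beta> q (enn W)) t x"
      proof (intro duh_mono_AE AE_I2)
        fix \<tau> :: real and y :: 'a assume \<tau>: "0 < \<tau>"
        show "ennreal (norm (c2 (hh_source \<gamma> (\<beta> + 1) u u \<tau> y))) \<le> potential \<gamma> \<beta> q (enn W) \<tau> y"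
          unfolding chs[OF c(2)] norm_scaleR using \<tau> Uqp[of \<tau> y] by (simp, intro pot) (auto simp: U_def W_def cut_def)
      qed
      moreover have "W t x = norm (c2 (u t x))" using t by (simp add: W_def cut_def)
      ultimately show ?case using order_trans[OF elim add_left_mono] by simp
    qed
    have Yle: "AE x in lborel. ennreal (Y t x) \<le> ennreal (norm (heat t (dist_of \<Phi>1) x)) + duh (potential \<gamma> \<beta> q (enn Y)) t x" if t: "t > 0" for t
    proof -
      have Yt: "Y t x = norm (v t x)" for x using t by (simp add: Y_def cut_def)
      have le: "duh (\<lambda>\<tau> y. ennreal (norm (hh_source \<gamma> (\<beta> + 1) v v \<tau> y))) t x \<le> duh (potential \<gamma> \<beta> q (enn Y)) t x" for x
      proof (intro duh_mono_AE AE_I2)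
        fix \<tau> :: real and y :: 'a assume \<tau>: "0 < \<tau>"
        show "ennreal (norm (hh_source \<gamma> (\<beta> + 1) v v \<tau> y)) \<le> potential \<gamma> \<beta> q (enn Y) \<tau> y"
          unfolding hs using \<tau> Yqp[of \<tau> y] by (intro pot) (auto simp: Y_def cut_def)
      qed
      show "AE x in lborel. ennreal (Y t x) \<le> ennreal (norm (heat t (dist_of \<Phi>1) x)) + duh (potential \<gamma> \<beta> q (enn Y)) t x"
        using mild_le[OF mv a real_lin_id t]
        by eventually_elim (use order_trans[OF _ add_left_mono[OF le]] Yt in simp)
    qed
    have Zle: "AE x in lborel. ennreal (Z t x) \<le> ennreal (norm (heat t (dist_of \<Phi>2) x)) + duh (potential \<gamma> \<beta> q (enn Z)) t x"
      and HZ: "AE x in lborel. ennreal (norm (heat t (dist_of \<Phi>2) x)) \<le> ennreal (Z t x) + duh (potential \<gamma> \<beta> q (enn Z)) t x" if t: "t > 0" for t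
    proof -
      have Zt: "Z t x = norm (z t x)" for x using t by (simp add: Z_def cut_def)
      have le: "duh (\<lambda>\<tau> y. ennreal (norm (hh_source \<gamma> (\<beta> + 1) v z \<tau> y))) t x \<le> duh (potential \<gamma> \<beta> q (enn Z)) t x" for x
      proof (intro duh_mono_AE AE_I2)
        fix \<tau> :: real and y :: 'a assume \<tau>: "0 < \<tau>"
        show "ennreal (norm (hh_source \<gamma> (\<beta> + 1) v z \<tau> y)) \<le> potential \<gamma> \<beta> q (enn Z) \<tau> y"
          unfolding hs using \<tau> Yqp[of \<tau> y] by (intro pot) (auto simp: Y_def Z_def cut_def)
      qed
      show "AE x in lborel. ennreal (Z t x) \<le> ennreal (norm (heat t (dist_of \<Phi>2) x)) + duh (potential \<gamma> \<beta> q (enn Z)) t x"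
        using mild_le[OF mzz a real_lin_id t]
        by eventually_elim (use order_trans[OF _ add_left_mono[OF le]] Zt in simp)
      show "AE x in lborel. ennreal (norm (heat t (dist_of \<Phi>2) x)) \<le> ennreal (Z t x) + duh (potential \<gamma> \<beta> q (enn Z)) t x"
        using mild_heat_le[OF mzz a t]
        by eventually_elim (use order_trans[OF _ add_left_mono[OF le]] Zt in simp)
    qed
    have mU: "(\<lambda>x. ennreal (f t x)) \<in> borel_measurable borel" if "jr f" for f t using jm_section[OF jm_ennreal[OF that]] .
    have Wb: "kw n \<sigma>1 k \<rho> M0 (enn W)"
      by (rule kb_mono_AE[OF Ub mU[OF Wm]]) (intro AE_I2 ennreal_leI WU)
    \<comment> \<open>So far c2 u has only the rate belonging to \<sigma>1. Its free evolution has
      the rate of \<sigma>2, and comparison with the Neumann series carries this rate over to c2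
      u.\<close>
    have Wz: "kw n \<sigma>2 kz \<rho>z (2 * 2 powr \<rho>z * B3) (enn W)"
      by (rule transferringD[OF Ma(2) qm jm_ennreal[OF Wm] q0' fin qa(1) Wb B3]) (use Wle in blast)
    have Zb: "kw n \<sigma>2 kz \<rho>z Bz (enn Z)" using zb by (simp add: Z_def kb_cut)
    have h\<Phi>1: "\<exists>C. kw n \<sigma>1 k' \<rho>' C (\<lambda>t x. ennreal (norm (heat t (dist_of \<Phi>1) x)))"
      if "0 \<le> \<rho>'" "0 \<le> k' + n * \<rho>'" "k' + n * \<rho>' \<le> \<sigma>1" for k' \<rho>'
      using that \<sigma>1p \<sigma>2 by (intro heat_homogeneous_bounded[OF n \<Phi>m(1) \<epsilon>1(2,1) _ _ _ _ _ s1(1)]) auto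
    have h\<Phi>2: "\<exists>C. kw n \<sigma>2 k' \<rho>' C (\<lambda>t x. ennreal (norm (heat t (dist_of \<Phi>2) x)))"
      if "0 \<le> \<rho>'" "0 \<le> k' + n * \<rho>'" "k' + n * \<rho>' \<le> \<sigma>2" for k' \<rho>'
      using that \<sigma>1p \<sigma>2 by (intro heat_homogeneous_bounded[OF n \<Phi>m(2) \<epsilon>2(2,1) _ _ _ _ _ s1(2)]) auto
    obtain A1 where A1: "kw n \<sigma>1 (k + \<eta>1) \<rho> A1 (\<lambda>t x. ennreal (norm (heat t (dist_of \<Phi>1) x)))"
      using h\<Phi>1[of \<rho> "k + \<eta>1"] \<eta>1 k0 \<rho>0 by auto
    obtain A2 where A2: "kw n \<sigma>2 (k + \<eta>2) \<rho> A2 (\<lambda>t x. ennreal (norm (heat t (dist_of \<Phi>2) x)))"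
      using h\<Phi>2[of \<rho> "k + \<eta>2"] \<eta>2 k0 \<rho>0 by auto
    \<comment> \<open>The larger weights are reached by the same comparison; the homogeneous data
      can be estimated there because k + \<eta>1 + n * \<rho> and k + \<eta>2 + n * \<rho> do not
      exceed their orders \<sigma>1 and \<sigma>2.\<close>
    have Y\<eta>: "kw n \<sigma>1 (k + \<eta>1) \<rho> (2 * 2 powr \<rho> * A1) (enn Y)"
      by (rule transferringD[OF Mb(2) qm jm_ennreal[OF Ym] q0' fin qa(2) Yb A1]) (use Yle in blast)
    have Z\<eta>: "kw n \<sigma>2 (k + \<eta>2) \<rho> (2 * 2 powr \<rho> * A2) (enn Z)"
      by (rule transferringD[OF Mc(2) qm jm_ennreal[OF Zm] q0' fin qa(3) Zb A2]) (use Zle in blast)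
    \<comment> \<open>The moduli of u and v differ by at most the c1-difference plus the c2-part.
      Here the splitting of u by c1 and c2 enters the nonlinear estimate.\<close>
    have e: "\<bar>norm (u t x) - norm (v t x)\<bar> \<le> norm (c1 (u t x) - v t x) + norm (c2 (u t x))" for t x
    proof -
      have "norm (c1 (u t x)) \<le> norm (c1 (u t x) - v t x) + norm (v t x)" using norm_triangle_ineq[of "c1 (u t x) - v t x" "v t x"] by simp
      moreover have "norm (v t x) \<le> norm (c1 (u t x) - v t x) + norm (c1 (u t x))" using norm_triangle_ineq4[of "c1 (u t x)" "c1 (u t x) - v t x"] by simp
      ultimately show ?thesis using c(3)[of "u t x"] real_lin_le(1)[OF c(1), of "u t x"] norm_ge_zero[of "c2 (u t x)"] unfolding abs_le_iff by linarith
    qed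
    have ineq1: "diff_ineq (2 * K) q (enn D1) (\<lambda>t x. ennreal (norm (c1 (heat t \<phi> x) - heat t (dist_of \<Phi>1) x))) W W Y"
    proof (rule diff_ineqI[OF mu mv a c(1) qm D1m Wm Wm Ym])
      show "0 \<le> 2 * K" using K by simp
      fix \<theta>1 \<theta>2 t x assume "0 < \<theta>1" "\<theta>1 < min 1 \<beta>" "0 < \<theta>2" "\<theta>2 < min 1 \<beta>" and t: "(0::real) < t"
      moreover have "q t x = \<kappa> * (norm (u t x) + norm (v t x))" using t by (simp add: q_def U_def Y_def cut_def)
      ultimately have "norm ((norm x powr \<gamma>) *\<^sub>R (norm (u t x) powr \<beta> *\<^sub>R c1 (u t x)) - (norm x powr \<gamma>) *\<^sub>R (norm (v t x) powr \<beta> *\<^sub>R v t x))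
        \<le> norm x powr \<gamma> * (q t x powr \<beta> * norm (c1 (u t x) - v t x))
          + (2 * max 1 \<beta> * (norm x powr \<gamma> * (q t x powr (\<beta> - \<theta>1) * (norm (c2 (u t x)) powr \<theta>1 * norm (v t x))))
          + 2 * max 1 \<beta> * (norm x powr \<gamma> * (q t x powr (\<beta> - \<theta>2) * (norm (c2 (u t x)) powr \<theta>2 * norm (v t x)))))"
        by (intro source_diff_self[OF _ \<kappa> \<kappa>\<beta>[unfolded K_def]] e \<beta>) auto
      then show "norm (c1 (hh_source \<gamma> (\<beta> + 1) u u t x) - hh_source \<gamma> (\<beta> + 1) v v t x) \<le>
       norm x powr \<gamma> * (q t x powr \<beta> * D1 t x) + (2 * K * (norm x powr \<gamma> * (q t x powr (\<beta> - \<theta>1) * (W t x powr \<theta>1 * Y t x)))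
      + 2 * K * (norm x powr \<gamma> * (q t x powr (\<beta> - \<theta>2) * (W t x powr \<theta>2 * Y t x))))"
        unfolding chs[OF c(1)] unfolding chs[OF real_lin_id] K_def using t by (simp add: D1_def W_def Y_def cut_def)
    qed (use D10 Y0 in \<open>auto simp: D1_def cut_def\<close>)
    have ineq2: "diff_ineq (2 * K) q (enn D2) (\<lambda>t x. ennreal (norm (c2 (heat t \<phi> x) - heat t (dist_of \<Phi>2) x))) D1 W Z"
    proof (rule diff_ineqI[OF mu mzz a c(2) qm D2m D1m Wm Zm])
      show "0 \<le> 2 * K" using K by simp
      fix \<theta>1 \<theta>2 t x assume "0 < \<theta>1" "\<theta>1 < min 1 \<beta>" "0 < \<theta>2" "\<theta>2 < min 1 \<beta>" and t: "(0::real) < t"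
      moreover have "norm (u t x) + norm (v t x) \<le> q t x" using t UYq[of t x] by (simp add: U_def Y_def cut_def)
      ultimately have "norm ((norm x powr \<gamma>) *\<^sub>R (norm (u t x) powr \<beta> *\<^sub>R c2 (u t x)) - (norm x powr \<gamma>) *\<^sub>R (norm (v t x) powr \<beta> *\<^sub>R z t x))
        \<le> norm x powr \<gamma> * (q t x powr \<beta> * norm (c2 (u t x) - z t x))
          + (2 * max 1 \<beta> * (norm x powr \<gamma> * (q t x powr (\<beta> - \<theta>1) * (norm (c1 (u t x) - v t x) powr \<theta>1 * norm (z t x))))
          + 2 * max 1 \<beta> * (norm x powr \<gamma> * (q t x powr (\<beta> - \<theta>2) * (norm (c2 (u t x)) powr \<theta>2 * norm (z t x)))))"
        by (intro source_diff_linear e \<beta>) auto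
      then show "norm (c2 (hh_source \<gamma> (\<beta> + 1) u u t x) - hh_source \<gamma> (\<beta> + 1) v z t x) \<le>
       norm x powr \<gamma> * (q t x powr \<beta> * D2 t x) + (2 * K * (norm x powr \<gamma> * (q t x powr (\<beta> - \<theta>1) * (D1 t x powr \<theta>1 * Z t x)))
      + 2 * K * (norm x powr \<gamma> * (q t x powr (\<beta> - \<theta>2) * (W t x powr \<theta>2 * Z t x))))"
        unfolding chs[OF c(2)] unfolding chs[OF real_lin_id] K_def using t by (simp add: D1_def D2_def W_def Z_def cut_def)
    qed (use D20 Z0 in \<open>auto simp: D2_def cut_def\<close>)
    have \<rho>z0: "0 \<le> \<rho>z" using g2 by (simp add: good_def)
    have K2: "0 \<le> 2 * K" using K by simp
    \<comment> \<open>The value L = \<bar>kz - k\<bar> / \<eta>1 spends just enough of the reserve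
      weight \<eta>1 to cover a deficit kz - k of W.\<close>
    have X1: "src_ok k \<rho> \<sigma>1 W Y"
      unfolding src_ok_def
    proof (intro conjI allI exI)
      show "kw n \<sigma>1 k \<rho> M0 (enn Y)" by (fact Yb)
      show "kw n \<sigma>2 kz \<rho>z (2 * 2 powr \<rho>z * B3) (enn W)" by (fact Wz)
      show "kw n \<sigma>1 (k + \<eta>1) \<rho> (2 * 2 powr \<rho> * A1) (enn Y)" by (fact Y\<eta>)
      show "0 \<le> \<bar>kz - k\<bar> / \<eta>1" "0 \<le> kz - k + \<bar>kz - k\<bar> / \<eta>1 * (k + \<eta>1 - k)" using \<eta>1(1) by auto
      show "0 < \<rho> \<or> \<bar>kz - k\<bar> / \<eta>1 * \<rho> \<le> \<rho>z + \<bar>kz - k\<bar> / \<eta>1 * \<rho>" using \<rho>z0 by simp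
    qed (fact Wm Ym W0 Y0 \<sigma>2(1))+
    have Y_targets: "\<exists>C. kw n \<sigma>1 k' \<rho>' C (enn Y)"
      if "k' \<le> k" "\<rho>' \<le> \<rho>" "0 \<le> \<rho>'" "0 \<le> k' + n * \<rho>'" for k' \<rho>'
    proof (rule bounded_chain[OF g1 qm q0 qb jm_ennreal[OF Ym] Yb h\<Phi>1 Yle that])
      fix k' \<rho>' assume "k' \<le> k" "\<rho>' \<le> \<rho>"
      moreover have "n * \<rho>' \<le> n * \<rho>" using \<open>\<rho>' \<le> \<rho>\<close> n0 by (intro mult_left_mono) auto
      ultimately show "k' + n * \<rho>' \<le> \<sigma>1" using k\<sigma> by linarith
    qed
    obtain A3 where A3: "kw n \<sigma>1 k \<rho> A3 (\<lambda>t x. ennreal (norm (heat t (dist_of \<Phi>1) x)))"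
      using h\<Phi>1[OF \<rho>0 k0] k\<sigma> by auto
    have sgm: "(\<lambda>x. ennreal (norm (h t x))) \<in> borel_measurable borel" if h: "sg h" and "t \<in> {0<..}" for t and h :: "real \<Rightarrow> 'a \<Rightarrow> complex"
    proof -
      have [measurable]: "h t \<in> borel_measurable borel" using that by (simp add: sg_def)
      show ?thesis by measurable
    qed
    have tri: "ennreal (norm (a - b)) \<le> ennreal (norm a) + ennreal (norm b)" for a b :: complex
      by (metis ennreal_leI ennreal_plus norm_ge_zero norm_triangle_ineq4)
    \<comment> \<open>Nothing bounds kz + n * \<rho>z by \<sigma>2, so the direct estimate of
      homogeneous data may fail at (kz, \<rho>z). The free evolution is bounded there from z and its
      Duhamel term, through \<open>HZ\<close>.\<close>
    obtain A4 where A4: "kw n \<sigma>2 kz \<rho>z A4 (duh (potential \<gamma> \<beta> q (enn Z)))"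
      using potential_bounded[OF g2 qm q0 qb jm_ennreal[OF Zm] Zb] by blast
    have A5: "kw n \<sigma>2 kz \<rho>z (2 powr \<rho>z * (Bz + A4)) (\<lambda>t x. ennreal (norm (heat t (dist_of \<Phi>2) x)))"
      by (rule kb_mono_AE[OF kb_add[OF Zb A4] sgm[OF s1(2)]]) (use HZ in auto)
    have Z_targets: "\<exists>C. kw n \<sigma>2 k' \<rho>' C (enn Z)"
      if "k' \<le> kz" "\<rho>' \<le> \<rho>z" "0 \<le> \<rho>'" "0 \<le> k' + n * \<rho>'" for k' \<rho>'
      by (rule bounded_chain[OF g2 qm q0 qb jm_ennreal[OF Zm] Zb bounded_semigroup[OF s1(2) g2 _ _ _ _ A5] Zle that])
    have H1d: "dec n \<sigma>1 k \<rho> (\<lambda>t x. ennreal (norm (c1 (heat t \<phi> x) - heat t (dist_of \<Phi>1) x)))"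
      by (rule decayingI[OF kb_mono_AE[OF kb_add[OF B1 A3] sgm[OF sH1]] B2(2,1)]) (assumption, intro AE_I2 tri)
    have H3d: "dec n \<sigma>2 kz \<rho>z (\<lambda>t x. ennreal (norm (c2 (heat t \<phi> x) - heat t (dist_of \<Phi>2) x)))"
      by (rule decayingI[OF kb_mono_AE[OF kb_add[OF B3 A5] sgm[OF sH3]] B4(2,1)]) (assumption, intro AE_I2 tri)
    have D1b: "kw n \<sigma>1 k \<rho> (2 powr \<rho> * (M0 + M0)) (enn D1)"
    proof (rule kb_mono_AE[OF kb_add[OF Ub Yb] mU[OF D1m]], rule AE_I2)
      fix t x
      have "ennreal (norm (c1 (u t x) - v t x)) \<le> ennreal (norm (u t x)) + ennreal (norm (v t x))"
        using order_trans[OF tri add_right_mono[OF ennreal_leI[OF real_lin_le(1)[OF c(1)]]]] .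
      then show "ennreal (D1 t x) \<le> ennreal (U t x) + ennreal (Y t x)" by (simp add: D1_def U_def Y_def cut_def)
    qed
    have D2b: "kw n \<sigma>2 kz \<rho>z (2 powr \<rho>z * (2 * 2 powr \<rho>z * B3 + Bz)) (enn D2)"
      by (rule kb_mono_AE[OF kb_add[OF Wz Zb] mU[OF D2m]], rule AE_I2) (simp add: D2_def W_def Z_def cut_def tri)
    have D1d: "dec n \<sigma>1 k \<rho> (enn D1)"
      by (rule Md(2)[OF qm q0' K2 jm_ennreal[OF D1m] qa(4) D1b H1d X1 X1 ineq1])
    have D1t: "dec n \<sigma>1 k' \<rho>' (enn D1)"
      if "k' \<le> k" "\<rho>' \<le> \<rho>" "0 \<le> \<rho>'" "0 \<le> k' + n * \<rho>'" for k' \<rho>'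
      by (rule decay_chain[OF g1 qm q0 K2 qb jm_ennreal[OF D1m] D1d decaying_semigroup[OF sH1 g1 _ _ _ _ H1d] Y_targets X1 X1 ineq1 that])
    have "\<forall>\<^sub>F \<delta> in at_right 0. 0 < \<delta> \<and> (\<exists>C. kb {0<..} (ew n \<sigma>1 k \<rho> + \<delta>) k \<rho> C (enn D1))"
      using D1d unfolding decaying_def by (intro eventually_conj eventually_at_right_less)
    from eventually_happens[OF this] obtain \<delta> C where \<delta>: "0 < \<delta>" "kb {0<..} (ew n \<sigma>1 k \<rho> + \<delta>) k \<rho> C (enn D1)" by auto
    \<comment> \<open>An extra rate \<delta> amounts to raising \<sigma>1 by 2 * \<delta>, which
      turns D1 into a factor with exponent above \<sigma>1. It already has weight k, so L = 0 in
      \<open>X3\<close>.\<close>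
    have ew\<delta>: "ew n \<sigma>1 k \<rho> + \<delta> = ew n (\<sigma>1 + 2 * \<delta>) k \<rho>" by (simp add: ew_def field_simps)
    have X3: "src_ok kz \<rho>z \<sigma>2 D1 Z"
      unfolding src_ok_def
    proof (intro conjI allI exI)
      show "kw n \<sigma>2 kz \<rho>z Bz (enn Z)" by (fact Zb)
      show "kb {0<..} (ew n (\<sigma>1 + 2 * \<delta>) k \<rho>) k \<rho> C (enn D1)" using \<delta>(2) unfolding ew\<delta> .
      show "\<sigma>1 < \<sigma>1 + 2 * \<delta>" using \<delta>(1) by simp
      show "kw n \<sigma>2 (k + \<eta>2) \<rho> (2 * 2 powr \<rho> * A2) (enn Z)" by (fact Z\<eta>)
      show "(0::real) \<le> 0" "0 \<le> k - k + 0 * (k + \<eta>2 - kz)" by auto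
      show "0 < \<rho> \<or> 0 * \<rho>z \<le> \<rho> + 0 * \<rho>" using \<rho>0 by simp
    qed (fact D1m Zm D10 Z0)+
    \<comment> \<open>With L = 1 the weights telescope: kz - k + (k + \<eta>2 - kz) = \<eta>2, and
      \<rho>z is balanced by the integrability exponent of W.\<close>
    have X4: "src_ok kz \<rho>z \<sigma>2 W Z"
      unfolding src_ok_def
    proof (intro conjI allI exI)
      show "kw n \<sigma>2 kz \<rho>z Bz (enn Z)" by (fact Zb)
      show "kw n \<sigma>2 kz \<rho>z (2 * 2 powr \<rho>z * B3) (enn W)" by (fact Wz)
      show "kw n \<sigma>2 (k + \<eta>2) \<rho> (2 * 2 powr \<rho> * A2) (enn Z)" by (fact Z\<eta>)
      show "(0::real) \<le> 1" "0 \<le> kz - k + 1 * (k + \<eta>2 - kz)" using \<eta>2(1) by auto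
      show "0 < \<rho> \<or> 1 * \<rho>z \<le> \<rho>z + 1 * \<rho>" using \<rho>0 by simp
    qed (fact Wm Zm W0 Z0 \<sigma>2(1))+
    have D2d: "dec n \<sigma>2 kz \<rho>z (enn D2)"
      by (rule Me(2)[OF qm q0' K2 jm_ennreal[OF D2m] qa(5) D2b H3d X3 X4 ineq2])
    have D2t: "dec n \<sigma>2 k' \<rho>' (enn D2)"
      if "k' \<le> kz" "\<rho>' \<le> \<rho>z" "0 \<le> \<rho>'" "0 \<le> k' + n * \<rho>'" for k' \<rho>'
      by (rule decay_chain[OF g2 qm q0 K2 qb jm_ennreal[OF D2m] D2d decaying_semigroup[OF sH3 g2 _ _ _ _ H3d] Z_targets X3 X4 ineq2 that])
    show ?thesis unfolding core_conclusion_def using D1t D2t by (simp add: D1_def D2_def decaying_def kb_cut)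
  qed
  then show ?thesis using M0(1) by blast
qed

end

section \<open>Translation from the norms and parameters of the definitions\<close>

lemma rcp_ereal: "rcp (ereal x) = 1 / x" and rcp_infinity: "rcp \<infinity> = 0"
  by (simp_all add: rcp_def one_ereal_def divide_ereal_def inverse_eq_divide)

lemma rcp_bounds:
  assumes "1 \<le> p" shows "0 \<le> rcp p" "rcp p \<le> 1"
proof -
  have "0 \<le> rcp p \<and> rcp p \<le> 1"
    using assms by (cases p) (simp_all add: rcp_ereal rcp_infinity)
  then show "0 \<le> rcp p" "rcp p \<le> 1" by auto
qed

lemma rcp_antimono:
  assumes "1 \<le> p" "p \<le> p'" shows "rcp p' \<le> rcp p"
  using assms by (cases p; cases p') (simp_all add: rcp_ereal rcp_infinity frac_le)

lemma rcp_less: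
  assumes "ereal \<alpha> < p" "0 < \<alpha>" shows "\<alpha> * rcp p < 1"
  using assms by (cases p) (simp_all add: rcp_ereal rcp_infinity)

lemma mz_section:
  fixes u :: "real \<Rightarrow> 'a::euclidean_space \<Rightarrow> complex"
  assumes u: "mz u" and t: "0 < t"
  shows "u t \<in> borel_measurable borel"
proof -
  have "(\<lambda>x::'a. (t, x)) \<in> borel \<rightarrow>\<^sub>M borel" by (intro borel_measurable_Pair) simp_all
  then have "(\<lambda>x::'a. (t, x)) \<in> borel \<rightarrow>\<^sub>M restrict_space borel ({0<..} \<times> UNIV)"
    using t by (intro measurable_restrict_space2) auto
  from measurable_compose[OF this u] show ?thesis by simp
qed

lemma ennreal_powr_mult_le:
  assumes t: "0 < t" and le: "ennreal (t powr e) * w \<le> ennreal C" and C: "0 \<le> C"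
  shows "w \<le> ennreal (C * t powr (- e))"
proof -
  have "ennreal (t powr (- e)) * ennreal (t powr e) = 1" using t by (simp add: ennreal_mult[symmetric] powr_add[symmetric])
  then have "w = ennreal (t powr (- e)) * (ennreal (t powr e) * w)" by (simp add: mult.assoc[symmetric])
  also have "\<dots> \<le> ennreal (t powr (- e)) * ennreal C" by (rule mult_left_mono[OF le]) simp
  also have "\<dots> = ennreal (C * t powr (- e))" using C by (simp add: ennreal_mult[symmetric] mult.commute)
  finally show ?thesis .
qed

lemma wweak_norm_le_iff:
  fixes f :: "'a::euclidean_space \<Rightarrow> complex"
  assumes [measurable]: "f \<in> borel_measurable borel" and "0 \<le> A"
  shows "wweak_norm p k f \<le> ennreal A \<longleftrightarrow> wk (rcp p) A (\<lambda>x. ennreal (norm x powr k) * ennreal (norm (f x)))"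
  unfolding wweak_norm_def using assms(2)
  by (subst weak_norm_le_iff) (simp_all add: norm_mult ennreal_mult)

lemma kb_wweakI:
  fixes f :: "real \<Rightarrow> 'a::euclidean_space \<Rightarrow> complex"
  assumes "\<And>t. 0 < t \<Longrightarrow> f t \<in> borel_measurable borel" "0 \<le> C"
    and "\<And>t. 0 < t \<Longrightarrow> ennreal (t powr e) * wweak_norm p k (f t) \<le> ennreal C"
  shows "kb {0<..} e k (rcp p) C (cnn f)"
  unfolding kb_def
proof
  fix t :: real assume "t \<in> {0<..}"
  then have t: "0 < t" by simp
  have "0 \<le> C * t powr (- e)" using assms(2) by simp
  then show "wk (rcp p) (C * t powr (- e)) (\<lambda>x. ennreal (norm x powr k) * ennreal (norm (f t x)))"
    using ennreal_powr_mult_le[OF t assms(3)[OF t] assms(2)] wweak_norm_le_iff[OF assms(1)[OF t]] by blast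
qed

lemma kb_wweakD:
  fixes f :: "real \<Rightarrow> 'a::euclidean_space \<Rightarrow> complex"
  assumes "kb {0<..} e k (rcp p) C (cnn f)" "0 < t" "f t \<in> borel_measurable borel" "C \<le> C'" "0 \<le> C'"
  shows "wweak_norm p k (f t) \<le> ennreal (C' * t powr (- e))"
proof -
  have "0 \<le> C' * t powr (- e)" using assms(5) by simp
  then show ?thesis using wweak_norm_le_iff[OF assms(3)] kbD[OF kb_weaken[OF assms(1,4)], of t] assms(2) by simp
qed

lemma K_norm_kb:
  fixes u :: "real \<Rightarrow> 'a::euclidean_space \<Rightarrow> complex"
  assumes u: "K_norm s p k u \<le> ennreal M" "0 \<le> M" "\<And>t. 0 < t \<Longrightarrow> u t \<in> borel_measurable borel" and n: "n = real DIM('a)"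
  shows "kw n (n * s) k (rcp p) M (cnn u)"
proof (rule kb_wweakI[OF u(3,2)])
  fix t :: real assume t: "0 < t"
  have e: "ew n (n * s) k (rcp p) = real DIM('a) / 2 * (s - k / real DIM('a) - rcp p)" by (simp add: ew_def n field_simps)
  show "ennreal (t powr ew n (n * s) k (rcp p)) * wweak_norm p k (u t) \<le> ennreal M"
    unfolding e by (rule order_trans[OF SUP_upper u(1)[unfolded K_norm_def]]) (simp add: t)
qed

lemma K_space_kb:
  fixes u :: "real \<Rightarrow> 'a::euclidean_space \<Rightarrow> complex"
  assumes u: "u \<in> K_space s p k" and n: "n = real DIM('a)"
  shows "\<exists>B. kw n (n * s) k (rcp p) B (cnn u)"
proof -
  have "mz u" "K_norm s p k u < \<infinity>" using u by (auto simp: K_space_def)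
  then obtain r where "K_norm s p k u = ennreal r" "0 \<le> r" by (cases "K_norm s p k u") auto
  then show ?thesis using K_norm_kb[of s p k u r n] mz_section[OF \<open>mz u\<close>] n by auto
qed

lemma heat_dist_diff: "heat t (dist_diff \<phi> \<theta>) = (\<lambda>x. heat t \<phi> x - heat t \<theta> x)"
  by (simp add: heat_def dist_diff_def fun_eq_iff)

lemma heat_dist_Re: "heat t (dist_Re \<phi>) = (\<lambda>x. complex_of_real (Re (heat t \<phi> x)))"
  and heat_dist_Im: "heat t (dist_Im \<phi>) = (\<lambda>x. complex_of_real (Im (heat t \<phi> x)))"
  by (auto simp: heat_def dist_Re_def dist_Im_def complex_eq_iff fun_eq_iff)

lemma hom_data_bound:
  assumes "small_angular 1 \<omega>"
  shows "hom_data \<omega> \<sigma> \<in> borel_measurable borel" "AE y in lborel. norm (hom_data \<omega> \<sigma> y) \<le> 1 * norm y powr (- \<sigma>)"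
proof -
  have [measurable]: "\<omega> \<in> borel_measurable borel" and b: "AE x in lborel. \<bar>\<omega> x\<bar> \<le> 1" using assms by (auto simp: small_angular_def)
  show "hom_data \<omega> \<sigma> \<in> borel_measurable borel" unfolding hom_data_def[abs_def] by measurable
  show "AE y in lborel. norm (hom_data \<omega> \<sigma> y) \<le> 1 * norm y powr (- \<sigma>)"
    using b by eventually_elim (auto simp: hom_data_def norm_mult mult_left_le_one_le)
qed

text \<open>Both cases of the theorem in one form, in the original norms: c1 selects the component
  that follows the nonlinear profile v, c2 the one that follows z.\<close>

definition asym_hyps where
  "asym_hyps d \<gamma> \<alpha> p k \<sigma> p0 k0 M a \<omega> \<eta> \<phi> c1 c2 u v z \<longleftrightarrow>
     \<bar>a\<bar> = 1 \<and> small_angular 1 \<omega> \<and> small_angular 1 \<eta> \<and> tempered_distribution \<phi> \<and>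
     K_norm (inv_qc d \<gamma> \<alpha>) p k (\<lambda>t. heat t \<phi>) \<le> ennreal 1 \<and>
     real_lin c1 \<and> real_lin c2 \<and> (\<forall>w. norm w \<le> norm (c1 w) + norm (c2 w)) \<and>
     hh_solution a \<gamma> \<alpha> p k M \<phi> u \<and> triangular_solution a \<gamma> \<alpha> p k M p0 k0 \<sigma> \<omega> \<eta> v z \<and>
     (\<exists>C\<ge>0. \<exists>\<delta>>0. \<forall>t>0. ennreal (t powr (d / 2 * ((2 + \<gamma>) / (\<alpha> - 1) / d - k / d - rcp p) + \<delta>)) *
        wweak_norm p k (\<lambda>x. c1 (heat t \<phi> x) - heat t (dist_of (hom_data \<omega> ((2 + \<gamma>) / (\<alpha> - 1)))) x) \<le> ennreal C) \<and>
     (\<exists>C\<ge>0. \<exists>\<delta>>0. \<forall>t>0. ennreal (t powr (d / 2 * (\<sigma> / d - k0 / d - rcp p0))) * wweak_norm p0 k0 (\<lambda>x. c2 (heat t \<phi> x)) +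
        ennreal (t powr (d / 2 * (\<sigma> / d - k0 / d - rcp p0) + \<delta>)) *
          wweak_norm p0 k0 (\<lambda>x. c2 (heat t \<phi> x) - heat t (dist_of (hom_data \<eta> \<sigma>)) x) \<le> ennreal C)"

text \<open>The bound is obtained for all t > 0; the restriction to large t is made only at the
  end.\<close>

definition faster_decay where
  "faster_decay d s p k D \<longleftrightarrow> (\<exists>\<delta>>0. \<exists>C>0. \<forall>t>0. wweak_norm p k (D t) \<le> ennreal (C * t powr (- (d / 2 * (s - k / d - rcp p)) - \<delta>)))"

lemma decaying_imp_faster_decay:
  fixes D :: "real \<Rightarrow> 'a::euclidean_space \<Rightarrow> complex"
  assumes D: "dec d (d * s) k (rcp p) (cnn D)"
    and m: "\<And>t. 0 < t \<Longrightarrow> D t \<in> borel_measurable borel" and d: "0 < d"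
  shows "faster_decay d s p k D"
proof -
  have "\<forall>\<^sub>F \<delta> in at_right 0. 0 < \<delta> \<and> (\<exists>C. kb {0<..} (ew d (d * s) k (rcp p) + \<delta>) k (rcp p) C (cnn D))"
    using D unfolding decaying_def by (intro eventually_conj eventually_at_right_less)
  from eventually_happens[OF this] obtain \<delta> C where \<delta>: "0 < \<delta>"
    "kb {0<..} (ew d (d * s) k (rcp p) + \<delta>) k (rcp p) C (cnn D)" by auto
  have e: "- (ew d (d * s) k (rcp p) + \<delta>) = - (d / 2 * (s - k / d - rcp p)) - \<delta>" using d by (simp add: ew_def field_simps)
  have "wweak_norm p k (D t) \<le> ennreal (max 1 C * t powr (- (d / 2 * (s - k / d - rcp p)) - \<delta>))" if "0 < t" for t
    using kb_wweakD[OF \<delta>(2) that m[OF that], of "max 1 C"] unfolding e by simp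
  then show ?thesis unfolding faster_decay_def using \<delta>(1) by (intro exI[of _ \<delta>] conjI exI[of _ "max 1 C"]) auto
qed

definition asym_conclusion where
  "asym_conclusion d \<gamma> \<alpha> p k \<sigma> p0 k0 c1 c2 u v z \<longleftrightarrow>
    (\<forall>p' k'. target_exps d p k p' k' \<longrightarrow> faster_decay d (inv_qc d \<gamma> \<alpha>) p' k' (\<lambda>t x. c1 (u t x) - v t x)) \<and>
    (\<forall>p' k'. target_exps d p0 k0 p' k' \<longrightarrow> faster_decay d (\<sigma> / d) p' k' (\<lambda>t x. c2 (u t x) - z t x))"

text \<open>Cleared of denominators, the parameter inequalities become the conditions of
  \<open>hh\<close>; those on k/d + 1/p make (k, 1/p) good for the scaling exponent, and
  \<open>admissible0\<close> together with the sign condition makes (k0, 1/p0) good for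
  \<sigma>.\<close>

theorem asymptotics:
  fixes \<gamma> \<alpha> l k k0 \<sigma> d :: real and p p0 :: ereal
  assumes d: "d = real DIM('a::euclidean_space)" and \<gamma>: "\<gamma> > - min 2 d" and \<alpha>: "\<alpha> > 1 + (2 + \<gamma>) / d"
    and l: "\<gamma> / (\<alpha> - 1) \<le> l" "(l + \<gamma>) / \<alpha> \<le> k" and p: "1 \<le> p" "ereal \<alpha> < p"
    and k: "0 \<le> k / d + rcp p" "(2 + \<gamma> * \<alpha>) / (d * \<alpha> * (\<alpha> - 1)) < k / d + rcp p" "k / d + rcp p < inv_qc d \<gamma> \<alpha>" "k / d + rcp p < (d + \<gamma>) / (d * \<alpha>)"
    and \<sigma>: "(2 + \<gamma>) / (\<alpha> - 1) < \<sigma>" "\<sigma> < d" and p0: "1 \<le> p0" "0 \<le> k0 / d + rcp p0" and ad: "admissible0 d \<gamma> \<alpha> p k \<sigma> p0 k0"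
  shows "\<exists>M0>0. \<forall>M a \<omega> \<eta> (\<phi> :: 'a dist) c1 c2 u v z. 0 \<le> M \<longrightarrow> M \<le> M0 \<longrightarrow> asym_hyps d \<gamma> \<alpha> p k \<sigma> p0 k0 M a \<omega> \<eta> \<phi> c1 c2 u v z \<longrightarrow>
    asym_conclusion d \<gamma> \<alpha> p k \<sigma> p0 k0 c1 c2 u v z"
proof -
  let ?\<rho> = "rcp p" and ?r = "rcp p0" and ?\<beta> = "\<alpha> - 1" and ?\<sigma>1 = "(2 + \<gamma>) / (\<alpha> - 1)"
  let ?s = "k + d * ?\<rho>"
  have d0: "0 < d" by (simp add: d)
  have \<gamma>2: "0 < 2 + \<gamma>" using \<gamma> by auto
  have \<beta>: "0 < ?\<beta>" using \<alpha> divide_pos_pos[OF \<gamma>2 d0] by linarith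
  have \<alpha>0: "0 < \<alpha>" using \<beta> by simp
  have s: "k / d + ?\<rho> = ?s / d" using d0 by (simp add: field_simps)
  have s0: "k0 / d + ?r = (k0 + d * ?r) / d" using d0 by (simp add: field_simps)
  have \<sigma>1: "?\<beta> * ?\<sigma>1 = 2 + \<gamma>" using \<beta> by simp
  have ks: "0 \<le> ?s" using k(1) d0 by (simp add: s zero_le_divide_iff)
  have k2: "2 + \<gamma> * \<alpha> < ?s * (\<alpha> * ?\<beta>)"
  proof -
    have "0 < d * \<alpha> * ?\<beta>" using d0 \<alpha>0 \<beta> by simp
    then have "2 + \<gamma> * \<alpha> < ?s / d * (d * \<alpha> * ?\<beta>)" using k(2) by (simp only: s pos_divide_less_eq)
    moreover have "?s / d * (d * \<alpha> * ?\<beta>) = ?s * (\<alpha> * ?\<beta>)" using d0 by simp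
    ultimately show ?thesis by simp
  qed
  have "(2 + \<gamma>) / ?\<beta> / d = inv_qc d \<gamma> \<alpha>" by (simp add: inv_qc_def mult.commute)
  then have qc: "d * inv_qc d \<gamma> \<alpha> = ?\<sigma>1" using d0 by (metis nonzero_mult_div_cancel_left times_divide_eq_right less_numeral_extra(3))
  have k3: "?s < ?\<sigma>1" using k(3) d0 unfolding qc[symmetric] s by (simp add: pos_divide_less_eq mult.commute)
  have k4: "?s * \<alpha> < d + \<gamma>"
  proof -
    have "0 < d * \<alpha>" using d0 \<alpha>0 by simp
    then have "?s / d * (d * \<alpha>) < d + \<gamma>" using k(4) by (simp only: s pos_less_divide_eq)
    then show ?thesis using d0 by simp
  qed
  have \<rho>: "0 \<le> ?\<rho>" "0 \<le> ?r" using rcp_bounds p p0 by auto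
  have \<alpha>\<rho>: "\<alpha> * ?\<rho> < 1" by (rule rcp_less[OF p(2) \<alpha>0])
  \<comment> \<open>\<gamma> * \<alpha> = \<gamma> * (\<alpha> - 1) + \<gamma> is at most (l +
    \<gamma>) * (\<alpha> - 1) by the first condition on l, and the lower bound on k
    finishes.\<close>
  have k\<gamma>: "\<gamma> \<le> ?\<beta> * k"
  proof -
    have "\<gamma> \<le> l * ?\<beta>" using l(1) \<beta> by (simp add: pos_divide_le_eq)
    moreover have "(l + \<gamma>) * ?\<beta> \<le> k * \<alpha> * ?\<beta>" using l(2) \<alpha>0 \<beta> by (intro mult_right_mono) (simp_all add: pos_divide_le_eq)
    ultimately have "\<gamma> * \<alpha> \<le> (?\<beta> * k) * \<alpha>" by (simp add: algebra_simps)
    then show ?thesis using \<alpha>0 by simp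
  qed
  have sub: "?\<beta> * ?s - \<gamma> < 2" using mult_strict_left_mono[OF k3 \<beta>] \<sigma>1 by linarith
  \<comment> \<open>The lower bound on k / d + 1/p, with its positive summand 2 dropped.\<close>
  have pos: "0 < ?\<beta> * ?s - \<gamma>"
  proof -
    have "\<gamma> * \<alpha> < (?\<beta> * ?s) * \<alpha>" using k2 by (simp add: mult_ac)
    then have "\<gamma> < ?\<beta> * ?s" using \<alpha>0 by (simp only: mult_less_cancel_right_pos)
    then show ?thesis by simp
  qed
  interpret hh "TYPE('a)" d ?\<beta> \<gamma> ?\<sigma>1 k ?\<rho>
    by (rule hh.intro[OF d \<beta> \<sigma>1 \<rho>(1) k\<gamma> sub pos k3 ks])
  have g1: "good k ?\<rho> ?\<sigma>1"
    unfolding good_def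
  proof (intro conjI)
    show "?\<beta> * ?\<rho> + ?\<rho> < 1" using \<alpha>\<rho> by (simp add: algebra_simps)
    show "?\<beta> * ?s - \<gamma> + k + d * ?\<rho> < d" using k4 by (simp add: algebra_simps)
    \<comment> \<open>The lower bound on k / d + 1/p is precisely integrability at time 0, by the
      identity (2 + \<gamma> * \<alpha>) / (\<alpha> - 1) = \<sigma>1 + \<gamma>, with \<sigma>1 the
      scaling exponent.\<close>
    have "(2 + \<gamma> * \<alpha>) / ?\<beta> < ?s * \<alpha>" using k2 \<beta> by (simp add: pos_divide_less_eq mult.assoc)
    moreover have "(2 + \<gamma> * \<alpha>) / ?\<beta> = ?\<sigma>1 + \<gamma>" using \<beta> by (simp add: field_simps)
    ultimately show "\<gamma> + ?\<sigma>1 < ?\<beta> * ?s + k + d * ?\<rho>" by (simp add: algebra_simps)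
  qed (fact \<rho>(1) ks)+
  have g2: "good k0 ?r \<sigma>"
    unfolding good_def
  proof (intro conjI)
    have e: "?\<beta> * (k / d + ?\<rho>) + k0 / d + ?r - \<gamma> / d = (?\<beta> * ?s + k0 + d * ?r - \<gamma>) / d"
      using d0 by (simp add: field_simps)
    have "?\<beta> * ?\<rho> + ?r < 1" and a1: "\<sigma> / d < (?\<beta> * ?s + k0 + d * ?r - \<gamma>) / d" and a2: "(?\<beta> * ?s + k0 + d * ?r - \<gamma>) / d < 1"
      using ad unfolding admissible0_def e by auto
    then show "?\<beta> * ?\<rho> + ?r < 1" by simp
    show "?\<beta> * ?s - \<gamma> + k0 + d * ?r < d" using a2 d0 by (simp add: pos_divide_less_eq)
    show "\<gamma> + \<sigma> < ?\<beta> * ?s + k0 + d * ?r" using a1 d0 by (simp add: divide_less_cancel)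
    show "0 \<le> k0 + d * ?r" using p0(2) d0 by (simp add: s0 zero_le_divide_iff)
  qed (fact \<rho>(2))
  obtain M0 where M0: "0 < M0" and main: "\<And>M a \<phi> \<Phi>1 \<Phi>2 c1 c2 u v z. M \<le> M0 \<Longrightarrow>
    core_hyps M \<sigma> k0 ?r a \<phi> \<Phi>1 \<Phi>2 c1 c2 u v z \<Longrightarrow> core_conclusion \<sigma> k0 ?r c1 c2 u v z"
    using core[OF g1 g2 \<sigma>] by blast
  have tgt: "k' \<le> kb'" "rcp p' \<le> rcp pb" "0 \<le> rcp p'" "0 \<le> k' + d * rcp p'" if "target_exps d pb kb' p' k'" "1 \<le> pb" for pb kb' p' k'
  proof -
    have "k' / d + rcp p' = (k' + d * rcp p') / d" using d0 by (simp add: field_simps)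
    then show "k' \<le> kb'" "rcp p' \<le> rcp pb" "0 \<le> rcp p'" "0 \<le> k' + d * rcp p'"
      using that d0 rcp_antimono rcp_bounds by (auto simp: target_exps_def zero_le_divide_iff)
  qed
  have concl: "asym_conclusion d \<gamma> \<alpha> p k \<sigma> p0 k0 c1 c2 u v z"
    if M: "0 \<le> M" "M \<le> M0" and hyp: "asym_hyps d \<gamma> \<alpha> p k \<sigma> p0 k0 M a \<omega> \<eta> \<phi> c1 c2 u v z" for M a \<omega> \<eta> c1 c2 u v z and \<phi> :: "'a dist"
  proof -
    have h: "\<bar>a\<bar> = 1" "small_angular 1 \<omega>" "small_angular 1 \<eta>" "tempered_distribution \<phi>"
       "K_norm (inv_qc d \<gamma> \<alpha>) p k (\<lambda>t. heat t \<phi>) \<le> ennreal 1"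
      and c: "real_lin c1" "real_lin c2" "\<forall>w. norm w \<le> norm (c1 w) + norm (c2 w)"
      and hu: "hh_solution a \<gamma> \<alpha> p k M \<phi> u" and ht: "triangular_solution a \<gamma> \<alpha> p k M p0 k0 \<sigma> \<omega> \<eta> v z"
      using hyp unfolding asym_hyps_def by blast+
    have hv: "hh_solution a \<gamma> \<alpha> p k M (dist_of (hom_data \<omega> ?\<sigma>1)) v" and hz: "z \<in> K_space (\<sigma> / d) p0 k0"
       "mild_solution a (dist_of (hom_data \<eta> \<sigma>)) (hh_source \<gamma> \<alpha> v z) z"
      using ht unfolding triangular_solution_def d by blast+
    have uK: "u \<in> K_space (inv_qc d \<gamma> \<alpha>) p k" "K_norm (inv_qc d \<gamma> \<alpha>) p k u \<le> ennreal M" "mild_solution a \<phi> (hh_source \<gamma> \<alpha> u u) u"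
      and vK: "v \<in> K_space (inv_qc d \<gamma> \<alpha>) p k" "K_norm (inv_qc d \<gamma> \<alpha>) p k v \<le> ennreal M" "mild_solution a (dist_of (hom_data \<omega> ?\<sigma>1)) (hh_source \<gamma> \<alpha> v v) v"
      using hu hv unfolding hh_solution_def d by blast+
    have mz: "mz u" "mz v" "mz z" using uK(1) vK(1) hz(1) by (auto simp: K_space_def)
    note ms = mz[THEN mz_section]
    have ub: "kw d ?\<sigma>1 k ?\<rho> M (cnn u)"
      and vb: "kw d ?\<sigma>1 k ?\<rho> M (cnn v)"
      using K_norm_kb[OF uK(2) M(1) ms(1) d] K_norm_kb[OF vK(2) M(1) ms(2) d] unfolding qc by blast+
    have zb: "\<exists>B. kw d \<sigma> k0 ?r B (cnn z)"
      using K_space_kb[OF hz(1) d] d0 by simp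
    note \<omega> = hom_data_bound[OF h(2), of ?\<sigma>1] and \<eta> = hom_data_bound[OF h(3), of \<sigma>]
    have \<sigma>1p: "0 \<le> ?\<sigma>1" using k3 ks by linarith
    have sg1: "sg (\<lambda>t. heat t (dist_of (hom_data \<omega> ?\<sigma>1)))"
      using \<sigma>1p \<sigma> d by (intro sg_dist_of[OF \<omega>]) auto
    have sg2: "sg (\<lambda>t. heat t (dist_of (hom_data \<eta> \<sigma>)))"
      using \<sigma>1p \<sigma> d by (intro sg_dist_of[OF \<eta>]) auto
    note sgs = sg_tempered[OF h(4)] sg_real_lin[OF c(1) sg_tempered[OF h(4)]] sg_real_lin[OF c(2) sg_tempered[OF h(4)]]
      sg_diff[OF sg_real_lin[OF c(1) sg_tempered[OF h(4)]] sg1] sg_diff[OF sg_real_lin[OF c(2) sg_tempered[OF h(4)]] sg2]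
    have sm: "g t \<in> borel_measurable borel" if "sg g" "0 < t" for t and g :: "real \<Rightarrow> 'a \<Rightarrow> complex" using that by (simp add: sg_def)
    have "kw d ?\<sigma>1 k ?\<rho> 1 (\<lambda>t x. ennreal (norm (heat t \<phi> x)))"
      using K_norm_kb[OF h(5) _ sm[OF sgs(1)] d] unfolding qc by simp
    then have B1: "kw d ?\<sigma>1 k ?\<rho> 1 (\<lambda>t x. ennreal (norm (c1 (heat t \<phi> x))))"
    proof (rule kb_mono_AE)
      fix t :: real assume "t \<in> {0<..}"
      then have [measurable]: "(\<lambda>x. c1 (heat t \<phi> x)) \<in> borel_measurable borel" using sm[OF sgs(2)] by simp
      show "(\<lambda>x. ennreal (norm (c1 (heat t \<phi> x)))) \<in> borel_measurable borel" by measurable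
    qed (intro AE_I2 ennreal_leI real_lin_le(1) c)
    have ewd: "d / 2 * (x / d - y / d - r) = ew d x y r" for x y r using d0 by (simp add: ew_def field_simps)
    note e1 = ewd[of ?\<sigma>1 k ?\<rho>] and e2 = ewd[of \<sigma> k0 ?r]
    obtain C1 \<delta>1 where C1: "0 \<le> C1" "0 < \<delta>1" "\<And>t. 0 < t \<Longrightarrow> ennreal (t powr (ew d ?\<sigma>1 k ?\<rho> + \<delta>1)) *
        wweak_norm p k (\<lambda>x. c1 (heat t \<phi> x) - heat t (dist_of (hom_data \<omega> ?\<sigma>1)) x) \<le> ennreal C1"
      using hyp unfolding asym_hyps_def e1 by blast
    obtain C2 \<delta>2 where C2: "0 \<le> C2" "0 < \<delta>2" "\<And>t. 0 < t \<Longrightarrow> ennreal (t powr (ew d \<sigma> k0 ?r)) * wweak_norm p0 k0 (\<lambda>x. c2 (heat t \<phi> x)) +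
        ennreal (t powr (ew d \<sigma> k0 ?r + \<delta>2)) * wweak_norm p0 k0 (\<lambda>x. c2 (heat t \<phi> x) - heat t (dist_of (hom_data \<eta> \<sigma>)) x) \<le> ennreal C2"
      using hyp unfolding asym_hyps_def e2 by blast
    have C2': "ennreal (t powr (ew d \<sigma> k0 ?r)) * wweak_norm p0 k0 (\<lambda>x. c2 (heat t \<phi> x)) \<le> ennreal C2"
       "ennreal (t powr (ew d \<sigma> k0 ?r + \<delta>2)) * wweak_norm p0 k0 (\<lambda>x. c2 (heat t \<phi> x) - heat t (dist_of (hom_data \<eta> \<sigma>)) x) \<le> ennreal C2"
      if "0 < t" for t
      using order_trans[OF _ C2(3)[OF that]] by (simp_all add: add_increasing add_increasing2)
    note B2 = kb_wweakI[OF sm[OF sgs(4)] C1(1,3)] and B3 = kb_wweakI[OF sm[OF sgs(3)] C2(1) C2'(1)] and B4 = kb_wweakI[OF sm[OF sgs(5)] C2(1) C2'(2)]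
    have \<beta>1: "?\<beta> + 1 = \<alpha>" by simp
    have X1: "\<exists>\<epsilon>\<ge>0. AE y in lborel. norm (hom_data \<omega> ?\<sigma>1 y) \<le> \<epsilon> * norm y powr (- ?\<sigma>1)" using \<omega>(2) zero_le_one by blast
    have X2: "\<exists>\<epsilon>\<ge>0. AE y in lborel. norm (hom_data \<eta> \<sigma> y) \<le> \<epsilon> * norm y powr (- \<sigma>)" using \<eta>(2) zero_le_one by blast
    have "core_hyps M \<sigma> k0 ?r a \<phi> (hom_data \<omega> ?\<sigma>1) (hom_data \<eta> \<sigma>) c1 c2 u v z"
      unfolding core_hyps_def \<beta>1
    proof (intro conjI)
      show "\<exists>B. kw d ?\<sigma>1 k ?\<rho> B (\<lambda>t x. ennreal (norm (c1 (heat t \<phi> x))))" by (rule exI) (rule B1)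
      show "\<exists>B \<delta>. 0 < \<delta> \<and> kb {0<..} (ew d ?\<sigma>1 k ?\<rho> + \<delta>) k ?\<rho> B (\<lambda>t x. ennreal (norm (c1 (heat t \<phi> x) - heat t (dist_of (hom_data \<omega> ?\<sigma>1)) x)))"
        by (intro exI conjI, rule C1(2), rule B2)
      show "\<exists>B. kw d \<sigma> k0 ?r B (\<lambda>t x. ennreal (norm (c2 (heat t \<phi> x))))" by (rule exI) (rule B3)
      show "\<exists>B \<delta>. 0 < \<delta> \<and> kb {0<..} (ew d \<sigma> k0 ?r + \<delta>) k0 ?r B (\<lambda>t x. ennreal (norm (c2 (heat t \<phi> x) - heat t (dist_of (hom_data \<eta> \<sigma>)) x)))"
        by (intro exI conjI, rule C2(2), rule B4)
    qed (fact h c mz ub vb zb uK(3) vK(3) hz(2) \<omega>(1) \<eta>(1) X1 X2)+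
    note D = main[OF M(2) this, unfolded core_conclusion_def]
    note D1 = D[THEN conjunct1, rule_format] and D2 = D[THEN conjunct2, rule_format]
    have m1: "(\<lambda>x. c1 (u t x) - v t x) \<in> borel_measurable borel" and m2: "(\<lambda>x. c2 (u t x) - z t x) \<in> borel_measurable borel" if "0 < t" for t
      using mz_section[OF mz_diff[OF mz_real_lin[OF c(1) mz(1)] mz(2)] that] mz_section[OF mz_diff[OF mz_real_lin[OF c(2) mz(1)] mz(3)] that] by auto
    have \<sigma>d: "d * (\<sigma> / d) = \<sigma>" using d0 by simp
    show ?thesis
      unfolding asym_conclusion_def
    proof (intro conjI allI impI)
      fix p' k' assume t: "target_exps d p k p' k'"
      show "faster_decay d (inv_qc d \<gamma> \<alpha>) p' k' (\<lambda>t x. c1 (u t x) - v t x)"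
        by (rule decaying_imp_faster_decay[OF _ m1 d0]) (unfold qc, rule D1[OF tgt[OF t p(1)]])
    next
      fix p' k' assume t: "target_exps d p0 k0 p' k'"
      show "faster_decay d (\<sigma> / d) p' k' (\<lambda>t x. c2 (u t x) - z t x)"
        by (rule decaying_imp_faster_decay[OF _ m2 d0]) (unfold \<sigma>d, rule D2[OF tgt[OF t p0(1)]])
    qed
  qed
  show ?thesis by (rule exI[of _ M0], rule conjI[OF M0], intro allI impI, rule concl; assumption)
qed

section \<open>Assembly of the two cases\<close>

lemma faster_decay_pair:
  assumes D: "faster_decay d s p k D" and E: "faster_decay d s' p' k' E"
  shows "\<exists>\<delta>1>0. \<exists>\<delta>2>0. \<exists>C>0. eventually (\<lambda>t.
      wweak_norm p k (D t) \<le> ennreal (C * t powr (- (d / 2 * (s - k / d - rcp p)) - \<delta>1)) \<and>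
      wweak_norm p' k' (E t) \<le> ennreal (C * t powr (- (d / 2 * (s' - k' / d - rcp p')) - \<delta>2))) at_top"
proof -
  obtain \<delta>1 C1 where 1: "0 < \<delta>1" "0 < C1" "\<And>t. 0 < t \<Longrightarrow> wweak_norm p k (D t) \<le> ennreal (C1 * t powr (- (d / 2 * (s - k / d - rcp p)) - \<delta>1))"
    using D unfolding faster_decay_def by blast
  obtain \<delta>2 C2 where 2: "0 < \<delta>2" "0 < C2" "\<And>t. 0 < t \<Longrightarrow> wweak_norm p' k' (E t) \<le> ennreal (C2 * t powr (- (d / 2 * (s' - k' / d - rcp p')) - \<delta>2))"
    using E unfolding faster_decay_def by blast
  have "eventually (\<lambda>t. wweak_norm p k (D t) \<le> ennreal (max C1 C2 * t powr (- (d / 2 * (s - k / d - rcp p)) - \<delta>1)) \<and>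
      wweak_norm p' k' (E t) \<le> ennreal (max C1 C2 * t powr (- (d / 2 * (s' - k' / d - rcp p')) - \<delta>2))) at_top"
    using eventually_gt_at_top[of 0]
  proof eventually_elim
    case (elim t)
    show ?case
      by (intro conjI order_trans[OF 1(3)[OF elim]] order_trans[OF 2(3)[OF elim]] ennreal_leI mult_right_mono) auto
  qed
  then show ?thesis using 1(1,2) 2(1) by (intro exI[of _ \<delta>1] exI[of _ \<delta>2] exI[of _ "max C1 C2"] conjI) auto
qed

lemma asym_hypsI:
  assumes "a \<in> {-1, 1}" "small_angular 1 \<omega>" "small_angular 1 \<eta>" "tempered_distribution \<phi>"
    "K_norm (inv_qc d \<gamma> \<alpha>) p k (\<lambda>t. heat t \<phi>) \<le> ennreal 1" "real_lin c1" "real_lin c2" "\<And>w. norm w \<le> norm (c1 w) + norm (c2 w)"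
    "hh_solution a \<gamma> \<alpha> p k M \<phi> u" "triangular_solution a \<gamma> \<alpha> p k M p0 k0 \<sigma> \<omega> \<eta> v z"
    and C: "0 < C1" "0 < C2" "0 < \<delta>1" "0 < \<delta>2"
    "\<And>t. 0 < t \<Longrightarrow> ennreal (t powr (d / 2 * ((2 + \<gamma>) / (\<alpha> - 1) / d - k / d - rcp p) + \<delta>1)) *
        wweak_norm p k (\<lambda>x. c1 (heat t \<phi> x) - heat t (dist_of (hom_data \<omega> ((2 + \<gamma>) / (\<alpha> - 1)))) x) \<le> ennreal C1"
    "\<And>t. 0 < t \<Longrightarrow> ennreal (t powr (d / 2 * (\<sigma> / d - k0 / d - rcp p0))) * wweak_norm p0 k0 (\<lambda>x. c2 (heat t \<phi> x)) +
        ennreal (t powr (d / 2 * (\<sigma> / d - k0 / d - rcp p0) + \<delta>2)) *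
          wweak_norm p0 k0 (\<lambda>x. c2 (heat t \<phi> x) - heat t (dist_of (hom_data \<eta> \<sigma>)) x) \<le> ennreal C2"
  shows "asym_hyps d \<gamma> \<alpha> p k \<sigma> p0 k0 M a \<omega> \<eta> \<phi> c1 c2 u v z"
  unfolding asym_hyps_def
proof (intro conjI)
  show "\<bar>a\<bar> = 1" using assms(1) by auto
  show "\<exists>C\<ge>0. \<exists>\<delta>>0. \<forall>t>0. ennreal (t powr (d / 2 * ((2 + \<gamma>) / (\<alpha> - 1) / d - k / d - rcp p) + \<delta>)) *
        wweak_norm p k (\<lambda>x. c1 (heat t \<phi> x) - heat t (dist_of (hom_data \<omega> ((2 + \<gamma>) / (\<alpha> - 1)))) x) \<le> ennreal C"
    using C(1,3) by (intro exI[of _ C1] exI[of _ \<delta>1] conjI allI impI C(5)) auto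
  show "\<exists>C\<ge>0. \<exists>\<delta>>0. \<forall>t>0. ennreal (t powr (d / 2 * (\<sigma> / d - k0 / d - rcp p0))) * wweak_norm p0 k0 (\<lambda>x. c2 (heat t \<phi> x)) +
        ennreal (t powr (d / 2 * (\<sigma> / d - k0 / d - rcp p0) + \<delta>)) *
          wweak_norm p0 k0 (\<lambda>x. c2 (heat t \<phi> x) - heat t (dist_of (hom_data \<eta> \<sigma>)) x) \<le> ennreal C"
    using C(2,4) by (intro exI[of _ C2] exI[of _ \<delta>2] conjI allI impI C(6)) auto
qed (use assms in blast)+

theorem theorem7p2:
  fixes d :: nat and a \<gamma> \<alpha> l k k0 \<sigma>1 \<sigma>2 :: real and q r p p0 :: ereal
  assumes "d = CARD('n::finite)" and "a \<in> {-1, 1}"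
    and "\<gamma> > - min 2 (real d)" and "\<alpha> > 1 + (2 + \<gamma>) / d"
    and "1 \<le> q" and "1 \<le> r" and "l / d + rcp q = inv_qc d \<gamma> \<alpha>" and "\<gamma> / (\<alpha> - 1) \<le> l"
    and "q = 1 \<longrightarrow> r = 1" and "q = \<infinity> \<longrightarrow> r = \<infinity>"
    and "1 \<le> p" and "ereal \<alpha> < p" and "(l + \<gamma>) / \<alpha> \<le> k" and "k \<le> l"
    and "0 \<le> k / d + rcp p"
    and "(2 + \<gamma> * \<alpha>) / (d * \<alpha> * (\<alpha> - 1)) < k / d + rcp p"
    and "k / d + rcp p < min (inv_qc d \<gamma> \<alpha>) ((d + \<gamma>) / (d * \<alpha>))"
    and "(2 + \<gamma>) / (\<alpha> - 1) \<le> \<sigma>1" and "\<sigma>1 < d"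
    and "(2 + \<gamma>) / (\<alpha> - 1) \<le> \<sigma>2" and "\<sigma>2 < d"
    and "1 \<le> p0"
  shows
    "\<exists>M>0. \<exists>\<epsilon>>0.
      \<forall>(\<omega>1 :: real^'n \<Rightarrow> real) (\<omega>2 :: real^'n \<Rightarrow> real) (\<phi> :: (real^'n) dist)
       (u :: real \<Rightarrow> real^'n \<Rightarrow> complex).
        small_angular \<epsilon> \<omega>1 \<and> small_angular \<epsilon> \<omega>2 \<and>
        tempered_distribution \<phi> \<and> nontrivial_dist \<phi> \<and>
        K_norm (inv_qc d \<gamma> \<alpha>) p k (\<lambda>t. heat t \<phi>) \<le> ennreal \<epsilon> \<and>
        hh_solution a \<gamma> \<alpha> p k M \<phi> u
        \<longrightarrow>
        (\<forall>p' k' p0' k0'. target_exps d p k p' k' \<and> target_exps d p0 k0 p0' k0' \<longrightarrow>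
          ((2 + \<gamma>) / (\<alpha> - 1) = \<sigma>1 \<and> \<sigma>1 < \<sigma>2 \<and> admissible0 d \<gamma> \<alpha> p k \<sigma>2 p0 k0 \<longrightarrow>
            (\<forall>u1S z2. S3_solution a \<gamma> \<alpha> p k M p0 k0 \<sigma>2 \<omega>1 \<omega>2 u1S z2 \<longrightarrow>
              (\<forall>C1>0. \<forall>C2>0. \<forall>\<delta>01>0. \<forall>\<delta>02>0.
                (\<forall>t>0.
                  ennreal (t powr (d / 2 * (\<sigma>1 / d - k / d - rcp p) + \<delta>01))
                    * wweak_norm p k
                        (heat t (dist_diff (dist_Re \<phi>) (dist_of (hom_data \<omega>1 \<sigma>1))))
                  \<le> ennreal C1 \<and>
                  ennreal (t powr (d / 2 * (\<sigma>2 / d - k0 / d - rcp p0)))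
                    * wweak_norm p0 k0 (heat t (dist_Im \<phi>))
                  + ennreal (t powr (d / 2 * (\<sigma>2 / d - k0 / d - rcp p0) + \<delta>02))
                    * wweak_norm p0 k0
                        (heat t (dist_diff (dist_Im \<phi>) (dist_of (hom_data \<omega>2 \<sigma>2))))
                  \<le> ennreal C2)
                \<longrightarrow>
                (\<exists>\<delta>1>0. \<exists>\<delta>2>0. \<exists>C>0. eventually (\<lambda>t.
                  wweak_norm p' k' (\<lambda>x. complex_of_real (Re (u t x)) - u1S t x)
                  \<le> ennreal (C * t powr (- (d / 2 * (inv_qc d \<gamma> \<alpha> - k' / d - rcp p')) - \<delta>1)) \<and>
                  wweak_norm p0' k0' (\<lambda>x. complex_of_real (Im (u t x)) - z2 t x)
                  \<le> ennreal (C * t powr (- (d / 2 * (\<sigma>2 / d - k0' / d - rcp p0')) - \<delta>2)))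
                  at_top))))
          \<and>
          ((2 + \<gamma>) / (\<alpha> - 1) = \<sigma>2 \<and> \<sigma>2 < \<sigma>1 \<and> admissible0 d \<gamma> \<alpha> p k \<sigma>1 p0 k0 \<longrightarrow>
            (\<forall>w1 u2S. S4_solution a \<gamma> \<alpha> p k M p0 k0 \<sigma>1 \<omega>1 \<omega>2 w1 u2S \<longrightarrow>
              (\<forall>C1>0. \<forall>C2>0. \<forall>\<delta>01>0. \<forall>\<delta>02>0.
                (\<forall>t>0.
                  ennreal (t powr (d / 2 * (\<sigma>1 / d - k0 / d - rcp p0)))
                    * wweak_norm p0 k0 (heat t (dist_Re \<phi>))
                  + ennreal (t powr (d / 2 * (\<sigma>1 / d - k0 / d - rcp p0) + \<delta>01))
                    * wweak_norm p0 k0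
                        (heat t (dist_diff (dist_Re \<phi>) (dist_of (hom_data \<omega>1 \<sigma>1))))
                  \<le> ennreal C1 \<and>
                  ennreal (t powr (d / 2 * (\<sigma>2 / d - k / d - rcp p) + \<delta>02))
                    * wweak_norm p k
                        (heat t (dist_diff (dist_Im \<phi>) (dist_of (hom_data \<omega>2 \<sigma>2))))
                  \<le> ennreal C2)
                \<longrightarrow>
                (\<exists>\<delta>1>0. \<exists>\<delta>2>0. \<exists>C>0. eventually (\<lambda>t.
                  wweak_norm p0' k0' (\<lambda>x. complex_of_real (Re (u t x)) - w1 t x)
                  \<le> ennreal (C * t powr (- (d / 2 * (\<sigma>1 / d - k0' / d - rcp p0')) - \<delta>1)) \<and>
                  wweak_norm p' k' (\<lambda>x. complex_of_real (Im (u t x)) - u2S t x)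
                  \<le> ennreal (C * t powr (- (d / 2 * (inv_qc d \<gamma> \<alpha> - k' / d - rcp p')) - \<delta>2)))
                  at_top)))))"
proof -
  have d: "real d = real DIM(real^'n)" using assms(1) by simp
  define P where "P \<sigma> M0 \<longleftrightarrow> (\<forall>M a \<omega> \<eta> (\<phi> :: (real^'n) dist) c1 c2 u v z. 0 \<le> M \<longrightarrow> M \<le> M0 \<longrightarrow>
      asym_hyps (real d) \<gamma> \<alpha> p k \<sigma> p0 k0 M a \<omega> \<eta> \<phi> c1 c2 u v z \<longrightarrow>
    asym_conclusion d \<gamma> \<alpha> p k \<sigma> p0 k0 c1 c2 u v z)" for \<sigma> M0 :: real
  have PD: "faster_decay d (inv_qc d \<gamma> \<alpha>) p' k' (\<lambda>t x. c1 (u t x) - v t x)" "faster_decay d (\<sigma> / d) p0' k0' (\<lambda>t x. c2 (u t x) - z t x)"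
    if "P \<sigma> M0" "0 \<le> M" "M \<le> M0" "asym_hyps (real d) \<gamma> \<alpha> p k \<sigma> p0 k0 M a \<omega> \<eta> \<phi> c1 c2 u v z"
      "target_exps d p k p' k'" "target_exps d p0 k0 p0' k0'"
    for \<sigma> M0 M a :: real and \<omega> \<eta> c1 c2 u v z p' k' p0' k0' and \<phi> :: "(real^'n) dist"
    using that unfolding P_def asym_conclusion_def by blast+
  \<comment> \<open>M has to be chosen before it is known which case applies, so the threshold is
    made conditional: an exponent \<sigma> that fails the conditions receives the dummy value
    1.\<close>
  have "\<exists>M0>0. (2 + \<gamma>) / (\<alpha> - 1) < \<sigma> \<and> 0 \<le> k0 / d + rcp p0 \<and> admissible0 d \<gamma> \<alpha> p k \<sigma> p0 k0 \<longrightarrow> P \<sigma> M0" if \<sigma>: "\<sigma> < d" for \<sigma> :: real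
  proof (cases "(2 + \<gamma>) / (\<alpha> - 1) < \<sigma> \<and> 0 \<le> k0 / d + rcp p0 \<and> admissible0 d \<gamma> \<alpha> p k \<sigma> p0 k0")
    case True
    have k4: "k / d + rcp p < inv_qc d \<gamma> \<alpha>" "k / d + rcp p < (d + \<gamma>) / (d * \<alpha>)" using assms(17) by auto
    have "\<exists>M0>0. P \<sigma> M0" unfolding P_def
      by (rule asymptotics[OF d assms(3,4,8,13,11,12,15,16) k4 _ \<sigma> assms(22)]) (use True in auto)
    then show ?thesis by blast
  qed (auto intro: exI[of _ 1])
  from this[OF assms(21)] this[OF assms(19)] obtain M2 M1 where M2: "0 < M2"
      "(2 + \<gamma>) / (\<alpha> - 1) < \<sigma>2 \<Longrightarrow> 0 \<le> k0 / d + rcp p0 \<Longrightarrow> admissible0 d \<gamma> \<alpha> p k \<sigma>2 p0 k0 \<Longrightarrow> P \<sigma>2 M2"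
    and M1: "0 < M1" "(2 + \<gamma>) / (\<alpha> - 1) < \<sigma>1 \<Longrightarrow> 0 \<le> k0 / d + rcp p0 \<Longrightarrow> admissible0 d \<gamma> \<alpha> p k \<sigma>1 p0 k0 \<Longrightarrow> P \<sigma>1 M1"
    by blast
  \<comment> \<open>The sign condition at (k0, p0) is inherited from any target pair, since k' \<le>
    k0 and 1/p' \<le> 1/p0.\<close>
  have tgt: "0 \<le> k0 / d + rcp p0" if "target_exps d p0 k0 p' k'" for p' k'
  proof -
    have "k' / d \<le> k0 / d" "rcp p' \<le> rcp p0" "0 \<le> k' / d + rcp p'"
      using that rcp_antimono[OF assms(22)] by (auto simp: target_exps_def intro: divide_right_mono)
    then show ?thesis by linarith
  qed
  have RI: "norm w \<le> norm (complex_of_real (Re w)) + norm (complex_of_real (Im w))"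
    and IR: "norm w \<le> norm (complex_of_real (Im w)) + norm (complex_of_real (Re w))" for w
    using cmod_le[of w] by simp_all
  show ?thesis
  \<comment> \<open>Smallness enters through the radius M of the ball containing both nonlinear
    solutions, taken below the thresholds of both cases. The bounds on the data enter as finite
    constants, and 1 serves for \<epsilon>.\<close>
  proof (rule exI[of _ "min M1 M2"], rule conjI, use M1(1) M2(1) in simp, rule exI[of _ 1], rule conjI, simp, intro allI impI, elim conjE,
      rule conjI; intro impI allI; elim conjE)
    fix \<omega>1 \<omega>2 :: "real^'n \<Rightarrow> real" and \<phi> :: "(real^'n) dist" and u p' k' p0' k0' u1S z2 and C1 C2 \<delta>1 \<delta>2 :: real
    assume \<omega>: "small_angular 1 \<omega>1" "small_angular 1 \<omega>2" and \<phi>: "tempered_distribution \<phi>" "K_norm (inv_qc d \<gamma> \<alpha>) p k (\<lambda>t. heat t \<phi>) \<le> ennreal 1"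
      and u: "hh_solution a \<gamma> \<alpha> p k (min M1 M2) \<phi> u" and t: "target_exps d p k p' k'" "target_exps d p0 k0 p0' k0'"
      and \<sigma>: "(2 + \<gamma>) / (\<alpha> - 1) = \<sigma>1" "\<sigma>1 < \<sigma>2" and ad: "admissible0 d \<gamma> \<alpha> p k \<sigma>2 p0 k0"
      and S: "S3_solution a \<gamma> \<alpha> p k (min M1 M2) p0 k0 \<sigma>2 \<omega>1 \<omega>2 u1S z2"
      and C: "0 < C1" "0 < C2" "0 < \<delta>1" "0 < \<delta>2"
      and le: "\<forall>t>0. ennreal (t powr (d / 2 * (\<sigma>1 / d - k / d - rcp p) + \<delta>1))
                    * wweak_norm p k (heat t (dist_diff (dist_Re \<phi>) (dist_of (hom_data \<omega>1 \<sigma>1)))) \<le> ennreal C1 \<and>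
                  ennreal (t powr (d / 2 * (\<sigma>2 / d - k0 / d - rcp p0))) * wweak_norm p0 k0 (heat t (dist_Im \<phi>))
                  + ennreal (t powr (d / 2 * (\<sigma>2 / d - k0 / d - rcp p0) + \<delta>2))
                    * wweak_norm p0 k0 (heat t (dist_diff (dist_Im \<phi>) (dist_of (hom_data \<omega>2 \<sigma>2)))) \<le> ennreal C2"
    have P: "P \<sigma>2 M2" using M2(2) tgt[OF t(2)] ad \<sigma> by simp
    have hyp: "asym_hyps (real d) \<gamma> \<alpha> p k \<sigma>2 p0 k0 (min M1 M2) a \<omega>1 \<omega>2 \<phi> (\<lambda>z. complex_of_real (Re z)) (\<lambda>z. complex_of_real (Im z)) u u1S z2"
      by (rule asym_hypsI[OF assms(2) \<omega> \<phi> real_lin_Re real_lin_Im RI u S[unfolded S3_solution_def] C])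
        (use le in \<open>simp_all add: \<sigma>(1) heat_dist_diff heat_dist_Re heat_dist_Im\<close>)
    note D = PD[OF P _ _ hyp t]
    show "\<exists>\<delta>1>0. \<exists>\<delta>2>0. \<exists>C>0. eventually (\<lambda>t.
                  wweak_norm p' k' (\<lambda>x. complex_of_real (Re (u t x)) - u1S t x)
                  \<le> ennreal (C * t powr (- (d / 2 * (inv_qc d \<gamma> \<alpha> - k' / d - rcp p')) - \<delta>1)) \<and>
                  wweak_norm p0' k0' (\<lambda>x. complex_of_real (Im (u t x)) - z2 t x)
                  \<le> ennreal (C * t powr (- (d / 2 * (\<sigma>2 / d - k0' / d - rcp p0')) - \<delta>2))) at_top"
      by (rule faster_decay_pair[OF D(1) D(2)]) (use M1(1) M2(1) in auto)
  next
    fix \<omega>1 \<omega>2 :: "real^'n \<Rightarrow> real" and \<phi> :: "(real^'n) dist" and u p' k' p0' k0' w1 u2S and C1 C2 \<delta>1 \<delta>2 :: real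
    assume \<omega>: "small_angular 1 \<omega>1" "small_angular 1 \<omega>2" and \<phi>: "tempered_distribution \<phi>" "K_norm (inv_qc d \<gamma> \<alpha>) p k (\<lambda>t. heat t \<phi>) \<le> ennreal 1"
      and u: "hh_solution a \<gamma> \<alpha> p k (min M1 M2) \<phi> u" and t: "target_exps d p k p' k'" "target_exps d p0 k0 p0' k0'"
      and \<sigma>: "(2 + \<gamma>) / (\<alpha> - 1) = \<sigma>2" "\<sigma>2 < \<sigma>1" and ad: "admissible0 d \<gamma> \<alpha> p k \<sigma>1 p0 k0"
      and S: "S4_solution a \<gamma> \<alpha> p k (min M1 M2) p0 k0 \<sigma>1 \<omega>1 \<omega>2 w1 u2S"
      and C: "0 < C1" "0 < C2" "0 < \<delta>1" "0 < \<delta>2"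
      and le: "\<forall>t>0. ennreal (t powr (d / 2 * (\<sigma>1 / d - k0 / d - rcp p0))) * wweak_norm p0 k0 (heat t (dist_Re \<phi>))
                  + ennreal (t powr (d / 2 * (\<sigma>1 / d - k0 / d - rcp p0) + \<delta>1))
                    * wweak_norm p0 k0 (heat t (dist_diff (dist_Re \<phi>) (dist_of (hom_data \<omega>1 \<sigma>1)))) \<le> ennreal C1 \<and>
                  ennreal (t powr (d / 2 * (\<sigma>2 / d - k / d - rcp p) + \<delta>2))
                    * wweak_norm p k (heat t (dist_diff (dist_Im \<phi>) (dist_of (hom_data \<omega>2 \<sigma>2)))) \<le> ennreal C2"
    have P: "P \<sigma>1 M1" using M1(2) tgt[OF t(2)] ad \<sigma> by simp
    \<comment> \<open>The roles are exchanged: now the imaginary part follows the nonlinear profile,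
      whose data come from \<omega>2, and the real part follows the linear one.\<close>
    have hyp: "asym_hyps (real d) \<gamma> \<alpha> p k \<sigma>1 p0 k0 (min M1 M2) a \<omega>2 \<omega>1 \<phi> (\<lambda>z. complex_of_real (Im z)) (\<lambda>z. complex_of_real (Re z)) u u2S w1"
      by (rule asym_hypsI[OF assms(2) \<omega>(2,1) \<phi> real_lin_Im real_lin_Re IR u S[unfolded S4_solution_def] C(2,1,4,3)])
        (use le in \<open>simp_all add: \<sigma>(1) heat_dist_diff heat_dist_Re heat_dist_Im\<close>)
    note D = PD[OF P _ _ hyp t]
    show "\<exists>\<delta>1>0. \<exists>\<delta>2>0. \<exists>C>0. eventually (\<lambda>t.
                  wweak_norm p0' k0' (\<lambda>x. complex_of_real (Re (u t x)) - w1 t x)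
                  \<le> ennreal (C * t powr (- (d / 2 * (\<sigma>1 / d - k0' / d - rcp p0')) - \<delta>1)) \<and>
                  wweak_norm p' k' (\<lambda>x. complex_of_real (Im (u t x)) - u2S t x)
                  \<le> ennreal (C * t powr (- (d / 2 * (inv_qc d \<gamma> \<alpha> - k' / d - rcp p')) - \<delta>2))) at_top"
      by (rule faster_decay_pair[OF D(2) D(1)]) (use M1(1) M2(1) in auto)
  qed
qed

end
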